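(* (a) A row contraction $T:\mathcal H\otimes\mathbb C^d\to\mathcal H$ is CCNC if and only if there are Hilbert spaces $\mathcal J,\mathcal K$ and a purely contractive Schur-class multiplier $b\in\mathscr S_d(\mathcal J,\mathcal K)$ such that $T$ is unitarily equivalent to an extremal Gleason solution $X^b$ for the de Branges-Rovnyak space $\mathscr H(b)$. (b) If $T$ is unitarily equivalent to an extremal Gleason solution $X^b$ for $\mathscr H(b)$, with $b$ purely contractive, then $b$ is (up to weak coincidence) the characteristic function $b_T$ of $T$. The characteristic function is a unitary invariant: if $T_1,T_2$ are unitarily equivalent CCNC row contractions, then $b_{T_1}$ and $b_{T_2}$ coincide weakly. (c) For any CCNC row contraction $T$ one can choose the characteristic function $b_T\in\mathscr S_d\big(\overline{\mathrm{Ran}(D_T)},\overline{\mathrm{Ran}(D_{T^*})}\big)$.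
   Context: Hilbert spaces are complex and separable (or finite-dimensional); $d\in\mathbb N$; $\mathbb B^d$ is the open unit ball of $\mathbb C^d$; $\bigvee$ denotes closed linear span; $zw^*:=\sum_j z_j\overline{w_j}$. For $z\in\mathbb B^d$ and a Hilbert space $\mathcal H$, $z^*:\mathcal H\to\mathcal H\otimes\mathbb C^d$ is $z^*h=(\overline z_1h,\dots,\overline z_dh)^T$ and $z:=(z^* )^*:\mathcal H\otimes\mathbb C^d\to\mathcal H$. A row contraction on $\mathcal H$ is a contraction $T=(T_1,\dots,T_d):\mathcal H\otimes\mathbb C^d\to\mathcal H$, $T(h_1,\dots,h_d)^T=\sum T_jh_j$; so $Tz^*=\sum\overline z_jT_j$. $D_T:=\sqrt{I-T^*T}$, $D_{T^*}:=\sqrt{I-TT^*}$. $T$ is CCNC if $\mathcal H=\bigvee_{z\in\mathbb B^d}(I-Tz^* )^{-1}\mathrm{Ran}(D_{T^*})$. Row contractions $T^{(1)},T^{(2)}$ on $\mathcal H_1,\mathcal H_2$ are unitarily equivalent if there is an onto isometry $U:\mathcal H_1\to\mathcal H_2$ with $UT^{(1)}_jU^*=T^{(2)}_j$ for all $j$. Schur class and Gleason solutions. $H^2_d$ is the Drury-Arveson space (reproducing kernel $1/(1-zw^* )$ on $\mathbb B^d$); $\mathscr S_d(\mathcal J,\mathcal K)$ is the set of contractive multipliers from $H^2_d\otimes\mathcal J$ to $H^2_d\otimes\mathcal K$ ($\mathscr L(\mathcal J,\mathcal K)$-valued functions on $\mathbb B^d$). For $b\in\mathscr S_d(\mathcal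 J,\mathcal K)$, $\mathscr H(b)$ is the $\mathcal K$-valued RKHS on $\mathbb B^d$ with kernel $k^b(z,w)=\frac{I-b(z)b(w)^*}{1-zw^*}$, and $k^b_z\in\mathscr L(\mathcal K,\mathscr H(b))$ is the adjoint of evaluation at $z$. A contraction $A$ is pure if $\|Ag\|<\|g\|$ for all $g\neq0$; $b$ is purely contractive if $b(z)$ is pure for all $z\in\mathbb B^d$. A row contraction $X$ on $\mathscr H(b)$ is a Gleason solution for $\mathscr H(b)$ if $\sum_jz_j(X_j^*f)(z)=f(z)-f(0)$ for all $f\in\mathscr H(b)$, $z\in\mathbb B^d$; it is contractive if $XX^*\le I-k_0^b(k_0^b)^*$ and extremal if $XX^*=I-k_0^b(k_0^b)^*$. Weak coincidence. $b_1\in\mathscr S_d(\mathcal H_1,\mathcal J_1)$ and $b_2\in\mathscr S_d(\mathcal H_2,\mathcal J_2)$ coincide weakly if there is an onto isometry $U:\mathcal J_1\to\mathcal J_2$ with $Ub_1(z)b_1(w)^*U^*=b_2(z)b_2(w)^*$ for all $z,w\in\mathbb B^d$. Characteristic function. Every row contraction $T$ has an isometric-pure decomposition $T=V-C$, where $V:=TP_{\mathrm{Ker}(D_T)}$ is a row partial isometry and $C$ is a pure row contraction on $\mathrm{Ker}(V)$, with $\mathrm{Ker}(C)^\perp\subseteq\mathrm{Ker}(V)$, $\mathrm{Ran}(C)\subseteq\mathrm{Ran}(V)^\perp$; $T$ is CCNC iff $V$ is. For a CCNC row partial isometry $V$ put $\mathcal R(V-z):=(V-z)\mathrm{Ker}(V)^\perp$.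 A model triple $(\gamma,\mathcal J_\infty,\mathcal J_0)$ for $V$ consists of Hilbert spaces with $\dim\mathcal J_\infty=\dim\mathrm{Ker}(V)$, $\dim\mathcal J_0=\dim\mathrm{Ran}(V)^\perp$, and a map $\gamma$ on $\mathbb B^d\cup\{\infty\}$ with $\gamma(z)\in\mathscr L(\mathcal J_0,\mathcal R(V-z)^\perp)$ a linear isomorphism for each $z\in\mathbb B^d$, $\gamma(\infty)\in\mathscr L(\mathcal J_\infty,\mathrm{Ker}(V))$, and $\gamma(0),\gamma(\infty)$ onto isometries. Then $D^\gamma(z):=\gamma(z)^*\gamma(0)$ is invertible, and with $N^\gamma(z):=(\gamma(z)^*\otimes I_d)\gamma(\infty)$ one sets $b_V^\gamma(z):=D^\gamma(z)^{-1}zN^\gamma(z)\in\mathscr L(\mathcal J_\infty,\mathcal J_0)$. For $T=V-C$ CCNC let $\delta:=-\gamma(0)^*T\gamma(\infty)$ (a pure contraction) and $b_T^\gamma(z):=D_{\delta^*}^{-1}(b_V^\gamma(z)+\delta)(I+\delta^*b_V^\gamma(z))^{-1}D_\delta$ (its adjoint is initially defined on the dense subspace $\mathrm{Ran}(D_{\delta^*})$ and extended by continuity). The characteristic function $b_T$ of $T$ is the weak coincidence class of $b_T^\gamma\in\mathscr S_d(\mathcal J_\infty,\mathcal J_0)$ (independent of the model triple), or any representative of it. *)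

theory Defs
  imports
    "HOL-Analysis.Analysis"
    "HOL-Library.Function_Algebras"
    "HOL-Library.Equipollence"
begin

section \<open>Complex vector spaces as ambient types\<close>

class complex_vector = ab_group_add +
  fixes scaleC :: "complex \<Rightarrow> 'a \<Rightarrow> 'a"  (infixr "*\<^sub>C" 75)
  assumes scaleC_add_right: "c *\<^sub>C (x + y) = c *\<^sub>C x + c *\<^sub>C y"
    and scaleC_add_left: "(c + c') *\<^sub>C x = c *\<^sub>C x + c' *\<^sub>C x"
    and scaleC_scaleC: "c *\<^sub>C (c' *\<^sub>C x) = (c * c') *\<^sub>C x"
    and scaleC_one: "1 *\<^sub>C x = x"

global_interpretation cvec: vector_space "scaleC :: complex \<Rightarrow> 'a \<Rightarrow> 'a::complex_vector"
  by unfold_locales (rule scaleC_add_right scaleC_add_left scaleC_scaleC scaleC_one)+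

instantiation complex :: complex_vector
begin
definition scaleC_complex_def: "c *\<^sub>C (x::complex) = c * x"
instance by standard (simp_all add: scaleC_complex_def algebra_simps)
end

instantiation "fun" :: (type, complex_vector) complex_vector
begin
definition scaleC_fun_def: "c *\<^sub>C (f::'a \<Rightarrow> 'b) = (\<lambda>x. c *\<^sub>C f x)"
instance
  by standard (simp_all add: scaleC_fun_def fun_eq_iff scaleC_add_right scaleC_add_left
      scaleC_scaleC scaleC_one)
end

instantiation vec :: (complex_vector, finite) complex_vector
begin
definition scaleC_vec_def: "c *\<^sub>C (x::'a ^ 'b) = (\<chi> i. c *\<^sub>C (x $ i))"
instance
  by standard (simp_all add: scaleC_vec_def vec_eq_iff scaleC_add_right scaleC_add_left
      scaleC_scaleC scaleC_one)
end

section \<open>Hilbert spaces\<close>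

text \<open>A Hilbert space is a linear subspace of an ambient complex vector space together with its own
  inner product, linear in the first argument. An operator is a function on the ambient types; only
  its values on the carrier of its domain matter.\<close>

record 'a hspace =
  hcarrier :: "'a set"
  hinner :: "'a \<Rightarrow> 'a \<Rightarrow> complex"

definition hnorm :: "'a hspace \<Rightarrow> 'a \<Rightarrow> real" where
  "hnorm H x = sqrt (Re (hinner H x x))"

definition hclosure :: "'a::complex_vector hspace \<Rightarrow> 'a set \<Rightarrow> 'a set" where
  "hclosure H S = {x \<in> hcarrier H. \<forall>e>0. \<exists>s\<in>S. hnorm H (x - s) < e}"

definition hilbert_space :: "'a::complex_vector hspace \<Rightarrow> bool" where
  "hilbert_space H \<longleftrightarrow>
     cvec.subspace (hcarrier H)
   \<and> (\<forall>x\<in>hcarrier H. \<forall>y\<in>hcarrier H. \<forall>z\<in>hcarrier H.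
        hinner H (x + y) z = hinner H x z + hinner H y z)
   \<and> (\<forall>c. \<forall>x\<in>hcarrier H. \<forall>y\<in>hcarrier H. hinner H (c *\<^sub>C x) y = c * hinner H x y)
   \<and> (\<forall>x\<in>hcarrier H. \<forall>y\<in>hcarrier H. hinner H y x = cnj (hinner H x y))
   \<and> (\<forall>x\<in>hcarrier H. x \<noteq> 0 \<longrightarrow> Re (hinner H x x) > 0)
   \<and> (\<forall>X::nat \<Rightarrow> 'a. (\<forall>n. X n \<in> hcarrier H)
        \<and> (\<forall>e>0. \<exists>N. \<forall>m\<ge>N. \<forall>n\<ge>N. hnorm H (X m - X n) < e)
        \<longrightarrow> (\<exists>l\<in>hcarrier H. (\<lambda>n. hnorm H (X n - l)) \<longlonglongrightarrow> 0))"

definition sep_hilbert :: "'a::complex_vector hspace \<Rightarrow> bool" where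
  "sep_hilbert H \<longleftrightarrow> hilbert_space H
   \<and> (\<exists>S. countable S \<and> S \<subseteq> hcarrier H \<and> hclosure H S = hcarrier H)"

definition hcspan :: "'a::complex_vector hspace \<Rightarrow> 'a set \<Rightarrow> 'a set" where
  "hcspan H S = hclosure H (cvec.span S)"

definition horth :: "'a::complex_vector hspace \<Rightarrow> 'a set \<Rightarrow> 'a set" where
  "horth H S = {x \<in> hcarrier H. \<forall>s\<in>S. hinner H x s = 0}"

definition hsub :: "'a hspace \<Rightarrow> 'a set \<Rightarrow> 'a hspace" where
  "hsub H S = \<lparr>hcarrier = S, hinner = hinner H\<rparr>"

definition hproj :: "'a::complex_vector hspace \<Rightarrow> 'a set \<Rightarrow> 'a \<Rightarrow> 'a" where
  "hproj H S x = (THE y. y \<in> S \<and> x - y \<in> horth H S)"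

definition onb :: "'a::complex_vector hspace \<Rightarrow> 'a set \<Rightarrow> bool" where
  "onb H E \<longleftrightarrow> E \<subseteq> hcarrier H
   \<and> (\<forall>e\<in>E. \<forall>f\<in>E. hinner H e f = (if e = f then 1 else 0))
   \<and> hcspan H E = hcarrier H"

definition same_hdim :: "'a::complex_vector hspace \<Rightarrow> 'b::complex_vector hspace \<Rightarrow> bool" where
  "same_hdim H K \<longleftrightarrow> (\<exists>E F. onb H E \<and> onb K F \<and> E \<approx> F)"

text \<open>The tensor product of \<open>H\<close> with \<open>\<complex>\<close>\<open>\<^sup>d\<close>, as column vectors with entries in \<open>H\<close>.\<close>

definition hcol :: "'a::complex_vector hspace \<Rightarrow> ('a ^ 'd) hspace" where
  "hcol H = \<lparr>hcarrier = {x. \<forall>j. x $ j \<in> hcarrier H},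
             hinner = (\<lambda>x y. \<Sum>j\<in>UNIV. hinner H (x $ j) (y $ j))\<rparr>"

section \<open>Operators\<close>

definition bounded_op ::
  "'a::complex_vector hspace \<Rightarrow> 'b::complex_vector hspace \<Rightarrow> ('a \<Rightarrow> 'b) \<Rightarrow> bool" where
  "bounded_op H K A \<longleftrightarrow>
     (\<forall>x\<in>hcarrier H. A x \<in> hcarrier K)
   \<and> (\<forall>x\<in>hcarrier H. \<forall>y\<in>hcarrier H. A (x + y) = A x + A y)
   \<and> (\<forall>c. \<forall>x\<in>hcarrier H. A (c *\<^sub>C x) = c *\<^sub>C A x)
   \<and> (\<exists>M. \<forall>x\<in>hcarrier H. hnorm K (A x) \<le> M * hnorm H x)"

definition contraction ::
  "'a::complex_vector hspace \<Rightarrow> 'b::complex_vector hspace \<Rightarrow> ('a \<Rightarrow> 'b) \<Rightarrow> bool" where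
  "contraction H K A \<longleftrightarrow> bounded_op H K A \<and> (\<forall>x\<in>hcarrier H. hnorm K (A x) \<le> hnorm H x)"

definition pure_contraction ::
  "'a::complex_vector hspace \<Rightarrow> 'b::complex_vector hspace \<Rightarrow> ('a \<Rightarrow> 'b) \<Rightarrow> bool" where
  "pure_contraction H K A \<longleftrightarrow> contraction H K A
   \<and> (\<forall>g\<in>hcarrier H. g \<noteq> 0 \<longrightarrow> hnorm K (A g) < hnorm H g)"

definition onto_isometry ::
  "'a::complex_vector hspace \<Rightarrow> 'b::complex_vector hspace \<Rightarrow> ('a \<Rightarrow> 'b) \<Rightarrow> bool" where
  "onto_isometry H K U \<longleftrightarrow> bounded_op H K U
   \<and> (\<forall>x\<in>hcarrier H. hnorm K (U x) = hnorm H x) \<and> U ` hcarrier H = hcarrier K"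

definition linear_iso ::
  "'a::complex_vector hspace \<Rightarrow> 'b::complex_vector hspace \<Rightarrow> ('a \<Rightarrow> 'b) \<Rightarrow> bool" where
  "linear_iso H K A \<longleftrightarrow> bounded_op H K A
   \<and> (\<exists>B. bounded_op K H B \<and> (\<forall>x\<in>hcarrier H. B (A x) = x) \<and> (\<forall>y\<in>hcarrier K. A (B y) = y))"

definition hadj ::
  "'a::complex_vector hspace \<Rightarrow> 'b::complex_vector hspace \<Rightarrow> ('a \<Rightarrow> 'b) \<Rightarrow> 'b \<Rightarrow> 'a" where
  "hadj H K A y = (THE x. x \<in> hcarrier H \<and> (\<forall>h\<in>hcarrier H. hinner K (A h) y = hinner H h x))"

text \<open>The value on the carrier of an operator inverse, adjoint, square root or extension is unique
  whenever it exists; this justifies the descriptions used here.\<close>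

definition hinverse :: "'a hspace \<Rightarrow> ('a \<Rightarrow> 'b) \<Rightarrow> 'b \<Rightarrow> 'a" where
  "hinverse H A = inv_into (hcarrier H) A"

definition positive_op :: "'a::complex_vector hspace \<Rightarrow> ('a \<Rightarrow> 'a) \<Rightarrow> bool" where
  "positive_op H A \<longleftrightarrow> bounded_op H H A \<and> (\<forall>x\<in>hcarrier H. hinner H (A x) x \<in> \<real>\<^sub>\<ge>\<^sub>0)"

definition hsqrt :: "'a::complex_vector hspace \<Rightarrow> ('a \<Rightarrow> 'a) \<Rightarrow> 'a \<Rightarrow> 'a" where
  "hsqrt H A = (SOME B. positive_op H B \<and> (\<forall>x\<in>hcarrier H. B (B x) = A x))"

definition hextension ::
  "'a::complex_vector hspace \<Rightarrow> 'b::complex_vector hspace \<Rightarrow> 'a set \<Rightarrow> ('a \<Rightarrow> 'b) \<Rightarrow> 'a \<Rightarrow> 'b" where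
  "hextension H K S f = (SOME B. bounded_op H K B \<and> (\<forall>x\<in>S. B x = f x))"

text \<open>The defect operators of \<open>A\<close> from \<open>H\<close> to \<open>K\<close>: the square roots of
  \<open>I - A\<^sup>* A\<close> and \<open>I - A A\<^sup>*\<close>.\<close>

definition defect ::
  "'a::complex_vector hspace \<Rightarrow> 'b::complex_vector hspace \<Rightarrow> ('a \<Rightarrow> 'b) \<Rightarrow> 'a \<Rightarrow> 'a" where
  "defect H K A = hsqrt H (\<lambda>x. x - hadj H K A (A x))"

definition defect_adj ::
  "'a::complex_vector hspace \<Rightarrow> 'b::complex_vector hspace \<Rightarrow> ('a \<Rightarrow> 'b) \<Rightarrow> 'b \<Rightarrow> 'b" where
  "defect_adj H K A = hsqrt K (\<lambda>y. y - A (hadj H K A y))"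

section \<open>Row contractions\<close>

definition row_contraction ::
  "'h::complex_vector hspace \<Rightarrow> ('h ^ 'd \<Rightarrow> 'h) \<Rightarrow> bool" where
  "row_contraction H T \<longleftrightarrow> contraction (hcol H) H T"

definition comp_op :: "('h::complex_vector ^ 'd \<Rightarrow> 'h) \<Rightarrow> 'd \<Rightarrow> 'h \<Rightarrow> 'h" where
  "comp_op T j h = T (axis j h)"

definition zstar :: "complex ^ 'd \<Rightarrow> 'h::complex_vector \<Rightarrow> 'h ^ 'd" where
  "zstar z h = (\<chi> j. cnj (z $ j) *\<^sub>C h)"

definition zrow :: "complex ^ 'd \<Rightarrow> 'h::complex_vector ^ 'd \<Rightarrow> 'h" where
  "zrow z x = (\<Sum>j\<in>UNIV. z $ j *\<^sub>C (x $ j))"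

definition zdot :: "complex ^ 'd \<Rightarrow> complex ^ 'd \<Rightarrow> complex" where
  "zdot z w = (\<Sum>j\<in>UNIV. z $ j * cnj (w $ j))"

abbreviation unit_ball :: "(complex ^ 'd) set" (\<open>\<bool>\<close>) where
  "\<bool> \<equiv> ball 0 1"

definition ccnc :: "'h::complex_vector hspace \<Rightarrow> ('h ^ 'd \<Rightarrow> 'h) \<Rightarrow> bool" where
  "ccnc H T \<longleftrightarrow>
     hcarrier H = hcspan H (\<Union>z\<in>\<bool>.
       hinverse H (\<lambda>h. h - T (zstar z h)) ` (defect_adj (hcol H) H T ` hcarrier H))"

definition unitarily_equivalent ::
  "'h::complex_vector hspace \<Rightarrow> ('h ^ 'd \<Rightarrow> 'h)
   \<Rightarrow> 'k::complex_vector hspace \<Rightarrow> ('k ^ 'd \<Rightarrow> 'k) \<Rightarrow> bool" where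
  "unitarily_equivalent H1 T1 H2 T2 \<longleftrightarrow>
     (\<exists>U. onto_isometry H1 H2 U
        \<and> (\<forall>j. \<forall>y\<in>hcarrier H2. U (comp_op T1 j (hadj H1 H2 U y)) = comp_op T2 j y))"

section \<open>Reproducing kernel Hilbert spaces and the Schur class\<close>

text \<open>A function on the ball is represented by a function on the whole space that vanishes off the
  ball. The operator-valued kernel determines the space up to irrelevant values of the inner product
  outside the carrier.\<close>

definition is_rkhs :: "'k::complex_vector hspace \<Rightarrow> (complex ^ 'd \<Rightarrow> complex ^ 'd \<Rightarrow> 'k \<Rightarrow> 'k)
   \<Rightarrow> (complex ^ 'd \<Rightarrow> 'k) hspace \<Rightarrow> bool" where
  "is_rkhs K k R \<longleftrightarrow> hilbert_space R
   \<and> (\<forall>f\<in>hcarrier R. (\<forall>z\<in>\<bool>. f z \<in> hcarrier K) \<and> (\<forall>z. z \<notin> \<bool> \<longrightarrow> f z = 0))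
   \<and> (\<forall>w\<in>\<bool>. \<forall>x\<in>hcarrier K.
        (\<lambda>z. if z \<in> \<bool> then k z w x else 0) \<in> hcarrier R
      \<and> (\<forall>f\<in>hcarrier R. hinner R f (\<lambda>z. if z \<in> \<bool> then k z w x else 0) = hinner K (f w) x))"

definition rkhs :: "'k::complex_vector hspace \<Rightarrow> (complex ^ 'd \<Rightarrow> complex ^ 'd \<Rightarrow> 'k \<Rightarrow> 'k)
   \<Rightarrow> (complex ^ 'd \<Rightarrow> 'k) hspace" where
  "rkhs K k = (SOME R. is_rkhs K k R)"

text \<open>The tensor product of the Drury-Arveson space with \<open>K\<close>, as a space of
  \<open>K\<close>-valued functions.\<close>

definition drury_arveson :: "'k::complex_vector hspace \<Rightarrow> (complex ^ 'd \<Rightarrow> 'k) hspace" where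
  "drury_arveson K = rkhs K (\<lambda>z w x. (1 / (1 - zdot z w)) *\<^sub>C x)"

definition schur_class :: "'j::complex_vector hspace \<Rightarrow> 'k::complex_vector hspace
   \<Rightarrow> (complex ^ 'd \<Rightarrow> 'j \<Rightarrow> 'k) \<Rightarrow> bool" where
  "schur_class J K b \<longleftrightarrow>
     (\<forall>z\<in>\<bool>. bounded_op J K (b z))
   \<and> contraction (drury_arveson J) (drury_arveson K)
       (\<lambda>f z. if z \<in> \<bool> then b z (f z) else 0)"

definition purely_contractive :: "'j::complex_vector hspace \<Rightarrow> 'k::complex_vector hspace
   \<Rightarrow> (complex ^ 'd \<Rightarrow> 'j \<Rightarrow> 'k) \<Rightarrow> bool" where
  "purely_contractive J K b \<longleftrightarrow> (\<forall>z\<in>\<bool>. pure_contraction J K (b z))"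

definition dbr_kernel :: "'j::complex_vector hspace \<Rightarrow> 'k::complex_vector hspace
   \<Rightarrow> (complex ^ 'd \<Rightarrow> 'j \<Rightarrow> 'k) \<Rightarrow> complex ^ 'd \<Rightarrow> complex ^ 'd \<Rightarrow> 'k \<Rightarrow> 'k" where
  "dbr_kernel J K b z w x = (1 / (1 - zdot z w)) *\<^sub>C (x - b z (hadj J K (b w) x))"

definition dbr_space :: "'j::complex_vector hspace \<Rightarrow> 'k::complex_vector hspace
   \<Rightarrow> (complex ^ 'd \<Rightarrow> 'j \<Rightarrow> 'k) \<Rightarrow> (complex ^ 'd \<Rightarrow> 'k) hspace" where
  "dbr_space J K b = rkhs K (dbr_kernel J K b)"

definition kernel_map :: "'j::complex_vector hspace \<Rightarrow> 'k::complex_vector hspace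
   \<Rightarrow> (complex ^ 'd \<Rightarrow> 'j \<Rightarrow> 'k) \<Rightarrow> complex ^ 'd \<Rightarrow> 'k \<Rightarrow> (complex ^ 'd \<Rightarrow> 'k)" where
  "kernel_map J K b z = hadj (dbr_space J K b) K (\<lambda>f. f z)"

definition gleason_solution :: "'j::complex_vector hspace \<Rightarrow> 'k::complex_vector hspace
   \<Rightarrow> (complex ^ 'd \<Rightarrow> 'j \<Rightarrow> 'k)
   \<Rightarrow> ((complex ^ 'd \<Rightarrow> 'k) ^ 'd \<Rightarrow> (complex ^ 'd \<Rightarrow> 'k)) \<Rightarrow> bool" where
  "gleason_solution J K b X \<longleftrightarrow> (let R = dbr_space J K b in
     row_contraction R X
   \<and> (\<forall>f\<in>hcarrier R. \<forall>z\<in>\<bool>.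
        (\<Sum>j\<in>UNIV. z $ j *\<^sub>C (hadj R R (comp_op X j) f z)) = f z - f 0))"

definition extremal_gleason :: "'j::complex_vector hspace \<Rightarrow> 'k::complex_vector hspace
   \<Rightarrow> (complex ^ 'd \<Rightarrow> 'j \<Rightarrow> 'k)
   \<Rightarrow> ((complex ^ 'd \<Rightarrow> 'k) ^ 'd \<Rightarrow> (complex ^ 'd \<Rightarrow> 'k)) \<Rightarrow> bool" where
  "extremal_gleason J K b X \<longleftrightarrow> (let R = dbr_space J K b; k0 = kernel_map J K b 0 in
     gleason_solution J K b X
   \<and> (\<forall>f\<in>hcarrier R. X (hadj (hcol R) R X f) = f - k0 (hadj K R k0 f)))"

definition weakly_coincide ::
  "'a::complex_vector hspace \<Rightarrow> 'b::complex_vector hspace \<Rightarrow> (complex ^ 'd \<Rightarrow> 'a \<Rightarrow> 'b)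
   \<Rightarrow> 'e::complex_vector hspace \<Rightarrow> 'f::complex_vector hspace \<Rightarrow> (complex ^ 'd \<Rightarrow> 'e \<Rightarrow> 'f) \<Rightarrow> bool" where
  "weakly_coincide H1 J1 b1 H2 J2 b2 \<longleftrightarrow>
     schur_class H1 J1 b1 \<and> schur_class H2 J2 b2
   \<and> (\<exists>U. onto_isometry J1 J2 U
        \<and> (\<forall>z\<in>\<bool>. \<forall>w\<in>\<bool>. \<forall>y\<in>hcarrier J2.
              U (b1 z (hadj H1 J1 (b1 w) (hadj J1 J2 U y))) = b2 z (hadj H2 J2 (b2 w) y)))"

section \<open>The characteristic function\<close>

definition hker :: "'a hspace \<Rightarrow> ('a \<Rightarrow> 'b::zero) \<Rightarrow> 'a set" where
  "hker H A = {x \<in> hcarrier H. A x = 0}"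

text \<open>The partially isometric part \<open>V\<close> of \<open>T\<close>.\<close>

definition iso_part :: "'h::complex_vector hspace \<Rightarrow> ('h ^ 'd \<Rightarrow> 'h) \<Rightarrow> 'h ^ 'd \<Rightarrow> 'h" where
  "iso_part H T x = T (hproj (hcol H) (hker (hcol H) (defect (hcol H) H T)) x)"

definition shifted_range ::
  "'h::complex_vector hspace \<Rightarrow> ('h ^ 'd \<Rightarrow> 'h) \<Rightarrow> complex ^ 'd \<Rightarrow> 'h set" where
  "shifted_range H V z = (\<lambda>x. V x - zrow z x) ` horth (hcol H) (hker (hcol H) V)"

text \<open>The value of the model map at infinity is the separate argument \<open>\<gamma>i\<close>.\<close>

definition model_triple :: "'h::complex_vector hspace \<Rightarrow> ('h ^ 'd \<Rightarrow> 'h)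
   \<Rightarrow> 'm::complex_vector hspace \<Rightarrow> 'n::complex_vector hspace
   \<Rightarrow> (complex ^ 'd \<Rightarrow> 'n \<Rightarrow> 'h) \<Rightarrow> ('m \<Rightarrow> 'h ^ 'd) \<Rightarrow> bool" where
  "model_triple H V Ji J0 \<gamma> \<gamma>i \<longleftrightarrow>
     sep_hilbert Ji \<and> sep_hilbert J0
   \<and> same_hdim Ji (hsub (hcol H) (hker (hcol H) V))
   \<and> same_hdim J0 (hsub H (horth H (V ` hcarrier (hcol H))))
   \<and> (\<forall>z\<in>\<bool>. linear_iso J0 (hsub H (horth H (shifted_range H V z))) (\<gamma> z))
   \<and> onto_isometry J0 (hsub H (horth H (shifted_range H V 0))) (\<gamma> 0)
   \<and> onto_isometry Ji (hsub (hcol H) (hker (hcol H) V)) \<gamma>i"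

text \<open>Below, \<open>hadj J0 H (\<gamma> z)\<close> is the adjoint of \<open>\<gamma> z\<close> regarded as a map into
  all of \<open>H\<close>.\<close>

definition model_D :: "'h::complex_vector hspace \<Rightarrow> 'n::complex_vector hspace
   \<Rightarrow> (complex ^ 'd \<Rightarrow> 'n \<Rightarrow> 'h) \<Rightarrow> complex ^ 'd \<Rightarrow> 'n \<Rightarrow> 'n" where
  "model_D H J0 \<gamma> z y = hadj J0 H (\<gamma> z) (\<gamma> 0 y)"

definition model_N :: "'h::complex_vector hspace \<Rightarrow> 'n::complex_vector hspace
   \<Rightarrow> (complex ^ 'd \<Rightarrow> 'n \<Rightarrow> 'h) \<Rightarrow> ('m \<Rightarrow> 'h ^ 'd) \<Rightarrow> complex ^ 'd \<Rightarrow> 'm \<Rightarrow> 'n ^ 'd" where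
  "model_N H J0 \<gamma> \<gamma>i z x = (\<chi> j. hadj J0 H (\<gamma> z) (\<gamma>i x $ j))"

definition model_bV :: "'h::complex_vector hspace \<Rightarrow> 'n::complex_vector hspace
   \<Rightarrow> (complex ^ 'd \<Rightarrow> 'n \<Rightarrow> 'h) \<Rightarrow> ('m \<Rightarrow> 'h ^ 'd) \<Rightarrow> complex ^ 'd \<Rightarrow> 'm \<Rightarrow> 'n" where
  "model_bV H J0 \<gamma> \<gamma>i z x = hinverse J0 (model_D H J0 \<gamma> z) (zrow z (model_N H J0 \<gamma> \<gamma>i z x))"

definition model_delta :: "'h::complex_vector hspace \<Rightarrow> ('h ^ 'd \<Rightarrow> 'h)
   \<Rightarrow> 'n::complex_vector hspace
   \<Rightarrow> (complex ^ 'd \<Rightarrow> 'n \<Rightarrow> 'h) \<Rightarrow> ('m \<Rightarrow> 'h ^ 'd) \<Rightarrow> 'm \<Rightarrow> 'n" where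
  "model_delta H T J0 \<gamma> \<gamma>i x = - hadj J0 H (\<gamma> 0) (T (\<gamma>i x))"

text \<open>With \<open>M z = (b\<^sub>V z + \<delta>) (I + \<delta>\<^sup>* b\<^sub>V z)\<inverse> D\<^sub>\<delta>\<close>, the inverse of the defect operator
  of \<open>\<delta>\<^sup>*\<close> is in general unbounded, so \<open>b\<^sub>T z\<close> is the adjoint of the bounded
  extension of \<open>(M z)\<^sup>*\<close> composed with that inverse, from the dense range of the defect operator
  to all of \<open>J0\<close>.\<close>

definition frostman_factor :: "'m::complex_vector hspace \<Rightarrow> 'n::complex_vector hspace
   \<Rightarrow> ('m \<Rightarrow> 'n) \<Rightarrow> ('m \<Rightarrow> 'n) \<Rightarrow> 'm \<Rightarrow> 'n" where
  "frostman_factor Ji J0 \<delta> B x =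
     (let u = hinverse Ji (\<lambda>v. v + hadj Ji J0 \<delta> (B v)) (defect Ji J0 \<delta> x) in B u + \<delta> u)"

definition model_bT :: "'h::complex_vector hspace \<Rightarrow> ('h ^ 'd \<Rightarrow> 'h)
   \<Rightarrow> 'm::complex_vector hspace \<Rightarrow> 'n::complex_vector hspace
   \<Rightarrow> (complex ^ 'd \<Rightarrow> 'n \<Rightarrow> 'h) \<Rightarrow> ('m \<Rightarrow> 'h ^ 'd) \<Rightarrow> complex ^ 'd \<Rightarrow> 'm \<Rightarrow> 'n" where
  "model_bT H T Ji J0 \<gamma> \<gamma>i z =
     (let \<delta> = model_delta H T J0 \<gamma> \<gamma>i;
          D = defect_adj Ji J0 \<delta>;
          M = frostman_factor Ji J0 \<delta> (model_bV H J0 \<gamma> \<gamma>i z)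
      in hadj J0 Ji (hextension J0 Ji (D ` hcarrier J0) (\<lambda>y. hadj Ji J0 M (hinverse J0 D y))))"

text \<open>In the next definition the model spaces live in the ambient space of complex sequences.
  This loses nothing: every separable Hilbert space is isometrically isomorphic to one of
  that form.\<close>

definition characteristic_function :: "'h::complex_vector hspace \<Rightarrow> ('h ^ 'd \<Rightarrow> 'h)
   \<Rightarrow> 'j::complex_vector hspace \<Rightarrow> 'k::complex_vector hspace
   \<Rightarrow> (complex ^ 'd \<Rightarrow> 'j \<Rightarrow> 'k) \<Rightarrow> bool" where
  "characteristic_function H T J K b \<longleftrightarrow>
     ccnc H T \<and> sep_hilbert J \<and> sep_hilbert K
   \<and> (\<exists>(Ji :: (nat \<Rightarrow> complex) hspace) (J0 :: (nat \<Rightarrow> complex) hspace) \<gamma> \<gamma>i.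
        model_triple H (iso_part H T) Ji J0 \<gamma> \<gamma>i
      \<and> weakly_coincide J K b Ji J0 (model_bT H T Ji J0 \<gamma> \<gamma>i))"

definition extremal_gleason_model :: "'h::complex_vector hspace \<Rightarrow> ('h ^ 'd \<Rightarrow> 'h)
   \<Rightarrow> 'j::complex_vector hspace \<Rightarrow> 'k::complex_vector hspace
   \<Rightarrow> (complex ^ 'd \<Rightarrow> 'j \<Rightarrow> 'k) \<Rightarrow> bool" where
  "extremal_gleason_model H T J K b \<longleftrightarrow>
     sep_hilbert J \<and> sep_hilbert K \<and> schur_class J K b \<and> purely_contractive J K b
   \<and> (\<exists>X. extremal_gleason J K b X \<and> unitarily_equivalent H T (dbr_space J K b) X)"

end

theory Submission
  imports Defs
begin

text \<open>Let \<open>T\<close> be a row contraction on \<open>H\<close> and \<open>G\<close> a bounded map with dense range and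
  \<open>G\<^sup>* G = I - T T\<^sup>*\<close>. Then \<open>h \<mapsto> (z \<mapsto> G (I - z T\<^sup>*)\<^sup>-\<^sup>1 h)\<close> maps \<open>H\<close> onto a reproducing kernel space
  with kernel \<open>G (I - z T\<^sup>*)\<^sup>-\<^sup>1 (I - T w\<^sup>*)\<^sup>-\<^sup>1 G\<^sup>*\<close>, and it is injective exactly when \<open>T\<close> is CCNC.
  A function \<open>b\<close> is a characteristic function of \<open>T\<close> exactly when its de Branges-Rovnyak kernel is of
  this form. For an extremal Gleason solution one takes \<open>G = k\<^sub>0\<^sup>*\<close>, whose range is dense because \<open>b(0)\<close>
  is pure; for a model triple one takes \<open>G = D\<^bsub>\<delta>\<^sup>*\<^esub> \<gamma>(0)\<^sup>*\<close>. Two such maps \<open>G\<close> differ by a unitary between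
  their target spaces, and this unitary is the weak coincidence.\<close>

section \<open>Geometry of a Hilbert space\<close>

text \<open>Two obstacles shape the argument. The operator \<open>E\<close>, the defect of the
  adjoint of \<open>\<delta>\<close>, is injective with dense range, but its inverse may be
  unbounded. The kernel identity of a model triple is therefore computed only for vectors in the
  range of \<open>E\<close>, where it is a finite calculation with inner products
  (\<open>f_inner\<close>), and is then carried to all vectors in one argument at a time
  (\<open>sesquilinear_identity_extend\<close>). Moreover the inverse of
  \<open>I + \<delta>^* b_V\<close> is not built by hand: since V and T differ only on Ker V, the
  resolvent of T itself yields the solution. Membership in the Schur class comes from the kernel
  identity by a lurking isometry. The de Branges-Rovnyak space exists because its kernel factors
  through a defect operator on the Drury-Arveson space, which in turn comes from square-summable
  families indexed by words. The unitaries between different realizations come from equal Gram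
  matrices of total families, so square roots enter mostly through their Gram forms, and CCNC is the
  totality of one such family.\<close>

lemma scaleC_simps [simp]:
  fixes x :: "'a::complex_vector"
  shows "0 *\<^sub>C x = 0" "c *\<^sub>C (0::'a) = 0" "1 *\<^sub>C x = x" "(-1) *\<^sub>C x = - x"
  by (simp_all add: scaleC_one)

lemma scaleC_diff_right: "c *\<^sub>C (x - y) = c *\<^sub>C x - c *\<^sub>C (y::'a::complex_vector)"
  by (rule cvec.scale_right_diff_distrib)

context
  fixes H :: "'a::complex_vector hspace"
  assumes H: "hilbert_space H"
begin

lemma carrier_subspace: "cvec.subspace (hcarrier H)"
  using H unfolding hilbert_space_def by blast

lemma carrier_0 [simp]: "0 \<in> hcarrier H"
  by (rule cvec.subspace_0[OF carrier_subspace])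
lemma carrier_add [simp]: "x \<in> hcarrier H \<Longrightarrow> y \<in> hcarrier H \<Longrightarrow> x + y \<in> hcarrier H"
  by (rule cvec.subspace_add[OF carrier_subspace])
lemma carrier_diff [simp]: "x \<in> hcarrier H \<Longrightarrow> y \<in> hcarrier H \<Longrightarrow> x - y \<in> hcarrier H"
  by (rule cvec.subspace_diff[OF carrier_subspace])
lemma carrier_minus [simp]: "x \<in> hcarrier H \<Longrightarrow> - x \<in> hcarrier H"
  by (rule cvec.subspace_neg[OF carrier_subspace])
lemma carrier_scale [simp]: "x \<in> hcarrier H \<Longrightarrow> c *\<^sub>C x \<in> hcarrier H"
  by (rule cvec.subspace_scale[OF carrier_subspace])
lemma carrier_sum [simp]: "(\<And>i. i \<in> I \<Longrightarrow> f i \<in> hcarrier H) \<Longrightarrow> (\<Sum>i\<in>I. f i) \<in> hcarrier H"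
  by (rule cvec.subspace_sum[OF carrier_subspace])

lemma hinner_add_left:
  "x \<in> hcarrier H \<Longrightarrow> y \<in> hcarrier H \<Longrightarrow> z \<in> hcarrier H \<Longrightarrow>
    hinner H (x + y) z = hinner H x z + hinner H y z"
  using H unfolding hilbert_space_def by blast

lemma hinner_scale_left:
  "x \<in> hcarrier H \<Longrightarrow> y \<in> hcarrier H \<Longrightarrow> hinner H (c *\<^sub>C x) y = c * hinner H x y"
  using H unfolding hilbert_space_def by blast

lemma hinner_cnj:
  "x \<in> hcarrier H \<Longrightarrow> y \<in> hcarrier H \<Longrightarrow> cnj (hinner H x y) = hinner H y x"
  using H unfolding hilbert_space_def by metis

lemma hinner_pos: "x \<in> hcarrier H \<Longrightarrow> x \<noteq> 0 \<Longrightarrow> Re (hinner H x x) > 0"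
  using H unfolding hilbert_space_def by blast

lemma hcomplete:
  assumes "\<And>n. X n \<in> hcarrier H"
    and "\<And>e. e > 0 \<Longrightarrow> \<exists>N::nat. \<forall>m\<ge>N. \<forall>n\<ge>N. hnorm H (X m - X n) < e"
  obtains l where "l \<in> hcarrier H" "(\<lambda>n. hnorm H (X n - l)) \<longlonglongrightarrow> 0"
  using H assms unfolding hilbert_space_def by blast

lemma hinner_zero_left [simp]: "y \<in> hcarrier H \<Longrightarrow> hinner H 0 y = 0"
  using hinner_scale_left[of 0 y 0] by simp

lemma hinner_minus_left:
  "x \<in> hcarrier H \<Longrightarrow> y \<in> hcarrier H \<Longrightarrow> hinner H (- x) y = - hinner H x y"
  using hinner_scale_left[of x y "-1"] by simp

lemma hinner_diff_left:
  "x \<in> hcarrier H \<Longrightarrow> y \<in> hcarrier H \<Longrightarrow> z \<in> hcarrier H \<Longrightarrow>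
    hinner H (x - y) z = hinner H x z - hinner H y z"
  using hinner_add_left[of x "- y" z] by (simp add: hinner_minus_left)

lemma hinner_add_right:
  assumes "x \<in> hcarrier H" "y \<in> hcarrier H" "z \<in> hcarrier H"
  shows "hinner H z (x + y) = hinner H z x + hinner H z y"
  using arg_cong[OF hinner_add_left[OF assms], of cnj] assms by (simp add: hinner_cnj)

lemma hinner_scale_right:
  assumes "x \<in> hcarrier H" "y \<in> hcarrier H"
  shows "hinner H y (c *\<^sub>C x) = cnj c * hinner H y x"
  using arg_cong[OF hinner_scale_left[OF assms], of cnj c] assms by (simp add: hinner_cnj)

lemma hinner_zero_right [simp]: "y \<in> hcarrier H \<Longrightarrow> hinner H y 0 = 0"
  using hinner_scale_right[of 0 y 0] by simp

lemma hinner_minus_right: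
  "x \<in> hcarrier H \<Longrightarrow> y \<in> hcarrier H \<Longrightarrow> hinner H y (- x) = - hinner H y x"
  using hinner_scale_right[of x y "-1"] by simp

lemma hinner_diff_right:
  "x \<in> hcarrier H \<Longrightarrow> y \<in> hcarrier H \<Longrightarrow> z \<in> hcarrier H \<Longrightarrow>
    hinner H z (x - y) = hinner H z x - hinner H z y"
  using hinner_add_right[of x "- y" z] by (simp add: hinner_minus_right)

lemmas hinner_simps = hinner_add_left hinner_add_right hinner_diff_left hinner_diff_right
  hinner_minus_left hinner_minus_right hinner_scale_left hinner_scale_right

lemma hinner_sum_left:
  "(\<And>i. i \<in> I \<Longrightarrow> f i \<in> hcarrier H) \<Longrightarrow> y \<in> hcarrier H \<Longrightarrow>
    hinner H (\<Sum>i\<in>I. f i) y = (\<Sum>i\<in>I. hinner H (f i) y)"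
  by (induction I rule: infinite_finite_induct) (simp_all add: hinner_add_left)

lemma hinner_sum_right:
  "(\<And>i. i \<in> I \<Longrightarrow> f i \<in> hcarrier H) \<Longrightarrow> y \<in> hcarrier H \<Longrightarrow>
    hinner H y (\<Sum>i\<in>I. f i) = (\<Sum>i\<in>I. hinner H y (f i))"
  by (induction I rule: infinite_finite_induct) (simp_all add: hinner_add_right)

lemma Im_hinner_self [simp]: "x \<in> hcarrier H \<Longrightarrow> Im (hinner H x x) = 0"
  using arg_cong[OF hinner_cnj[of x x], of Im] by simp

lemma Re_hinner_self_ge0: "x \<in> hcarrier H \<Longrightarrow> Re (hinner H x x) \<ge> 0"
  using hinner_pos[of x] by (cases "x = 0") auto

lemma hnorm_ge0 [simp]: "x \<in> hcarrier H \<Longrightarrow> hnorm H x \<ge> 0"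
  using Re_hinner_self_ge0 by (simp add: hnorm_def)

lemma hnorm_sq: "x \<in> hcarrier H \<Longrightarrow> (hnorm H x)\<^sup>2 = Re (hinner H x x)"
  using Re_hinner_self_ge0[of x] by (simp add: hnorm_def)

lemma hinner_self: "x \<in> hcarrier H \<Longrightarrow> hinner H x x = of_real ((hnorm H x)\<^sup>2)"
  by (simp add: hnorm_sq complex_eq_iff)

lemma hnorm_zero [simp]: "hnorm H 0 = 0"
  by (simp add: hnorm_def)

lemma hnorm_eq_0 [simp]: "x \<in> hcarrier H \<Longrightarrow> hnorm H x = 0 \<longleftrightarrow> x = 0"
  using hinner_pos[of x] by (cases "x = 0") (auto simp: hnorm_def)

lemma hinner_self_eq_0 [simp]: "x \<in> hcarrier H \<Longrightarrow> hinner H x x = 0 \<longleftrightarrow> x = 0"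
  by (simp add: hinner_self)

lemma hinner_eq_0_commute:
  "x \<in> hcarrier H \<Longrightarrow> y \<in> hcarrier H \<Longrightarrow> hinner H x y = 0 \<longleftrightarrow> hinner H y x = 0"
  by (metis hinner_cnj complex_cnj_zero)

lemma hnorm_pos: "x \<in> hcarrier H \<Longrightarrow> x \<noteq> 0 \<Longrightarrow> hnorm H x > 0"
  using hnorm_ge0[of x] hnorm_eq_0[of x] by linarith

lemma hnorm_scale: "x \<in> hcarrier H \<Longrightarrow> hnorm H (c *\<^sub>C x) = cmod c * hnorm H x"
proof -
  assume x: "x \<in> hcarrier H"
  have "hinner H (c *\<^sub>C x) (c *\<^sub>C x) = of_real ((cmod c)\<^sup>2) * hinner H x x"
    using x by (simp add: hinner_simps complex_norm_square algebra_simps del: of_real_power)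
  then show ?thesis
    using x by (simp add: hnorm_def real_sqrt_mult)
qed

lemma hnorm_minus [simp]: "x \<in> hcarrier H \<Longrightarrow> hnorm H (- x) = hnorm H x"
  using hnorm_scale[of x "-1"] by simp

lemma hnorm_minus_commute:
  "x \<in> hcarrier H \<Longrightarrow> y \<in> hcarrier H \<Longrightarrow> hnorm H (x - y) = hnorm H (y - x)"
  using hnorm_minus[of "x - y"] by simp

lemma hnorm_add_sq:
  assumes "x \<in> hcarrier H" "y \<in> hcarrier H"
  shows "(hnorm H (x + y))\<^sup>2 = (hnorm H x)\<^sup>2 + (hnorm H y)\<^sup>2 + 2 * Re (hinner H x y)"
proof -
  have "Re (hinner H y x) = Re (hinner H x y)"
    using assms by (metis hinner_cnj complex_cnj(1) complex.sel(1) cnj.sel(1))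
  then show ?thesis
    using assms by (simp add: hnorm_sq hinner_simps)
qed

lemma hnorm_diff_sq:
  assumes "x \<in> hcarrier H" "y \<in> hcarrier H"
  shows "(hnorm H (x - y))\<^sup>2 = (hnorm H x)\<^sup>2 + (hnorm H y)\<^sup>2 - 2 * Re (hinner H x y)"
  using hnorm_add_sq[of x "- y"] assms by (simp add: hinner_simps)

lemma Cauchy_Schwarz:
  assumes x: "x \<in> hcarrier H" and y: "y \<in> hcarrier H"
  shows "cmod (hinner H x y) \<le> hnorm H x * hnorm H y"
proof (cases "y = 0")
  case False
  define n where "n = (hnorm H y)\<^sup>2"
  have n: "n > 0" using hnorm_pos[OF y False] by (simp add: n_def)
  define a where "a = hinner H x y"
  \<comment> \<open>With this coefficient, \<open>c *\<^sub>C y\<close> is the projection of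
    \<open>x\<close> onto the line of \<open>y\<close>.\<close>
  define c where "c = a / of_real n"
  have "0 \<le> (hnorm H (x - c *\<^sub>C y))\<^sup>2" by simp
  also have "\<dots> = (hnorm H x)\<^sup>2 + (cmod c)\<^sup>2 * n - 2 * Re (cnj c * a)"
    using x y by (subst hnorm_diff_sq) (simp_all add: hnorm_scale power_mult_distrib n_def hinner_simps a_def)
  also have "cnj c * a = of_real ((cmod a)\<^sup>2 / n)"
    by (simp add: c_def complex_norm_square mult.commute del: of_real_power)
  also have "(cmod c)\<^sup>2 * n = (cmod a)\<^sup>2 / n"
    using n by (simp add: c_def norm_divide power_divide power2_eq_square)
  finally have "(cmod a)\<^sup>2 \<le> (hnorm H x)\<^sup>2 * n"
    using n by (simp add: field_simps)
  then have "(cmod a)\<^sup>2 \<le> (hnorm H x * hnorm H y)\<^sup>2"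
    by (simp add: n_def power_mult_distrib)
  then show ?thesis
    using x y unfolding a_def by (metis power2_le_imp_le hnorm_ge0 mult_nonneg_nonneg)
qed (use x in simp)

lemma hnorm_triangle:
  assumes x: "x \<in> hcarrier H" and y: "y \<in> hcarrier H"
  shows "hnorm H (x + y) \<le> hnorm H x + hnorm H y"
proof (rule power2_le_imp_le)
  have "Re (hinner H x y) \<le> hnorm H x * hnorm H y"
    using Cauchy_Schwarz[OF x y] complex_Re_le_cmod order_trans by blast
  then show "(hnorm H (x + y))\<^sup>2 \<le> (hnorm H x + hnorm H y)\<^sup>2"
    using x y by (simp add: hnorm_add_sq power2_sum)
qed (use x y in simp)

lemma hnorm_triangle_diff:
  assumes "x \<in> hcarrier H" "y \<in> hcarrier H" "z \<in> hcarrier H"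
  shows "hnorm H (x - z) \<le> hnorm H (x - y) + hnorm H (y - z)"
  using hnorm_triangle[of "x - y" "y - z"] assms by simp

lemma hnorm_triangle_minus:
  assumes "x \<in> hcarrier H" "y \<in> hcarrier H"
  shows "hnorm H (x - y) \<le> hnorm H x + hnorm H y"
  using hnorm_triangle[of "x" "- y"] assms by simp

lemma hnorm_triangle_rev:
  assumes "x \<in> hcarrier H" "y \<in> hcarrier H"
  shows "\<bar>hnorm H x - hnorm H y\<bar> \<le> hnorm H (x - y)"
  using hnorm_triangle[of "x - y" y] hnorm_triangle[of "y - x" x] hnorm_minus_commute[of x y] assms
  by simp

lemma hinner_ext:
  assumes "x \<in> hcarrier H" "x' \<in> hcarrier H" "\<And>y. y \<in> hcarrier H \<Longrightarrow> hinner H y x = hinner H y x'"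
  shows "x = x'"
proof -
  have "hinner H (x - x') (x - x') = 0"
    using assms(1,2) assms(3)[of "x - x'"] by (simp only: hinner_diff_right carrier_diff) simp
  then show ?thesis
    using assms by simp
qed

lemma hinner_ext_left:
  assumes "x \<in> hcarrier H" "x' \<in> hcarrier H" "\<And>y. y \<in> hcarrier H \<Longrightarrow> hinner H x y = hinner H x' y"
  shows "x = x'"
  by (rule hinner_ext) (use assms in \<open>metis hinner_cnj\<close>)+

section \<open>Limits in norm\<close>

lemma hlim_unique:
  assumes "\<And>n. X n \<in> hcarrier H" "l \<in> hcarrier H" "l' \<in> hcarrier H"
    and "(\<lambda>n. hnorm H (X n - l)) \<longlonglongrightarrow> 0" "(\<lambda>n. hnorm H (X n - l')) \<longlonglongrightarrow> 0"
  shows "l = l'"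
proof -
  have "(\<lambda>n. hnorm H (X n - l) + hnorm H (X n - l')) \<longlonglongrightarrow> 0 + 0"
    by (intro tendsto_add assms)
  moreover have "hnorm H (l - l') \<le> hnorm H (X n - l) + hnorm H (X n - l')" for n
    using hnorm_triangle_diff[of l "X n" l'] assms(1-3) hnorm_minus_commute[of l "X n"] by simp
  ultimately have "hnorm H (l - l') \<le> 0"
    by (intro LIMSEQ_le_const[of _ "0::real"]) auto
  then show ?thesis
    using assms(2,3) hnorm_ge0[of "l - l'"] hnorm_eq_0[of "l - l'"]
    by (metis carrier_diff eq_iff_diff_eq_0 order_antisym)
qed

lemma hlim_bound:
  assumes "\<And>n. X n \<in> hcarrier H" "l \<in> hcarrier H" "(\<lambda>n. hnorm H (X n - l)) \<longlonglongrightarrow> 0"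
    and "y \<in> hcarrier H" "\<And>n. n \<ge> N \<Longrightarrow> hnorm H (X n - y) \<le> B"
  shows "hnorm H (l - y) \<le> B"
proof -
  have "(\<lambda>n. hnorm H (X n - l) + B) \<longlonglongrightarrow> 0 + B"
    by (intro tendsto_add assms tendsto_const)
  moreover have "hnorm H (l - y) \<le> hnorm H (X n - l) + B" if "n \<ge> N" for n
    using hnorm_triangle_diff[of l "X n" y] assms(1,2,4) assms(5)[OF that] hnorm_minus_commute[of l "X n"] by simp
  ultimately show ?thesis
    by (intro LIMSEQ_le_const[of _ "B"]) auto
qed

lemma hlim_hinner:
  assumes "\<And>n. X n \<in> hcarrier H" "l \<in> hcarrier H" "(\<lambda>n. hnorm H (X n - l)) \<longlonglongrightarrow> 0" "y \<in> hcarrier H"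
  shows "(\<lambda>n. hinner H (X n) y) \<longlonglongrightarrow> hinner H l y"
proof (rule Lim_transform_bound[where g = "\<lambda>n. hnorm H (X n - l) * hnorm H y", THEN LIM_zero_cancel])
  show "\<forall>\<^sub>F n in sequentially. norm (hinner H (X n) y - hinner H l y) \<le> norm (hnorm H (X n - l) * hnorm H y)"
    using assms Cauchy_Schwarz[of "X n - l" y for n] by (simp add: hinner_diff_left abs_mult)
  show "(\<lambda>n. hnorm H (X n - l) * hnorm H y) \<longlonglongrightarrow> 0"
    using tendsto_mult[OF assms(3) tendsto_const[of "hnorm H y"]] by simp
qed

text \<open>A majorant principle: increments dominated by those of a convergent scalar sequence
  telescope to a Cauchy estimate. It serves the Neumann series with a geometric majorant and the
  square root iteration with a quadratic one.\<close>

lemma telescoping_converges: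
  assumes X: "\<And>n. X n \<in> hcarrier H" and s: "s \<longlonglongrightarrow> c"
    and inc: "\<And>n. hnorm H (X (Suc n) - X n) \<le> s (Suc n) - s n"
  obtains l where "l \<in> hcarrier H" "(\<lambda>n. hnorm H (X n - l)) \<longlonglongrightarrow> 0"
    "\<And>n. hnorm H (X n - l) \<le> c - s n"
proof -
  have *: "hnorm H (X (n + k) - X n) \<le> s (n + k) - s n" for n k
  proof (induction k)
    case (Suc k)
    show ?case
      using hnorm_triangle_diff[of "X (Suc (n + k))" "X (n + k)" "X n"] X Suc inc[of "n + k"] by simp
  qed (use X in simp)
  have **: "hnorm H (X m - X n) \<le> s m - s n" if "m \<ge> n" for m n
    using *[of n "m - n"] that by simp
  have "incseq s"
    using ** X by (intro monoI) (metis diff_ge_0_iff_ge hnorm_ge0 carrier_diff order_trans)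
  have "\<exists>N. \<forall>m\<ge>N. \<forall>n\<ge>N. hnorm H (X m - X n) < e" if "e > 0" for e
  proof -
    have "Cauchy s" using s LIMSEQ_imp_Cauchy by blast
    then obtain N where N: "\<forall>m\<ge>N. \<forall>n\<ge>N. norm (s m - s n) < e"
      using \<open>e > 0\<close> unfolding Cauchy_iff by blast
    have "hnorm H (X m - X n) < e" if "m \<ge> N" "n \<ge> N" for m n
    proof (cases "m \<ge> n")
      case True
      then show ?thesis using **[OF True] N that by (smt (verit) real_norm_def)
    next
      case False
      then have "hnorm H (X n - X m) < e"
        using **[of m n] N that by (smt (verit) real_norm_def nle_le)
      then show ?thesis using X hnorm_minus_commute by metis
    qed
    then show ?thesis by blast
  qed
  then obtain l where l: "l \<in> hcarrier H" "(\<lambda>n. hnorm H (X n - l)) \<longlonglongrightarrow> 0"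
    using hcomplete[of X] X by blast
  have "hnorm H (l - X n) \<le> c - s n" for n
    using **[of n] incseq_le[OF \<open>incseq s\<close> s]
    by (intro hlim_bound[OF X l X, of n]) (smt (verit))
  then have "hnorm H (X n - l) \<le> c - s n" for n
    using X l hnorm_minus_commute by metis
  with l show thesis using that by blast
qed

section \<open>Closed subspaces and projections\<close>

lemma hclosure_subset: "hclosure H S \<subseteq> hcarrier H"
  by (auto simp: hclosure_def)

lemma hclosure_incl: "S \<subseteq> hcarrier H \<Longrightarrow> S \<subseteq> hclosure H S"
  by (auto simp: hclosure_def) (metis diff_self hnorm_zero)

lemma hclosure_mono: "S \<subseteq> S' \<Longrightarrow> hclosure H S \<subseteq> hclosure H S'"
  by (force simp: hclosure_def)

lemma hclosure_idem:
  assumes "S \<subseteq> hcarrier H" shows "hclosure H (hclosure H S) = hclosure H S"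
proof
  show "hclosure H (hclosure H S) \<subseteq> hclosure H S"
  proof
    fix x assume "x \<in> hclosure H (hclosure H S)"
    then have x: "x \<in> hcarrier H" "\<And>e. e > 0 \<Longrightarrow> \<exists>s\<in>hclosure H S. hnorm H (x - s) < e"
      by (auto simp: hclosure_def)
    have "\<exists>s\<in>S. hnorm H (x - s) < e" if "e > 0" for e
    proof -
      obtain t where t: "t \<in> hclosure H S" "hnorm H (x - t) < e/2" using x(2)[of "e/2"] half_gt_zero[OF \<open>e > 0\<close>] by blast
      then obtain s where s: "s \<in> S" "hnorm H (t - s) < e/2"
        using half_gt_zero[OF \<open>e > 0\<close>] unfolding hclosure_def by blast
      have "hnorm H (x - s) \<le> hnorm H (x - t) + hnorm H (t - s)"
        using s t x(1) assms hclosure_subset[of S] by (intro hnorm_triangle_diff) auto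
      then have "hnorm H (x - s) < e" using s t by linarith
      with s show ?thesis by blast
    qed
    then show "x \<in> hclosure H S" using x by (simp add: hclosure_def)
  qed
qed (rule hclosure_incl[OF hclosure_subset])

lemma hclosure_subspace:
  assumes S: "cvec.subspace S" "S \<subseteq> hcarrier H"
  shows "cvec.subspace (hclosure H S)"
proof (rule cvec.subspaceI)
  show "0 \<in> hclosure H S" using hclosure_incl[OF S(2)] cvec.subspace_0[OF S(1)] by blast
next
  fix x y assume *: "x \<in> hclosure H S" "y \<in> hclosure H S"
  have "\<exists>s\<in>S. hnorm H (x + y - s) < e" if "e > 0" for e
  proof -
    obtain s t where s: "s \<in> S" "hnorm H (x - s) < e/2" and t: "t \<in> S" "hnorm H (y - t) < e/2"
      using * half_gt_zero[OF \<open>e > 0\<close>] unfolding hclosure_def by blast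
    have "hnorm H ((x - s) + (y - t)) \<le> hnorm H (x - s) + hnorm H (y - t)"
      using s t * S(2) hclosure_subset[of S] by (intro hnorm_triangle carrier_diff) auto
    then have "hnorm H ((x - s) + (y - t)) < e" using s t by linarith
    then have "hnorm H (x + y - (s + t)) < e"
      by (simp add: algebra_simps)
    then show ?thesis using cvec.subspace_add[OF S(1) s(1) t(1)] by blast
  qed
  then show "x + y \<in> hclosure H S" using * by (auto simp: hclosure_def)
next
  fix c x assume *: "x \<in> hclosure H S"
  have "\<exists>s\<in>S. hnorm H (c *\<^sub>C x - s) < e" if "e > 0" for e
  proof -
    \<comment> \<open>The summand 1 keeps the quotient meaningful when \<open>c = 0\<close>.\<close>
    obtain s where s: "s \<in> S" "hnorm H (x - s) < e / (cmod c + 1)"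
      using * divide_pos_pos[OF \<open>e > 0\<close> add_nonneg_pos[OF norm_ge_zero[of c] zero_less_one]]
      unfolding hclosure_def by blast
    have "hnorm H (c *\<^sub>C x - c *\<^sub>C s) = cmod c * hnorm H (x - s)"
      using * s S hclosure_subset[of S]
      by (subst scaleC_diff_right[symmetric], subst hnorm_scale) (auto intro!: carrier_diff)
    also have "\<dots> \<le> cmod c * (e / (cmod c + 1))"
      using s by (intro mult_left_mono) auto
    also have "\<dots> < e" using that by (simp add: field_simps add_pos_nonneg)
    finally show ?thesis using cvec.subspace_scale[OF S(1) s(1)] by blast
  qed
  then show "c *\<^sub>C x \<in> hclosure H S" using * by (auto simp: hclosure_def)
qed

lemma hilbert_hsub:
  assumes S: "cvec.subspace S" "S \<subseteq> hcarrier H" "hclosure H S \<subseteq> S"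
  shows "hilbert_space (hsub H S)"
proof -
  have n: "hnorm (hsub H S) x = hnorm H x" for x by (simp add: hnorm_def hsub_def)
  have "\<exists>l\<in>S. (\<lambda>n. hnorm H (X n - l)) \<longlonglongrightarrow> 0"
    if X: "\<And>n. X n \<in> S" and C: "\<And>e. e > 0 \<Longrightarrow> \<exists>N::nat. \<forall>m\<ge>N. \<forall>n\<ge>N. hnorm H (X m - X n) < e" for X
  proof -
    obtain l where l: "l \<in> hcarrier H" "(\<lambda>n. hnorm H (X n - l)) \<longlonglongrightarrow> 0"
      using hcomplete[of X] X C S(2) by blast
    have "\<exists>s\<in>S. hnorm H (l - s) < e" if "e > 0" for e :: real
    proof -
      obtain n :: nat where "hnorm H (X n - l) < e"
        using LIMSEQ_D[OF l(2) \<open>e > 0\<close>] l X S(2) by (auto simp: subset_iff)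
      moreover have "X n \<in> hcarrier H" using X S(2) by blast
      ultimately show ?thesis using X[of n] l hnorm_minus_commute[of l "X n"] by metis
    qed
    then have "l \<in> S" using S(3) l by (auto simp: hclosure_def)
    with l show ?thesis by blast
  qed
  then show ?thesis
    unfolding hilbert_space_def n
    using S(1,2) by (auto simp: hsub_def hinner_add_left hinner_scale_left hinner_cnj hinner_pos subset_iff)
qed

lemma horth_subset: "horth H S \<subseteq> hcarrier H"
  by (auto simp: horth_def)

lemma horth_subspace:
  assumes "S \<subseteq> hcarrier H" shows "cvec.subspace (horth H S)"
  using assms by (intro cvec.subspaceI) (auto simp: horth_def hinner_simps subset_iff)

lemma hclosure_horth:
  assumes "S \<subseteq> hcarrier H" shows "hclosure H (horth H S) \<subseteq> horth H S"
proof
  fix x assume x: "x \<in> hclosure H (horth H S)"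
  have "hinner H x s = 0" if s: "s \<in> S" for s
  proof (rule ccontr)
    assume "hinner H x s \<noteq> 0"
    then have p: "cmod (hinner H x s) / (hnorm H s + 1) > 0"
      using s assms by (simp add: add_nonneg_pos subset_iff)
    then obtain y where y: "y \<in> horth H S" "hnorm H (x - y) < cmod (hinner H x s) / (hnorm H s + 1)"
      using x unfolding hclosure_def by blast
    have xy: "x \<in> hcarrier H" "y \<in> hcarrier H" "s \<in> hcarrier H" "hinner H y s = 0"
      using x y s assms by (auto simp: hclosure_def horth_def)
    have "cmod (hinner H x s) = cmod (hinner H (x - y) s)"
      using xy by (simp add: hinner_diff_left)
    also have "\<dots> \<le> hnorm H (x - y) * hnorm H s" using xy by (simp add: Cauchy_Schwarz)
    also have "\<dots> \<le> hnorm H (x - y) * (hnorm H s + 1)" using xy by (intro mult_left_mono) auto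
    also have "\<dots> < cmod (hinner H x s)"
      using y(2) xy by (subst (asm) pos_less_divide_eq) (simp_all add: add_nonneg_pos)
    finally show False by simp
  qed
  then show "x \<in> horth H S" using x by (auto simp: horth_def hclosure_def)
qed

lemma hilbert_horth: "S \<subseteq> hcarrier H \<Longrightarrow> hilbert_space (hsub H (horth H S))"
  by (intro hilbert_hsub horth_subspace horth_subset hclosure_horth)

text \<open>If the residual had a component along some \<open>s\<close>, moving \<open>y\<close> by
  that component would stay in \<open>S\<close> and strictly shorten the distance.\<close>

lemma closest_point_orthogonal:
  assumes S: "cvec.subspace S" "S \<subseteq> hcarrier H" and x: "x \<in> hcarrier H" and y: "y \<in> S"
    and min: "\<And>s. s \<in> S \<Longrightarrow> hnorm H (x - y) \<le> hnorm H (x - s)"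
  shows "x - y \<in> horth H S"
proof -
  have "hinner H (x - y) s = 0" if s: "s \<in> S" for s
  proof (rule ccontr)
    assume a0: "hinner H (x - y) s \<noteq> 0"
    define a where "a = hinner H (x - y) s"
    have mem: "y \<in> hcarrier H" "s \<in> hcarrier H" using s y S by auto
    have "s \<noteq> 0" using a0 x mem by auto
    define n where "n = (hnorm H s)\<^sup>2"
    have n: "n > 0" using hnorm_pos[OF mem(2) \<open>s \<noteq> 0\<close>] by (simp add: n_def)
    define c where "c = a / of_real n"
    have "y + c *\<^sub>C s \<in> S" using S(1) s y by (simp add: cvec.subspace_add cvec.subspace_scale)
    then have "hnorm H (x - y) \<le> hnorm H (x - (y + c *\<^sub>C s))" by (rule min)
    then have "(hnorm H (x - y))\<^sup>2 \<le> (hnorm H ((x - y) - c *\<^sub>C s))\<^sup>2"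
      using x mem by (intro power_mono) (simp_all add: diff_diff_add)
    also have "\<dots> = (hnorm H (x - y))\<^sup>2 + (cmod c)\<^sup>2 * n - 2 * Re (cnj c * a)"
      using x mem by (subst hnorm_diff_sq) (simp_all add: hnorm_scale power_mult_distrib n_def a_def hinner_scale_right)
    also have "cnj c * a = of_real ((cmod a)\<^sup>2 / n)"
      by (simp add: c_def complex_norm_square mult.commute del: of_real_power)
    also have "(cmod c)\<^sup>2 * n = (cmod a)\<^sup>2 / n"
      using n by (simp add: c_def norm_divide power_divide power2_eq_square)
    finally have "(cmod a)\<^sup>2 / n \<le> 0" by simp
    then show False using n a0 by (simp add: a_def divide_le_0_iff)
  qed
  then show ?thesis using x y S by (auto simp: horth_def)
qed

text \<open>A minimizing sequence is Cauchy by the parallelogram law: the midpoint of two of its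
  members stays in \<open>S\<close>, so it cannot come closer to \<open>x\<close> than the infimum
  \<open>d\<close>.\<close>

theorem projection_exists:
  assumes S: "cvec.subspace S" "S \<subseteq> hcarrier H" "hclosure H S \<subseteq> S" and x: "x \<in> hcarrier H"
  obtains y where "y \<in> S" "x - y \<in> horth H S"
proof -
  define d where "d = (INF s\<in>S. hnorm H (x - s))"
  have S0: "0 \<in> S" using S(1) cvec.subspace_0 by blast
  have bdd: "bdd_below ((\<lambda>s. hnorm H (x - s)) ` S)"
    using x S(2) by (intro bdd_belowI[of _ 0]) auto
  have d_le: "d \<le> hnorm H (x - s)" if "s \<in> S" for s
    unfolding d_def using bdd that by (rule cINF_lower)
  have d0: "d \<ge> 0" unfolding d_def using S0 x S(2) by (intro cINF_greatest) auto
  have "\<exists>s\<in>S. hnorm H (x - s) < d + 1 / real (Suc n)" for n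
    using cINF_less_iff[OF _ bdd, of "d + 1 / real (Suc n)"] S0 unfolding d_def[symmetric] by auto
  then obtain Y where Y: "\<And>n. Y n \<in> S" "\<And>n. hnorm H (x - Y n) < d + 1 / real (Suc n)"
    by metis
  have YH: "Y n \<in> hcarrier H" for n using Y S by auto
  \<comment> \<open>The bound is 4 (d + e)^2 - 4 d^2 for e = 1 / (N + 1), simplified by e^2 \<le>
    e.\<close>
  have est: "(hnorm H (Y m - Y n))\<^sup>2 \<le> (8 * d + 4) / real (Suc N)" if "m \<ge> N" "n \<ge> N" for m n N
  proof -
    let ?e = "1 / real (Suc N)"
    let ?u = "x - Y m" and ?v = "x - Y n"
    have "(1/2) *\<^sub>C (Y m + Y n) \<in> S" using Y S by (simp add: cvec.subspace_add cvec.subspace_scale)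
    then have "d \<le> hnorm H (x - (1/2) *\<^sub>C (Y m + Y n))" by (rule d_le)
    also have "x - (1/2) *\<^sub>C (Y m + Y n) = (1/2) *\<^sub>C (?u + ?v)"
    proof -
      have "x = (1/2) *\<^sub>C (x + x)" by (simp flip: scaleC_add_left add: scaleC_add_right)
      then show ?thesis by (metis (no_types, opaque_lifting) scaleC_diff_right add_diff_add)
    qed
    also have "hnorm H \<dots> = hnorm H (?u + ?v) / 2" using x YH by (simp add: hnorm_scale)
    finally have "(2 * d)\<^sup>2 \<le> (hnorm H (?u + ?v))\<^sup>2" using d0 by (intro power_mono) auto
    moreover have "(hnorm H (?u + ?v))\<^sup>2 + (hnorm H (?u - ?v))\<^sup>2 = 2 * (hnorm H ?u)\<^sup>2 + 2 * (hnorm H ?v)\<^sup>2"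
      using x YH hnorm_add_sq[of ?u ?v] hnorm_diff_sq[of ?u ?v] by simp
    moreover have "(hnorm H (x - Y k))\<^sup>2 \<le> (d + ?e)\<^sup>2" if "k \<ge> N" for k
    proof (rule power_mono)
      have "1 / real (Suc k) \<le> ?e" using that by (simp add: field_simps)
      then show "hnorm H (x - Y k) \<le> d + ?e" using Y(2)[of k] by linarith
    qed (use x YH in simp)
    moreover have "hnorm H (?u - ?v) = hnorm H (Y m - Y n)"
      using hnorm_minus_commute[of "Y m" "Y n"] YH by simp
    ultimately have "(hnorm H (Y m - Y n))\<^sup>2 \<le> 4 * (d + ?e)\<^sup>2 - 4 * d\<^sup>2"
      using that by (smt (verit) power_mult_distrib four_x_squared)
    also have "\<dots> = 8 * d * ?e + 4 * ?e * ?e" by (simp add: power2_eq_square algebra_simps)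
    also have "\<dots> \<le> 8 * d * ?e + 4 * ?e * 1" by (intro add_left_mono mult_left_mono) auto
    also have "\<dots> = (8 * d + 4) / real (Suc N)" by (simp add: add_divide_distrib)
    finally show ?thesis .
  qed
  have "\<exists>N. \<forall>m\<ge>N. \<forall>n\<ge>N. hnorm H (Y m - Y n) < e" if e: "e > 0" for e
  proof -
    obtain N where "(8 * d + 4) / e\<^sup>2 < real (Suc N)"
      using reals_Archimedean2 by (metis less_trans lessI of_nat_less_iff)
    then have N: "(8 * d + 4) / real (Suc N) < e\<^sup>2" using e by (simp add: field_simps)
    have "hnorm H (Y m - Y n) < e" if "m \<ge> N" "n \<ge> N" for m n
      using est[OF that] N e by (intro power2_less_imp_less[of _ e]) auto
    then show ?thesis by blast
  qed
  then obtain y where y: "y \<in> hcarrier H" "(\<lambda>n. hnorm H (Y n - y)) \<longlonglongrightarrow> 0"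
    using hcomplete[of Y] YH by blast
  have "\<exists>s\<in>S. hnorm H (y - s) < e" if "e > 0" for e
    using LIMSEQ_D[OF y(2) that] Y(1) YH y(1) hnorm_minus_commute[of y] by (auto simp: abs_of_nonneg) (metis le_refl)
  then have yS: "y \<in> S" using S(3) y(1) by (auto simp: hclosure_def)
  have "hnorm H (x - y) \<le> d + e" if "e > 0" for e
  proof -
    obtain N where N: "1 / real (Suc N) < e" using nat_approx_posE[OF \<open>e > 0\<close>] by blast
    have "hnorm H (Y n - x) \<le> d + e" if "n \<ge> N" for n
    proof -
      have "1 / real (Suc n) \<le> 1 / real (Suc N)" using that by (simp add: field_simps)
      then show ?thesis using Y(2)[of n] N hnorm_minus_commute[OF YH x, of n] by linarith
    qed
    then show ?thesis
      using hlim_bound[OF YH y x, of N "d + e"] hnorm_minus_commute[OF y(1) x] by simp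
  qed
  then have "hnorm H (x - y) \<le> d" by (rule field_le_epsilon)
  then have "x - y \<in> horth H S"
    using closest_point_orthogonal[OF S(1,2) x yS] d_le order_trans by blast
  with yS show thesis using that by blast
qed

lemma hproj_eq:
  assumes S: "cvec.subspace S" "S \<subseteq> hcarrier H" and "y \<in> S" "x - y \<in> horth H S" and x: "x \<in> hcarrier H"
  shows "hproj H S x = y"
  unfolding hproj_def
proof (rule the_equality)
  fix y' assume y': "y' \<in> S \<and> x - y' \<in> horth H S"
  have "y - y' \<in> S" using y' assms cvec.subspace_diff by blast
  have "y - y' = (x - y') - (x - y)" by simp
  then have "y - y' \<in> horth H S" using cvec.subspace_diff[OF horth_subspace[OF S(2)]] y' assms by metis
  with \<open>y - y' \<in> S\<close> have "hinner H (y - y') (y - y') = 0" by (auto simp: horth_def)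
  then show "y' = y" using S y' assms(3) by (simp add: subset_iff)
qed (use assms in simp)

context
  fixes S assumes S: "cvec.subspace S" "S \<subseteq> hcarrier H" "hclosure H S \<subseteq> S"
begin

lemma hproj_props:
  assumes "x \<in> hcarrier H"
  shows "hproj H S x \<in> S" "x - hproj H S x \<in> horth H S"
proof -
  obtain y where "y \<in> S" "x - y \<in> horth H S" using projection_exists[OF S assms] by blast
  then show "hproj H S x \<in> S" "x - hproj H S x \<in> horth H S"
    using hproj_eq[OF S(1,2) _ _ assms] by auto
qed

text \<open>The nontrivial inclusion holds because the residual of the projection onto
  \<open>S\<close> is orthogonal both to the vector and to its projection, hence to itself.\<close>

lemma horth_horth: "horth H (horth H S) = S"
proof
  show "S \<subseteq> horth H (horth H S)"
    using S(2) by (auto simp: horth_def subset_iff hinner_eq_0_commute)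
  show "horth H (horth H S) \<subseteq> S"
  proof
    fix x assume x: "x \<in> horth H (horth H S)"
    then have xH: "x \<in> hcarrier H" by (simp add: horth_def)
    note p = hproj_props[OF xH]
    let ?r = "x - hproj H S x"
    have "hinner H x ?r = 0" using x p(2) by (simp add: horth_def)
    moreover have "hinner H ?r (hproj H S x) = 0" using p by (simp add: horth_def)
    then have "hinner H (hproj H S x) ?r = 0"
      using xH p S(2) by (subst hinner_eq_0_commute) auto
    ultimately have "hinner H ?r ?r = 0"
      using xH p S(2) by (subst hinner_diff_left) auto
    then show "x \<in> S" using p xH S(2) by (auto simp: subset_iff)
  qed
qed

end

text \<open>Projection onto the closure leaves a residual orthogonal to \<open>S\<close>. Density
  and totality are checked in this form below, which replaces approximation arguments by inner
  products.\<close>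

lemma dense_iff:
  assumes S: "cvec.subspace S" "S \<subseteq> hcarrier H"
  shows "hclosure H S = hcarrier H \<longleftrightarrow> (\<forall>x\<in>hcarrier H. (\<forall>s\<in>S. hinner H x s = 0) \<longrightarrow> x = 0)"
proof
  assume d: "hclosure H S = hcarrier H"
  show "\<forall>x\<in>hcarrier H. (\<forall>s\<in>S. hinner H x s = 0) \<longrightarrow> x = 0"
  proof (intro ballI impI)
    fix x assume x: "x \<in> hcarrier H" "\<forall>s\<in>S. hinner H x s = 0"
    have "S \<subseteq> horth H {x}"
      using x S by (auto simp: horth_def subset_iff hinner_eq_0_commute)
    then have "hclosure H S \<subseteq> horth H {x}"
      using hclosure_mono[of S "horth H {x}"] hclosure_horth[of "{x}"] x by blast
    then have "x \<in> horth H {x}" using d x by blast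
    then show "x = 0" using x by (simp add: horth_def)
  qed
next
  assume *: "\<forall>x\<in>hcarrier H. (\<forall>s\<in>S. hinner H x s = 0) \<longrightarrow> x = 0"
  show "hclosure H S = hcarrier H"
  proof
    show "hcarrier H \<subseteq> hclosure H S"
    proof
      fix x assume x: "x \<in> hcarrier H"
      note cl = hclosure_subspace[OF S] hclosure_subset[of S] order.eq_iff[THEN iffD1, OF hclosure_idem[OF S(2)], THEN conjunct1]
      obtain y where y: "y \<in> hclosure H S" "x - y \<in> horth H (hclosure H S)"
        using projection_exists[OF cl x] by blast
      then have "x - y = 0"
        using bspec[OF *, of "x - y"] hclosure_incl[OF S(2)] unfolding horth_def by blast
      with y show "x \<in> hclosure H S" by simp
    qed
  qed (rule hclosure_subset)
qed

lemma span_subset_carrier: "S \<subseteq> hcarrier H \<Longrightarrow> cvec.span S \<subseteq> hcarrier H"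
  by (rule cvec.span_minimal[OF _ carrier_subspace])

lemma horth_span:
  assumes "S \<subseteq> hcarrier H" "x \<in> hcarrier H" "\<And>s. s \<in> S \<Longrightarrow> hinner H x s = 0" "t \<in> cvec.span S"
  shows "hinner H x t = 0"
proof -
  have "S \<subseteq> horth H {x}"
    using assms(1,2,3) by (auto simp: horth_def subset_iff hinner_eq_0_commute)
  then have "cvec.span S \<subseteq> horth H {x}" using assms(2) by (intro cvec.span_minimal horth_subspace) auto
  with assms(4) have "t \<in> hcarrier H" "hinner H t x = 0" by (auto simp: horth_def)
  then show ?thesis using assms(2) by (simp add: hinner_eq_0_commute)
qed

lemma hcspan_total_iff:
  assumes S: "S \<subseteq> hcarrier H"
  shows "hcspan H S = hcarrier H \<longleftrightarrow> (\<forall>x\<in>hcarrier H. (\<forall>s\<in>S. hinner H x s = 0) \<longrightarrow> x = 0)"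
proof -
  have "(\<forall>t\<in>cvec.span S. hinner H x t = 0) \<longleftrightarrow> (\<forall>s\<in>S. hinner H x s = 0)" if "x \<in> hcarrier H" for x
    using horth_span[OF S that] cvec.span_base by metis
  then show ?thesis
    unfolding hcspan_def by (simp add: dense_iff[OF cvec.subspace_span span_subset_carrier[OF S]])
qed

text \<open>The kernel of \<open>f\<close> is closed by the bound. If it is not everything, a vector
  \<open>u\<close> orthogonal to it spans the rest of the space modulo the kernel, so a multiple of
  \<open>u\<close> represents \<open>f\<close>.\<close>

lemma riesz_representation:
  assumes add: "\<And>x y. x \<in> hcarrier H \<Longrightarrow> y \<in> hcarrier H \<Longrightarrow> f (x + y) = f x + f y"
    and scale: "\<And>c x. x \<in> hcarrier H \<Longrightarrow> f (c *\<^sub>C x) = c * f x"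
    and bnd: "\<And>x. x \<in> hcarrier H \<Longrightarrow> cmod (f x) \<le> M * hnorm H x"
  obtains y where "y \<in> hcarrier H" "\<And>x. x \<in> hcarrier H \<Longrightarrow> f x = hinner H x y"
proof -
  define N where "N = {x \<in> hcarrier H. f x = 0}"
  have f0: "f 0 = 0" using scale[of 0 0] by simp
  have fdiff: "f (x - y) = f x - f y" if "x \<in> hcarrier H" "y \<in> hcarrier H" for x y
    using add[of x "(-1) *\<^sub>C y"] scale[of y "-1"] that by simp
  have N: "cvec.subspace N" "N \<subseteq> hcarrier H"
    by (auto simp: N_def f0 add scale intro!: cvec.subspaceI)
  have "hclosure H N \<subseteq> N"
  proof
    fix x assume x: "x \<in> hclosure H N"
    then have xH: "x \<in> hcarrier H" by (simp add: hclosure_def)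
    have "cmod (f x) \<le> e" if e: "e > 0" for e
    proof -
      obtain s where s: "s \<in> N" "hnorm H (x - s) < e / (\<bar>M\<bar> + 1)"
        using x divide_pos_pos[OF e add_nonneg_pos[OF abs_ge_zero[of M] zero_less_one]]
        unfolding hclosure_def by blast
      have "cmod (f x) = cmod (f (x - s))" using s xH by (simp add: N_def fdiff)
      also have "\<dots> \<le> M * hnorm H (x - s)" using s xH by (intro bnd) (simp add: N_def)
      also have "\<dots> \<le> (\<bar>M\<bar> + 1) * hnorm H (x - s)" using s xH by (intro mult_right_mono) (simp_all add: N_def)
      also have "\<dots> \<le> e" using s(2) by (simp add: field_simps)
      finally show ?thesis .
    qed
    then have "cmod (f x) \<le> 0" by (metis field_le_epsilon add_0)
    then show "x \<in> N" using xH by (simp add: N_def)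
  qed
  note N = N this
  show thesis
  proof (cases "N = hcarrier H")
    case True
    then show thesis using that[of 0] by (auto simp: N_def)
  next
    case False
    then obtain x0 where x0: "x0 \<in> hcarrier H" "x0 \<notin> N" using N(2) by blast
    obtain p where p: "p \<in> N" "x0 - p \<in> horth H N" using projection_exists[OF N x0(1)] by blast
    define u where "u = x0 - p"
    have u: "u \<in> hcarrier H" "u \<noteq> 0" using x0 p by (auto simp: u_def N_def)
    have fu: "f u \<noteq> 0" using x0 p N(2) by (auto simp: u_def N_def fdiff)
    \<comment> \<open>Scaled so that \<open>hinner H u y = f u\<close>.\<close>
    define y where "y = (cnj (f u) / of_real ((hnorm H u)\<^sup>2)) *\<^sub>C u"
    show thesis
    proof (rule that[of y])
      show "y \<in> hcarrier H" using u by (simp add: y_def)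
      fix x assume x: "x \<in> hcarrier H"
      have "x - (f x / f u) *\<^sub>C u \<in> N" using x u fu by (simp add: N_def fdiff scale)
      then have "hinner H u (x - (f x / f u) *\<^sub>C u) = 0" using p(2) by (simp add: horth_def u_def)
      then have "hinner H (x - (f x / f u) *\<^sub>C u) u = 0"
        using x u by (subst hinner_eq_0_commute) auto
      then have "hinner H x u = f x / f u * of_real ((hnorm H u)\<^sup>2)"
        using x u by (simp add: hinner_simps hinner_self)
      then show "f x = hinner H x y"
        using x u fu by (simp add: y_def hinner_scale_right)
    qed
  qed
qed

end

section \<open>Bounded operators and adjoints\<close>

lemma hsub_simps [simp]:
  "hcarrier (hsub H S) = S" "hinner (hsub H S) = hinner H" "hnorm (hsub H S) = hnorm H"
  by (simp_all add: hsub_def hnorm_def fun_eq_iff)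

lemma bounded_opI:
  assumes "\<And>x. x \<in> hcarrier H \<Longrightarrow> A x \<in> hcarrier K"
    and "\<And>x y. x \<in> hcarrier H \<Longrightarrow> y \<in> hcarrier H \<Longrightarrow> A (x + y) = A x + A y"
    and "\<And>c x. x \<in> hcarrier H \<Longrightarrow> A (c *\<^sub>C x) = c *\<^sub>C A x"
    and "\<And>x. x \<in> hcarrier H \<Longrightarrow> hnorm K (A x) \<le> M * hnorm H x"
  shows "bounded_op H K A"
  using assms unfolding bounded_op_def by blast

lemma op_closed: "bounded_op H K A \<Longrightarrow> x \<in> hcarrier H \<Longrightarrow> A x \<in> hcarrier K"
  by (simp add: bounded_op_def)
lemma op_add: "bounded_op H K A \<Longrightarrow> x \<in> hcarrier H \<Longrightarrow> y \<in> hcarrier H \<Longrightarrow> A (x + y) = A x + A y"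
  by (simp add: bounded_op_def)
lemma op_scale: "bounded_op H K A \<Longrightarrow> x \<in> hcarrier H \<Longrightarrow> A (c *\<^sub>C x) = c *\<^sub>C A x"
  by (simp add: bounded_op_def)

lemma op_zero: "bounded_op H K A \<Longrightarrow> hilbert_space H \<Longrightarrow> A 0 = 0"
  using op_scale[of H K A 0 0] by simp

lemma op_minus: "bounded_op H K A \<Longrightarrow> x \<in> hcarrier H \<Longrightarrow> A (- x) = - A x"
  using op_scale[of H K A x "-1"] by simp

lemma op_diff:
  "bounded_op H K A \<Longrightarrow> hilbert_space H \<Longrightarrow> x \<in> hcarrier H \<Longrightarrow> y \<in> hcarrier H \<Longrightarrow> A (x - y) = A x - A y"
  using op_add[of H K A x "- y"] by (simp add: op_minus)

lemma op_sum:
  assumes "bounded_op H K A" "hilbert_space H" "\<And>i. i \<in> I \<Longrightarrow> f i \<in> hcarrier H"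
  shows "A (\<Sum>i\<in>I. f i) = (\<Sum>i\<in>I. A (f i))"
  using assms(3)
  by (induction I rule: infinite_finite_induct) (simp_all add: op_zero[OF assms(1,2)] op_add[OF assms(1)] assms(2))

lemma op_bound:
  assumes "bounded_op H K A" "hilbert_space H"
  shows "\<exists>M\<ge>0. \<forall>x\<in>hcarrier H. hnorm K (A x) \<le> M * hnorm H x"
proof -
  obtain M where M: "\<And>x. x \<in> hcarrier H \<Longrightarrow> hnorm K (A x) \<le> M * hnorm H x"
    using assms(1) unfolding bounded_op_def by blast
  have "hnorm K (A x) \<le> \<bar>M\<bar> * hnorm H x" if "x \<in> hcarrier H" for x
  proof -
    have "M * hnorm H x \<le> \<bar>M\<bar> * hnorm H x"
      using that assms(2) by (intro mult_right_mono) auto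
    then show ?thesis using M[OF that] by linarith
  qed
  then show ?thesis by (intro exI[of _ "\<bar>M\<bar>"]) simp
qed

lemma bounded_op_comp:
  assumes "bounded_op H K A" "bounded_op K L B" "hilbert_space H" "hilbert_space K"
  shows "bounded_op H L (\<lambda>x. B (A x))"
proof -
  obtain M where M: "M \<ge> 0" "\<And>x. x \<in> hcarrier H \<Longrightarrow> hnorm K (A x) \<le> M * hnorm H x"
    using op_bound[OF assms(1,3)] by blast
  obtain N where N: "N \<ge> 0" "\<And>x. x \<in> hcarrier K \<Longrightarrow> hnorm L (B x) \<le> N * hnorm K x"
    using op_bound[OF assms(2,4)] by blast
  show ?thesis
  proof (rule bounded_opI)
    fix x assume x: "x \<in> hcarrier H"
    have "hnorm L (B (A x)) \<le> N * hnorm K (A x)" by (rule N(2)[OF op_closed[OF assms(1) x]])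
    also have "\<dots> \<le> N * (M * hnorm H x)" using M(2)[OF x] N(1) by (rule mult_left_mono)
    finally show "hnorm L (B (A x)) \<le> (N * M) * hnorm H x" by (simp add: mult.assoc)
  qed (use assms(3,4) in \<open>simp_all add: op_closed[OF assms(1)] op_closed[OF assms(2)]
      op_add[OF assms(1)] op_add[OF assms(2)] op_scale[OF assms(1)] op_scale[OF assms(2)]\<close>)
qed

lemma bounded_op_add:
  assumes "bounded_op H K A" "bounded_op H K B" "hilbert_space H" "hilbert_space K"
  shows "bounded_op H K (\<lambda>x. A x + B x)"
proof -
  obtain M where M: "M \<ge> 0" "\<And>x. x \<in> hcarrier H \<Longrightarrow> hnorm K (A x) \<le> M * hnorm H x"
    using op_bound[OF assms(1,3)] by blast
  obtain N where N: "N \<ge> 0" "\<And>x. x \<in> hcarrier H \<Longrightarrow> hnorm K (B x) \<le> N * hnorm H x"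
    using op_bound[OF assms(2,3)] by blast
  show ?thesis
  proof (rule bounded_opI)
    fix x assume x: "x \<in> hcarrier H"
    have "hnorm K (A x + B x) \<le> hnorm K (A x) + hnorm K (B x)"
      by (rule hnorm_triangle[OF assms(4) op_closed[OF assms(1) x] op_closed[OF assms(2) x]])
    then show "hnorm K (A x + B x) \<le> (M + N) * hnorm H x"
      using M(2)[OF x] N(2)[OF x] by (simp add: distrib_right)
  qed (use assms(3,4) in \<open>simp_all add: op_closed[OF assms(1)] op_closed[OF assms(2)] op_add[OF assms(1)]
        op_add[OF assms(2)] op_scale[OF assms(1)] op_scale[OF assms(2)] scaleC_add_right\<close>)
qed

lemma bounded_op_scale:
  assumes "bounded_op H K A" "hilbert_space H" "hilbert_space K"
  shows "bounded_op H K (\<lambda>x. c *\<^sub>C A x)"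
proof -
  obtain M where M: "M \<ge> 0" "\<And>x. x \<in> hcarrier H \<Longrightarrow> hnorm K (A x) \<le> M * hnorm H x"
    using op_bound[OF assms(1,2)] by blast
  have bnd: "hnorm K (c *\<^sub>C A x) \<le> (cmod c * M) * hnorm H x" if x: "x \<in> hcarrier H" for x
    using mult_left_mono[OF M(2)[OF x], of "cmod c"] assms(2,3) x
    by (simp add: hnorm_scale op_closed[OF assms(1)] mult.assoc)
  show ?thesis
    using assms(2,3) bnd
    by (intro bounded_opI[where M = "cmod c * M"])
      (simp_all add: op_closed[OF assms(1)] op_add[OF assms(1)] op_scale[OF assms(1)] scaleC_add_right mult.commute)
qed

lemma bounded_op_id: "bounded_op H H (\<lambda>x. x)"
  by (rule bounded_opI[where M = 1]) auto

lemma bounded_op_minus: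
  assumes "bounded_op H K A" "hilbert_space H" "hilbert_space K"
  shows "bounded_op H K (\<lambda>x. - A x)"
  using bounded_op_scale[OF assms, of "-1"] by simp

lemma bounded_op_diff:
  assumes "bounded_op H K A" "bounded_op H K B" "hilbert_space H" "hilbert_space K"
  shows "bounded_op H K (\<lambda>x. A x - B x)"
  using bounded_op_add[OF assms(1) bounded_op_minus[OF assms(2-4)] assms(3,4)] by simp

section \<open>Adjoints\<close>

context
  fixes H :: "'a::complex_vector hspace" and K :: "'b::complex_vector hspace" and A
  assumes H: "hilbert_space H" and K: "hilbert_space K" and A: "bounded_op H K A"
begin

lemma hadj_exists:
  assumes y: "y \<in> hcarrier K"
  shows "\<exists>!x. x \<in> hcarrier H \<and> (\<forall>h\<in>hcarrier H. hinner K (A h) y = hinner H h x)"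
proof -
  obtain M where M: "M \<ge> 0" "\<And>x. x \<in> hcarrier H \<Longrightarrow> hnorm K (A x) \<le> M * hnorm H x"
    using op_bound[OF A H] by blast
  obtain x where x: "x \<in> hcarrier H" "\<And>h. h \<in> hcarrier H \<Longrightarrow> hinner K (A h) y = hinner H h x"
  proof (rule riesz_representation[OF H, of "\<lambda>h. hinner K (A h) y" "M * hnorm K y"])
    fix h assume h: "h \<in> hcarrier H"
    have "cmod (hinner K (A h) y) \<le> hnorm K (A h) * hnorm K y"
      using h y by (intro Cauchy_Schwarz K op_closed[OF A])
    also have "\<dots> \<le> (M * hnorm H h) * hnorm K y"
      using M(2)[OF h] y K by (intro mult_right_mono) auto
    finally show "cmod (hinner K (A h) y) \<le> M * hnorm K y * hnorm H h" by (simp add: mult_ac)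
  qed (use y in \<open>simp_all add: op_add[OF A] op_scale[OF A] hinner_simps[OF K] op_closed[OF A]\<close>)
  show ?thesis
  proof (rule ex1I)
    fix x' assume "x' \<in> hcarrier H \<and> (\<forall>h\<in>hcarrier H. hinner K (A h) y = hinner H h x')"
    then show "x' = x" using x by (intro hinner_ext[OF H]) auto
  qed (use x in auto)
qed

lemma hadj_closed: "y \<in> hcarrier K \<Longrightarrow> hadj H K A y \<in> hcarrier H"
  and hadj_inner: "y \<in> hcarrier K \<Longrightarrow> h \<in> hcarrier H \<Longrightarrow> hinner K (A h) y = hinner H h (hadj H K A y)"
  unfolding hadj_def using theI'[OF hadj_exists] by blast+

text \<open>The way adjoints are computed throughout: propose a vector and check the
  pairing.\<close>

lemma hadj_eqI:
  "y \<in> hcarrier K \<Longrightarrow> x \<in> hcarrier H \<Longrightarrow> (\<And>h. h \<in> hcarrier H \<Longrightarrow> hinner K (A h) y = hinner H h x)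
    \<Longrightarrow> hadj H K A y = x"
  using hadj_exists[of y] hadj_closed[of y] hadj_inner[of y] by blast

lemma hadj_inner': 
  assumes "y \<in> hcarrier K" "h \<in> hcarrier H"
  shows "hinner K y (A h) = hinner H (hadj H K A y) h"
  using arg_cong[OF hadj_inner[OF assms], of cnj] assms
  by (simp add: hinner_cnj[OF H] hinner_cnj[OF K] hadj_closed op_closed[OF A])

text \<open>Test the bound of \<open>A\<close> on the vector \<open>hadj H K A y\<close> itself and
  cancel one factor of its norm.\<close>

lemma hnorm_hadj_le:
  assumes M: "M \<ge> 0" "\<And>x. x \<in> hcarrier H \<Longrightarrow> hnorm K (A x) \<le> M * hnorm H x" and y: "y \<in> hcarrier K"
  shows "hnorm H (hadj H K A y) \<le> M * hnorm K y"
proof (cases "hadj H K A y = 0")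
  case False
  let ?x = "hadj H K A y"
  have x: "?x \<in> hcarrier H" using y by (rule hadj_closed)
  have "(hnorm H ?x)\<^sup>2 = cmod (hinner K (A ?x) y)"
    using x y by (simp add: hadj_inner hinner_self[OF H] del: of_real_power)
  also have "\<dots> \<le> hnorm K (A ?x) * hnorm K y" using x y by (intro Cauchy_Schwarz K op_closed[OF A])
  also have "\<dots> \<le> (M * hnorm H ?x) * hnorm K y" using M(2)[OF x] y K by (intro mult_right_mono) auto
  finally have "hnorm H ?x * hnorm H ?x \<le> hnorm H ?x * (M * hnorm K y)"
    by (simp add: power2_eq_square mult_ac)
  then show ?thesis using hnorm_pos[OF H x False] by simp
qed (use M y K H in simp)

lemma bounded_op_hadj: "bounded_op K H (hadj H K A)"
proof -
  obtain M where M: "M \<ge> 0" "\<And>x. x \<in> hcarrier H \<Longrightarrow> hnorm K (A x) \<le> M * hnorm H x"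
    using op_bound[OF A H] by blast
  show ?thesis
    by (rule bounded_opI[where M = M])
      (use H K in \<open>auto simp: hadj_closed hnorm_hadj_le[OF M] hinner_simps[OF H] hinner_simps[OF K]
        op_closed[OF A] hadj_inner intro!: hadj_eqI\<close>)
qed

end

lemma hadj_hadj:
  assumes "hilbert_space H" "hilbert_space K" "bounded_op H K A" "x \<in> hcarrier H"
  shows "hadj K H (hadj H K A) x = A x"
  using assms(1,2,4)
  by (intro hadj_eqI bounded_op_hadj assms) (simp_all add: op_closed[OF assms(3)] hadj_inner'[OF assms(1-3)])

lemma contraction_hadj:
  assumes "hilbert_space H" "hilbert_space K" "contraction H K A"
  shows "contraction K H (hadj H K A)"
  using assms hnorm_hadj_le[of H K A 1] bounded_op_hadj[of H K A] by (auto simp: contraction_def)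

lemma polarization:
  assumes H: "hilbert_space H" and K: "hilbert_space K" and A: "bounded_op H K A"
    and iso: "\<And>x. x \<in> hcarrier H \<Longrightarrow> hnorm K (A x) = hnorm H x"
    and x: "x \<in> hcarrier H" and y: "y \<in> hcarrier H"
  shows "hinner K (A x) (A y) = hinner H x y"
proof -
  have re: "Re (hinner K (A u) (A v)) = Re (hinner H u v)" if "u \<in> hcarrier H" "v \<in> hcarrier H" for u v
    using hnorm_add_sq[OF H that] hnorm_add_sq[OF K op_closed[OF A that(1)] op_closed[OF A that(2)]]
      iso[of "u + v"] iso that by (simp add: op_add[OF A] H)
  \<comment> \<open>The real part after multiplication by \<open>- \<i>\<close> is the imaginary
    part before it.\<close>
  have "Im (hinner K (A x) (A y)) = Im (hinner H x y)"
    using re[of "(- \<i>) *\<^sub>C x" y] x y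
    by (simp add: op_scale[OF A] hinner_scale_left[OF H] hinner_scale_left[OF K] op_closed[OF A] H del: cvec.scale_minus_left)
  then show ?thesis using re[OF x y] by (simp add: complex_eq_iff)
qed

lemma onto_isometry_op: "onto_isometry H K U \<Longrightarrow> bounded_op H K U"
  by (simp add: onto_isometry_def)

lemma onto_isometryI:
  assumes "bounded_op H K U" "\<And>x. x \<in> hcarrier H \<Longrightarrow> hnorm K (U x) = hnorm H x"
    and "\<And>y. y \<in> hcarrier K \<Longrightarrow> \<exists>x\<in>hcarrier H. U x = y"
  shows "onto_isometry H K U"
  using assms op_closed[OF assms(1)] by (auto simp: onto_isometry_def image_iff)

context
  fixes H :: "'a::complex_vector hspace" and K :: "'b::complex_vector hspace" and U
  assumes H: "hilbert_space H" and K: "hilbert_space K" and U: "onto_isometry H K U"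
begin

lemma onto_isometry_inner:
  "x \<in> hcarrier H \<Longrightarrow> y \<in> hcarrier H \<Longrightarrow> hinner K (U x) (U y) = hinner H x y"
  using U polarization[OF H K, of U] by (simp add: onto_isometry_def)

lemma onto_isometry_hadj_left: "x \<in> hcarrier H \<Longrightarrow> hadj H K U (U x) = x"
  using op_closed[OF onto_isometry_op[OF U]] by (intro hadj_eqI[OF H K onto_isometry_op[OF U]]) (simp_all add: onto_isometry_inner)

lemma onto_isometry_hadj_right: "y \<in> hcarrier K \<Longrightarrow> U (hadj H K U y) = y"
  using U onto_isometry_hadj_left unfolding onto_isometry_def by (metis imageE)

lemma onto_isometry_hadj: "onto_isometry K H (hadj H K U)"
proof (rule onto_isometryI)
  show "bounded_op K H (hadj H K U)" by (intro bounded_op_hadj H K onto_isometry_op[OF U])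
  show "hnorm H (hadj H K U y) = hnorm K y" if "y \<in> hcarrier K" for y
    using U onto_isometry_hadj_right[OF that] hadj_closed[OF H K onto_isometry_op[OF U] that]
    unfolding onto_isometry_def by metis
  show "\<exists>y\<in>hcarrier K. hadj H K U y = x" if "x \<in> hcarrier H" for x
    using onto_isometry_hadj_left[OF that] op_closed[OF onto_isometry_op[OF U] that] by blast
qed

end

lemma onto_isometry_id: "onto_isometry H H (\<lambda>x. x)"
  by (auto simp: onto_isometry_def bounded_op_id)

section \<open>Inverses, square roots and extensions\<close>

context
  fixes H :: "'a::complex_vector hspace" and A and q :: real
  assumes H: "hilbert_space H" and A: "bounded_op H H A"
    and q: "0 \<le> q" "q < 1" and Aq: "\<And>x. x \<in> hcarrier H \<Longrightarrow> hnorm H (A x) \<le> q * hnorm H x"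
begin

lemma neumann_lower:
  assumes "x \<in> hcarrier H" shows "(1 - q) * hnorm H x \<le> hnorm H (x - A x)"
  using hnorm_triangle_rev[OF H assms op_closed[OF A assms]] Aq[OF assms] by (simp add: algebra_simps)

text \<open>Picard iteration of \<open>x \<mapsto> y + A x\<close> from 0: the increments shrink by
  the factor \<open>q\<close>, and the limit is a fixed point by continuity of
  \<open>A\<close>.\<close>

lemma neumann_solution:
  assumes y: "y \<in> hcarrier H"
  shows "\<exists>x\<in>hcarrier H. x - A x = y"
proof -
  define X where "X = rec_nat 0 (\<lambda>_ x. y + A x)"
  have X0: "X 0 = 0" and XS: "X (Suc n) = y + A (X n)" for n by (simp_all add: X_def)
  have XH: "X n \<in> hcarrier H" for n
    by (induction n) (simp_all add: X0 XS H y op_closed[OF A])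
  have inc: "hnorm H (X (Suc n) - X n) \<le> q ^ n * hnorm H y" for n
  proof (induction n)
    case (Suc n)
    have "hnorm H (X (Suc (Suc n)) - X (Suc n)) = hnorm H (A (X (Suc n) - X n))"
      by (simp add: XS[of "Suc n"] XS[of n] op_diff[OF A H] XH H y op_closed[OF A] op_add[OF A])
    also have "\<dots> \<le> q * hnorm H (X (Suc n) - X n)" by (intro Aq carrier_diff H XH)
    also have "\<dots> \<le> q * (q ^ n * hnorm H y)" using Suc q by (intro mult_left_mono) auto
    finally show ?case by (simp add: mult.assoc)
  qed (simp add: X0 XS op_zero[OF A H])
  \<comment> \<open>The tail of the geometric series with a negative sign: it increases to 0, and
    its increments are exactly the bounds in \<open>inc\<close>.\<close>
  define s where "s n = - (q ^ n * hnorm H y / (1 - q))" for n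
  have "s \<longlonglongrightarrow> - (0 * hnorm H y / (1 - q))"
    unfolding s_def using q by (intro tendsto_intros LIMSEQ_realpow_zero) auto
  then have slim: "s \<longlonglongrightarrow> 0" by simp
  have "s (Suc n) - s n = q ^ n * hnorm H y" for n
  proof -
    have "s (Suc n) - s n = ((1 - q) * (q ^ n * hnorm H y)) / (1 - q)"
      by (simp add: s_def algebra_simps diff_divide_distrib)
    then show ?thesis using q by simp
  qed
  then have inc': "hnorm H (X (Suc n) - X n) \<le> s (Suc n) - s n" for n using inc by simp
  obtain x where x: "x \<in> hcarrier H" "(\<lambda>n. hnorm H (X n - x)) \<longlonglongrightarrow> 0"
    by (rule telescoping_converges[OF H, where X = X, OF XH slim inc'])
  have le: "norm (hnorm H (X (Suc n) - (y + A x))) \<le> q * hnorm H (X n - x)" for n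
    using Aq[of "X n - x"] by (simp add: XS op_diff[OF A H] XH x H op_closed[OF A] y)
  have "(\<lambda>n. q * hnorm H (X n - x)) \<longlonglongrightarrow> 0"
    using tendsto_mult[OF tendsto_const[of q] x(2)] by simp
  then have "(\<lambda>n. hnorm H (X (Suc n) - (y + A x))) \<longlonglongrightarrow> 0"
    by (rule Lim_null_comparison[OF always_eventually, rule_format, OF le])
  then have "x = y + A x"
    using hlim_unique[OF H, of "\<lambda>n. X (Suc n)" x "y + A x"] LIMSEQ_Suc[OF x(2)]
    by (simp add: XH x H y op_closed[OF A])
  then have "x - A x = y" by (simp add: algebra_simps)
  with x show ?thesis by blast
qed

lemma neumann_inj: "inj_on (\<lambda>x. x - A x) (hcarrier H)"
proof (rule inj_onI)
  fix x x' assume x: "x \<in> hcarrier H" "x' \<in> hcarrier H" "x - A x = x' - A x'"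
  have "(x - x') - A (x - x') = (x - A x) - (x' - A x')"
    by (simp add: op_diff[OF A H x(1,2)] algebra_simps)
  then have "(1 - q) * hnorm H (x - x') \<le> 0"
    using neumann_lower[of "x - x'"] x H by simp
  then have "hnorm H (x - x') \<le> 0" using q by (simp add: mult_le_0_iff)
  then show "x = x'" using x H
    by (metis carrier_diff eq_iff_diff_eq_0 hnorm_eq_0 hnorm_ge0 order_antisym)
qed

lemma neumann_inverse:
  assumes y: "y \<in> hcarrier H"
  shows "hinverse H (\<lambda>x. x - A x) y \<in> hcarrier H"
    and "hinverse H (\<lambda>x. x - A x) y - A (hinverse H (\<lambda>x. x - A x) y) = y"
proof -
  have "y \<in> (\<lambda>x. x - A x) ` hcarrier H" using neumann_solution[OF y] by blast
  from inv_into_into[OF this] f_inv_into_f[OF this]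
  show "hinverse H (\<lambda>x. x - A x) y \<in> hcarrier H"
    and "hinverse H (\<lambda>x. x - A x) y - A (hinverse H (\<lambda>x. x - A x) y) = y"
    by (simp_all add: hinverse_def)
qed

lemma neumann_inverse_eqI:
  assumes "x \<in> hcarrier H" "x - A x = y"
  shows "hinverse H (\<lambda>x. x - A x) y = x"
  using inv_into_f_f[OF neumann_inj assms(1)] assms(2) by (simp add: hinverse_def)

lemma bounded_op_neumann: "bounded_op H H (hinverse H (\<lambda>x. x - A x))"
proof (rule bounded_opI[where M = "1 / (1 - q)"])
  fix y assume y: "y \<in> hcarrier H"
  note i = neumann_inverse[OF y]
  show "hnorm H (hinverse H (\<lambda>x. x - A x) y) \<le> 1 / (1 - q) * hnorm H y"
    using neumann_lower[OF i(1)] q unfolding i(2) by (simp add: field_simps)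
next
  fix x y assume "x \<in> hcarrier H" "y \<in> hcarrier H"
  note i = neumann_inverse[OF this(1)] neumann_inverse[OF this(2)]
  show "hinverse H (\<lambda>x. x - A x) (x + y) = hinverse H (\<lambda>x. x - A x) x + hinverse H (\<lambda>x. x - A x) y"
    by (rule neumann_inverse_eqI)
      (use i H in \<open>simp_all add: op_add[OF A i(1,3)] add_diff_add del: add_diff_eq diff_add_eq diff_diff_eq2\<close>)
next
  fix c x assume "x \<in> hcarrier H"
  note i = neumann_inverse[OF this]
  show "hinverse H (\<lambda>x. x - A x) (c *\<^sub>C x) = c *\<^sub>C hinverse H (\<lambda>x. x - A x) x"
    by (rule neumann_inverse_eqI) (use i H in \<open>simp_all add: op_scale[OF A] scaleC_diff_right[symmetric]\<close>)
qed (use neumann_inverse in simp)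

end

text \<open>Over the complex numbers a real quadratic form forces symmetry: expanding it at
  \<open>u + v\<close> compares imaginary parts, and inserting \<open>\<i> *\<^sub>C x\<close> turns
  this into a comparison of real parts.\<close>

lemma positive_op_selfadjoint:
  assumes H: "hilbert_space H" and B: "positive_op H B" and x: "x \<in> hcarrier H" and y: "y \<in> hcarrier H"
  shows "hinner H (B x) y = hinner H x (B y)"
proof -
  have Bop: "bounded_op H H B" using B by (simp add: positive_op_def)
  note cl = op_closed[OF Bop]
  have real: "Im (hinner H (B u) u) = 0" if "u \<in> hcarrier H" for u
    using B that by (auto simp: positive_op_def complex_nonneg_Reals_iff)
  have im: "Im (hinner H (B u) v) = - Im (hinner H (B v) u)" if "u \<in> hcarrier H" "v \<in> hcarrier H" for u v
    using real[of "u + v"] real[of u] real[of v] that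
    by (simp add: op_add[OF Bop] hinner_simps[OF H] cl H)
  have "Im (hinner H (B (\<i> *\<^sub>C x)) y) = - Im (hinner H (B y) (\<i> *\<^sub>C x))"
    using x y H by (intro im) simp_all
  then have re: "Re (hinner H (B x) y) = Re (hinner H (B y) x)"
    using x y by (simp add: op_scale[OF Bop] hinner_simps[OF H] cl H)
  have "hinner H (B x) y = cnj (hinner H (B y) x)"
    using re im[OF x y] by (simp add: complex_eq_iff)
  then show ?thesis using x y by (simp add: hinner_cnj[OF H] cl)
qed

text \<open>The iteration \<open>S\<^sub>n\<^sub>+\<^sub>1 = (X + S\<^sub>n\<^sup>2) / 2\<close> is dominated in norm by the scalar iteration
  \<open>s\<^sub>n\<^sub>+\<^sub>1 = (1 + s\<^sub>n\<^sup>2) / 2\<close>, which increases to a limit at most \<open>1\<close>; the limit \<open>S\<close> satisfies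
  \<open>(I - S)\<^sup>2 = I - X\<close>.\<close>

lemma sqrt_exists:
  assumes H: "hilbert_space H" and X: "bounded_op H H X"
    and sa: "\<And>x y. x \<in> hcarrier H \<Longrightarrow> y \<in> hcarrier H \<Longrightarrow> hinner H (X x) y = hinner H x (X y)"
    and contr: "\<And>x. x \<in> hcarrier H \<Longrightarrow> hnorm H (X x) \<le> hnorm H x"
  shows "\<exists>B. positive_op H B \<and> (\<forall>x\<in>hcarrier H. B (B x) = x - X x)"
proof -
  define s :: "nat \<Rightarrow> real" where "s = rec_nat 0 (\<lambda>_ r. (1 + r\<^sup>2) / 2)"
  have s0: "s 0 = 0" and sS: "s (Suc n) = (1 + (s n)\<^sup>2) / 2" for n by (simp_all add: s_def)
  have s01: "0 \<le> s n \<and> s n \<le> 1" for n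
    by (induction n) (auto simp: s0 sS power_le_one)
  have s_inc: "s n \<le> s (Suc n)" for n
  proof -
    have "0 \<le> (1 - s n)\<^sup>2" by simp
    then show ?thesis by (simp add: sS power2_eq_square algebra_simps)
  qed
  obtain c where c: "s \<longlonglongrightarrow> c" "c \<le> 1"
    using incseq_convergent[of s 1] s_inc s01 LIMSEQ_le_const2[of s _ 1] incseq_SucI[of s] by metis
  define S where "S = rec_nat (\<lambda>x. 0) (\<lambda>_ P x. (1/2) *\<^sub>C (X x + P (P x)))"
  have S0: "S 0 = (\<lambda>x. 0)" and SS: "S (Suc n) = (\<lambda>x. (1/2) *\<^sub>C (X x + S n (S n x)))" for n
    by (simp_all add: S_def)
  have Sop: "bounded_op H H (S n)" for n
  proof (induction n)
    case 0
    show ?case unfolding S0 by (rule bounded_opI[where M = 0]) (simp_all add: H)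
  next
    case (Suc n)
    show ?case unfolding SS
      by (intro bounded_op_scale bounded_op_add X H bounded_op_comp[OF Suc Suc])
  qed
  note Scl = op_closed[OF Sop] and Xcl = op_closed[OF X]
  have Ssa: "hinner H (S n x) y = hinner H x (S n y)" if "x \<in> hcarrier H" "y \<in> hcarrier H" for n x y
    using that by (induction n arbitrary: x y)
      (simp_all add: S0 SS H hinner_simps[OF H] Scl Xcl sa)
  have Sn: "hnorm H (S n x) \<le> s n * hnorm H x" if "x \<in> hcarrier H" for n x
    using that
  proof (induction n arbitrary: x)
    case 0
    then show ?case by (simp add: S0 s0 H)
  next
    case (Suc n)
    have "hnorm H (S n (S n x)) \<le> s n * hnorm H (S n x)" using Suc Scl by blast
    also have "\<dots> \<le> s n * (s n * hnorm H x)" using Suc s01 by (intro mult_left_mono) auto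
    finally have "hnorm H (X x + S n (S n x)) \<le> hnorm H x + (s n)\<^sup>2 * hnorm H x"
      using hnorm_triangle[OF H, of "X x" "S n (S n x)"] contr[of x] Suc.prems Scl Xcl
      by (simp add: power2_eq_square mult.assoc)
    moreover have "hnorm H (S (Suc n) x) = hnorm H (X x + S n (S n x)) / 2"
      using hnorm_scale[OF H, of "X x + S n (S n x)" "1/2"] Suc.prems H by (simp add: SS Scl Xcl)
    ultimately show ?case by (simp add: sS algebra_simps)
  qed
  have Sinc: "hnorm H (S (Suc n) x - S n x) \<le> (s (Suc n) - s n) * hnorm H x" if "x \<in> hcarrier H" for n x
    using that
  proof (induction n arbitrary: x)
    case 0
    then show ?case using contr[of x] by (simp add: S0 SS s0 sS hnorm_scale H Xcl)
  next
    case (Suc n)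
    let ?P = "S (Suc n)" and ?Q = "S n"
    note x = Suc.prems
    have "S (Suc (Suc n)) x - ?P x = (1/2) *\<^sub>C (?P (?P x) - ?Q (?Q x))"
      by (simp add: SS[of "Suc n"] SS[of n] scaleC_diff_right scaleC_add_right)
    \<comment> \<open>A difference of squares split as (P - Q) P + Q (P - Q), a form that is valid
      for noncommuting operators.\<close>
    also have "?P (?P x) - ?Q (?Q x) = (?P (?P x) - ?Q (?P x)) + ?Q (?P x - ?Q x)"
      using x by (simp add: op_diff[OF Sop H] Scl)
    finally have "hnorm H (S (Suc (Suc n)) x - ?P x)
        = hnorm H ((?P (?P x) - ?Q (?P x)) + ?Q (?P x - ?Q x)) / 2"
      using x by (simp add: hnorm_scale H Scl)
    also have "hnorm H ((?P (?P x) - ?Q (?P x)) + ?Q (?P x - ?Q x))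
        \<le> hnorm H (?P (?P x) - ?Q (?P x)) + hnorm H (?Q (?P x - ?Q x))"
      using x by (intro hnorm_triangle H) (simp_all add: Scl H)
    also have "\<dots> \<le> (s (Suc n) - s n) * hnorm H (?P x) + s n * hnorm H (?P x - ?Q x)"
      using x by (intro add_mono Suc.IH Sn) (simp_all add: Scl H)
    also have "\<dots> \<le> (s (Suc n) - s n) * (s (Suc n) * hnorm H x) + s n * ((s (Suc n) - s n) * hnorm H x)"
      using x s01 s_inc by (intro add_mono mult_left_mono Suc.IH Sn) auto
    also have "\<dots> = ((s (Suc n))\<^sup>2 - (s n)\<^sup>2) * hnorm H x"
      by (simp add: power2_eq_square algebra_simps)
    finally have "hnorm H (S (Suc (Suc n)) x - ?P x) \<le> ((s (Suc n))\<^sup>2 - (s n)\<^sup>2) / 2 * hnorm H x"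
      by simp
    also have "((s (Suc n))\<^sup>2 - (s n)\<^sup>2) / 2 = s (Suc (Suc n)) - s (Suc n)"
      by (simp add: sS[of "Suc n"] sS[of n] field_simps)
    finally show ?case .
  qed
  have "\<exists>l\<in>hcarrier H. (\<lambda>n. hnorm H (S n x - l)) \<longlonglongrightarrow> 0" if x: "x \<in> hcarrier H" for x
  proof -
    have "(\<lambda>n. s n * hnorm H x) \<longlonglongrightarrow> c * hnorm H x" by (intro tendsto_intros c)
    then show ?thesis
      using telescoping_converges[OF H, of "\<lambda>n. S n x" "\<lambda>n. s n * hnorm H x"] Sinc[OF x] Scl[OF x]
      by (metis left_diff_distrib)
  qed
  then obtain L where L: "\<And>x. x \<in> hcarrier H \<Longrightarrow> L x \<in> hcarrier H"
    "\<And>x. x \<in> hcarrier H \<Longrightarrow> (\<lambda>n. hnorm H (S n x - L x)) \<longlonglongrightarrow> 0" by metis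
  have Linner: "(\<lambda>n. hinner H (S n x) y) \<longlonglongrightarrow> hinner H (L x) y"
    if "x \<in> hcarrier H" "y \<in> hcarrier H" for x y
    using that by (intro hlim_hinner[OF H] L Scl)
  have Ln: "hnorm H (L x) \<le> hnorm H x" if x: "x \<in> hcarrier H" for x
  proof -
    have "hnorm H (S n x - 0) \<le> hnorm H x" for n
    proof -
      have "s n * hnorm H x \<le> 1 * hnorm H x" using s01[of n] x H by (intro mult_right_mono) auto
      then show ?thesis using Sn[OF x, of n] by simp
    qed
    then show ?thesis
      using hlim_bound[OF H, of "\<lambda>n. S n x" "L x" 0 0 "hnorm H x"] Scl[OF x] L[OF x] H by simp
  qed
  have Lsa: "hinner H (L x) y = hinner H x (L y)" if "x \<in> hcarrier H" "y \<in> hcarrier H" for x y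
  proof (rule LIMSEQ_unique)
    show "(\<lambda>n. hinner H (S n x) y) \<longlonglongrightarrow> hinner H (L x) y" using that by (rule Linner)
    show "(\<lambda>n. hinner H (S n x) y) \<longlonglongrightarrow> hinner H x (L y)"
      using tendsto_cnj[OF Linner[OF that(2,1)]] that by (simp add: hinner_cnj[OF H] Scl L Ssa)
  qed
  have Lop: "bounded_op H H L"
  proof (rule bounded_opI[where M = 1])
    fix x y assume xy: "x \<in> hcarrier H" "y \<in> hcarrier H"
    show "L (x + y) = L x + L y"
      by (rule hinner_ext_left[OF H]) (use xy in \<open>simp_all add: H L Lsa hinner_simps[OF H]\<close>)
  next
    fix c x assume x: "x \<in> hcarrier H"
    show "L (c *\<^sub>C x) = c *\<^sub>C L x"
      by (rule hinner_ext_left[OF H]) (use x in \<open>simp_all add: H L Lsa hinner_simps[OF H]\<close>)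
  qed (use L Ln in auto)
  \<comment> \<open>The recursion passes to the limit weakly: in the quadratic term one factor is
    moved to \<open>y\<close> by symmetry, leaving a product of two convergent vectors.\<close>
  have Lfix: "L x + L x = X x + L (L x)" if x: "x \<in> hcarrier H" for x
  proof (rule hinner_ext_left[OF H])
    fix y assume y: "y \<in> hcarrier H"
    have "(\<lambda>n. hinner H (S n x - L x) (S n y) + hinner H (L x) (S n y)) \<longlonglongrightarrow> 0 + hinner H (L x) (L y)"
    proof (rule tendsto_add)
      show "(\<lambda>n. hinner H (L x) (S n y)) \<longlonglongrightarrow> hinner H (L x) (L y)"
        using tendsto_cnj[OF Linner[of y "L x"]] x y by (simp add: hinner_cnj[OF H] Scl L)
      have "norm (hinner H (S n x - L x) (S n y)) \<le> norm (hnorm H (S n x - L x)) * hnorm H y" for n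
      proof -
        have "s n * hnorm H y \<le> 1 * hnorm H y" using s01[of n] y H by (intro mult_right_mono) auto
        then have "hnorm H (S n y) \<le> hnorm H y" using Sn[OF y, of n] by simp
        then have "hnorm H (S n x - L x) * hnorm H (S n y) \<le> hnorm H (S n x - L x) * hnorm H y"
          using x H by (intro mult_left_mono) (simp_all add: Scl L)
        then show ?thesis
          using Cauchy_Schwarz[OF H, of "S n x - L x" "S n y"] x y H by (simp add: Scl L)
      qed
      then show "(\<lambda>n. hinner H (S n x - L x) (S n y)) \<longlonglongrightarrow> 0"
        by (intro tendsto_0_le[OF L(2)[OF x], where K = "hnorm H y"]) auto
    qed
    moreover have "hinner H (S n x - L x) (S n y) + hinner H (L x) (S n y) = hinner H (S n (S n x)) y" for n
      using x y by (simp add: hinner_simps[OF H] Scl L Ssa H)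
    ultimately have lim: "(\<lambda>n. hinner H (S n (S n x)) y) \<longlonglongrightarrow> hinner H (L (L x)) y"
      using x y by (simp add: Lsa L)
    have "(\<lambda>n. 2 * hinner H (S (Suc n) x) y) \<longlonglongrightarrow> 2 * hinner H (L x) y"
      by (intro tendsto_mult tendsto_const LIMSEQ_Suc Linner x y)
    moreover have "2 * hinner H (S (Suc n) x) y = hinner H (X x) y + hinner H (S n (S n x)) y" for n
      using x y by (simp add: SS hinner_simps[OF H] H Scl Xcl)
    moreover have "(\<lambda>n. hinner H (X x) y + hinner H (S n (S n x)) y) \<longlonglongrightarrow> hinner H (X x) y + hinner H (L (L x)) y"
      by (intro tendsto_add tendsto_const lim)
    ultimately have "2 * hinner H (L x) y = hinner H (X x) y + hinner H (L (L x)) y"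
      using LIMSEQ_unique by fastforce
    then show "hinner H (L x + L x) y = hinner H (X x + L (L x)) y"
      using x y by (simp add: hinner_simps[OF H] L H Xcl)
  qed (use x in \<open>simp_all add: L H Xcl\<close>)
  have "positive_op H (\<lambda>x. x - L x)"
    unfolding positive_op_def
  proof (intro conjI ballI)
    show "bounded_op H H (\<lambda>x. x - L x)" by (intro bounded_op_diff bounded_op_id Lop H)
    fix x assume x: "x \<in> hcarrier H"
    have "cmod (hinner H (L x) x) \<le> hnorm H (L x) * hnorm H x" using x by (intro Cauchy_Schwarz H L)
    also have "\<dots> \<le> hnorm H x * hnorm H x" using x Ln H by (intro mult_right_mono) auto
    finally have "cmod (hinner H (L x) x) \<le> (hnorm H x)\<^sup>2" by (simp add: power2_eq_square)
    then have "Re (hinner H (L x) x) \<le> (hnorm H x)\<^sup>2"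
      using complex_Re_le_cmod order_trans by blast
    moreover have "cnj (hinner H (L x) x) = hinner H (L x) x"
      using x by (simp add: hinner_cnj[OF H] L Lsa)
    then have "Im (hinner H (L x) x) = 0" by (simp add: complex_eq_iff)
    ultimately show "hinner H (x - L x) x \<in> \<real>\<^sub>\<ge>\<^sub>0"
      using x by (simp add: hinner_simps[OF H] L hinner_self[OF H] complex_nonneg_Reals_iff)
  qed
  moreover have "(x - L x) - L (x - L x) = x - X x" if "x \<in> hcarrier H" for x
    using Lfix[OF that] that by (simp add: op_diff[OF Lop H] L algebra_simps)
  ultimately show ?thesis by blast
qed

section \<open>Defect operators of a contraction\<close>

context
  fixes H :: "'a::complex_vector hspace" and K :: "'b::complex_vector hspace" and A
  assumes H: "hilbert_space H" and K: "hilbert_space K" and A: "contraction H K A"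
begin

private lemma Aop: "bounded_op H K A" using A by (simp add: contraction_def)

lemma defect_spec:
  "positive_op H (defect H K A) \<and> (\<forall>x\<in>hcarrier H. defect H K A (defect H K A x) = x - hadj H K A (A x))"
proof -
  have "\<exists>B. positive_op H B \<and> (\<forall>x\<in>hcarrier H. B (B x) = x - hadj H K A (A x))"
  proof (rule sqrt_exists[OF H])
  show "bounded_op H H (\<lambda>x. hadj H K A (A x))" by (intro bounded_op_comp[OF Aop bounded_op_hadj] H K Aop)
next
  fix x y assume xy: "x \<in> hcarrier H" "y \<in> hcarrier H"
  note cl = xy[THEN op_closed[OF Aop]]
  show "hinner H (hadj H K A (A x)) y = hinner H x (hadj H K A (A y))"
    using xy cl by (simp add: hadj_inner[OF H K Aop, symmetric] hadj_inner'[OF H K Aop, symmetric])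
next
  fix x assume x: "x \<in> hcarrier H"
  have "hnorm H (hadj H K A (A x)) \<le> hnorm K (A x)"
    using contraction_hadj[OF H K A] op_closed[OF Aop x] by (simp add: contraction_def)
  then show "hnorm H (hadj H K A (A x)) \<le> hnorm H x"
    using A x unfolding contraction_def by (meson order_trans)
  qed
  then show ?thesis unfolding defect_def hsqrt_def by (rule someI_ex)
qed

lemma defect_positive: "positive_op H (defect H K A)"
  and defect_sq: "x \<in> hcarrier H \<Longrightarrow> defect H K A (defect H K A x) = x - hadj H K A (A x)"
  using defect_spec by auto

lemma defect_op: "bounded_op H H (defect H K A)"
  using defect_positive by (simp add: positive_op_def)

lemma defect_selfadjoint:
  "x \<in> hcarrier H \<Longrightarrow> y \<in> hcarrier H \<Longrightarrow> hinner H (defect H K A x) y = hinner H x (defect H K A y)"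
  by (rule positive_op_selfadjoint[OF H defect_positive])

text \<open>\<open>hsqrt\<close> merely chooses some positive root. Its Gram form depends on
  \<open>A\<close> alone, so calculations in this form are independent of the choice.\<close>

lemma defect_inner:
  assumes "x \<in> hcarrier H" "y \<in> hcarrier H"
  shows "hinner H (defect H K A x) (defect H K A y) = hinner H x y - hinner K (A x) (A y)"
  using assms op_closed[OF defect_op] op_closed[OF Aop]
  by (simp add: defect_selfadjoint defect_sq hinner_simps[OF H] hadj_closed[OF H K Aop] hadj_inner[OF H K Aop])

lemma defect_adj_spec:
  "positive_op K (defect_adj H K A) \<and>
    (\<forall>y\<in>hcarrier K. defect_adj H K A (defect_adj H K A y) = y - A (hadj H K A y))"
proof -
  have eq: "hadj K H (hadj H K A) (hadj H K A y) = A (hadj H K A y)" if "y \<in> hcarrier K" for y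
    using that by (intro hadj_hadj[OF H K Aop] hadj_closed[OF H K Aop])
  have "\<exists>B. positive_op K B \<and> (\<forall>y\<in>hcarrier K. B (B y) = y - A (hadj H K A y))"
  proof (rule sqrt_exists[OF K])
    show "bounded_op K K (\<lambda>y. A (hadj H K A y))" by (intro bounded_op_comp[OF bounded_op_hadj Aop] H K Aop)
  next
    fix x y assume xy: "x \<in> hcarrier K" "y \<in> hcarrier K"
    note cl = xy[THEN hadj_closed[OF H K Aop]]
    show "hinner K (A (hadj H K A x)) y = hinner K x (A (hadj H K A y))"
      using xy cl by (simp add: hadj_inner[OF H K Aop] hadj_inner'[OF H K Aop])
  next
    fix y assume y: "y \<in> hcarrier K"
    have "hnorm K (A (hadj H K A y)) \<le> hnorm H (hadj H K A y)"
      using A hadj_closed[OF H K Aop y] by (simp add: contraction_def)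
    also have "\<dots> \<le> hnorm K y"
      using contraction_hadj[OF H K A] y by (simp add: contraction_def)
    finally show "hnorm K (A (hadj H K A y)) \<le> hnorm K y" .
  qed
  then show ?thesis
    unfolding defect_adj_def hsqrt_def by (rule someI_ex)
qed

lemma defect_adj_positive: "positive_op K (defect_adj H K A)"
  and defect_adj_sq: "y \<in> hcarrier K \<Longrightarrow> defect_adj H K A (defect_adj H K A y) = y - A (hadj H K A y)"
  using defect_adj_spec by auto

lemma defect_adj_op: "bounded_op K K (defect_adj H K A)"
  using defect_adj_positive by (simp add: positive_op_def)

lemma defect_adj_selfadjoint:
  "x \<in> hcarrier K \<Longrightarrow> y \<in> hcarrier K \<Longrightarrow> hinner K (defect_adj H K A x) y = hinner K x (defect_adj H K A y)"
  by (rule positive_op_selfadjoint[OF K defect_adj_positive])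

lemma defect_adj_inner:
  assumes "x \<in> hcarrier K" "y \<in> hcarrier K"
  shows "hinner K (defect_adj H K A x) (defect_adj H K A y) =
    hinner K x y - hinner H (hadj H K A x) (hadj H K A y)"
  using assms op_closed[OF defect_adj_op] op_closed[OF Aop] hadj_closed[OF H K Aop]
  by (simp add: defect_adj_selfadjoint defect_adj_sq hinner_simps[OF K] hadj_inner'[OF H K Aop])

end

text \<open>Extension by continuity of an operator known only through a linear graph
  \<open>S\<close> over a dense set. With a graph, single-valuedness is a consequence of the norm
  bound instead of a separate obligation.\<close>

lemma graph_extension:
  assumes H: "hilbert_space H" and K: "hilbert_space K"
    and S: "S \<subseteq> hcarrier H \<times> hcarrier K" "(0, 0) \<in> S"
    and Sadd: "\<And>u v u' v'. (u, v) \<in> S \<Longrightarrow> (u', v') \<in> S \<Longrightarrow> (u + u', v + v') \<in> S"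
    and Sscale: "\<And>c u v. (u, v) \<in> S \<Longrightarrow> (c *\<^sub>C u, c *\<^sub>C v) \<in> S"
    and M: "M \<ge> 0" "\<And>u v. (u, v) \<in> S \<Longrightarrow> hnorm K v \<le> M * hnorm H u"
    and dense: "hclosure H (fst ` S) = hcarrier H"
  obtains L where "bounded_op H K L" "\<And>u v. (u, v) \<in> S \<Longrightarrow> L u = v"
    "\<And>x. x \<in> hcarrier H \<Longrightarrow> hnorm K (L x) \<le> M * hnorm H x"
proof -
  have Sdiff: "hnorm K (v - v') \<le> M * hnorm H (u - u')" if "(u, v) \<in> S" "(u', v') \<in> S" for u v u' v'
    using M(2)[OF Sadd[OF that(1) Sscale[OF that(2), of "-1"]]] by simp
  have mem: "u \<in> hcarrier H" "v \<in> hcarrier K" if "(u, v) \<in> S" for u v using that S by auto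
  have approx: "\<exists>u v. (u, v) \<in> S \<and> hnorm H (x - u) < e" if "x \<in> hcarrier H" "e > 0" for x e
  proof -
    have "x \<in> hclosure H (fst ` S)" using that(1) dense by simp
    then show ?thesis using that(2) unfolding hclosure_def by force
  qed
  \<comment> \<open>The value at \<open>x\<close> is pinned down by a Lipschitz estimate against
    every graph point. Linearity is later read off from this estimate, without returning to the
    approximating sequences.\<close>
  have "\<exists>y\<in>hcarrier K. \<forall>(u, v)\<in>S. hnorm K (y - v) \<le> M * hnorm H (x - u)" if x: "x \<in> hcarrier H" for x
  proof -
    have "\<exists>u v. (u, v) \<in> S \<and> hnorm H (x - u) < 1 / real (Suc n)" for n
      using approx[OF x, of "1 / real (Suc n)"] by simp
    then obtain U V where UV: "\<And>n. (U n, V n) \<in> S" "\<And>n. hnorm H (x - U n) < 1 / real (Suc n)" by metis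
    have Ulim: "(\<lambda>n. hnorm H (x - U n)) \<longlonglongrightarrow> 0"
    proof (rule Lim_null_comparison[OF always_eventually LIMSEQ_inverse_real_of_nat], rule allI)
      show "norm (hnorm H (x - U n)) \<le> inverse (real (Suc n))" for n
        using UV(2)[of n] mem[OF UV(1)[of n]] x H by (simp add: inverse_eq_divide)
    qed
    have "\<exists>N. \<forall>m\<ge>N. \<forall>n\<ge>N. hnorm K (V m - V n) < e" if e: "e > 0" for e
    proof -
      have "e / (2 * M + 1) > 0" using e M by (simp add: add_nonneg_pos)
      then obtain N where N: "\<forall>n\<ge>N. hnorm H (x - U n) < e / (2 * M + 1)"
        using LIMSEQ_D[OF Ulim, of "e / (2 * M + 1)"] by (auto simp: abs_less_iff)
      have "hnorm K (V m - V n) < e" if "m \<ge> N" "n \<ge> N" for m n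
      proof -
        have "hnorm H (U m - U n) \<le> hnorm H (x - U m) + hnorm H (x - U n)"
          using hnorm_triangle_diff[OF H mem(1)[OF UV(1)[of m]] x mem(1)[OF UV(1)[of n]]]
            hnorm_minus_commute[OF H x mem(1)[OF UV(1)[of m]]] by simp
        moreover have "hnorm H (x - U m) < e / (2 * M + 1)" "hnorm H (x - U n) < e / (2 * M + 1)"
          using N that by blast+
        ultimately have "hnorm H (U m - U n) \<le> 2 * (e / (2 * M + 1))" by linarith
        then have "M * hnorm H (U m - U n) \<le> M * (2 * (e / (2 * M + 1)))" using M(1) by (rule mult_left_mono)
        also have "\<dots> < e" using e M(1) by (simp add: field_simps add_nonneg_pos)
        finally show ?thesis using Sdiff[OF UV(1)[of m] UV(1)[of n]] by linarith
      qed
      then show ?thesis by blast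
    qed
    then obtain y where y: "y \<in> hcarrier K" "(\<lambda>n. hnorm K (V n - y)) \<longlonglongrightarrow> 0"
      using hcomplete[OF K, of V] mem[OF UV(1)] by blast
    have "hnorm K (y - v) \<le> M * hnorm H (x - u)" if uv: "(u, v) \<in> S" for u v
    proof (rule LIMSEQ_le_const)
      show "(\<lambda>n. hnorm K (V n - y) + M * (hnorm H (x - U n) + hnorm H (x - u))) \<longlonglongrightarrow> M * hnorm H (x - u)"
        using tendsto_add[OF y(2) tendsto_mult[OF tendsto_const[of M] tendsto_add[OF Ulim tendsto_const[of "hnorm H (x - u)"]]]] by simp
      show "\<exists>N. \<forall>n\<ge>N. hnorm K (y - v) \<le> hnorm K (V n - y) + M * (hnorm H (x - U n) + hnorm H (x - u))"
      proof (intro exI allI impI)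
        fix n
        have "hnorm K (y - v) \<le> hnorm K (y - V n) + hnorm K (V n - v)"
          using y mem[OF UV(1)] mem[OF uv] by (intro hnorm_triangle_diff K) auto
        moreover have "hnorm K (V n - v) \<le> M * hnorm H (U n - u)" by (rule Sdiff[OF UV(1) uv])
        moreover have "hnorm H (U n - u) \<le> hnorm H (U n - x) + hnorm H (x - u)"
          using x mem[OF UV(1)] mem[OF uv] by (intro hnorm_triangle_diff H) auto
        then have "M * hnorm H (U n - u) \<le> M * (hnorm H (U n - x) + hnorm H (x - u))"
          using M(1) by (rule mult_left_mono)
        ultimately show "hnorm K (y - v) \<le> hnorm K (V n - y) + M * (hnorm H (x - U n) + hnorm H (x - u))"
          using hnorm_minus_commute[OF H x mem(1)[OF UV(1)]] hnorm_minus_commute[OF K y(1) mem(2)[OF UV(1)]]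
          by (metis add_left_mono order_trans)
      qed
    qed
    then show ?thesis using y by blast
  qed
  then obtain L where L: "\<And>x. x \<in> hcarrier H \<Longrightarrow> L x \<in> hcarrier K"
    "\<And>x u v. x \<in> hcarrier H \<Longrightarrow> (u, v) \<in> S \<Longrightarrow> hnorm K (L x - v) \<le> M * hnorm H (x - u)"
    unfolding Ball_def by (simp split: prod.splits) metis
  have zero: "a = b" if "a \<in> hcarrier K" "b \<in> hcarrier K"
    and ab: "\<And>e. e > 0 \<Longrightarrow> hnorm K (a - b) \<le> C * e" and C: "C \<ge> 0" for a b C
  proof -
    have "hnorm K (a - b) \<le> e" if e: "e > 0" for e
    proof -
      have "hnorm K (a - b) \<le> C * (e / (C + 1))" using C e by (intro ab) (simp add: add_nonneg_pos)
      also have "\<dots> \<le> e" using C e by (simp add: field_simps add_nonneg_pos)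
      finally show ?thesis .
    qed
    then have "hnorm K (a - b) \<le> 0" by (metis field_le_epsilon add_0)
    then show ?thesis using that(1,2) K
      by (metis carrier_diff eq_iff_diff_eq_0 hnorm_eq_0 hnorm_ge0 order_antisym)
  qed
  show thesis
  proof (rule that[of L])
    show "L u = v" if uv: "(u, v) \<in> S" for u v
      using L(2)[OF mem(1)[OF uv] uv] mem[OF uv] L(1)[of u] K H
      by (metis diff_self hnorm_zero mult_zero_right carrier_diff eq_iff_diff_eq_0 hnorm_eq_0 hnorm_ge0 order_antisym)
    show bnd: "hnorm K (L x) \<le> M * hnorm H x" if "x \<in> hcarrier H" for x
      using L(2)[OF that S(2)] by simp
    show "bounded_op H K L"
    proof (rule bounded_opI[where M = M])
      fix x y assume x: "x \<in> hcarrier H" and y: "y \<in> hcarrier H"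
      show "L (x + y) = L x + L y"
      \<comment> \<open>Approximating the sum costs \<open>2 * M * e\<close>, and each summand costs
        \<open>M * e\<close>.\<close>
      proof (rule zero[where C = "4 * M"])
        fix e :: real assume e: "e > 0"
        obtain u v where u: "(u, v) \<in> S" "hnorm H (x - u) < e" using approx[OF x e] by blast
        obtain u' v' where u': "(u', v') \<in> S" "hnorm H (y - u') < e" using approx[OF y e] by blast
        note m = mem[OF u(1)] mem[OF u'(1)]
        let ?a = "L (x + y) - (v + v')"
        have "L (x + y) - (L x + L y) = (?a - (L x - v)) - (L y - v')" by simp
        also have "hnorm K \<dots> \<le> hnorm K (?a - (L x - v)) + hnorm K (L y - v')"
          using x y m L H K by (intro hnorm_triangle_minus[OF K]) simp_all
        also have "hnorm K (?a - (L x - v)) \<le> hnorm K ?a + hnorm K (L x - v)"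
          using x y m L H K by (intro hnorm_triangle_minus[OF K]) simp_all
        finally have "hnorm K (L (x + y) - (L x + L y)) \<le> hnorm K ?a + hnorm K (L x - v) + hnorm K (L y - v')"
          by simp
        moreover have "hnorm K ?a \<le> M * hnorm H ((x + y) - (u + u'))"
          using x y H by (intro L(2) Sadd u u') simp
        moreover have "hnorm H ((x - u) + (y - u')) \<le> hnorm H (x - u) + hnorm H (y - u')"
          using x y m H by (intro hnorm_triangle[OF H]) simp_all
        then have "hnorm H ((x + y) - (u + u')) \<le> 2 * e" using u u' by (simp add: algebra_simps)
        then have "M * hnorm H ((x + y) - (u + u')) \<le> M * (2 * e)" using M(1) by (rule mult_left_mono)
        moreover have "hnorm K (L x - v) \<le> M * e"
          using L(2)[OF x u(1)] mult_left_mono[OF less_imp_le[OF u(2)] M(1)] by linarith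
        moreover have "hnorm K (L y - v') \<le> M * e"
          using L(2)[OF y u'(1)] mult_left_mono[OF less_imp_le[OF u'(2)] M(1)] by linarith
        ultimately show "hnorm K (L (x + y) - (L x + L y)) \<le> 4 * M * e" by simp
      qed (use x y L H K M in simp_all)
    next
      fix c x assume x: "x \<in> hcarrier H"
      show "L (c *\<^sub>C x) = c *\<^sub>C L x"
      proof (rule zero[where C = "2 * cmod c * M"])
        fix e :: real assume e: "e > 0"
        obtain u v where u: "(u, v) \<in> S" "hnorm H (x - u) < e" using approx[OF x e] by blast
        note m = mem[OF u(1)]
        have "L (c *\<^sub>C x) - c *\<^sub>C L x = (L (c *\<^sub>C x) - c *\<^sub>C v) - c *\<^sub>C (L x - v)" by (simp add: scaleC_diff_right)
        also have "hnorm K \<dots> \<le> hnorm K (L (c *\<^sub>C x) - c *\<^sub>C v) + hnorm K (c *\<^sub>C (L x - v))"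
          using x m L H K by (intro hnorm_triangle_minus[OF K]) simp_all
        also have "hnorm K (c *\<^sub>C (L x - v)) = cmod c * hnorm K (L x - v)"
          using x m L K by (simp add: hnorm_scale)
        finally have "hnorm K (L (c *\<^sub>C x) - c *\<^sub>C L x) \<le> hnorm K (L (c *\<^sub>C x) - c *\<^sub>C v) + cmod c * hnorm K (L x - v)" .
        moreover have "hnorm K (L (c *\<^sub>C x) - c *\<^sub>C v) \<le> M * hnorm H (c *\<^sub>C x - c *\<^sub>C u)"
          using x H by (intro L(2) Sscale u) simp
        moreover have "hnorm H (c *\<^sub>C x - c *\<^sub>C u) = cmod c * hnorm H (x - u)"
          using x m H by (simp add: scaleC_diff_right[symmetric] hnorm_scale)
        moreover have "M * hnorm H (x - u) \<le> M * e" using M(1) u(2) by (intro mult_left_mono) auto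
        then have "cmod c * (M * hnorm H (x - u)) \<le> cmod c * (M * e)" by (rule mult_left_mono) simp
        moreover have "hnorm K (L x - v) \<le> M * e"
          using L(2)[OF x u(1)] mult_left_mono[OF less_imp_le[OF u(2)] M(1)] by linarith
        then have "cmod c * hnorm K (L x - v) \<le> cmod c * (M * e)" by (rule mult_left_mono) simp
        ultimately show "hnorm K (L (c *\<^sub>C x) - c *\<^sub>C L x) \<le> 2 * cmod c * M * e" by (simp add: mult_ac)
      qed (use x L H K M in simp_all)
    qed (use L bnd in auto)
  qed
qed

section \<open>Direct sums and operators determined by Gram matrices\<close>

instantiation prod :: (complex_vector, complex_vector) complex_vector
begin
definition scaleC_prod_def: "c *\<^sub>C (p::'a \<times> 'b) = (c *\<^sub>C fst p, c *\<^sub>C snd p)"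
instance
  by standard (simp_all add: scaleC_prod_def prod_eq_iff scaleC_add_right scaleC_add_left
      scaleC_scaleC scaleC_one)
end

text \<open>The orthogonal direct sum. It is the ambient space for spans of graphs, and the target
  of the lurking isometry in \<open>schur_classI\<close>.\<close>

definition hprod :: "'a::complex_vector hspace \<Rightarrow> 'b::complex_vector hspace \<Rightarrow> ('a \<times> 'b) hspace" where
  "hprod H K = \<lparr>hcarrier = hcarrier H \<times> hcarrier K,
     hinner = (\<lambda>p q. hinner H (fst p) (fst q) + hinner K (snd p) (snd q))\<rparr>"

lemma hprod_simps [simp]:
  "hcarrier (hprod H K) = hcarrier H \<times> hcarrier K"
  "hinner (hprod H K) p q = hinner H (fst p) (fst q) + hinner K (snd p) (snd q)"
  by (simp_all add: hprod_def)

lemma hnorm_hprod: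
  assumes "hilbert_space H" "hilbert_space K" "p \<in> hcarrier H \<times> hcarrier K"
  shows "hnorm (hprod H K) p = sqrt ((hnorm H (fst p))\<^sup>2 + (hnorm K (snd p))\<^sup>2)"
  using assms by (auto simp: hnorm_def[of "hprod H K"] hnorm_sq)

text \<open>Extracts coordinate limits in direct sums, columns and square-summable families: each
  coordinate is dominated by the norm of the whole vector.\<close>

lemma hcomplete_dominated:
  assumes H: "hilbert_space H" and X: "\<And>n::nat. X n \<in> hcarrier H"
    and le: "\<And>m n. hnorm H (X m - X n) \<le> d m n"
    and d: "\<And>e. e > 0 \<Longrightarrow> \<exists>N. \<forall>m\<ge>N. \<forall>n\<ge>N. d m n < e"
  shows "\<exists>l\<in>hcarrier H. (\<lambda>n. hnorm H (X n - l)) \<longlonglongrightarrow> 0"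
proof -
  have "\<exists>N. \<forall>m\<ge>N. \<forall>n\<ge>N. hnorm H (X m - X n) < e" if e: "e > 0" for e
  proof -
    obtain N where "\<forall>m\<ge>N. \<forall>n\<ge>N. d m n < e" using d[OF e] by blast
    then show ?thesis by (intro exI[of _ N] allI impI) (rule le_less_trans[OF le], blast)
  qed
  then obtain l where "l \<in> hcarrier H" "(\<lambda>n. hnorm H (X n - l)) \<longlonglongrightarrow> 0"
    by (rule hcomplete[OF H X])
  then show ?thesis by (rule bexI[rotated])
qed

lemma hilbert_hprod:
  assumes H: "hilbert_space H" and K: "hilbert_space K"
  shows "hilbert_space (hprod H K)"
proof -
  have "\<exists>l\<in>hcarrier H \<times> hcarrier K. (\<lambda>n. hnorm (hprod H K) (X n - l)) \<longlonglongrightarrow> 0"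
    if X: "\<And>n. X n \<in> hcarrier H \<times> hcarrier K"
      and C: "\<And>e. e > 0 \<Longrightarrow> \<exists>N::nat. \<forall>m\<ge>N. \<forall>n\<ge>N. hnorm (hprod H K) (X m - X n) < e" for X
  proof -
    have XH: "fst (X n) \<in> hcarrier H" and XK: "snd (X n) \<in> hcarrier K" for n using X[of n] by auto
    have nX: "hnorm (hprod H K) (X n - l) = sqrt ((hnorm H (fst (X n) - fst l))\<^sup>2 + (hnorm K (snd (X n) - snd l))\<^sup>2)"
      if "l \<in> hcarrier H \<times> hcarrier K" for n l
      using that XH[of n] XK[of n] H K by (subst hnorm_hprod) (auto simp: mem_Times_iff)
    have le: "hnorm H (fst (X m) - fst (X n)) \<le> hnorm (hprod H K) (X m - X n)"
      "hnorm K (snd (X m) - snd (X n)) \<le> hnorm (hprod H K) (X m - X n)" for m n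
      using real_sqrt_sum_squares_ge1 real_sqrt_sum_squares_ge2 by (auto simp: nX[OF X])
    obtain a where a: "a \<in> hcarrier H" "(\<lambda>n. hnorm H (fst (X n) - a)) \<longlonglongrightarrow> 0"
      using hcomplete_dominated[OF H XH le(1) C] by blast
    obtain b where b: "b \<in> hcarrier K" "(\<lambda>n. hnorm K (snd (X n) - b)) \<longlonglongrightarrow> 0"
      using hcomplete_dominated[OF K XK le(2) C] by blast
    have "(\<lambda>n. sqrt ((hnorm H (fst (X n) - a))\<^sup>2 + (hnorm K (snd (X n) - b))\<^sup>2)) \<longlonglongrightarrow> sqrt (0\<^sup>2 + 0\<^sup>2)"
      by (intro tendsto_intros a b)
    then have "(\<lambda>n. hnorm (hprod H K) (X n - (a, b))) \<longlonglongrightarrow> 0"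
      using a b by (simp add: nX)
    then show ?thesis using a b by blast
  qed
  moreover have "Re (hinner H (fst x) (fst x) + hinner K (snd x) (snd x)) > 0"
    if "x \<in> hcarrier H \<times> hcarrier K" "x \<noteq> 0" for x
  proof (cases "fst x = 0")
    case True
    then have "snd x \<noteq> 0" using that(2) by (simp add: prod_eq_iff)
    then show ?thesis using that True hinner_pos[OF K, of "snd x"] H by (auto simp: mem_Times_iff)
  next
    case False
    then show ?thesis using that hinner_pos[OF H, of "fst x"] Re_hinner_self_ge0[OF K, of "snd x"]
      by (auto simp: mem_Times_iff)
  qed
  moreover have "cvec.subspace (hcarrier H \<times> hcarrier K)"
    by (rule cvec.subspaceI) (auto simp: mem_Times_iff scaleC_prod_def H K)
  ultimately show ?thesis
    unfolding hilbert_space_def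
    by (auto simp: hinner_simps[OF H] hinner_simps[OF K] scaleC_prod_def hinner_cnj[OF H] hinner_cnj[OF K]
        distrib_left)
qed

text \<open>Equality of Gram matrices spreads by sesquilinearity from the pairs
  (\<open>\<phi> i\<close>, \<open>\<psi> i\<close>) to their span. That span is thus the graph of
  an isometry, and totality of \<open>\<phi>\<close> makes its domain dense.\<close>

lemma isometric_extension:
  assumes H: "hilbert_space H" and K: "hilbert_space K"
    and \<phi>: "\<And>i. i \<in> I \<Longrightarrow> \<phi> i \<in> hcarrier H" and \<psi>: "\<And>i. i \<in> I \<Longrightarrow> \<psi> i \<in> hcarrier K"
    and gram: "\<And>i j. i \<in> I \<Longrightarrow> j \<in> I \<Longrightarrow> hinner K (\<psi> i) (\<psi> j) = hinner H (\<phi> i) (\<phi> j)"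
    and total: "\<And>x. x \<in> hcarrier H \<Longrightarrow> (\<And>i. i \<in> I \<Longrightarrow> hinner H x (\<phi> i) = 0) \<Longrightarrow> x = 0"
  obtains U where "bounded_op H K U" "\<And>i. i \<in> I \<Longrightarrow> U (\<phi> i) = \<psi> i"
    "\<And>x. x \<in> hcarrier H \<Longrightarrow> hnorm K (U x) = hnorm H x"
proof -
  define P where "P = (\<lambda>i. (\<phi> i, \<psi> i)) ` I"
  define S where "S = cvec.span P"
  let ?E = "hcarrier H \<times> hcarrier K"
  have Sinn: "hinner K (snd p) (snd q) = hinner H (fst p) (fst q)" and SE: "p \<in> ?E"
    if "p \<in> S" "q \<in> S" for p q
  proof -
    \<comment> \<open>\<open>sub\<close> is for span induction in the second argument of the Gram
      identity, \<open>sub'\<close> for the first.\<close>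
    have sub: "cvec.subspace {q \<in> ?E. hinner K (snd p) (snd q) = hinner H (fst p) (fst q)}" if "p \<in> ?E" for p
      using that by (intro cvec.subspaceI)
        (auto simp: mem_Times_iff scaleC_prod_def H K hinner_simps[OF H] hinner_simps[OF K])
    have sub': "cvec.subspace {p \<in> ?E. hinner K (snd p) (snd q) = hinner H (fst p) (fst q)}" if "q \<in> ?E" for q
      using that by (intro cvec.subspaceI)
        (auto simp: mem_Times_iff scaleC_prod_def H K hinner_simps[OF H] hinner_simps[OF K])
    have PE: "P \<subseteq> ?E" using \<phi> \<psi> by (auto simp: P_def)
    have 1: "q \<in> {q \<in> ?E. hinner K (snd p) (snd q) = hinner H (fst p) (fst q)}" if "p \<in> P" for p
      using \<open>q \<in> S\<close> sub[of p] that PE gram unfolding S_def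
      by (elim cvec.span_induct[where P = "\<lambda>q. q \<in> {q \<in> ?E. hinner K (snd p) (snd q) = hinner H (fst p) (fst q)}"])
        (auto simp: P_def)
    have qE: "q \<in> ?E" if "q \<in> S" for q
      using cvec.span_minimal[OF PE] carrier_subspace[OF hilbert_hprod[OF H K]] that unfolding S_def by auto
    then have "p \<in> {p \<in> ?E. hinner K (snd p) (snd q) = hinner H (fst p) (fst q)}"
      using \<open>p \<in> S\<close> sub'[OF qE[OF \<open>q \<in> S\<close>]] 1 PE unfolding S_def
      by (elim cvec.span_induct[where P = "\<lambda>p. p \<in> {p \<in> ?E. hinner K (snd p) (snd q) = hinner H (fst p) (fst q)}"]) auto
    then show "hinner K (snd p) (snd q) = hinner H (fst p) (fst q)" "p \<in> ?E" by auto
  qed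
  have Ssub: "cvec.subspace S" unfolding S_def by (rule cvec.subspace_span)
  have nrm: "hnorm K v = hnorm H u" if "(u, v) \<in> S" for u v
    using Sinn[OF that that] by (simp add: hnorm_def)
  have fS: "cvec.subspace (fst ` S)"
  proof (rule cvec.subspaceI)
    show "0 \<in> fst ` S" using cvec.subspace_0[OF Ssub] by (metis fst_zero imageI)
    show "x + y \<in> fst ` S" if "x \<in> fst ` S" "y \<in> fst ` S" for x y
      using that cvec.subspace_add[OF Ssub] by (metis (no_types, lifting) fst_add imageE imageI)
    show "c *\<^sub>C x \<in> fst ` S" if "x \<in> fst ` S" for c x
    proof -
      obtain p where "p \<in> S" "x = fst p" using \<open>x \<in> fst ` S\<close> by blast
      then show ?thesis using cvec.subspace_scale[OF Ssub, of p c] by (force simp: scaleC_prod_def)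
    qed
  qed
  have fSH: "fst ` S \<subseteq> hcarrier H" using SE by force
  have \<phi>S: "\<phi> i \<in> fst ` S" if "i \<in> I" for i
  proof -
    have "(\<phi> i, \<psi> i) \<in> S" using that unfolding S_def P_def by (intro cvec.span_base imageI)
    then show ?thesis by force
  qed
  have dense: "hclosure H (fst ` S) = hcarrier H"
    unfolding dense_iff[OF H fS fSH]
  proof (intro ballI impI)
    fix x assume x: "x \<in> hcarrier H" "\<forall>s\<in>fst ` S. hinner H x s = 0"
    show "x = 0" by (rule total[OF x(1)]) (rule x(2)[rule_format, OF \<phi>S])
  qed
  obtain U where U: "bounded_op H K U" "\<And>u v. (u, v) \<in> S \<Longrightarrow> U u = v"
    "\<And>x. x \<in> hcarrier H \<Longrightarrow> hnorm K (U x) \<le> 1 * hnorm H x"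
  proof (rule graph_extension[OF H K, of S 1])
    show "S \<subseteq> ?E" using SE by blast
    show "(0, 0) \<in> S" using cvec.subspace_0[OF Ssub] by (simp add: zero_prod_def)
    show "(u + u', v + v') \<in> S" if "(u, v) \<in> S" "(u', v') \<in> S" for u v u' v'
      using cvec.subspace_add[OF Ssub that] by simp
    show "(c *\<^sub>C u, c *\<^sub>C v) \<in> S" if "(u, v) \<in> S" for c u v
      using cvec.subspace_scale[OF Ssub that, of c] by (simp add: scaleC_prod_def)
  qed (use nrm dense in auto)
  have iso: "hnorm K (U x) = hnorm H x" if x: "x \<in> hcarrier H" for x
  proof (rule order_antisym)
    show "hnorm K (U x) \<le> hnorm H x" using U(3)[OF x] by simp
    have "hnorm H x \<le> hnorm K (U x) + e" if e: "e > 0" for e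
    proof -
      have "x \<in> hclosure H (fst ` S)" "e / 2 > 0" using x dense e by auto
      then have "\<exists>s\<in>fst ` S. hnorm H (x - s) < e / 2" unfolding hclosure_def by blast
      then obtain u v where uv: "(u, v) \<in> S" "hnorm H (x - u) < e / 2" by auto
      have uH: "u \<in> hcarrier H" using SE[OF uv(1) uv(1)] by simp
      have "hnorm K (U x - U u) \<le> hnorm H (x - u)"
        using U(3)[of "x - u"] x uH H by (simp add: op_diff[OF U(1) H])
      moreover have "\<bar>hnorm K (U x) - hnorm K (U u)\<bar> \<le> hnorm K (U x - U u)"
        using x uH by (intro hnorm_triangle_rev[OF K] op_closed[OF U(1)])
      moreover have "\<bar>hnorm H x - hnorm H u\<bar> \<le> hnorm H (x - u)"
        using x uH by (intro hnorm_triangle_rev[OF H])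
      moreover have "hnorm K (U u) = hnorm H u" using nrm[OF uv(1)] U(2)[OF uv(1)] by simp
      ultimately show ?thesis using uv(2) by linarith
    qed
    then show "hnorm H x \<le> hnorm K (U x)" by (rule field_le_epsilon)
  qed
  have "U (\<phi> i) = \<psi> i" if "i \<in> I" for i
    by (rule U(2)) (use that in \<open>auto simp: S_def P_def intro: cvec.span_base\<close>)
  then show thesis using that U(1) iso by blast
qed

text \<open>For an isometry the residual of \<open>y\<close> after applying the adjoint and then
  \<open>U\<close> is orthogonal to the range, so totality of the range makes it vanish.\<close>

lemma isometry_range_closed:
  assumes H: "hilbert_space H" and K: "hilbert_space K" and U: "bounded_op H K U"
    and iso: "\<And>x. x \<in> hcarrier H \<Longrightarrow> hnorm K (U x) = hnorm H x"
    and total: "\<And>y. y \<in> hcarrier K \<Longrightarrow> (\<And>x. x \<in> hcarrier H \<Longrightarrow> hinner K y (U x) = 0) \<Longrightarrow> y = 0"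
  shows "onto_isometry H K U"
proof (rule onto_isometryI[OF U iso])
  fix y assume y: "y \<in> hcarrier K"
  let ?x = "hadj H K U y"
  have x: "?x \<in> hcarrier H" using y by (rule hadj_closed[OF H K U])
  have "y - U ?x = 0"
  proof (rule total)
    fix h assume h: "h \<in> hcarrier H"
    show "hinner K (y - U ?x) (U h) = 0"
      using h x y polarization[OF H K U iso x h] hadj_inner'[OF H K U y h]
      by (simp add: hinner_diff_left[OF K] op_closed[OF U])
  qed (use x y K op_closed[OF U x] in simp)
  then show "\<exists>x\<in>hcarrier H. U x = y" using x by (intro bexI[of _ ?x]) auto
qed

text \<open>Source of the two decisive unitaries: the one between the targets of two defect maps,
  and the one from \<open>H\<close> onto the de Branges-Rovnyak space.\<close>

lemma gram_unitary:
  assumes H: "hilbert_space H" and K: "hilbert_space K"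
    and \<phi>: "\<And>i. i \<in> I \<Longrightarrow> \<phi> i \<in> hcarrier H" and \<psi>: "\<And>i. i \<in> I \<Longrightarrow> \<psi> i \<in> hcarrier K"
    and gram: "\<And>i j. i \<in> I \<Longrightarrow> j \<in> I \<Longrightarrow> hinner K (\<psi> i) (\<psi> j) = hinner H (\<phi> i) (\<phi> j)"
    and total: "\<And>x. x \<in> hcarrier H \<Longrightarrow> (\<And>i. i \<in> I \<Longrightarrow> hinner H x (\<phi> i) = 0) \<Longrightarrow> x = 0"
    and total': "\<And>x. x \<in> hcarrier K \<Longrightarrow> (\<And>i. i \<in> I \<Longrightarrow> hinner K x (\<psi> i) = 0) \<Longrightarrow> x = 0"
  obtains U where "onto_isometry H K U" "\<And>i. i \<in> I \<Longrightarrow> U (\<phi> i) = \<psi> i"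
proof -
  obtain U where U: "bounded_op H K U" "\<And>i. i \<in> I \<Longrightarrow> U (\<phi> i) = \<psi> i"
    "\<And>x. x \<in> hcarrier H \<Longrightarrow> hnorm K (U x) = hnorm H x"
    by (rule isometric_extension[OF H K, where I = I and \<phi> = \<phi> and \<psi> = \<psi>])
      (use \<phi> \<psi> gram total in auto)
  have "onto_isometry H K U"
    by (rule isometry_range_closed[OF H K U(1,3)]) (use total' \<phi> U(2) in metis)+
  then show thesis using that U(2) by blast
qed

text \<open>Transport of structure along an injective linear map. Reproducing kernel spaces and
  sequence models are realized in this way.\<close>

definition himage :: "'a::complex_vector hspace \<Rightarrow> ('a \<Rightarrow> 'b::complex_vector) \<Rightarrow> 'b hspace" where
  "himage H \<Phi> = \<lparr>hcarrier = \<Phi> ` hcarrier H,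
     hinner = (\<lambda>f g. hinner H (inv_into (hcarrier H) \<Phi> f) (inv_into (hcarrier H) \<Phi> g))\<rparr>"

lemma himage_hilbert:
  assumes H: "hilbert_space H"
    and add: "\<And>x y. x \<in> hcarrier H \<Longrightarrow> y \<in> hcarrier H \<Longrightarrow> \<Phi> (x + y) = \<Phi> x + \<Phi> y"
    and scale: "\<And>c x. x \<in> hcarrier H \<Longrightarrow> \<Phi> (c *\<^sub>C x) = c *\<^sub>C \<Phi> x"
    and inj: "\<And>x. x \<in> hcarrier H \<Longrightarrow> \<Phi> x = 0 \<Longrightarrow> x = 0"
  shows "hilbert_space (himage H \<Phi>)" and "onto_isometry H (himage H \<Phi>) \<Phi>"
    and "hcarrier (himage H \<Phi>) = \<Phi> ` hcarrier H"
    and "\<And>x y. x \<in> hcarrier H \<Longrightarrow> y \<in> hcarrier H \<Longrightarrow> hinner (himage H \<Phi>) (\<Phi> x) (\<Phi> y) = hinner H x y"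
proof -
  have diff: "\<Phi> (x - y) = \<Phi> x - \<Phi> y" if "x \<in> hcarrier H" "y \<in> hcarrier H" for x y
    using add[of x "(-1) *\<^sub>C y"] scale[of y "-1"] that H by simp
  have \<Phi>0: "\<Phi> 0 = 0" using scale[of 0 0] H by simp
  have "inj_on \<Phi> (hcarrier H)"
  proof (rule inj_onI)
    fix x y assume "x \<in> hcarrier H" "y \<in> hcarrier H" "\<Phi> x = \<Phi> y"
    then show "x = y" using inj[of "x - y"] diff[of x y] H by simp
  qed
  then have inv: "inv_into (hcarrier H) \<Phi> (\<Phi> x) = x" if "x \<in> hcarrier H" for x
    using that by simp
  show car: "hcarrier (himage H \<Phi>) = \<Phi> ` hcarrier H" by (simp add: himage_def)
  show inn: "hinner (himage H \<Phi>) (\<Phi> x) (\<Phi> y) = hinner H x y" if "x \<in> hcarrier H" "y \<in> hcarrier H" for x y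
    using that by (simp add: himage_def inv)
  have nrm: "hnorm (himage H \<Phi>) (\<Phi> x) = hnorm H x" if "x \<in> hcarrier H" for x
    using that by (simp add: hnorm_def inn)
  show "hilbert_space (himage H \<Phi>)"
    unfolding hilbert_space_def car ball_simps
  proof (intro conjI ballI allI impI)
    show "cvec.subspace (\<Phi> ` hcarrier H)"
    proof (rule cvec.subspaceI)
      show "0 \<in> \<Phi> ` hcarrier H" using imageI[OF carrier_0[OF H], of \<Phi>] \<Phi>0 by simp
      show "x + y \<in> \<Phi> ` hcarrier H" if "x \<in> \<Phi> ` hcarrier H" "y \<in> \<Phi> ` hcarrier H" for x y
        using that H by (auto simp: add[symmetric])
      show "c *\<^sub>C x \<in> \<Phi> ` hcarrier H" if "x \<in> \<Phi> ` hcarrier H" for c x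
        using that H by (auto simp: scale[symmetric])
    qed
  next
    fix X :: "nat \<Rightarrow> 'b"
    assume *: "(\<forall>n. X n \<in> \<Phi> ` hcarrier H) \<and>
      (\<forall>e>0. \<exists>N. \<forall>m\<ge>N. \<forall>n\<ge>N. hnorm (himage H \<Phi>) (X m - X n) < e)"
    then have "\<forall>n. \<exists>y. y \<in> hcarrier H \<and> X n = \<Phi> y" by blast
    then obtain Y where Y: "\<And>n. Y n \<in> hcarrier H" "\<And>n. X n = \<Phi> (Y n)" by metis
    have d: "hnorm (himage H \<Phi>) (\<Phi> x - \<Phi> y) = hnorm H (x - y)" if "x \<in> hcarrier H" "y \<in> hcarrier H" for x y
      using that H by (simp add: diff[symmetric] nrm)
    obtain l where l: "l \<in> hcarrier H" "(\<lambda>n. hnorm H (Y n - l)) \<longlonglongrightarrow> 0"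
      using hcomplete[OF H, of Y] * Y(1) by (auto simp: Y(2) d)
    then show "\<exists>l\<in>\<Phi> ` hcarrier H. (\<lambda>n. hnorm (himage H \<Phi>) (X n - l)) \<longlonglongrightarrow> 0"
      using Y(1) by (auto simp: Y(2) d)
  qed (auto simp: add[symmetric] scale[symmetric] inn H hinner_simps[OF H] hinner_cnj[OF H] nrm \<Phi>0 intro!: hinner_pos[OF H])
  show "onto_isometry H (himage H \<Phi>) \<Phi>"
    by (rule onto_isometryI, rule bounded_opI[where M = 1]) (auto simp: car add scale nrm)
qed

section \<open>Columns and row operators\<close>

lemma scaleC_vec_nth [simp]: "(c *\<^sub>C x) $ j = c *\<^sub>C (x $ j)"
  by (simp add: scaleC_vec_def)

lemma hcarrier_hcol: "x \<in> hcarrier (hcol H) \<longleftrightarrow> (\<forall>j. x $ j \<in> hcarrier H)"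
  by (simp add: hcol_def)

lemma hinner_hcol: "hinner (hcol H) x y = (\<Sum>j\<in>UNIV. hinner H (x $ j) (y $ j))"
  by (simp add: hcol_def)

lemma hnorm_hcol:
  "hilbert_space H \<Longrightarrow> x \<in> hcarrier (hcol H) \<Longrightarrow> hnorm (hcol H) x = sqrt (\<Sum>j\<in>UNIV. (hnorm H (x $ j))\<^sup>2)"
  by (simp add: hnorm_def[of "hcol H"] hinner_hcol hnorm_sq hcarrier_hcol)

lemma hilbert_hcol:
  fixes H :: "'h::complex_vector hspace"
  assumes H: "hilbert_space H"
  shows "hilbert_space (hcol H :: ('h ^ 'd) hspace)"
proof -
  let ?C = "hcol H :: ('h ^ 'd) hspace"
  have "\<exists>l\<in>hcarrier ?C. (\<lambda>n. hnorm ?C (X n - l)) \<longlonglongrightarrow> 0"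
    if X: "\<And>n. X n \<in> hcarrier ?C"
      and C: "\<And>e. e > 0 \<Longrightarrow> \<exists>N::nat. \<forall>m\<ge>N. \<forall>n\<ge>N. hnorm ?C (X m - X n) < e" for X
  proof -
    have XH: "X n $ j \<in> hcarrier H" for n j using X by (simp add: hcarrier_hcol)
    have "\<exists>l\<in>hcarrier H. (\<lambda>n. hnorm H (X n $ j - l)) \<longlonglongrightarrow> 0" for j
    proof -
      have le: "hnorm H (X m $ j - X n $ j) \<le> hnorm ?C (X m - X n)" for m n
      proof -
        have "(hnorm H ((X m - X n) $ j))\<^sup>2 \<le> (\<Sum>j\<in>UNIV. (hnorm H ((X m - X n) $ j))\<^sup>2)"
          by (rule member_le_sum) auto
        moreover have "X m - X n \<in> hcarrier ?C" using XH H by (simp add: hcarrier_hcol)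
        ultimately show ?thesis by (simp add: hnorm_hcol H real_le_rsqrt)
      qed
      show ?thesis by (rule hcomplete_dominated[OF H XH le C])
    qed
    then obtain l where l: "\<And>j. l j \<in> hcarrier H" "\<And>j. (\<lambda>n. hnorm H (X n $ j - l j)) \<longlonglongrightarrow> 0" by metis
    let ?l = "(\<chi> j. l j) :: 'h ^ 'd"
    have lC: "?l \<in> hcarrier ?C" using l by (simp add: hcarrier_hcol)
    have "(\<lambda>n. sqrt (\<Sum>j\<in>UNIV. (hnorm H (X n $ j - l j))\<^sup>2)) \<longlonglongrightarrow> sqrt (\<Sum>j\<in>(UNIV::'d set). 0\<^sup>2)"
      by (intro tendsto_intros l)
    moreover have "hnorm ?C (X n - ?l) = sqrt (\<Sum>j\<in>UNIV. (hnorm H (X n $ j - l j))\<^sup>2)" for n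
      using XH l H by (subst hnorm_hcol) (simp_all add: hcarrier_hcol)
    ultimately show ?thesis by (intro bexI[OF _ lC]) simp
  qed
  moreover have "Re (\<Sum>j\<in>UNIV. hinner H (x $ j) (x $ j)) > 0" if "x \<in> hcarrier ?C" "x \<noteq> 0" for x
  proof -
    obtain j where "x $ j \<noteq> 0" using \<open>x \<noteq> 0\<close> by (auto simp: vec_eq_iff)
    then show ?thesis unfolding Re_sum
      using that(1) hinner_pos[OF H] Re_hinner_self_ge0[OF H]
      by (intro sum_pos2[of UNIV j]) (auto simp: hcarrier_hcol)
  qed
  moreover have "cvec.subspace (hcarrier ?C)"
    by (rule cvec.subspaceI) (auto simp: hcarrier_hcol H)
  ultimately show ?thesis
    unfolding hilbert_space_def
    by (auto simp: hinner_hcol hcarrier_hcol hinner_simps[OF H] hinner_cnj[OF H] sum.distrib sum_distrib_left)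
qed

lemma zstar_closed: "hilbert_space H \<Longrightarrow> h \<in> hcarrier H \<Longrightarrow> zstar z h \<in> hcarrier (hcol H)"
  by (simp add: zstar_def hcarrier_hcol)

lemma zrow_closed: "hilbert_space H \<Longrightarrow> x \<in> hcarrier (hcol H) \<Longrightarrow> zrow z x \<in> hcarrier H"
  by (simp add: zrow_def hcarrier_hcol)

lemma axis_closed: "hilbert_space H \<Longrightarrow> h \<in> hcarrier H \<Longrightarrow> axis j h \<in> hcarrier (hcol H)"
  by (simp add: axis_def hcarrier_hcol)

lemma zstar_zrow_inner:
  assumes H: "hilbert_space H" and h: "h \<in> hcarrier H" and x: "x \<in> hcarrier (hcol H)"
  shows "hinner (hcol H) (zstar z h) x = hinner H h (zrow z x)"
    and "hinner (hcol H) x (zstar z h) = hinner H (zrow z x) h"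
  using h x by (simp_all add: hinner_hcol zstar_def zrow_def hcarrier_hcol H hinner_simps[OF H]
      hinner_sum_left[OF H] hinner_sum_right[OF H])

text \<open>\<open>zstar\<close> conjugates its coefficients, which is why the point of the second
  vector comes first in \<open>zdot\<close>.\<close>

lemma zstar_inner:
  assumes H: "hilbert_space H" and "h \<in> hcarrier H" "k \<in> hcarrier H"
  shows "hinner (hcol H) (zstar w h) (zstar z k) = zdot z w * hinner H h k"
  using assms by (simp add: hinner_hcol zstar_def zdot_def H hinner_simps[OF H] sum_distrib_left mult_ac)

lemma zdot_self: "zdot z z = of_real ((norm z)\<^sup>2)"
  by (simp add: zdot_def norm_vec_def L2_set_def sum_nonneg complex_norm_square del: of_real_power)

lemma hnorm_zstar:
  assumes H: "hilbert_space H" and h: "h \<in> hcarrier H"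
  shows "hnorm (hcol H) (zstar z h) = norm z * hnorm H h"
proof (rule power2_eq_imp_eq)
  have "hinner (hcol H) (zstar z h) (zstar z h) = of_real ((norm z)\<^sup>2 * (hnorm H h)\<^sup>2)"
    using h by (simp add: zstar_inner[OF H] zdot_self hinner_self[OF H])
  then show "(hnorm (hcol H) (zstar z h))\<^sup>2 = (norm z * hnorm H h)\<^sup>2"
    using h by (simp add: hnorm_sq[OF hilbert_hcol[OF H]] zstar_closed[OF H] power_mult_distrib)
qed (use h H hnorm_ge0[OF hilbert_hcol[OF H] zstar_closed[OF H h]] in simp_all)

lemma zstar_add: "zstar z (x + y) = zstar z x + zstar z y"
  and zstar_scale: "zstar z (c *\<^sub>C x) = c *\<^sub>C zstar z x"
  by (simp_all add: vec_eq_iff zstar_def scaleC_add_right scaleC_scaleC mult.commute)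

lemma zrow_add: "zrow z (x + y) = zrow z x + zrow z y"
  and zrow_scale: "zrow z (c *\<^sub>C x) = c *\<^sub>C zrow z x"
  by (simp_all add: zrow_def scaleC_add_right scaleC_scaleC mult.commute sum.distrib cvec.scale_sum_right)

lemma bounded_op_zstar:
  assumes H: "hilbert_space H"
  shows "bounded_op H (hcol H) (zstar z)"
  by (rule bounded_opI[where M = "norm z"])
    (simp_all add: zstar_closed[OF H] hnorm_zstar[OF H] zstar_add zstar_scale)

lemma hadj_zstar:
  assumes H: "hilbert_space H" and x: "x \<in> hcarrier (hcol H)"
  shows "hadj H (hcol H) (zstar z) x = zrow z x"
  using x by (intro hadj_eqI[OF H hilbert_hcol[OF H] bounded_op_zstar[OF H]])
    (simp_all add: zrow_closed[OF H] zstar_zrow_inner[OF H])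

lemma hnorm_zrow:
  assumes H: "hilbert_space H" and x: "x \<in> hcarrier (hcol H)"
  shows "hnorm H (zrow z x) \<le> norm z * hnorm (hcol H) x"
  using hnorm_hadj_le[OF H hilbert_hcol[OF H] bounded_op_zstar[OF H] norm_ge_zero eq_refl[OF hnorm_zstar[OF H]] x]
  by (simp add: hadj_zstar[OF H x])

lemma bounded_op_zrow:
  assumes H: "hilbert_space H"
  shows "bounded_op (hcol H) H (zrow z)"
  by (rule bounded_opI[where M = "norm z"])
    (simp_all add: zrow_closed[OF H] hnorm_zrow[OF H] zrow_add zrow_scale)

text \<open>Cauchy-Schwarz for the coordinate vectors, obtained by regarding them as columns over
  the one-dimensional Hilbert space.\<close>

lemma one_minus_zdot: "z \<in> \<bool> \<Longrightarrow> w \<in> \<bool> \<Longrightarrow> 1 - zdot z w \<noteq> 0"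
proof
  assume zw: "z \<in> \<bool>" "w \<in> \<bool>" and eq: "1 - zdot z w = 0"
  have cv: "hilbert_space (\<lparr>hcarrier = UNIV, hinner = (\<lambda>x y. x * cnj y)\<rparr> :: complex hspace)" (is "hilbert_space ?C")
  proof -
    have n: "hnorm ?C x = cmod x" for x by (simp add: hnorm_def cmod_def power2_eq_square)
    have "\<exists>l. (\<lambda>n. cmod (X n - l)) \<longlonglongrightarrow> 0"
      if "\<forall>e>0. \<exists>N. \<forall>m\<ge>N. \<forall>n\<ge>N. cmod (X m - X n) < e" for X :: "nat \<Rightarrow> complex"
    proof -
      have "Cauchy X" using that by (simp add: Cauchy_iff)
      then show ?thesis using Cauchy_convergent[of X] by (auto simp: convergent_def tendsto_norm_zero_iff LIM_zero_iff)
    qed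
    moreover have "Re x * Re x + Im x * Im x > 0" if "x \<noteq> 0" for x
      using that by (metis complex_eq_iff sum_squares_gt_zero_iff zero_complex.simps)
    ultimately show ?thesis
      unfolding hilbert_space_def n by (auto simp: scaleC_complex_def algebra_simps)
  qed
  have "cmod (zdot z w) = cmod (hinner (hcol ?C) (zstar w 1) (zstar z 1))"
    by (subst zstar_inner[OF cv]) simp_all
  also have "\<dots> \<le> hnorm (hcol ?C) (zstar w 1) * hnorm (hcol ?C) (zstar z 1)"
    by (intro Cauchy_Schwarz hilbert_hcol zstar_closed cv) simp_all
  also have "\<dots> = norm w * norm z" by (simp add: hnorm_zstar[OF cv] hnorm_def[of ?C])
  also have "\<dots> < 1" using zw mult_strict_mono[of "norm w" 1 "norm z" 1] by (simp add: mult.commute) 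
  finally show False using eq by simp
qed

lemma row_op_expand:
  assumes H: "hilbert_space H" and T: "bounded_op (hcol H) K T" and x: "x \<in> hcarrier (hcol H)"
  shows "T x = (\<Sum>j\<in>UNIV. T (axis j (x $ j)))"
proof -
  have "x = (\<Sum>j\<in>UNIV. axis j (x $ j))"
    by (simp add: vec_eq_iff axis_def sum.delta)
  then have "T x = T (\<Sum>j\<in>UNIV. axis j (x $ j))" by simp
  also have "\<dots> = (\<Sum>j\<in>UNIV. T (axis j (x $ j)))"
    using x by (intro op_sum[OF T hilbert_hcol[OF H]] axis_closed[OF H]) (simp add: hcarrier_hcol)
  finally show ?thesis .
qed

section \<open>Resolvents of a row contraction at a point of the ball\<close>

context
  fixes H :: "'h::complex_vector hspace" and T :: "'h ^ 'd \<Rightarrow> 'h" and z :: "complex ^ 'd"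
  assumes H: "hilbert_space H" and T: "row_contraction H T" and z: "z \<in> \<bool>"
begin

private lemma row_bounded: "bounded_op (hcol H) H T" using T by (simp add: row_contraction_def contraction_def)

private lemma norm_less_1: "0 \<le> norm z" "norm z < 1" using z by simp_all

lemma row_zstar_op: "bounded_op H H (\<lambda>h. T (zstar z h))"
  by (intro bounded_op_comp[OF bounded_op_zstar row_bounded] H hilbert_hcol)

lemma row_zstar_norm: "h \<in> hcarrier H \<Longrightarrow> hnorm H (T (zstar z h)) \<le> norm z * hnorm H h"
  using T zstar_closed[OF H] hnorm_zstar[OF H] unfolding row_contraction_def contraction_def by metis

abbreviation (input) row_resolvent :: "'h \<Rightarrow> 'h" where
  "row_resolvent \<equiv> hinverse H (\<lambda>h. h - T (zstar z h))"

lemma row_resolvent_closed: "y \<in> hcarrier H \<Longrightarrow> row_resolvent y \<in> hcarrier H"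
  and row_resolvent_eq: "y \<in> hcarrier H \<Longrightarrow> row_resolvent y - T (zstar z (row_resolvent y)) = y"
  by (rule neumann_inverse[OF H row_zstar_op norm_less_1 row_zstar_norm]; assumption)+

lemma row_resolvent_eqI: "x \<in> hcarrier H \<Longrightarrow> x - T (zstar z x) = y \<Longrightarrow> row_resolvent y = x"
  by (rule neumann_inverse_eqI[OF H row_zstar_op norm_less_1 row_zstar_norm])

lemma row_resolvent_op: "bounded_op H H row_resolvent"
  by (rule bounded_op_neumann[OF H row_zstar_op norm_less_1 row_zstar_norm])

lemma zrow_hadj_op: "bounded_op H H (\<lambda>h. zrow z (hadj (hcol H) H T h))"
  by (intro bounded_op_comp[OF bounded_op_hadj bounded_op_zrow] H hilbert_hcol row_bounded)

lemma zrow_hadj_inner: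
  assumes "h \<in> hcarrier H" "k \<in> hcarrier H"
  shows "hinner H (T (zstar z h)) k = hinner H h (zrow z (hadj (hcol H) H T k))"
  using assms by (simp add: hadj_inner[OF hilbert_hcol[OF H] H row_bounded] zstar_closed[OF H]
      zstar_zrow_inner[OF H] hadj_closed[OF hilbert_hcol[OF H] H row_bounded])

lemma zrow_hadj_norm:
  assumes h: "h \<in> hcarrier H"
  shows "hnorm H (zrow z (hadj (hcol H) H T h)) \<le> norm z * hnorm H h"
proof -
  have "hnorm H (zrow z (hadj (hcol H) H T h)) \<le> norm z * hnorm (hcol H) (hadj (hcol H) H T h)"
    using h by (intro hnorm_zrow[OF H] hadj_closed[OF hilbert_hcol[OF H] H row_bounded])
  also have "\<dots> \<le> norm z * hnorm H h"
    using contraction_hadj[OF hilbert_hcol[OF H] H] T h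
    by (intro mult_left_mono) (auto simp: row_contraction_def contraction_def)
  finally show ?thesis .
qed

lemma zrow_hadj_solution: "y \<in> hcarrier H \<Longrightarrow> \<exists>x\<in>hcarrier H. x - zrow z (hadj (hcol H) H T x) = y"
  by (rule neumann_solution[OF H zrow_hadj_op norm_less_1 zrow_hadj_norm])

text \<open>The resolvent is cancelled by its adjoint factor on the left. Since every
  \<open>h\<close> has the form \<open>x - zrow z (hadj (hcol H) H T x)\<close>, pairings of
  \<open>h\<close> with resolvent vectors reduce to pairings of \<open>x\<close> with plain
  vectors.\<close>

lemma row_resolvent_inner:
  assumes x: "x \<in> hcarrier H" and y: "y \<in> hcarrier H"
  shows "hinner H (x - zrow z (hadj (hcol H) H T x)) (row_resolvent y) = hinner H x y"
proof -
  let ?r = "row_resolvent y"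
  have r: "?r \<in> hcarrier H" using y by (rule row_resolvent_closed)
  have Tr: "T (zstar z ?r) \<in> hcarrier H" by (rule op_closed[OF row_zstar_op r])
  have "hinner H x y = hinner H x (?r - T (zstar z ?r))" by (simp only: row_resolvent_eq[OF y])
  also have "\<dots> = hinner H x ?r - cnj (hinner H (T (zstar z ?r)) x)"
    using x r Tr by (simp add: hinner_simps[OF H] hinner_cnj[OF H])
  also have "\<dots> = hinner H x ?r - hinner H (zrow z (hadj (hcol H) H T x)) ?r"
    using x r op_closed[OF zrow_hadj_op x] by (simp add: zrow_hadj_inner hinner_cnj[OF H])
  finally show ?thesis
    using x r op_closed[OF zrow_hadj_op x] by (simp add: hinner_simps[OF H])
qed

end

section \<open>Reproducing kernel Hilbert spaces\<close>

definition kfun :: "(complex ^ 'd \<Rightarrow> complex ^ 'd \<Rightarrow> 'k \<Rightarrow> 'k::zero) \<Rightarrow> complex ^ 'd \<Rightarrow> 'k \<Rightarrow> complex ^ 'd \<Rightarrow> 'k" where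
  "kfun k w x = (\<lambda>z. if z \<in> \<bool> then k z w x else 0)"

context
  fixes K :: "'k::complex_vector hspace" and k :: "complex ^ 'd \<Rightarrow> complex ^ 'd \<Rightarrow> 'k \<Rightarrow> 'k" and R
  assumes K: "hilbert_space K" and R: "is_rkhs K k R"
begin

lemma rkhs_hilbert: "hilbert_space R"
  using R unfolding is_rkhs_def by blast

lemma rkhs_val: "f \<in> hcarrier R \<Longrightarrow> z \<in> \<bool> \<Longrightarrow> f z \<in> hcarrier K"
  and rkhs_off: "f \<in> hcarrier R \<Longrightarrow> z \<notin> \<bool> \<Longrightarrow> f z = 0"
  using R unfolding is_rkhs_def by blast+

lemma kfun_closed: "w \<in> \<bool> \<Longrightarrow> x \<in> hcarrier K \<Longrightarrow> kfun k w x \<in> hcarrier R"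
  and rkhs_reproduces: "w \<in> \<bool> \<Longrightarrow> x \<in> hcarrier K \<Longrightarrow> f \<in> hcarrier R \<Longrightarrow> hinner R f (kfun k w x) = hinner K (f w) x"
  using R unfolding is_rkhs_def kfun_def by blast+

lemma rkhs_eqI:
  assumes "f \<in> hcarrier R" "g \<in> hcarrier R" "\<And>z. z \<in> \<bool> \<Longrightarrow> f z = g z"
  shows "f = g"
proof
  fix z show "f z = g z"
    using assms rkhs_off[of f z] rkhs_off[of g z] by (cases "z \<in> \<bool>") simp_all
qed

lemma rkhs_total:
  assumes f: "f \<in> hcarrier R" and 0: "\<And>w x. w \<in> \<bool> \<Longrightarrow> x \<in> hcarrier K \<Longrightarrow> hinner R f (kfun k w x) = 0"
  shows "f = 0"
proof (rule rkhs_eqI[OF f carrier_0[OF rkhs_hilbert]])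
  fix z :: "complex ^ 'd" assume z: "z \<in> \<bool>"
  have "hinner K (f z) (f z) = 0"
    using 0[OF z rkhs_val[OF f z]] rkhs_reproduces[OF z rkhs_val[OF f z] f] by simp
  then show "f z = 0 z" using rkhs_val[OF f z] K by simp
qed

lemma kfun_inner:
  assumes "w \<in> \<bool>" "x \<in> hcarrier K" "z \<in> \<bool>" "y \<in> hcarrier K"
  shows "hinner R (kfun k w x) (kfun k z y) = hinner K (k z w x) y"
  using rkhs_reproduces[OF assms(3,4) kfun_closed[OF assms(1,2)]] assms(3) by (simp add: kfun_def)

context
  fixes w M
  assumes w: "w \<in> \<bool>" and M: "M \<ge> 0" "\<And>x. x \<in> hcarrier K \<Longrightarrow> hnorm K (k w w x) \<le> M * hnorm K x"
begin

text \<open>Pair \<open>f\<close> with the kernel function for the vector \<open>f w\<close>. The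
  square of its norm is \<open>hinner K (k w w (f w)) (f w)\<close>, so Cauchy-Schwarz leaves one
  factor \<open>hnorm K (f w)\<close> to cancel.\<close>

lemma rkhs_eval_op: "bounded_op R K (\<lambda>f. f w)"
proof (rule bounded_opI[where M = "sqrt M"])
  fix f assume f: "f \<in> hcarrier R"
  show fw: "f w \<in> hcarrier K" by (rule rkhs_val[OF f w])
  note kf = kfun_closed[OF w fw]
  have kw: "k w w (f w) \<in> hcarrier K" using rkhs_val[OF kf w] w by (simp add: kfun_def)
  have "(hnorm R (kfun k w (f w)))\<^sup>2 = Re (hinner K (k w w (f w)) (f w))"
    by (simp add: hnorm_sq[OF rkhs_hilbert kf] kfun_inner[OF w fw w fw])
  also have "\<dots> \<le> hnorm K (k w w (f w)) * hnorm K (f w)"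
    using Cauchy_Schwarz[OF K kw fw] complex_Re_le_cmod order_trans by blast
  also have "\<dots> \<le> M * hnorm K (f w) * hnorm K (f w)"
    using M(2)[OF fw] fw K by (intro mult_right_mono) auto
  also have "\<dots> = (sqrt M * hnorm K (f w))\<^sup>2"
    using M(1) by (simp add: power_mult_distrib power2_eq_square)
  finally have le: "hnorm R (kfun k w (f w)) \<le> sqrt M * hnorm K (f w)"
    by (rule power2_le_imp_le) (use M(1) fw K in simp)
  have "hnorm K (f w) * hnorm K (f w) = Re (hinner R f (kfun k w (f w)))"
    by (simp add: rkhs_reproduces[OF w fw f] hnorm_sq[OF K fw, symmetric] power2_eq_square)
  also have "\<dots> \<le> hnorm R f * hnorm R (kfun k w (f w))"
    using Cauchy_Schwarz[OF rkhs_hilbert f kf] complex_Re_le_cmod order_trans by blast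
  also have "\<dots> \<le> hnorm R f * (sqrt M * hnorm K (f w))"
    using le f rkhs_hilbert by (intro mult_left_mono) auto
  finally have *: "hnorm K (f w) * hnorm K (f w) \<le> (sqrt M * hnorm R f) * hnorm K (f w)"
    by (simp add: mult_ac)
  show "hnorm K (f w) \<le> sqrt M * hnorm R f"
  proof (cases "f w = 0")
    case True
    then show ?thesis using M(1) f rkhs_hilbert K by simp
  next
    case False
    then show ?thesis using * hnorm_pos[OF K fw] by simp
  qed
qed (simp_all add: scaleC_fun_def)

lemma rkhs_hadj_eval:
  assumes x: "x \<in> hcarrier K"
  shows "hadj R K (\<lambda>f. f w) x = kfun k w x"
  by (rule hadj_eqI[OF rkhs_hilbert K rkhs_eval_op x kfun_closed[OF w x]])
    (rule rkhs_reproduces[OF w x, symmetric])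

end

end

text \<open>A factorization of the kernel as \<open>G z\<close> times the adjoint of
  \<open>G w\<close> realizes the space as the functions \<open>z \<mapsto> G z h\<close>. This also
  justifies the choice made in \<open>rkhs\<close>.\<close>

lemma rkhs_exists:
  fixes k :: "complex ^ 'd \<Rightarrow> complex ^ 'd \<Rightarrow> 'k::complex_vector \<Rightarrow> 'k"
  assumes E: "hilbert_space E" and K: "hilbert_space K"
    and G: "\<And>z. z \<in> \<bool> \<Longrightarrow> bounded_op E K (G z)"
    and k: "\<And>z w x. z \<in> \<bool> \<Longrightarrow> w \<in> \<bool> \<Longrightarrow> x \<in> hcarrier K \<Longrightarrow> k z w x = G z (hadj E K (G w) x)"
  shows "is_rkhs K k (rkhs K k)"
proof -
  define N where "N = {h \<in> hcarrier E. \<forall>z\<in>\<bool>. G z h = 0}"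
  have NE: "N \<subseteq> hcarrier E" by (auto simp: N_def)
  \<comment> \<open>The complement stands for the quotient by the common kernel \<open>N\<close>; on
    it \<open>h\<close> is determined by its function.\<close>
  define M where "M = horth E N"
  define E' where "E' = hsub E M"
  have E': "hilbert_space E'" unfolding E'_def M_def by (rule hilbert_horth[OF E NE])
  have cE': "hcarrier E' = M" and iE': "hinner E' = hinner E" by (simp_all add: E'_def)
  have ME: "x \<in> hcarrier E" if "x \<in> M" for x using that by (simp add: M_def horth_def)
  define \<Phi> where "\<Phi> h = (\<lambda>z. if z \<in> \<bool> then G z h else 0)" for h
  have "\<Phi> (x + y) = \<Phi> x + \<Phi> y" if "x \<in> hcarrier E'" "y \<in> hcarrier E'" for x y
    using that by (auto simp: \<Phi>_def cE' fun_eq_iff op_add[OF G] ME)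
  moreover have "\<Phi> (c *\<^sub>C x) = c *\<^sub>C \<Phi> x" if "x \<in> hcarrier E'" for c x
    using that by (auto simp: \<Phi>_def cE' fun_eq_iff op_scale[OF G] ME scaleC_fun_def)
  moreover have "x = 0" if x: "x \<in> hcarrier E'" "\<Phi> x = 0" for x
  proof -
    have xM: "x \<in> M" "x \<in> hcarrier E" using x ME by (simp_all add: cE')
    have "G z x = 0" if "z \<in> \<bool>" for z
      using fun_cong[OF x(2), of z] that by (simp add: \<Phi>_def)
    then have "x \<in> N" using xM by (simp add: N_def)
    then have "hinner E x x = 0" using xM by (simp add: M_def horth_def)
    then show ?thesis using xM E by simp
  qed
  ultimately have im: "hilbert_space (himage E' \<Phi>)" "hcarrier (himage E' \<Phi>) = \<Phi> ` M"
    "\<And>x y. x \<in> M \<Longrightarrow> y \<in> M \<Longrightarrow> hinner (himage E' \<Phi>) (\<Phi> x) (\<Phi> y) = hinner E x y"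
    using himage_hilbert[OF E', of \<Phi>] by (auto simp: cE' iE')
  have adj: "hadj E K (G w) x \<in> M" if w: "w \<in> \<bool>" and x: "x \<in> hcarrier K" for w x
  proof -
    have "hinner E (hadj E K (G w) x) h = 0" if h: "h \<in> N" for h
      using hadj_inner'[OF E K G[OF w] x, of h] h w x K by (simp add: N_def)
    then show ?thesis using hadj_closed[OF E K G[OF w] x] by (simp add: M_def horth_def)
  qed
  have ker: "(\<lambda>z. if z \<in> \<bool> then k z w x else 0) = \<Phi> (hadj E K (G w) x)"
    if "w \<in> \<bool>" "x \<in> hcarrier K" for w x
    using that by (auto simp: \<Phi>_def fun_eq_iff k)
  have "is_rkhs K k (himage E' \<Phi>)"
    unfolding is_rkhs_def im(2)
  proof (intro conjI ballI im(1))
    fix f and z :: "complex ^ 'd" assume "f \<in> \<Phi> ` M" "z \<in> \<bool>"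
    then show "f z \<in> hcarrier K" using ME op_closed[OF G] by (auto simp: \<Phi>_def)
  next
    fix f assume "f \<in> \<Phi> ` M"
    then show "\<forall>z. z \<notin> \<bool> \<longrightarrow> f z = 0" by (auto simp: \<Phi>_def)
  next
    fix w :: "complex ^ 'd" and x assume wx: "w \<in> \<bool>" "x \<in> hcarrier K"
    show "(\<lambda>z. if z \<in> \<bool> then k z w x else 0) \<in> \<Phi> ` M"
      unfolding ker[OF wx] by (rule imageI[OF adj[OF wx]])
    fix f assume "f \<in> \<Phi> ` M"
    then obtain h where h: "h \<in> M" "f = \<Phi> h" by blast
    show "hinner (himage E' \<Phi>) f (\<lambda>z. if z \<in> \<bool> then k z w x else 0) = hinner K (f w) x"
      unfolding ker[OF wx] h(2) im(3)[OF h(1) adj[OF wx]]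
      using wx hadj_inner[OF E K G[OF wx(1)] wx(2) ME[OF h(1)]] by (simp add: \<Phi>_def)
  qed
  then show ?thesis unfolding rkhs_def by (rule someI)
qed

section \<open>Square-summable families\<close>

text \<open>Unordered sums over an arbitrary index type, so the set of words can serve as index
  without an enumeration.\<close>

definition hl2 :: "'k::complex_vector hspace \<Rightarrow> ('i \<Rightarrow> 'k) hspace" where
  "hl2 K = \<lparr>hcarrier = {f. (\<forall>i. f i \<in> hcarrier K) \<and> (\<lambda>i. (hnorm K (f i))\<^sup>2) summable_on UNIV},
     hinner = (\<lambda>f g. \<Sum>\<^sub>\<infinity>i. hinner K (f i) (g i))\<rparr>"

context
  fixes K :: "'k::complex_vector hspace"
  assumes K: "hilbert_space K"
begin

lemma hcarrier_hl2:
  "f \<in> hcarrier (hl2 K) \<longleftrightarrow> (\<forall>i. f i \<in> hcarrier K) \<and> (\<lambda>i. (hnorm K (f i))\<^sup>2) summable_on UNIV"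
  by (simp add: hl2_def)

lemma hl2_summable:
  assumes "f \<in> hcarrier (hl2 K)" "g \<in> hcarrier (hl2 K)"
  shows "(\<lambda>i. hinner K (f i) (g i)) summable_on UNIV"
proof (rule abs_summable_summable, rule Infinite_Sum.abs_summable_on_comparison_test')
  show "(\<lambda>i. (hnorm K (f i))\<^sup>2 + (hnorm K (g i))\<^sup>2) summable_on UNIV"
    using assms by (intro summable_on_add) (simp_all add: hcarrier_hl2)
  fix i
  have "cmod (hinner K (f i) (g i)) \<le> hnorm K (f i) * hnorm K (g i)"
    using assms by (intro Cauchy_Schwarz K) (simp_all add: hcarrier_hl2)
  also have "\<dots> \<le> 2 * (hnorm K (f i) * hnorm K (g i))"
    using assms K by (simp add: hcarrier_hl2)
  also have "\<dots> \<le> (hnorm K (f i))\<^sup>2 + (hnorm K (g i))\<^sup>2"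
    using sum_squares_bound[of "hnorm K (f i)" "hnorm K (g i)"] by simp
  finally show "norm (hinner K (f i) (g i)) \<le> (hnorm K (f i))\<^sup>2 + (hnorm K (g i))\<^sup>2" .
qed

lemma hinner_hl2:
  assumes "f \<in> hcarrier (hl2 K)" "g \<in> hcarrier (hl2 K)"
  shows "((\<lambda>i. hinner K (f i) (g i)) has_sum hinner (hl2 K) f g) UNIV"
  using has_sum_infsum[OF hl2_summable[OF assms]] by (simp add: hl2_def)

lemma hnorm_hl2:
  assumes f: "f \<in> hcarrier (hl2 K)"
  shows "((\<lambda>i. (hnorm K (f i))\<^sup>2) has_sum Re (hinner (hl2 K) f f)) UNIV"
  using has_sum_Re[OF hinner_hl2[OF f f]] f by (simp add: hnorm_sq[OF K] hcarrier_hl2)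

lemma hl2_add:
  assumes f: "f \<in> hcarrier (hl2 K)" and g: "g \<in> hcarrier (hl2 K)"
  shows "f + g \<in> hcarrier (hl2 K)"
proof -
  have "(\<lambda>i. (hnorm K (f i + g i))\<^sup>2) summable_on UNIV"
  proof (rule summable_on_comparison_test)
    show "(\<lambda>i. 2 * (hnorm K (f i))\<^sup>2 + 2 * (hnorm K (g i))\<^sup>2) summable_on UNIV"
      using f g by (intro summable_on_add summable_on_cmult_right) (simp_all add: hcarrier_hl2)
    fix i
    have fg: "f i \<in> hcarrier K" "g i \<in> hcarrier K" using f g by (simp_all add: hcarrier_hl2)
    have "(hnorm K (f i + g i))\<^sup>2 + (hnorm K (f i - g i))\<^sup>2 = 2 * (hnorm K (f i))\<^sup>2 + 2 * (hnorm K (g i))\<^sup>2"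
      by (simp add: hnorm_add_sq[OF K fg] hnorm_diff_sq[OF K fg])
    moreover have "(hnorm K (f i - g i))\<^sup>2 \<ge> 0" by simp
    ultimately show "(hnorm K (f i + g i))\<^sup>2 \<le> 2 * (hnorm K (f i))\<^sup>2 + 2 * (hnorm K (g i))\<^sup>2"
      by linarith
  qed simp
  then show ?thesis using f g K by (simp add: hcarrier_hl2)
qed

lemma hl2_scale:
  assumes f: "f \<in> hcarrier (hl2 K)"
  shows "c *\<^sub>C f \<in> hcarrier (hl2 K)"
proof -
  have fi: "f i \<in> hcarrier K" for i using f by (simp add: hcarrier_hl2)
  have "(\<lambda>i. (cmod c)\<^sup>2 * (hnorm K (f i))\<^sup>2) summable_on UNIV"
    using f by (intro summable_on_cmult_right) (simp add: hcarrier_hl2)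
  moreover have "(cmod c)\<^sup>2 * (hnorm K (f i))\<^sup>2 = (hnorm K ((c *\<^sub>C f) i))\<^sup>2" for i
    by (simp add: scaleC_fun_def hnorm_scale[OF K fi] power_mult_distrib)
  ultimately show ?thesis using fi K by (simp add: hcarrier_hl2 scaleC_fun_def)
qed

lemma hl2_minus:
  "f \<in> hcarrier (hl2 K) \<Longrightarrow> g \<in> hcarrier (hl2 K) \<Longrightarrow> f - g \<in> hcarrier (hl2 K)"
  using hl2_add[of f "(-1) *\<^sub>C g"] hl2_scale[of g "-1"] by simp

lemma hl2_sum_le:
  assumes f: "f \<in> hcarrier (hl2 K)" and F: "finite F"
  shows "(\<Sum>i\<in>F. (hnorm K (f i))\<^sup>2) \<le> Re (hinner (hl2 K) f f)"
  by (rule finite_sum_le_has_sum[OF hnorm_hl2[OF f] F]) auto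

lemma hilbert_hl2: "hilbert_space (hl2 K :: ('i \<Rightarrow> 'k) hspace)"
proof -
  let ?E = "hl2 K :: ('i \<Rightarrow> 'k) hspace"
  have Re_ge0: "Re (hinner ?E f f) \<ge> 0" if "f \<in> hcarrier ?E" for f
    using has_sum_nonneg[OF hnorm_hl2[OF that]] by simp
  have nsq: "(hnorm ?E f)\<^sup>2 = Re (hinner ?E f f)" if "f \<in> hcarrier ?E" for f
    using Re_ge0[OF that] by (simp add: hnorm_def)
  have complete: "\<exists>l\<in>hcarrier ?E. (\<lambda>n. hnorm ?E (X n - l)) \<longlonglongrightarrow> 0"
    if X: "\<And>n. X n \<in> hcarrier ?E"
      and C: "\<And>e. e > 0 \<Longrightarrow> \<exists>N::nat. \<forall>m\<ge>N. \<forall>n\<ge>N. hnorm ?E (X m - X n) < e" for X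
  proof -
    have XK: "X n i \<in> hcarrier K" for n i using X[of n] by (simp add: hcarrier_hl2)
    have le: "hnorm K (X m i - X n i) \<le> hnorm ?E (X m - X n)" for m n i
    proof -
      have "(hnorm K ((X m - X n) i))\<^sup>2 \<le> Re (hinner ?E (X m - X n) (X m - X n))"
        using hl2_sum_le[OF hl2_minus[OF X X], of "{i}"] by simp
      then show ?thesis by (simp add: hnorm_def[of ?E] real_le_rsqrt)
    qed
    have "\<exists>l\<in>hcarrier K. (\<lambda>n. hnorm K (X n i - l)) \<longlonglongrightarrow> 0" for i
      by (rule hcomplete_dominated[OF K XK le C])
    then obtain l where l: "\<And>i. l i \<in> hcarrier K" "\<And>i. (\<lambda>n. hnorm K (X n i - l i)) \<longlonglongrightarrow> 0" by metis
    \<comment> \<open>A Fatou-type step: the uniform Cauchy bound on finite partial sums survives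
      the coordinatewise limit in \<open>m\<close>.\<close>
    have fin: "(\<Sum>i\<in>F. (hnorm K (X n i - l i))\<^sup>2) \<le> e\<^sup>2"
      if N: "\<forall>m\<ge>N. \<forall>n\<ge>N. hnorm ?E (X m - X n) < e" and n: "n \<ge> N" and F: "finite F" for N e n F
    proof (rule LIMSEQ_le_const2)
      have "(\<lambda>m. hnorm K (X n i - X m i)) \<longlonglongrightarrow> hnorm K (X n i - l i)" for i
      proof (rule LIM_zero_cancel, rule Lim_null_comparison[OF always_eventually l(2)[of i]], rule allI)
        fix m
        show "norm (hnorm K (X n i - X m i) - hnorm K (X n i - l i)) \<le> hnorm K (X m i - l i)"
          using hnorm_triangle_rev[OF K, of "X n i - X m i" "X n i - l i"] XK l K
            hnorm_minus_commute[OF K XK[of m i] l(1)[of i]] by simp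
      qed
      then show "(\<lambda>m. \<Sum>i\<in>F. (hnorm K (X n i - X m i))\<^sup>2) \<longlonglongrightarrow> (\<Sum>i\<in>F. (hnorm K (X n i - l i))\<^sup>2)"
        by (intro tendsto_intros)
      have "(\<Sum>i\<in>F. (hnorm K (X n i - X m i))\<^sup>2) \<le> e\<^sup>2" if m: "m \<ge> N" for m
      proof -
        have "(\<Sum>i\<in>F. (hnorm K ((X n - X m) i))\<^sup>2) \<le> (hnorm ?E (X n - X m))\<^sup>2"
          using hl2_sum_le[OF hl2_minus[OF X X] F] by (simp add: nsq[OF hl2_minus[OF X X]])
        also have "\<dots> \<le> e\<^sup>2"
        proof (rule power_mono)
          show "hnorm ?E (X n - X m) \<le> e" using N n m by (simp add: less_imp_le)
          show "0 \<le> hnorm ?E (X n - X m)"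
            using Re_ge0[OF hl2_minus[OF X X]] by (simp add: hnorm_def)
        qed
        finally show ?thesis by simp
      qed
      then show "\<exists>N. \<forall>m\<ge>N. (\<Sum>i\<in>F. (hnorm K (X n i - X m i))\<^sup>2) \<le> e\<^sup>2" by blast
    qed
    have mem: "X n - l \<in> hcarrier ?E" and bnd: "hnorm ?E (X n - l) \<le> e"
      if N: "\<forall>m\<ge>N. \<forall>n\<ge>N. hnorm ?E (X m - X n) < e" and n: "n \<ge> N" and e: "e > 0" for N e n
    proof -
      have "(\<lambda>i. (hnorm K (X n i - l i))\<^sup>2) summable_on UNIV"
        by (rule nonneg_bdd_above_summable_on) (auto intro!: bdd_aboveI2 fin[OF N n])
      then show m: "X n - l \<in> hcarrier ?E" using XK l K by (simp add: hcarrier_hl2)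
      have "Re (hinner ?E (X n - l) (X n - l)) \<le> e\<^sup>2"
        by (rule has_sum_le_finite_sums[OF hnorm_hl2[OF m]]) (use fin[OF N n] in simp)
      then show "hnorm ?E (X n - l) \<le> e" using e by (simp add: hnorm_def real_le_lsqrt)
    qed
    obtain N1 where N1: "\<forall>m\<ge>N1. \<forall>n\<ge>N1. hnorm ?E (X m - X n) < 1" using C[of 1] by auto
    \<comment> \<open>\<open>l\<close> is a member of the sequence minus a square-summable
      error.\<close>
    have lE: "l \<in> hcarrier ?E"
      using hl2_minus[OF X mem[OF N1 order_refl zero_less_one], of N1] by simp
    have "(\<lambda>n. hnorm ?E (X n - l)) \<longlonglongrightarrow> 0"
    proof (rule LIMSEQ_I)
      fix r :: real assume r: "r > 0"
      then obtain N where N: "\<forall>m\<ge>N. \<forall>n\<ge>N. hnorm ?E (X m - X n) < r / 2" using C[of "r/2"] by auto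
      have "norm (hnorm ?E (X n - l) - 0) < r" if n: "n \<ge> N" for n
      proof -
        have "hnorm ?E (X n - l) \<le> r / 2" using bnd[OF N n] r by simp
        moreover have "hnorm ?E (X n - l) \<ge> 0"
          using Re_ge0[OF hl2_minus[OF X lE]] by (simp add: hnorm_def)
        ultimately show ?thesis using r by simp
      qed
      then show "\<exists>N. \<forall>n\<ge>N. norm (hnorm ?E (X n - l) - 0) < r" by blast
    qed
    then show ?thesis by (rule bexI[OF _ lE])
  qed
  have pos: "Re (hinner ?E f f) > 0" if f: "f \<in> hcarrier ?E" "f \<noteq> 0" for f
  proof -
    obtain i where "f i \<noteq> 0" using f(2) by (auto simp: fun_eq_iff)
    then have "(hnorm K (f i))\<^sup>2 > 0" using f(1) hnorm_pos[OF K, of "f i"] by (simp add: hcarrier_hl2)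
    moreover have "(hnorm K (f i))\<^sup>2 \<le> Re (hinner ?E f f)" using hl2_sum_le[OF f(1), of "{i}"] by simp
    ultimately show ?thesis by linarith
  qed
  have "cvec.subspace (hcarrier ?E)"
    by (rule cvec.subspaceI) (simp_all add: hl2_add hl2_scale, simp add: hcarrier_hl2 K)
  moreover have "hinner ?E (f + g) h = hinner ?E f h + hinner ?E g h"
    if "f \<in> hcarrier ?E" "g \<in> hcarrier ?E" "h \<in> hcarrier ?E" for f g h
  proof -
    have "(\<lambda>i. hinner K ((f + g) i) (h i)) = (\<lambda>i. hinner K (f i) (h i) + hinner K (g i) (h i))"
      using that by (simp add: hcarrier_hl2 hinner_add_left[OF K])
    then show ?thesis
      using has_sum_unique[OF hinner_hl2[OF hl2_add[OF that(1,2)] that(3)]]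
        has_sum_add[OF hinner_hl2[OF that(1,3)] hinner_hl2[OF that(2,3)]] by simp
  qed
  moreover have "hinner ?E (c *\<^sub>C f) g = c * hinner ?E f g"
    if "f \<in> hcarrier ?E" "g \<in> hcarrier ?E" for c f g
  proof -
    have "(\<lambda>i. hinner K ((c *\<^sub>C f) i) (g i)) = (\<lambda>i. c * hinner K (f i) (g i))"
      using that by (simp add: hcarrier_hl2 scaleC_fun_def hinner_scale_left[OF K])
    then show ?thesis
      using has_sum_unique[OF hinner_hl2[OF hl2_scale[OF that(1)] that(2)]]
        has_sum_cmult_right[OF hinner_hl2[OF that]] by simp
  qed
  moreover have "hinner ?E g f = cnj (hinner ?E f g)" if "f \<in> hcarrier ?E" "g \<in> hcarrier ?E" for f g
  proof -
    have "(\<lambda>i. cnj (hinner K (f i) (g i))) = (\<lambda>i. hinner K (g i) (f i))"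
      using that by (simp add: hcarrier_hl2 hinner_cnj[OF K])
    then have "((\<lambda>i. hinner K (g i) (f i)) has_sum cnj (hinner ?E f g)) UNIV"
      using has_sum_cnj_iff[THEN iffD2, OF hinner_hl2[OF that]] by simp
    then show ?thesis using has_sum_unique[OF hinner_hl2[OF that(2,1)]] by simp
  qed
  ultimately show ?thesis
    unfolding hilbert_space_def using pos complete by blast
qed

end

section \<open>The Drury-Arveson space\<close>

text \<open>The full Fock space: \<open>word_val u \<alpha>\<close> is the product of the coordinates of \<open>u\<close> along the word \<open>\<alpha>\<close>.
  Summing \<open>word_val z \<alpha> * cnj (word_val w \<alpha>)\<close> over all words gives the kernel \<open>1 / (1 - zdot z w)\<close>.\<close>

primrec word_val :: "complex ^ 'd \<Rightarrow> 'd list \<Rightarrow> complex" where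
  "word_val u [] = 1"
| "word_val u (j # \<alpha>) = u $ j * word_val u \<alpha>"

text \<open>Splitting off the first letter of a nonempty word gives S = 1 + (sum of the coordinates)
  S. Summability comes first, from geometric bounds.\<close>

lemma word_val_has_sum:
  fixes u :: "complex ^ 'd"
  assumes u: "(\<Sum>j\<in>UNIV. cmod (u $ j)) < 1"
  shows "(\<lambda>\<alpha>. cmod (word_val u \<alpha>)) summable_on UNIV"
    and "(word_val u has_sum (1 / (1 - (\<Sum>j\<in>UNIV. u $ j)))) UNIV"
proof -
  define r where "r = (\<Sum>j\<in>UNIV. cmod (u $ j))"
  have r: "0 \<le> r" "r < 1" using u by (simp_all add: r_def sum_nonneg)
  \<comment> \<open>Words of bounded length are finite in number and exhaust all words; the same
    splitting gives a uniform bound over them by induction.\<close>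
  define L where "L n = {\<alpha>::'d list. length \<alpha> \<le> n}" for n
  let ?c = "\<lambda>(j, \<alpha>). j # (\<alpha>::'d list)"
  have inj: "inj_on ?c A" for A by (auto simp: inj_on_def)
  have L0: "L 0 = {[]}" by (auto simp: L_def)
  have LS: "L (Suc n) = insert [] (?c ` (UNIV \<times> L n))" for n
  proof (intro set_eqI iffI)
    fix \<alpha> assume "\<alpha> \<in> L (Suc n)"
    then show "\<alpha> \<in> insert [] (?c ` (UNIV \<times> L n))" by (cases \<alpha>) (auto simp: L_def)
  qed (auto simp: L_def)
  have Lfin: "finite (L n)" for n by (induction n) (simp_all add: L0 LS)
  have Lbnd: "(\<Sum>\<alpha>\<in>L n. cmod (word_val u \<alpha>)) \<le> 1 / (1 - r)" for n
  proof (induction n)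
    case 0
    show ?case using r by (simp add: L0)
  next
    case (Suc n)
    have "(\<Sum>\<alpha>\<in>L (Suc n). cmod (word_val u \<alpha>)) = 1 + (\<Sum>\<alpha>\<in>?c ` (UNIV \<times> L n). cmod (word_val u \<alpha>))"
      unfolding LS by (subst sum.insert) (auto simp: Lfin)
    also have "(\<Sum>\<alpha>\<in>?c ` (UNIV \<times> L n). cmod (word_val u \<alpha>))
        = (\<Sum>(j, \<alpha>)\<in>UNIV \<times> L n. cmod (u $ j) * cmod (word_val u \<alpha>))"
      by (subst sum.reindex[OF inj]) (simp add: split_def norm_mult)
    also have "\<dots> = r * (\<Sum>\<alpha>\<in>L n. cmod (word_val u \<alpha>))"
      by (simp add: r_def sum_product sum.cartesian_product)
    also have "\<dots> \<le> r * (1 / (1 - r))" using Suc r by (intro mult_left_mono)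
    also have "1 + r * (1 / (1 - r)) = 1 / (1 - r)" using r by (simp add: field_simps)
    finally show ?case by simp
  qed
  show abs: "(\<lambda>\<alpha>. cmod (word_val u \<alpha>)) summable_on UNIV"
  proof (rule nonneg_bdd_above_summable_on)
    show "bdd_above (sum (\<lambda>\<alpha>. cmod (word_val u \<alpha>)) ` {F. F \<subseteq> UNIV \<and> finite F})"
    proof (rule bdd_aboveI2)
      fix F :: "'d list set" assume "F \<in> {F. F \<subseteq> UNIV \<and> finite F}"
      then have F: "finite F" by simp
      have "F \<subseteq> L (Max (length ` F))" using F by (auto simp: L_def)
      then have "(\<Sum>\<alpha>\<in>F. cmod (word_val u \<alpha>)) \<le> (\<Sum>\<alpha>\<in>L (Max (length ` F)). cmod (word_val u \<alpha>))"
        by (intro sum_mono2 Lfin) auto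
      then show "(\<Sum>\<alpha>\<in>F. cmod (word_val u \<alpha>)) \<le> 1 / (1 - r)" using Lbnd order_trans by blast
    qed
  qed simp
  define S where "S = infsum (word_val u) UNIV"
  have sm: "word_val u summable_on UNIV" by (rule abs_summable_summable[OF abs])
  have hs: "(word_val u has_sum S) UNIV" unfolding S_def by (rule has_sum_infsum[OF sm])
  have sub: "word_val u summable_on (?c ` (UNIV \<times> UNIV))"
    by (rule summable_on_subset_banach[OF sm]) simp
  then have sub': "(\<lambda>(j, \<alpha>). u $ j * word_val u \<alpha>) summable_on (UNIV \<times> UNIV)"
    by (subst (asm) summable_on_reindex[OF inj]) (simp add: o_def split_def)
  have univ: "UNIV = insert [] (?c ` (UNIV \<times> UNIV))"
  proof (intro set_eqI iffI)
    fix \<alpha> :: "'d list" show "\<alpha> \<in> insert [] (?c ` (UNIV \<times> UNIV))" by (cases \<alpha>) auto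
  qed simp
  \<comment> \<open>The sum over nonempty words, regrouped by first letter.\<close>
  have "((\<lambda>j. u $ j * S) has_sum (infsum (word_val u) (?c ` (UNIV \<times> UNIV)))) UNIV"
  proof (rule has_sum_Sigma'[where f = "\<lambda>(j, \<alpha>). u $ j * word_val u \<alpha>" and B = "\<lambda>_. UNIV"])
    have "infsum (word_val u) (?c ` (UNIV \<times> UNIV)) = infsum (\<lambda>(j, \<alpha>). u $ j * word_val u \<alpha>) (UNIV \<times> UNIV)"
      by (subst infsum_reindex[OF inj]) (simp add: o_def split_def)
    then show "((\<lambda>(j, \<alpha>). u $ j * word_val u \<alpha>) has_sum infsum (word_val u) (?c ` (UNIV \<times> UNIV))) (UNIV \<times> UNIV)"
      using has_sum_infsum[OF sub'] by simp
    show "((\<lambda>\<alpha>. case (j, \<alpha>) of (j, \<alpha>) \<Rightarrow> u $ j * word_val u \<alpha>) has_sum u $ j * S) UNIV" for j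
      using has_sum_cmult_right[OF hs] by simp
  qed
  moreover have "((\<lambda>j. u $ j * S) has_sum (\<Sum>j\<in>UNIV. u $ j * S)) UNIV" by (rule has_sum_finite) simp
  ultimately have inf: "infsum (word_val u) (?c ` (UNIV \<times> UNIV)) = (\<Sum>j\<in>UNIV. u $ j * S)"
    by (rule has_sum_unique)
  have "(word_val u has_sum (word_val u [] + infsum (word_val u) (?c ` (UNIV \<times> UNIV))))
      (insert [] (?c ` (UNIV \<times> UNIV)))"
    by (rule has_sum_insert[OF _ has_sum_infsum[OF sub]]) auto
  then have "(word_val u has_sum (word_val u [] + infsum (word_val u) (?c ` (UNIV \<times> UNIV)))) UNIV"
    unfolding univ[symmetric] .
  then have "S = word_val u [] + infsum (word_val u) (?c ` (UNIV \<times> UNIV))"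
    by (rule has_sum_unique[OF hs])
  also have "\<dots> = 1 + (\<Sum>j\<in>UNIV. u $ j) * S" unfolding inf by (simp add: sum_distrib_right)
  finally have fixed: "S = 1 + (\<Sum>j\<in>UNIV. u $ j) * S" .
  have "S * (1 - (\<Sum>j\<in>UNIV. u $ j)) = S - (\<Sum>j\<in>UNIV. u $ j) * S" by (simp add: right_diff_distrib mult.commute)
  also have "\<dots> = 1" unfolding diff_eq_eq by (rule fixed)
  finally have "S * (1 - (\<Sum>j\<in>UNIV. u $ j)) = 1" .
  moreover from this have "1 - (\<Sum>j\<in>UNIV. u $ j) \<noteq> 0" by auto
  ultimately have "S = 1 / (1 - (\<Sum>j\<in>UNIV. u $ j))" by (simp add: field_simps)
  then show "(word_val u has_sum (1 / (1 - (\<Sum>j\<in>UNIV. u $ j)))) UNIV" using hs by simp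
qed

text \<open>The coordinatewise product of \<open>z\<close> with the conjugate of \<open>w\<close>
  turns the kernel series into a single word series; Cauchy-Schwarz keeps the sum of the moduli
  below 1.\<close>

lemma word_val_kernel_has_sum:
  fixes z w :: "complex ^ 'd"
  assumes z: "z \<in> \<bool>" and w: "w \<in> \<bool>"
  shows "((\<lambda>\<alpha>. word_val z \<alpha> * cnj (word_val w \<alpha>)) has_sum (1 / (1 - zdot z w))) UNIV"
proof -
  define u :: "complex ^ 'd" where "u = (\<chi> j. z $ j * cnj (w $ j))"
  have wv: "word_val u \<alpha> = word_val z \<alpha> * cnj (word_val w \<alpha>)" for \<alpha>
    by (induction \<alpha>) (simp_all add: u_def)
  have "(\<Sum>j\<in>UNIV. cmod (u $ j)) = (\<Sum>j\<in>UNIV. \<bar>cmod (z $ j)\<bar> * \<bar>cmod (w $ j)\<bar>)"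
    by (simp add: u_def norm_mult)
  also have "\<dots> \<le> norm z * norm w"
    unfolding norm_vec_def by (rule L2_set_mult_ineq)
  also have "\<dots> < 1" using z w mult_strict_mono[of "norm z" 1 "norm w" 1] by simp
  finally have "(word_val u has_sum (1 / (1 - (\<Sum>j\<in>UNIV. u $ j)))) UNIV"
    by (rule word_val_has_sum(2))
  moreover have "word_val u = (\<lambda>\<alpha>. word_val z \<alpha> * cnj (word_val w \<alpha>))" using wv by blast
  moreover have "(\<Sum>j\<in>UNIV. u $ j) = zdot z w" by (simp add: u_def zdot_def)
  ultimately show ?thesis by simp
qed

text \<open>The geometric vectors \<open>v w x\<close> in the Fock space with coefficients in
  \<open>K\<close> have the required Gram form, so the adjoints of the maps \<open>v z\<close>
  factor the kernel. The passage to their closed span, the symmetric Fock space, is left to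
  \<open>rkhs_exists\<close>.\<close>

lemma drury_arveson_rkhs:
  fixes K :: "'k::complex_vector hspace"
  assumes K: "hilbert_space K"
  shows "is_rkhs K (\<lambda>z w x. (1 / (1 - zdot z w)) *\<^sub>C x) (drury_arveson K :: (complex ^ 'd \<Rightarrow> 'k) hspace)"
proof -
  let ?E = "hl2 K :: ('d list \<Rightarrow> 'k) hspace"
  note E = hilbert_hl2[OF K, where 'i = "'d list"]
  define v :: "complex ^ 'd \<Rightarrow> 'k \<Rightarrow> 'd list \<Rightarrow> 'k" where "v w x = (\<lambda>\<alpha>. cnj (word_val w \<alpha>) *\<^sub>C x)" for w x
  have vE: "v w x \<in> hcarrier ?E" if w: "w \<in> \<bool>" and x: "x \<in> hcarrier K" for w x
  proof -
    have "(\<lambda>\<alpha>. Re (word_val w \<alpha> * cnj (word_val w \<alpha>))) summable_on UNIV"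
      by (rule has_sum_imp_summable[OF has_sum_Re[OF word_val_kernel_has_sum[OF w w]]])
    then have "(\<lambda>\<alpha>. Re (word_val w \<alpha> * cnj (word_val w \<alpha>)) * (hnorm K x)\<^sup>2) summable_on UNIV"
      by (rule summable_on_cmult_left)
    moreover have "Re (word_val w \<alpha> * cnj (word_val w \<alpha>)) * (hnorm K x)\<^sup>2 = (hnorm K (v w x \<alpha>))\<^sup>2" for \<alpha>
      using x by (simp add: v_def hnorm_scale[OF K] power_mult_distrib complex_mult_cnj cmod_power2)
    ultimately show ?thesis using x K by (simp add: hcarrier_hl2[OF K] v_def)
  qed
  have vinn: "hinner ?E (v w x) (v z y) = (1 / (1 - zdot z w)) * hinner K x y"
    if "w \<in> \<bool>" "z \<in> \<bool>" "x \<in> hcarrier K" "y \<in> hcarrier K" for w z x y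
  proof (rule has_sum_unique)
    show "((\<lambda>\<alpha>. hinner K (v w x \<alpha>) (v z y \<alpha>)) has_sum hinner ?E (v w x) (v z y)) UNIV"
      using that by (intro hinner_hl2[OF K] vE)
    have "((\<lambda>\<alpha>. word_val z \<alpha> * cnj (word_val w \<alpha>) * hinner K x y) has_sum (1 / (1 - zdot z w)) * hinner K x y) UNIV"
      using that by (intro has_sum_cmult_left word_val_kernel_has_sum)
    moreover have "(\<lambda>\<alpha>. word_val z \<alpha> * cnj (word_val w \<alpha>) * hinner K x y) = (\<lambda>\<alpha>. hinner K (v w x \<alpha>) (v z y \<alpha>))"
      using that K by (simp add: v_def hinner_simps[OF K] mult_ac)
    ultimately show "((\<lambda>\<alpha>. hinner K (v w x \<alpha>) (v z y \<alpha>)) has_sum (1 / (1 - zdot z w)) * hinner K x y) UNIV"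
      by simp
  qed
  have vop: "bounded_op K ?E (v w)" if w: "w \<in> \<bool>" for w
  proof (rule bounded_opI[where M = "sqrt (cmod (1 / (1 - zdot w w)))"])
    fix x assume x: "x \<in> hcarrier K"
    show "v w x \<in> hcarrier ?E" by (rule vE[OF w x])
    have "(hnorm ?E (v w x))\<^sup>2 \<le> cmod (hinner ?E (v w x) (v w x))"
      by (simp add: hnorm_sq[OF E vE[OF w x]] complex_Re_le_cmod)
    also have "\<dots> = cmod (1 / (1 - zdot w w)) * (hnorm K x)\<^sup>2"
      by (simp add: vinn[OF w w x x] norm_mult norm_divide hinner_self[OF K x] del: of_real_power)
    also have "\<dots> = (sqrt (cmod (1 / (1 - zdot w w))) * hnorm K x)\<^sup>2"
      by (simp add: power_mult_distrib)
    finally show "hnorm ?E (v w x) \<le> sqrt (cmod (1 / (1 - zdot w w))) * hnorm K x"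
      by (rule power2_le_imp_le) (use x K in simp)
  qed (simp_all add: v_def fun_eq_iff scaleC_fun_def scaleC_add_right scaleC_scaleC mult.commute)
  show ?thesis
    unfolding drury_arveson_def
  proof (rule rkhs_exists[OF E K, where G = "\<lambda>z. hadj K ?E (v z)"])
    show op: "bounded_op ?E K (hadj K ?E (v z))" if "z \<in> \<bool>" for z
      by (rule bounded_op_hadj[OF K E vop[OF that]])
    fix z w :: "complex ^ 'd" and x assume zw: "z \<in> \<bool>" "w \<in> \<bool>" and x: "x \<in> hcarrier K"
    have "hadj K ?E (v z) (v w x) = (1 / (1 - zdot z w)) *\<^sub>C x"
    proof (rule hadj_eqI[OF K E vop[OF zw(1)] vE[OF zw(2) x]])
      show "(1 / (1 - zdot z w)) *\<^sub>C x \<in> hcarrier K" using x K by simp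
      fix h assume h: "h \<in> hcarrier K"
      have "hinner ?E (v z h) (v w x) = cnj (hinner ?E (v w x) (v z h))"
        using zw x h by (simp add: hinner_cnj[OF E] vE)
      also have "\<dots> = hinner K h ((1 / (1 - zdot z w)) *\<^sub>C x)"
        using zw x h K by (simp add: vinn hinner_simps[OF K] hinner_cnj[OF K])
      finally show "hinner ?E (v z h) (v w x) = hinner K h ((1 / (1 - zdot z w)) *\<^sub>C x)" .
    qed
    then show "(1 / (1 - zdot z w)) *\<^sub>C x = hadj K ?E (v z) (hadj ?E K (hadj K ?E (v w)) x)"
      by (simp add: hadj_hadj[OF K E vop[OF zw(2)] x])
  qed
qed

section \<open>Schur multipliers and de Branges-Rovnyak spaces\<close>

abbreviation (input) szego :: "complex ^ 'd \<Rightarrow> complex ^ 'd \<Rightarrow> 'k::complex_vector \<Rightarrow> 'k" where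
  "szego \<equiv> \<lambda>z w x. (1 / (1 - zdot z w)) *\<^sub>C x"

context
  fixes K :: "'k::complex_vector hspace"
  assumes K: "hilbert_space K"
begin

lemmas da_hilbert = rkhs_hilbert[OF K drury_arveson_rkhs[OF K]]
lemmas da_val = rkhs_val[OF K drury_arveson_rkhs[OF K]]
lemmas da_off = rkhs_off[OF K drury_arveson_rkhs[OF K]]
lemmas da_kfun_closed = kfun_closed[OF K drury_arveson_rkhs[OF K]]
lemmas da_reproduces = rkhs_reproduces[OF K drury_arveson_rkhs[OF K]]
lemmas da_total = rkhs_total[OF K drury_arveson_rkhs[OF K]]
lemmas da_kfun_inner = kfun_inner[OF K drury_arveson_rkhs[OF K]]

lemma da_eval_op: "w \<in> \<bool> \<Longrightarrow> bounded_op (drury_arveson K) K (\<lambda>f. f w)"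
  by (rule rkhs_eval_op[OF K drury_arveson_rkhs[OF K] _ norm_ge_zero eq_refl[OF hnorm_scale[OF K]]])

end

context
  fixes J :: "'j::complex_vector hspace" and K :: "'k::complex_vector hspace"
    and b :: "complex ^ 'd \<Rightarrow> 'j \<Rightarrow> 'k"
  assumes J: "hilbert_space J" and K: "hilbert_space K"
begin

text \<open>With \<open>M\<close> the multiplication by \<open>b\<close>, the kernel is evaluation
  at \<open>z\<close> times I - M M^* times the adjoint of evaluation at \<open>w\<close>. Splitting
  the middle factor as the square of \<open>?D\<close> gives the factorization.\<close>

lemma dbr_space_rkhs:
  assumes b: "schur_class J K b"
  shows "is_rkhs K (dbr_kernel J K b) (dbr_space J K b)"
proof -
  let ?EJ = "drury_arveson J :: (complex ^ 'd \<Rightarrow> 'j) hspace"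
  let ?EK = "drury_arveson K :: (complex ^ 'd \<Rightarrow> 'k) hspace"
  define M where "M = (\<lambda>f z. if z \<in> \<bool> then b z (f z) else 0)"
  have bop: "bounded_op J K (b z)" if "z \<in> \<bool>" for z using b that by (simp add: schur_class_def)
  have M: "contraction ?EJ ?EK M" using b by (simp add: schur_class_def M_def)
  then have Mop: "bounded_op ?EJ ?EK M" by (simp add: contraction_def)
  note EJ = da_hilbert[OF J, where 'd = 'd] and EK = da_hilbert[OF K, where 'd = 'd]
  let ?D = "defect_adj ?EJ ?EK M"
  note Dop = defect_adj_op[OF EJ EK M]
  \<comment> \<open>The eigenvector relation of multipliers: the adjoint of \<open>M\<close> acts on
    a kernel function by applying the adjoint of \<open>b w\<close> to its vector.\<close>
  have Mk: "hadj ?EJ ?EK M (kfun szego w x) = kfun szego w (hadj J K (b w) x)"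
    if w: "w \<in> \<bool>" and x: "x \<in> hcarrier K" for w x
  proof (rule hadj_eqI[OF EJ EK Mop])
    have bx: "hadj J K (b w) x \<in> hcarrier J" by (rule hadj_closed[OF J K bop[OF w] x])
    show "kfun szego w x \<in> hcarrier ?EK" by (rule da_kfun_closed[OF K w x])
    show "kfun szego w (hadj J K (b w) x) \<in> hcarrier ?EJ" by (rule da_kfun_closed[OF J w bx])
    fix f assume f: "f \<in> hcarrier ?EJ"
    have "hinner ?EK (M f) (kfun szego w x) = hinner K (b w (f w)) x"
      using w by (simp add: da_reproduces[OF K w x op_closed[OF Mop f]]) (simp add: M_def)
    also have "\<dots> = hinner J (f w) (hadj J K (b w) x)"
      by (rule hadj_inner[OF J K bop[OF w] x da_val[OF J f w]])
    also have "\<dots> = hinner ?EJ f (kfun szego w (hadj J K (b w) x))"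
      by (rule da_reproduces[OF J w bx f, symmetric])
    finally show "hinner ?EK (M f) (kfun szego w x) = hinner ?EJ f (kfun szego w (hadj J K (b w) x))" .
  qed
  have Gop: "bounded_op ?EK K (\<lambda>f. ?D f z)" if "z \<in> \<bool>" for z
    by (rule bounded_op_comp[OF Dop da_eval_op[OF K that] EK EK])
  have Gadj: "hadj ?EK K (\<lambda>f. ?D f w) x = ?D (kfun szego w x)" if w: "w \<in> \<bool>" and x: "x \<in> hcarrier K" for w x
  proof (rule hadj_eqI[OF EK K Gop[OF w] x])
    note kf = da_kfun_closed[OF K w x]
    show "?D (kfun szego w x) \<in> hcarrier ?EK" by (rule op_closed[OF Dop kf])
    fix f assume f: "f \<in> hcarrier ?EK"
    show "hinner K (?D f w) x = hinner ?EK f (?D (kfun szego w x))"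
      using da_reproduces[OF K w x op_closed[OF Dop f]] defect_adj_selfadjoint[OF EJ EK M f kf] by simp
  qed
  show ?thesis
    unfolding dbr_space_def
  proof (rule rkhs_exists[OF EK K Gop])
    fix z w :: "complex ^ 'd" and x assume z: "z \<in> \<bool>" and w: "w \<in> \<bool>" and x: "x \<in> hcarrier K"
    have bx: "hadj J K (b w) x \<in> hcarrier J" by (rule hadj_closed[OF J K bop[OF w] x])
    have "?D (hadj ?EK K (\<lambda>f. ?D f w) x) z = (kfun szego w x - M (kfun szego w (hadj J K (b w) x))) z"
      by (simp only: Gadj[OF w x] defect_adj_sq[OF EJ EK M da_kfun_closed[OF K w x]] Mk[OF w x])
    also have "\<dots> = dbr_kernel J K b z w x"
      using z bx by (simp add: M_def kfun_def dbr_kernel_def op_scale[OF bop[OF z]] scaleC_diff_right)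
    finally show "dbr_kernel J K b z w x = ?D (hadj ?EK K (\<lambda>f. ?D f w) x) z" by simp
  qed
qed

text \<open>A lurking isometry. Divided by \<open>1 - zdot z w\<close>, the hypothesis says that the
  kernel functions and the pairs in \<open>\<psi>\<close> have the same Gram matrix. The first
  component of the resulting isometry is a contraction whose adjoint is multiplication by
  \<open>b\<close>.\<close>

lemma schur_classI:
  assumes L: "hilbert_space L" and bop: "\<And>z. z \<in> \<bool> \<Longrightarrow> bounded_op J K (b z)"
    and g: "\<And>z x. z \<in> \<bool> \<Longrightarrow> x \<in> hcarrier K \<Longrightarrow> g z x \<in> hcarrier L"
    and ker: "\<And>z w x y. z \<in> \<bool> \<Longrightarrow> w \<in> \<bool> \<Longrightarrow> x \<in> hcarrier K \<Longrightarrow> y \<in> hcarrier K \<Longrightarrow>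
      hinner K x y - hinner J (hadj J K (b w) x) (hadj J K (b z) y) = (1 - zdot z w) * hinner L (g w x) (g z y)"
  shows "schur_class J K b"
proof -
  let ?EJ = "drury_arveson J :: (complex ^ 'd \<Rightarrow> 'j) hspace"
  let ?EK = "drury_arveson K :: (complex ^ 'd \<Rightarrow> 'k) hspace"
  define M where "M = (\<lambda>f z. if z \<in> \<bool> then b z (f z) else 0)"
  note EJ = da_hilbert[OF J, where 'd = 'd] and EK = da_hilbert[OF K, where 'd = 'd]
  let ?P = "hprod ?EJ L"
  note P = hilbert_hprod[OF EJ L]
  have adj: "hadj J K (b w) x \<in> hcarrier J" if "w \<in> \<bool>" "x \<in> hcarrier K" for w x
    by (rule hadj_closed[OF J K bop[OF that(1)] that(2)])
  define I where "I = (\<bool> :: (complex ^ 'd) set) \<times> hcarrier K"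
  define \<phi> where "\<phi> = (\<lambda>(w :: complex ^ 'd, x :: 'k). kfun szego w x)"
  define \<psi> where "\<psi> = (\<lambda>(w :: complex ^ 'd, x :: 'k). (kfun szego w (hadj J K (b w) x), g w x))"
  obtain U where U: "bounded_op ?EK ?P U" "\<And>i. i \<in> I \<Longrightarrow> U (\<phi> i) = \<psi> i"
    "\<And>f. f \<in> hcarrier ?EK \<Longrightarrow> hnorm ?P (U f) = hnorm ?EK f"
  proof (rule isometric_extension[OF EK P, of I \<phi> \<psi>])
    show "\<phi> i \<in> hcarrier ?EK" if "i \<in> I" for i
      using that by (auto simp: I_def \<phi>_def intro: da_kfun_closed[OF K])
    show "\<psi> i \<in> hcarrier ?P" if "i \<in> I" for i
      using that g adj by (auto simp: I_def \<psi>_def intro: da_kfun_closed[OF J])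
    show "hinner ?P (\<psi> i) (\<psi> j) = hinner ?EK (\<phi> i) (\<phi> j)" if ij: "i \<in> I" "j \<in> I" for i j
    proof -
      obtain w x z y where i: "i = (w, x)" "w \<in> \<bool>" "x \<in> hcarrier K"
        and j: "j = (z, y)" "z \<in> \<bool>" "y \<in> hcarrier K" using ij by (auto simp: I_def)
      have ne: "1 - zdot z w \<noteq> 0" by (rule one_minus_zdot[OF j(2) i(2)])
      have "hinner ?P (\<psi> i) (\<psi> j) =
          (1 / (1 - zdot z w)) * hinner J (hadj J K (b w) x) (hadj J K (b z) y) + hinner L (g w x) (g z y)"
        using i j adj by (simp add: \<psi>_def da_kfun_inner[OF J] hinner_scale_left[OF J])
      also have "hinner L (g w x) (g z y)
          = (hinner K x y - hinner J (hadj J K (b w) x) (hadj J K (b z) y)) / (1 - zdot z w)"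
        using ker[OF j(2) i(2,3) j(3)] ne by (simp add: field_simps)
      also have "(1 / (1 - zdot z w)) * hinner J (hadj J K (b w) x) (hadj J K (b z) y) + \<dots>
          = (1 / (1 - zdot z w)) * hinner K x y"
        by (simp add: diff_divide_distrib)
      also have "\<dots> = hinner ?EK (\<phi> i) (\<phi> j)"
        using i j by (simp add: \<phi>_def da_kfun_inner[OF K] hinner_scale_left[OF K])
      finally show ?thesis .
    qed
    show "f = 0" if f: "f \<in> hcarrier ?EK" and 0: "\<And>i. i \<in> I \<Longrightarrow> hinner ?EK f (\<phi> i) = 0" for f
    proof (rule da_total[OF K f])
      fix w :: "complex ^ 'd" and x assume "w \<in> \<bool>" "x \<in> hcarrier K"
      then show "hinner ?EK f (kfun szego w x) = 0" using 0[of "(w, x)"] by (simp add: I_def \<phi>_def)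
    qed
  qed auto
  define A where "A = (\<lambda>f. fst (U f))"
  have Ucl: "U f \<in> hcarrier ?P" if "f \<in> hcarrier ?EK" for f by (rule op_closed[OF U(1) that])
  have An: "hnorm ?EJ (A f) \<le> hnorm ?EK f" if f: "f \<in> hcarrier ?EK" for f
  proof -
    have "hnorm ?EJ (A f) \<le> hnorm ?P (U f)"
      using Ucl[OF f] by (simp add: hnorm_hprod[OF EJ L] A_def real_le_rsqrt mem_Times_iff)
    then show ?thesis using U(3)[OF f] by simp
  qed
  have A: "contraction ?EK ?EJ A"
    unfolding contraction_def
  proof (intro conjI ballI An)
    show "bounded_op ?EK ?EJ A"
      by (rule bounded_opI[where M = 1])
        (use Ucl An in \<open>auto simp: A_def op_add[OF U(1)] op_scale[OF U(1)] scaleC_prod_def mem_Times_iff\<close>)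
  qed
  then have Aop: "bounded_op ?EK ?EJ A" by (simp add: contraction_def)
  \<comment> \<open>Both sides vanish off the ball, so agreement at its points is equality of
    functions and contractivity transfers to \<open>M\<close>.\<close>
  have eq: "hadj ?EK ?EJ A f = M f" if f: "f \<in> hcarrier ?EJ" for f
  proof
    fix w :: "complex ^ 'd"
    let ?g = "hadj ?EK ?EJ A f"
    have g: "?g \<in> hcarrier ?EK" by (rule hadj_closed[OF EK EJ Aop f])
    show "?g w = M f w"
    proof (cases "w \<in> \<bool>")
      case w: True
      have "?g w = b w (f w)"
      proof (rule hinner_ext_left[OF K])
        show "?g w \<in> hcarrier K" by (rule da_val[OF K g w])
        show "b w (f w) \<in> hcarrier K" by (rule op_closed[OF bop[OF w] da_val[OF J f w]])
        fix x assume x: "x \<in> hcarrier K"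
        have "A (kfun szego w x) = kfun szego w (hadj J K (b w) x)"
          using U(2)[of "(w, x)"] w x by (simp add: I_def \<phi>_def \<psi>_def A_def)
        then have "hinner ?EK ?g (kfun szego w x) = hinner ?EJ f (kfun szego w (hadj J K (b w) x))"
          using hadj_inner'[OF EK EJ Aop f da_kfun_closed[OF K w x]] by simp
        then show "hinner K (?g w) x = hinner K (b w (f w)) x"
          by (simp add: da_reproduces[OF K w x g] da_reproduces[OF J w adj[OF w x] f]
              hadj_inner[OF J K bop[OF w] x da_val[OF J f w]])
      qed
      then show ?thesis using w by (simp add: M_def)
    qed (simp add: da_off[OF K g] M_def)
  qed
  have "contraction ?EJ ?EK (hadj ?EK ?EJ A)" by (rule contraction_hadj[OF EK EJ A])
  then have "contraction ?EJ ?EK M"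
    unfolding contraction_def bounded_op_def using EJ by (simp add: eq[symmetric])
  then show ?thesis using bop by (simp add: schur_class_def M_def)
qed

end

section \<open>Separability and orthonormal bases\<close>

lemma sep_hilbertD: "sep_hilbert H \<Longrightarrow> hilbert_space H"
  by (simp add: sep_hilbert_def)

lemma sep_hilbert_onto_isometry:
  assumes H: "sep_hilbert H" and K: "hilbert_space K" and U: "onto_isometry H K U"
  shows "sep_hilbert K"
proof -
  note hH = sep_hilbertD[OF H] and Uop = onto_isometry_op[OF U]
  obtain S where S: "countable S" "S \<subseteq> hcarrier H" "hclosure H S = hcarrier H"
    using H by (auto simp: sep_hilbert_def)
  have "hcarrier K \<subseteq> hclosure K (U ` S)"
  proof
    fix y assume y: "y \<in> hcarrier K"
    then obtain x where x: "x \<in> hcarrier H" "y = U x" using U by (auto simp: onto_isometry_def)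
    have "\<exists>s\<in>U ` S. hnorm K (y - s) < e" if "e > 0" for e
    proof -
      obtain s where s: "s \<in> S" "hnorm H (x - s) < e" using x S(3) \<open>e > 0\<close> unfolding hclosure_def by blast
      have sH: "s \<in> hcarrier H" using s S(2) by blast
      have "hnorm K (y - U s) = hnorm H (x - s)"
        using U x sH hH by (simp add: op_diff[OF Uop hH, symmetric] onto_isometry_def)
      then show ?thesis using s by (intro bexI[of _ "U s"]) auto
    qed
    then show "y \<in> hclosure K (U ` S)" using y by (simp add: hclosure_def)
  qed
  moreover have "U ` S \<subseteq> hcarrier K" using S(2) op_closed[OF Uop] by blast
  ultimately show ?thesis
    unfolding sep_hilbert_def using K S(1) hclosure_subset[OF K, of "U ` S"] by blast
qed

text \<open>The projection of a countable dense set is dense in \<open>M\<close>: for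
  \<open>x\<close> in \<open>M\<close>, projecting an approximant does not increase its distance to
  \<open>x\<close>, by Pythagoras.\<close>

lemma sep_hilbert_hsub:
  assumes H: "sep_hilbert H" and M: "cvec.subspace M" "M \<subseteq> hcarrier H" "hclosure H M \<subseteq> M"
  shows "sep_hilbert (hsub H M)"
proof -
  note hH = sep_hilbertD[OF H]
  obtain S where S: "countable S" "S \<subseteq> hcarrier H" "hclosure H S = hcarrier H"
    using H by (auto simp: sep_hilbert_def)
  note pr = hproj_props[OF hH M]
  have "M \<subseteq> hclosure (hsub H M) (hproj H M ` S)"
  proof
    fix x assume x: "x \<in> M"
    have "\<exists>s\<in>hproj H M ` S. hnorm H (x - s) < e" if "e > 0" for e
    proof -
      have xH: "x \<in> hcarrier H" using x M(2) by blast
      obtain s where s: "s \<in> S" "hnorm H (x - s) < e"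
        using xH S(3) \<open>e > 0\<close> unfolding hclosure_def by blast
      have sH: "s \<in> hcarrier H" using s S(2) by blast
      let ?p = "hproj H M s"
      have pH: "?p \<in> hcarrier H" using pr(1)[OF sH] M(2) by blast
      have d: "x - ?p \<in> M" using cvec.subspace_diff[OF M(1) x pr(1)[OF sH]] .
      then have "hinner H (s - ?p) (x - ?p) = 0" using pr(2)[OF sH] by (simp add: horth_def)
      then have "(hnorm H ((s - ?p) - (x - ?p)))\<^sup>2 = (hnorm H (s - ?p))\<^sup>2 + (hnorm H (x - ?p))\<^sup>2"
        using xH sH pH hH by (subst hnorm_diff_sq[OF hH]) simp_all
      then have "(hnorm H (x - ?p))\<^sup>2 \<le> (hnorm H (s - x))\<^sup>2" by simp
      then have "hnorm H (x - ?p) \<le> hnorm H (s - x)"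
        by (rule power2_le_imp_le) (use xH sH hH in simp)
      then show ?thesis using s hnorm_minus_commute[OF hH xH sH] by (intro bexI[of _ ?p]) auto
    qed
    then show "x \<in> hclosure (hsub H M) (hproj H M ` S)" using x by (simp add: hclosure_def)
  qed
  moreover have "hproj H M ` S \<subseteq> M" using pr(1) S(2) by blast
  moreover have "hclosure (hsub H M) (hproj H M ` S) \<subseteq> M" by (auto simp: hclosure_def)
  ultimately show ?thesis
    unfolding sep_hilbert_def using hilbert_hsub[OF hH M] S(1) by auto
qed

lemma sep_hilbert_hcol:
  fixes H :: "'h::complex_vector hspace"
  assumes H: "sep_hilbert H"
  shows "sep_hilbert (hcol H :: ('h ^ 'd) hspace)"
proof -
  let ?C = "hcol H :: ('h ^ 'd) hspace"
  note hH = sep_hilbertD[OF H]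
  note hC = hilbert_hcol[OF hH, where 'd = 'd]
  obtain S where S: "countable S" "S \<subseteq> hcarrier H" "hclosure H S = hcarrier H"
    using H by (auto simp: sep_hilbert_def)
  define F where "F = vec_lambda ` (PiE (UNIV :: 'd set) (\<lambda>_. S))"
  have F: "x \<in> F \<longleftrightarrow> (\<forall>j. x $ j \<in> S)" for x :: "'h ^ 'd"
  proof
    assume "\<forall>j. x $ j \<in> S"
    then show "x \<in> F" unfolding F_def by (intro image_eqI[of _ _ "vec_nth x"]) (auto simp: vec_nth_inverse)
  qed (auto simp: F_def PiE_def)
  have "countable F" unfolding F_def by (intro countable_image countable_PiE) (use S in auto)
  moreover have FC: "F \<subseteq> hcarrier ?C" unfolding subset_iff F hcarrier_hcol using S(2) by blast
  moreover have "hcarrier ?C \<subseteq> hclosure ?C F"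
  proof
    fix x assume x: "x \<in> hcarrier ?C"
    have "\<exists>s\<in>F. hnorm ?C (x - s) < e" if e: "e > 0" for e
    proof -
      define n where "n = real CARD('d)"
      have n: "n > 0" by (simp add: n_def)
      \<comment> \<open>\<open>n\<close> squares of this size add up to
        \<open>e\<^sup>2\<close>.\<close>
      have "\<exists>s\<in>S. hnorm H (x $ j - s) < e / sqrt n" for j
      proof -
        have "x $ j \<in> hclosure H S" using x S(3) by (simp add: hcarrier_hcol)
        then show ?thesis using e n unfolding hclosure_def by simp
      qed
      then obtain s where s: "\<And>j. s j \<in> S" "\<And>j. hnorm H (x $ j - s j) < e / sqrt n" by metis
      let ?s = "(\<chi> j. s j) :: 'h ^ 'd"
      have sF: "?s \<in> F" using s by (simp add: F)
      have xs: "x - ?s \<in> hcarrier ?C" using x FC sF hC by (intro carrier_diff[OF hC]) auto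
      have "(\<Sum>j\<in>UNIV. (hnorm H ((x - ?s) $ j))\<^sup>2) < (\<Sum>j\<in>(UNIV::'d set). (e / sqrt n)\<^sup>2)"
      proof (rule sum_strict_mono)
        fix j
        have "hnorm H ((x - ?s) $ j) \<ge> 0" using xs hH by (simp add: hcarrier_hcol)
        then show "(hnorm H ((x - ?s) $ j))\<^sup>2 < (e / sqrt n)\<^sup>2"
          using s(2)[of j] by (intro power_strict_mono) auto
      qed auto
      also have "\<dots> = e\<^sup>2" using n by (simp add: power_divide n_def)
      finally have "sqrt (\<Sum>j\<in>UNIV. (hnorm H ((x - ?s) $ j))\<^sup>2) < e"
        using e by (metis real_sqrt_less_mono real_sqrt_abs abs_of_pos)
      then have "hnorm ?C (x - ?s) < e" by (simp only: hnorm_hcol[OF hH xs])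
      then show ?thesis using sF by (rule bexI)
    qed
    then show "x \<in> hclosure ?C F" using x by (simp add: hclosure_def)
  qed
  ultimately show ?thesis
    unfolding sep_hilbert_def using hC hclosure_subset[OF hC, of F] by blast
qed

text \<open>A maximal orthonormal set by Zorn: a nonzero vector orthogonal to it could be normalized
  and adjoined. Bases are needed because \<open>same_hdim\<close> is phrased through them.\<close>

lemma onb_exists:
  assumes H: "hilbert_space H"
  shows "\<exists>E. onb H E"
proof -
  define \<A> where "\<A> = {E. E \<subseteq> hcarrier H \<and> (\<forall>e\<in>E. \<forall>f\<in>E. hinner H e f = (if e = f then 1 else 0))}"
  have "\<exists>M\<in>\<A>. \<forall>X\<in>\<A>. M \<subseteq> X \<longrightarrow> X = M"
  proof (rule subset_Zorn')
    fix \<C> assume C: "subset.chain \<A> \<C>"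
    have "hinner H e f = (if e = f then 1 else 0)" if ef: "e \<in> \<Union>\<C>" "f \<in> \<Union>\<C>" for e f
    proof -
      obtain A B where AB: "A \<in> \<C>" "B \<in> \<C>" "e \<in> A" "f \<in> B" using ef by blast
      then have "A \<subseteq> B \<or> B \<subseteq> A" using C by (auto simp: subset.chain_def)
      then obtain D where "D \<in> \<C>" "e \<in> D" "f \<in> D" using AB by blast
      then show ?thesis using C by (auto simp: subset.chain_def \<A>_def)
    qed
    moreover have "\<Union>\<C> \<subseteq> hcarrier H" using C by (auto simp: subset.chain_def \<A>_def)
    ultimately show "\<Union>\<C> \<in> \<A>" by (simp add: \<A>_def)
  qed
  then obtain E where E: "E \<in> \<A>" "\<And>X. X \<in> \<A> \<Longrightarrow> E \<subseteq> X \<Longrightarrow> X = E" by blast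
  have EH: "E \<subseteq> hcarrier H" and Eon: "\<And>e f. e \<in> E \<Longrightarrow> f \<in> E \<Longrightarrow> hinner H e f = (if e = f then 1 else 0)"
    using E(1) by (auto simp: \<A>_def)
  have "hcspan H E = hcarrier H"
    unfolding hcspan_total_iff[OF H EH]
  proof (intro ballI impI, rule ccontr)
    fix x assume x: "x \<in> hcarrier H" "\<forall>s\<in>E. hinner H x s = 0" "x \<noteq> 0"
    let ?n = "hnorm H x"
    have n: "?n > 0" by (rule hnorm_pos[OF H x(1,3)])
    define u where "u = of_real (1 / ?n) *\<^sub>C x"
    have u: "u \<in> hcarrier H" using x H by (simp add: u_def)
    have "hnorm H u = 1" using n by (simp add: u_def hnorm_scale[OF H x(1)] norm_divide)
    then have uu: "hinner H u u = 1" by (simp add: hinner_self[OF H u])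
    have ue: "hinner H u e = 0" "hinner H e u = 0" if "e \<in> E" for e
    proof -
      show "hinner H u e = 0" using x that EH H by (auto simp: u_def hinner_simps[OF H] subset_iff)
      then show "hinner H e u = 0" using u that EH hinner_eq_0_commute[OF H] by blast
    qed
    have "u \<notin> E" using ue uu by force
    have "insert u E \<in> \<A>"
      using EH u uu ue Eon \<open>u \<notin> E\<close> by (auto simp: \<A>_def)
    then show False using E(2)[of "insert u E"] \<open>u \<notin> E\<close> by blast
  qed
  then show ?thesis using EH Eon by (intro exI[of _ E]) (simp add: onb_def)
qed

lemma same_hdim_onto_isometry:
  assumes H: "hilbert_space H" and K: "hilbert_space K" and U: "onto_isometry H K U"
  shows "same_hdim H K"
proof -
  note Uop = onto_isometry_op[OF U] and Uin = onto_isometry_inner[OF H K U]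
  obtain E where E: "onb H E" using onb_exists[OF H] by blast
  then have EH: "E \<subseteq> hcarrier H" and span: "hcspan H E = hcarrier H" by (simp_all add: onb_def)
  have inj: "inj_on U (hcarrier H)"
    using onto_isometry_hadj_left[OF H K U] by (rule inj_on_inverseI)
  have UE: "U ` E \<subseteq> hcarrier K" using EH op_closed[OF Uop] by blast
  have "hcspan K (U ` E) = hcarrier K"
    unfolding hcspan_total_iff[OF K UE]
  proof (intro ballI impI)
    fix y assume y: "y \<in> hcarrier K" "\<forall>s\<in>U ` E. hinner K y s = 0"
    have "y \<in> U ` hcarrier H" using U y(1) by (simp add: onto_isometry_def)
    then obtain x where x: "x \<in> hcarrier H" "y = U x" by blast
    have "x = 0"
      using span[unfolded hcspan_total_iff[OF H EH]] y x EH Uin by (auto simp: subset_iff)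
    then show "y = 0" using x op_zero[OF Uop H] by simp
  qed
  moreover have "\<forall>e\<in>U ` E. \<forall>f\<in>U ` E. hinner K e f = (if e = f then 1 else 0)"
    using E EH Uin inj_on_eq_iff[OF inj] by (auto simp: onb_def subset_iff)
  ultimately have "onb K (U ` E)" using UE by (simp add: onb_def)
  moreover have "E \<approx> U ` E"
    unfolding eqpoll_def by (rule exI[of _ U]) (use inj EH inj_on_subset in \<open>auto simp: bij_betw_def\<close>)
  ultimately show ?thesis using E by (auto simp: same_hdim_def)
qed

text \<open>The inner products with a dense sequence determine a vector, so the Hilbert structure
  can be transported to the resulting sequences. This treats finite and infinite dimension
  alike.\<close>

lemma sep_hilbert_sequence_model:
  assumes H: "sep_hilbert H"
  obtains L :: "(nat \<Rightarrow> complex) hspace" and U where "sep_hilbert L" "onto_isometry L H U"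
proof -
  note hH = sep_hilbertD[OF H]
  obtain S where S: "countable S" "S \<subseteq> hcarrier H" "hclosure H S = hcarrier H"
    using H by (auto simp: sep_hilbert_def)
  have "0 \<in> hclosure H S" using S(3) hH by simp
  then have ne: "S \<noteq> {}" unfolding hclosure_def using zero_less_one by blast
  define s where "s = from_nat_into S"
  have sS: "range s = S" unfolding s_def by (rule range_from_nat_into[OF ne S(1)])
  have sH: "s n \<in> hcarrier H" for n using sS S(2) by blast
  define \<Phi> where "\<Phi> h = (\<lambda>n. hinner H h (s n))" for h
  have add: "\<Phi> (x + y) = \<Phi> x + \<Phi> y" if "x \<in> hcarrier H" "y \<in> hcarrier H" for x y
    using that by (simp add: \<Phi>_def fun_eq_iff hinner_simps[OF hH] sH)
  have scale: "\<Phi> (c *\<^sub>C x) = c *\<^sub>C \<Phi> x" if "x \<in> hcarrier H" for c x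
    using that by (simp add: \<Phi>_def fun_eq_iff hinner_simps[OF hH] sH scaleC_fun_def scaleC_complex_def)
  have inj: "x = 0" if x: "x \<in> hcarrier H" "\<Phi> x = 0" for x
  proof -
    have "hinner H x t = 0" if "t \<in> S" for t
      using x(2) that sS by (auto simp: \<Phi>_def fun_eq_iff)
    then have "S \<subseteq> horth H {x}" using S(2) x(1) by (auto simp: horth_def subset_iff hinner_eq_0_commute[OF hH])
    then have "hclosure H S \<subseteq> horth H {x}"
      using hclosure_mono[OF hH, of S "horth H {x}"] hclosure_horth[OF hH, of "{x}"] x by blast
    then have "hinner H x x = 0" using x S(3) by (auto simp: horth_def)
    then show ?thesis using x hH by simp
  qed
  note im = himage_hilbert[OF hH, of \<Phi>, OF add scale inj]
  have "sep_hilbert (himage H \<Phi>)"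
    by (rule sep_hilbert_onto_isometry[OF H im(1,2)])
  moreover have "onto_isometry (himage H \<Phi>) H (hadj H (himage H \<Phi>) \<Phi>)"
    by (rule onto_isometry_hadj[OF hH im(1,2)])
  ultimately show thesis by (rule that)
qed

section \<open>Kernel representations of a row contraction\<close>

lemma pure_contractionI:
  assumes H: "hilbert_space H" and K: "hilbert_space K" and A: "bounded_op H K A"
    and pure: "\<And>g. g \<in> hcarrier H \<Longrightarrow> g \<noteq> 0 \<Longrightarrow> hnorm K (A g) < hnorm H g"
  shows "pure_contraction H K A"
proof -
  have "hnorm K (A g) \<le> hnorm H g" if "g \<in> hcarrier H" for g
    using pure[OF that] op_zero[OF A H] H K by (cases "g = 0") auto
  then show ?thesis using A pure by (auto simp: pure_contraction_def contraction_def)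
qed

text \<open>The square of the norm of \<open>A g\<close> is the pairing of \<open>g\<close> with the
  adjoint applied to \<open>A g\<close>. Strictness for the adjoint at \<open>A g\<close>, when that
  is nonzero, gives strictness for \<open>A\<close> at \<open>g\<close> after cancellation.\<close>

lemma pure_contraction_of_adjoint:
  assumes H: "hilbert_space H" and K: "hilbert_space K" and A: "bounded_op H K A"
    and pure: "pure_contraction K H (hadj H K A)"
  shows "pure_contraction H K A"
proof (rule pure_contractionI[OF H K A])
  fix g assume g: "g \<in> hcarrier H" "g \<noteq> 0"
  have Ag: "A g \<in> hcarrier K" by (rule op_closed[OF A g(1)])
  have gpos: "hnorm H g > 0" by (rule hnorm_pos[OF H g])
  show "hnorm K (A g) < hnorm H g"
  proof (cases "A g = 0")
    case True
    then show ?thesis using gpos K by simp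
  next
    case False
    have Apos: "hnorm K (A g) > 0" by (rule hnorm_pos[OF K Ag False])
    have "(hnorm K (A g))\<^sup>2 = Re (hinner H g (hadj H K A (A g)))"
      by (simp add: hnorm_sq[OF K Ag] hadj_inner[OF H K A Ag g(1)])
    also have "\<dots> \<le> hnorm H g * hnorm H (hadj H K A (A g))"
      using Cauchy_Schwarz[OF H g(1) hadj_closed[OF H K A Ag]] complex_Re_le_cmod order_trans by blast
    also have "\<dots> < hnorm H g * hnorm K (A g)"
      using pure Ag False gpos by (intro mult_strict_left_mono) (simp_all add: pure_contraction_def)
    finally show ?thesis using Apos by (simp add: power2_eq_square)
  qed
qed

text \<open>A map \<open>G\<close> with dense range and \<open>G\<^sup>* G = I - T T\<^sup>*\<close>: a coordinate-free defect operator of \<open>T\<^sup>*\<close>.\<close>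

definition defect_map :: "'h::complex_vector hspace \<Rightarrow> ('h ^ 'd \<Rightarrow> 'h) \<Rightarrow> 'k::complex_vector hspace
    \<Rightarrow> ('h \<Rightarrow> 'k) \<Rightarrow> bool" where
  "defect_map H T K G \<longleftrightarrow> bounded_op H K G
   \<and> (\<forall>y\<in>hcarrier K. (\<forall>h\<in>hcarrier H. hinner K y (G h) = 0) \<longrightarrow> y = 0)
   \<and> (\<forall>h\<in>hcarrier H. \<forall>k\<in>hcarrier H. hinner K (G h) (G k) =
        hinner H h k - hinner (hcol H) (hadj (hcol H) H T h) (hadj (hcol H) H T k))"

text \<open>The kernel \<open>(I - b(z) b(w)\<^sup>*) / (1 - z w\<^sup>*)\<close> equals
  \<open>G (I - z T\<^sup>*)\<^sup>-\<^sup>1 (I - T w\<^sup>*)\<^sup>-\<^sup>1 G\<^sup>*\<close>.\<close>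

definition kernel_factor :: "'h::complex_vector hspace \<Rightarrow> ('h ^ 'd \<Rightarrow> 'h) \<Rightarrow> 'j::complex_vector hspace
    \<Rightarrow> 'k::complex_vector hspace \<Rightarrow> (complex ^ 'd \<Rightarrow> 'j \<Rightarrow> 'k) \<Rightarrow> ('h \<Rightarrow> 'k) \<Rightarrow> bool" where
  "kernel_factor H T J K b G \<longleftrightarrow> defect_map H T K G
     \<and> (\<forall>z\<in>\<bool>. \<forall>w\<in>\<bool>. \<forall>x\<in>hcarrier K. \<forall>y\<in>hcarrier K.
          hinner K x y - hinner J (hadj J K (b w) x) (hadj J K (b z) y) =
          (1 - zdot z w) * hinner H (row_resolvent H T w (hadj H K G x)) (row_resolvent H T z (hadj H K G y)))"

text \<open>The bridge between the two sides of the theorem: extremal Gleason solutions and model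
  triples both yield it, and all functions representing the same \<open>T\<close> coincide
  weakly.\<close>

definition represents :: "'h::complex_vector hspace \<Rightarrow> ('h ^ 'd \<Rightarrow> 'h) \<Rightarrow> 'j::complex_vector hspace
    \<Rightarrow> 'k::complex_vector hspace \<Rightarrow> (complex ^ 'd \<Rightarrow> 'j \<Rightarrow> 'k) \<Rightarrow> bool" where
  "represents H T J K b \<longleftrightarrow> (\<exists>G. kernel_factor H T J K b G)"

lemma representsI:
  assumes "defect_map H T K G"
    and "\<And>z w x y. z \<in> \<bool> \<Longrightarrow> w \<in> \<bool> \<Longrightarrow> x \<in> hcarrier K \<Longrightarrow> y \<in> hcarrier K \<Longrightarrow>
      hinner K x y - hinner J (hadj J K (b w) x) (hadj J K (b z) y) =
      (1 - zdot z w) * hinner H (row_resolvent H T w (hadj H K G x)) (row_resolvent H T z (hadj H K G y))"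
  shows "represents H T J K b"
  unfolding represents_def kernel_factor_def by (rule exI[of _ G]) (simp add: assms)

lemma kernel_factor_map: "kernel_factor H T J K b G \<Longrightarrow> defect_map H T K G"
  by (simp add: kernel_factor_def)

lemma kernel_factor_eq:
  assumes "kernel_factor H T J K b G" "z \<in> \<bool>" "w \<in> \<bool>" "x \<in> hcarrier K" "y \<in> hcarrier K"
  shows "hinner K x y - hinner J (hadj J K (b w) x) (hadj J K (b z) y) =
    (1 - zdot z w) * hinner H (row_resolvent H T w (hadj H K G x)) (row_resolvent H T z (hadj H K G y))"
  using assms unfolding kernel_factor_def by blast

lemma row_contraction_op: "row_contraction H T \<Longrightarrow> bounded_op (hcol H) H T"
  by (simp add: row_contraction_def contraction_def)

lemma defect_mapD:
  assumes "defect_map H T K G"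
  shows "bounded_op H K G"
    and "\<And>y. y \<in> hcarrier K \<Longrightarrow> (\<And>h. h \<in> hcarrier H \<Longrightarrow> hinner K y (G h) = 0) \<Longrightarrow> y = 0"
    and "\<And>h k. h \<in> hcarrier H \<Longrightarrow> k \<in> hcarrier H \<Longrightarrow> hinner K (G h) (G k) =
        hinner H h k - hinner (hcol H) (hadj (hcol H) H T h) (hadj (hcol H) H T k)"
  using assms unfolding defect_map_def by blast+

section \<open>CCNC and weak coincidence in terms of defect maps\<close>

context
  fixes H :: "'h::complex_vector hspace" and T :: "'h ^ 'd \<Rightarrow> 'h"
  assumes H: "hilbert_space H" and T: "row_contraction H T"
begin

text \<open>The square root in the definition of CCNC may be exchanged for any defect map, since
  both have the same Gram form and hence the same kernel.\<close>

lemma ccnc_iff: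
  assumes K: "hilbert_space K" and G: "defect_map H T K G"
  shows "ccnc H T \<longleftrightarrow> (\<forall>h\<in>hcarrier H.
    (\<forall>w\<in>\<bool>. \<forall>x\<in>hcarrier K. hinner H h (row_resolvent H T w (hadj H K G x)) = 0) \<longrightarrow> h = 0)"
proof -
  note C = hilbert_hcol[OF H, where 'd = 'd] and Gop = defect_mapD(1)[OF G]
  have Tc: "contraction (hcol H) H T" using T by (simp add: row_contraction_def)
  define D where "D = defect_adj (hcol H) H T"
  note Dop = defect_adj_op[OF C H Tc, folded D_def]
  define S where "S = (\<Union>z\<in>\<bool>. row_resolvent H T z ` (D ` hcarrier H))"
  have SH: "S \<subseteq> hcarrier H"
    unfolding S_def using row_resolvent_closed[OF H T] op_closed[OF Dop] by blast
  \<comment> \<open>Write \<open>h\<close> as \<open>q\<close> minus \<open>zrow w\<close> of the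
    adjoint at \<open>q\<close>. Pairing \<open>h\<close> with a resolvent of \<open>y\<close> then
    means pairing \<open>q\<close> with \<open>y\<close>, so the two conditions become
    \<open>D q = 0\<close> and \<open>G q = 0\<close>.\<close>
  have key: "(\<forall>k\<in>hcarrier H. hinner H h (row_resolvent H T w (D k)) = 0) \<longleftrightarrow>
      (\<forall>x\<in>hcarrier K. hinner H h (row_resolvent H T w (hadj H K G x)) = 0)"
    if h: "h \<in> hcarrier H" and w: "w \<in> \<bool>" for h w
  proof -
    obtain q where q: "q \<in> hcarrier H" "q - zrow w (hadj (hcol H) H T q) = h"
      using zrow_hadj_solution[OF H T w h] by blast
    have inn: "hinner H h (row_resolvent H T w y) = hinner H q y" if "y \<in> hcarrier H" for y
      using row_resolvent_inner[OF H T w q(1) that] by (simp add: q(2))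
    have "(\<forall>k\<in>hcarrier H. hinner H h (row_resolvent H T w (D k)) = 0) \<longleftrightarrow>
        (\<forall>k\<in>hcarrier H. hinner H (D q) k = 0)"
      using defect_adj_selfadjoint[OF C H Tc q(1), folded D_def] op_closed[OF Dop] by (simp add: inn)
    also have "\<dots> \<longleftrightarrow> D q = 0"
      using op_closed[OF Dop q(1)] hinner_self_eq_0[OF H] H by auto
    also have "\<dots> \<longleftrightarrow> hinner H (D q) (D q) = 0"
      using op_closed[OF Dop q(1)] H by simp
    also have "\<dots> \<longleftrightarrow> hinner K (G q) (G q) = 0"
      using defect_adj_inner[OF C H Tc q(1) q(1)] defect_mapD(3)[OF G q(1) q(1)] by (simp add: D_def)
    also have "\<dots> \<longleftrightarrow> (\<forall>x\<in>hcarrier K. hinner K (G q) x = 0)"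
      using op_closed[OF Gop q(1)] K by auto
    also have "\<dots> \<longleftrightarrow> (\<forall>x\<in>hcarrier K. hinner H h (row_resolvent H T w (hadj H K G x)) = 0)"
      using hadj_closed[OF H K Gop] by (simp add: inn hadj_inner[OF H K Gop _ q(1)])
    finally show ?thesis .
  qed
  have "ccnc H T \<longleftrightarrow> hcspan H S = hcarrier H" unfolding ccnc_def S_def D_def by auto
  also have "\<dots> \<longleftrightarrow> (\<forall>h\<in>hcarrier H. (\<forall>s\<in>S. hinner H h s = 0) \<longrightarrow> h = 0)"
    by (rule hcspan_total_iff[OF H SH])
  also have "\<dots> \<longleftrightarrow> (\<forall>h\<in>hcarrier H.
    (\<forall>w\<in>\<bool>. \<forall>x\<in>hcarrier K. hinner H h (row_resolvent H T w (hadj H K G x)) = 0) \<longrightarrow> h = 0)"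
  proof (rule ball_cong[OF refl])
    fix h assume h: "h \<in> hcarrier H"
    have "(\<forall>s\<in>S. hinner H h s = 0) \<longleftrightarrow>
        (\<forall>w\<in>\<bool>. \<forall>k\<in>hcarrier H. hinner H h (row_resolvent H T w (D k)) = 0)"
      unfolding S_def by blast
    then show "((\<forall>s\<in>S. hinner H h s = 0) \<longrightarrow> h = 0) \<longleftrightarrow>
       ((\<forall>w\<in>\<bool>. \<forall>x\<in>hcarrier K. hinner H h (row_resolvent H T w (hadj H K G x)) = 0) \<longrightarrow> h = 0)"
      using key[OF h] by simp
  qed
  finally show ?thesis .
qed

text \<open>\<open>G1 h \<mapsto> G2 h\<close> preserves Gram forms between dense ranges, so it
  extends to a unitary \<open>W\<close>. It matches the adjoints of the two maps, hence the two
  kernels, and comparing these leaves the products of \<open>b\<close> with its adjoint.\<close>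

lemma represents_weakly_coincide:
  assumes J1: "hilbert_space J1" and K1: "hilbert_space K1" and J2: "hilbert_space J2" and K2: "hilbert_space K2"
    and b1: "schur_class J1 K1 b1" "represents H T J1 K1 b1"
    and b2: "schur_class J2 K2 b2" "represents H T J2 K2 b2"
  shows "weakly_coincide J1 K1 b1 J2 K2 b2"
proof -
  obtain G1 where rG1: "kernel_factor H T J1 K1 b1 G1"
    using b1(2) unfolding represents_def by (rule exE)
  note G1 = kernel_factor_map[OF rG1] and k1 = kernel_factor_eq[OF rG1]
  obtain G2 where rG2: "kernel_factor H T J2 K2 b2 G2"
    using b2(2) unfolding represents_def by (rule exE)
  note G2 = kernel_factor_map[OF rG2] and k2 = kernel_factor_eq[OF rG2]
  note G1op = defect_mapD(1)[OF G1] and G2op = defect_mapD(1)[OF G2]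
  obtain W where W: "onto_isometry K1 K2 W" "\<And>h. h \<in> hcarrier H \<Longrightarrow> W (G1 h) = G2 h"
  proof (rule gram_unitary[OF K1 K2, of "hcarrier H" G1 G2])
    show "hinner K2 (G2 i) (G2 j) = hinner K1 (G1 i) (G1 j)" if "i \<in> hcarrier H" "j \<in> hcarrier H" for i j
      using defect_mapD(3)[OF G1 that] defect_mapD(3)[OF G2 that] by simp
  qed (use op_closed[OF G1op] op_closed[OF G2op] defect_mapD(2)[OF G1] defect_mapD(2)[OF G2] in auto)
  note Wop = onto_isometry_op[OF W(1)]
  have adjW: "hadj H K2 G2 (W x) = hadj H K1 G1 x" if x: "x \<in> hcarrier K1" for x
  proof (rule hadj_eqI[OF H K2 G2op op_closed[OF Wop x] hadj_closed[OF H K1 G1op x]])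
    fix h assume h: "h \<in> hcarrier H"
    show "hinner K2 (G2 h) (W x) = hinner H h (hadj H K1 G1 x)"
      using onto_isometry_inner[OF K1 K2 W(1) op_closed[OF G1op h] x] W(2)[OF h]
        hadj_inner[OF H K1 G1op x h] by simp
  qed
  have b1op: "bounded_op J1 K1 (b1 z)" and b2op: "bounded_op J2 K2 (b2 z)" if "z \<in> \<bool>" for z
    using b1(1) b2(1) that by (simp_all add: schur_class_def)
  have "W (b1 z (hadj J1 K1 (b1 w) (hadj K1 K2 W y))) = b2 z (hadj J2 K2 (b2 w) y)"
    if z: "z \<in> \<bool>" and w: "w \<in> \<bool>" and y: "y \<in> hcarrier K2" for z w y
  proof -
    define x where "x = hadj K1 K2 W y"
    have x: "x \<in> hcarrier K1" unfolding x_def by (rule hadj_closed[OF K1 K2 Wop y])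
    have Wx: "W x = y" unfolding x_def by (rule onto_isometry_hadj_right[OF K1 K2 W(1) y])
    note c1 = hadj_closed[OF J1 K1 b1op[OF w] x] and c2 = hadj_closed[OF J2 K2 b2op[OF w] y]
    note d1 = op_closed[OF b1op[OF z] c1] and d2 = op_closed[OF b2op[OF z] c2]
    have "W (b1 z (hadj J1 K1 (b1 w) x)) = b2 z (hadj J2 K2 (b2 w) y)"
    proof (rule hinner_ext_left[OF K2 op_closed[OF Wop d1] d2])
      fix y' assume y': "y' \<in> hcarrier K2"
      define x' where "x' = hadj K1 K2 W y'"
      have x': "x' \<in> hcarrier K1" unfolding x'_def by (rule hadj_closed[OF K1 K2 Wop y'])
      have Wx': "W x' = y'" unfolding x'_def by (rule onto_isometry_hadj_right[OF K1 K2 W(1) y'])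
      have "hinner K2 (W (b1 z (hadj J1 K1 (b1 w) x))) y' = hinner K1 (b1 z (hadj J1 K1 (b1 w) x)) x'"
        using onto_isometry_inner[OF K1 K2 W(1) d1 x'] by (simp add: Wx')
      also have "\<dots> = hinner J1 (hadj J1 K1 (b1 w) x) (hadj J1 K1 (b1 z) x')"
        by (rule hadj_inner[OF J1 K1 b1op[OF z] x' c1])
      \<comment> \<open>The two kernel identities have equal right-hand sides by
        \<open>adjW\<close>, and equal first terms because \<open>W\<close> is unitary.\<close>
      also have "\<dots> = hinner J2 (hadj J2 K2 (b2 w) y) (hadj J2 K2 (b2 z) y')"
        using k1[OF z w x x'] k2[OF z w y y'] onto_isometry_inner[OF K1 K2 W(1) x x'] adjW[OF x] adjW[OF x']
        by (simp add: Wx Wx' algebra_simps)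
      also have "\<dots> = hinner K2 (b2 z (hadj J2 K2 (b2 w) y)) y'"
        by (rule hadj_inner[OF J2 K2 b2op[OF z] y' c2, symmetric])
      finally show "hinner K2 (W (b1 z (hadj J1 K1 (b1 w) x))) y' = hinner K2 (b2 z (hadj J2 K2 (b2 w) y)) y'" .
    qed
    then show ?thesis by (simp add: x_def)
  qed
  then show ?thesis using b1(1) b2(1) W(1) unfolding weakly_coincide_def by blast
qed

text \<open>A characteristic function is given only up to weak coincidence, so the factorization has
  to be pulled back: the adjoint of the coincidence unitary is composed with the defect map.\<close>

lemma represents_of_weakly_coincide:
  assumes J1: "hilbert_space J1" and K1: "hilbert_space K1" and J2: "hilbert_space J2" and K2: "hilbert_space K2"
    and wc: "weakly_coincide J1 K1 b1 J2 K2 b2" and b2: "represents H T J2 K2 b2"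
  shows "represents H T J1 K1 b1"
proof -
  obtain G2 where rG2: "kernel_factor H T J2 K2 b2 G2"
    using b2 unfolding represents_def by (rule exE)
  note G2 = kernel_factor_map[OF rG2] and k2 = kernel_factor_eq[OF rG2]
  obtain U where U': "onto_isometry K1 K2 U \<and> (\<forall>z\<in>\<bool>. \<forall>w\<in>\<bool>. \<forall>y\<in>hcarrier K2.
      U (b1 z (hadj J1 K1 (b1 w) (hadj K1 K2 U y))) = b2 z (hadj J2 K2 (b2 w) y))"
    using wc[unfolded weakly_coincide_def, THEN conjunct2, THEN conjunct2] by (rule exE)
  note U = U'[THEN conjunct1] and Ub = U'[THEN conjunct2, rule_format]
  note Uop = onto_isometry_op[OF U] and G2op = defect_mapD(1)[OF G2]
  note U' = onto_isometry_hadj[OF K1 K2 U]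
  let ?V = "hadj K1 K2 U"
  define G where "G = (\<lambda>h. ?V (G2 h))"
  have Gop: "bounded_op H K1 G"
    unfolding G_def by (rule bounded_op_comp[OF G2op onto_isometry_op[OF U'] H K2])
  have UG: "U (G h) = G2 h" if "h \<in> hcarrier H" for h
    unfolding G_def by (rule onto_isometry_hadj_right[OF K1 K2 U op_closed[OF G2op that]])
  have adjG: "hadj H K1 G x = hadj H K2 G2 (U x)" if x: "x \<in> hcarrier K1" for x
  proof (rule hadj_eqI[OF H K1 Gop x hadj_closed[OF H K2 G2op op_closed[OF Uop x]]])
    fix h assume h: "h \<in> hcarrier H"
    show "hinner K1 (G h) x = hinner H h (hadj H K2 G2 (U x))"
      using onto_isometry_inner[OF K1 K2 U op_closed[OF Gop h] x] UG[OF h]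
        hadj_inner[OF H K2 G2op op_closed[OF Uop x] h] by simp
  qed
  have "defect_map H T K1 G"
    unfolding defect_map_def
  proof (intro conjI ballI impI Gop)
    fix h k assume hk: "h \<in> hcarrier H" "k \<in> hcarrier H"
    show "hinner K1 (G h) (G k) = hinner H h k - hinner (hcol H) (hadj (hcol H) H T h) (hadj (hcol H) H T k)"
      using defect_mapD(3)[OF G2 hk] onto_isometry_inner[OF K1 K2 U op_closed[OF Gop hk(1)] op_closed[OF Gop hk(2)]]
      by (simp add: UG hk)
  next
    fix y assume y: "y \<in> hcarrier K1" "\<forall>h\<in>hcarrier H. hinner K1 y (G h) = 0"
    have "U y = 0"
    proof (rule defect_mapD(2)[OF G2 op_closed[OF Uop y(1)]])
      fix h assume h: "h \<in> hcarrier H"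
      show "hinner K2 (U y) (G2 h) = 0"
        using onto_isometry_inner[OF K1 K2 U y(1) op_closed[OF Gop h]] y(2) h by (simp add: UG)
    qed
    then show "y = 0"
      using onto_isometry_inner[OF K1 K2 U y(1) y(1)] y(1) K1 K2 by simp
  qed
  moreover have "hinner K1 x y - hinner J1 (hadj J1 K1 (b1 w) x) (hadj J1 K1 (b1 z) y) =
      (1 - zdot z w) * hinner H (row_resolvent H T w (hadj H K1 G x)) (row_resolvent H T z (hadj H K1 G y))"
    if z: "z \<in> \<bool>" and w: "w \<in> \<bool>" and x: "x \<in> hcarrier K1" and y: "y \<in> hcarrier K1" for z w x y
  proof -
    have b1op: "bounded_op J1 K1 (b1 z)" "bounded_op J1 K1 (b1 w)" and b2op: "bounded_op J2 K2 (b2 z)" "bounded_op J2 K2 (b2 w)"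
      using wc z w by (simp_all add: weakly_coincide_def schur_class_def)
    note Ux = op_closed[OF Uop x] and Uy = op_closed[OF Uop y]
    note c1 = hadj_closed[OF J1 K1 b1op(2) x] and c2 = hadj_closed[OF J2 K2 b2op(2) Ux]
    have "hinner J1 (hadj J1 K1 (b1 w) x) (hadj J1 K1 (b1 z) y) = hinner K1 (b1 z (hadj J1 K1 (b1 w) x)) y"
      by (rule hadj_inner[OF J1 K1 b1op(1) y c1, symmetric])
    also have "\<dots> = hinner K2 (U (b1 z (hadj J1 K1 (b1 w) x))) (U y)"
      by (rule onto_isometry_inner[OF K1 K2 U op_closed[OF b1op(1) c1] y, symmetric])
    also have "U (b1 z (hadj J1 K1 (b1 w) x)) = b2 z (hadj J2 K2 (b2 w) (U x))"
      using Ub[OF z w Ux] by (simp add: onto_isometry_hadj_left[OF K1 K2 U x])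
    also have "hinner K2 \<dots> (U y) = hinner J2 (hadj J2 K2 (b2 w) (U x)) (hadj J2 K2 (b2 z) (U y))"
      by (rule hadj_inner[OF J2 K2 b2op(1) Uy c2])
    finally show ?thesis
      using k2[OF z w Ux Uy] by (simp add: adjG x y onto_isometry_inner[OF K1 K2 U x y])
  qed
  ultimately show ?thesis by (rule representsI)
qed

end

lemma zstar_map: "bounded_op H K A \<Longrightarrow> h \<in> hcarrier H \<Longrightarrow> zstar w (A h) = (\<chi> j. A (zstar w h $ j))"
  by (simp add: zstar_def vec_eq_iff op_scale)

text \<open>Turns componentwise equivalence into intertwining of whole rows and of their adjoints,
  with \<open>U\<close> acting on each entry of a column.\<close>

lemma unitary_row_conjugate:
  fixes H :: "'h::complex_vector hspace" and T :: "'h ^ 'd \<Rightarrow> 'h"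
    and H2 :: "'g::complex_vector hspace" and T2 :: "'g ^ 'd \<Rightarrow> 'g"
  assumes H: "hilbert_space H" and T: "row_contraction H T"
    and H2: "hilbert_space H2" and T2: "row_contraction H2 T2"
    and U: "onto_isometry H H2 U"
    and eq: "\<forall>j. \<forall>y\<in>hcarrier H2. U (comp_op T j (hadj H H2 U y)) = comp_op T2 j y"
  shows "x \<in> hcarrier (hcol H) \<Longrightarrow> T2 (\<chi> j. U (x $ j)) = U (T x)"
    and "h \<in> hcarrier H \<Longrightarrow> hadj (hcol H2) H2 T2 (U h) = (\<chi> j. U (hadj (hcol H) H T h $ j))"
proof -
  note C = hilbert_hcol[OF H, where 'd = 'd] and C2 = hilbert_hcol[OF H2, where 'd = 'd]
  note Top = row_contraction_op[OF T] and T2op = row_contraction_op[OF T2] and Uop = onto_isometry_op[OF U]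
  show 1: "T2 (\<chi> j. U (x $ j)) = U (T x)" if x: "x \<in> hcarrier (hcol H)" for x
  proof -
    have xj: "x $ j \<in> hcarrier H" for j using x by (simp add: hcarrier_hcol)
    have "T2 (\<chi> j. U (x $ j)) = (\<Sum>j\<in>UNIV. T2 (axis j (U (x $ j))))"
      by (subst row_op_expand[OF H2 T2op]) (simp_all add: hcarrier_hcol op_closed[OF Uop] xj)
    also have "\<dots> = (\<Sum>j\<in>UNIV. U (T (axis j (x $ j))))"
      using eq[rule_format, OF op_closed[OF Uop xj]] onto_isometry_hadj_left[OF H H2 U xj]
      by (intro sum.cong) (simp_all add: comp_op_def)
    also have "\<dots> = U (\<Sum>j\<in>UNIV. T (axis j (x $ j)))"
      by (rule op_sum[OF Uop H, symmetric]) (intro op_closed[OF Top] axis_closed[OF H] xj)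
    also have "\<dots> = U (T x)" by (simp add: row_op_expand[OF H Top x])
    finally show ?thesis .
  qed
  show "hadj (hcol H2) H2 T2 (U h) = (\<chi> j. U (hadj (hcol H) H T h $ j))" if h: "h \<in> hcarrier H"
  proof (rule hadj_eqI[OF C2 H2 T2op op_closed[OF Uop h]])
    let ?t = "hadj (hcol H) H T h"
    have t: "?t \<in> hcarrier (hcol H)" by (rule hadj_closed[OF C H Top h])
    then have tj: "?t $ j \<in> hcarrier H" for j by (simp add: hcarrier_hcol)
    show "(\<chi> j. U (?t $ j)) \<in> hcarrier (hcol H2)" using tj op_closed[OF Uop] by (simp add: hcarrier_hcol)
    fix y :: "'g ^ 'd" assume y: "y \<in> hcarrier (hcol H2)"
    define x :: "'h ^ 'd" where "x = (\<chi> j. hadj H H2 U (y $ j))"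
    have yj: "y $ j \<in> hcarrier H2" for j using y by (simp add: hcarrier_hcol)
    have x: "x \<in> hcarrier (hcol H)" using hadj_closed[OF H H2 Uop yj] by (simp add: x_def hcarrier_hcol)
    have Ux: "y $ j = U (x $ j)" for j by (simp add: x_def onto_isometry_hadj_right[OF H H2 U yj])
    have yx: "y = (\<chi> j. U (x $ j))" by (simp add: vec_eq_iff Ux)
    have "hinner H2 (T2 y) (U h) = hinner H (T x) h"
      using onto_isometry_inner[OF H H2 U op_closed[OF Top x] h] 1[OF x] yx by simp
    also have "\<dots> = hinner (hcol H) x ?t" by (rule hadj_inner[OF C H Top h x])
    also have "\<dots> = hinner (hcol H2) y (\<chi> j. U (?t $ j))"
      using x by (simp add: hinner_hcol Ux onto_isometry_inner[OF H H2 U] tj hcarrier_hcol)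
    finally show "hinner H2 (T2 y) (U h) = hinner (hcol H2) y (\<chi> j. U (?t $ j))" .
  qed
qed

text \<open>\<open>G2\<close> composed with \<open>U\<close> is a defect map for \<open>T\<close>,
  because \<open>U\<close> intertwines adjoints and resolvents.\<close>

lemma represents_unitary:
  fixes H :: "'h::complex_vector hspace" and T :: "'h ^ 'd \<Rightarrow> 'h"
    and H2 :: "'g::complex_vector hspace" and T2 :: "'g ^ 'd \<Rightarrow> 'g"
  assumes H: "hilbert_space H" and T: "row_contraction H T"
    and H2: "hilbert_space H2" and T2: "row_contraction H2 T2" and K: "hilbert_space K"
    and ue: "unitarily_equivalent H T H2 T2" and b: "represents H2 T2 J K b"
  shows "represents H T J K b"
proof -
  obtain U where U': "onto_isometry H H2 U \<and>
      (\<forall>j. \<forall>y\<in>hcarrier H2. U (comp_op T j (hadj H H2 U y)) = comp_op T2 j y)"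
    using ue unfolding unitarily_equivalent_def by (rule exE)
  note U = U'[THEN conjunct1] and eq = U'[THEN conjunct2]
  note conj = unitary_row_conjugate[OF H T H2 T2 U eq]
  note C = hilbert_hcol[OF H, where 'd = 'd] and Uop = onto_isometry_op[OF U] and Top = row_contraction_op[OF T]
  obtain G2 where rG2: "kernel_factor H2 T2 J K b G2"
    using b unfolding represents_def by (rule exE)
  note G2 = kernel_factor_map[OF rG2] and k2 = kernel_factor_eq[OF rG2]
  note G2op = defect_mapD(1)[OF G2]
  define G where "G = (\<lambda>h. G2 (U h))"
  have Gop: "bounded_op H K G" unfolding G_def by (rule bounded_op_comp[OF Uop G2op H H2])
  have UG: "U (hadj H K G x) = hadj H2 K G2 x" if x: "x \<in> hcarrier K" for x
  proof -
    have c2: "hadj H2 K G2 x \<in> hcarrier H2" by (rule hadj_closed[OF H2 K G2op x])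
    have c: "hadj H H2 U (hadj H2 K G2 x) \<in> hcarrier H" by (rule hadj_closed[OF H H2 Uop c2])
    have "hadj H K G x = hadj H H2 U (hadj H2 K G2 x)"
    proof (rule hadj_eqI[OF H K Gop x c])
      fix h assume h: "h \<in> hcarrier H"
      show "hinner K (G h) x = hinner H h (hadj H H2 U (hadj H2 K G2 x))"
        unfolding G_def using hadj_inner[OF H2 K G2op x op_closed[OF Uop h]] hadj_inner[OF H H2 Uop c2 h] by simp
    qed
    then show ?thesis by (simp add: onto_isometry_hadj_right[OF H H2 U c2])
  qed
  have UR: "U (row_resolvent H T w h) = row_resolvent H2 T2 w (U h)" if w: "w \<in> \<bool>" and h: "h \<in> hcarrier H" for w h
  proof (rule row_resolvent_eqI[OF H2 T2 w, symmetric])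
    let ?r = "row_resolvent H T w h"
    have r: "?r \<in> hcarrier H" by (rule row_resolvent_closed[OF H T w h])
    then show "U ?r \<in> hcarrier H2" by (rule op_closed[OF Uop])
    have z: "zstar w (U ?r) = (\<chi> j. U (zstar w ?r $ j))"
      by (rule zstar_map[OF Uop r])
    have "U ?r - T2 (zstar w (U ?r)) = U (?r - T (zstar w ?r))"
      unfolding z conj(1)[OF zstar_closed[OF H r]]
      by (rule op_diff[OF Uop H r op_closed[OF Top zstar_closed[OF H r]], symmetric])
    also have "\<dots> = U h" by (simp only: row_resolvent_eq[OF H T w h])
    finally show "U ?r - T2 (zstar w (U ?r)) = U h" .
  qed
  have "defect_map H T K G"
    unfolding defect_map_def
  proof (intro conjI ballI impI Gop)
    fix h k assume hk: "h \<in> hcarrier H" "k \<in> hcarrier H"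
    have "hinner (hcol H2) (hadj (hcol H2) H2 T2 (U h)) (hadj (hcol H2) H2 T2 (U k))
        = hinner (hcol H) (hadj (hcol H) H T h) (hadj (hcol H) H T k)"
      using hk[THEN hadj_closed[OF C H Top]]
      by (simp add: conj(2) hk hinner_hcol hcarrier_hcol onto_isometry_inner[OF H H2 U])
    then show "hinner K (G h) (G k) = hinner H h k - hinner (hcol H) (hadj (hcol H) H T h) (hadj (hcol H) H T k)"
      using defect_mapD(3)[OF G2 op_closed[OF Uop hk(1)] op_closed[OF Uop hk(2)]]
      by (simp add: G_def onto_isometry_inner[OF H H2 U] hk)
  next
    fix y assume y: "y \<in> hcarrier K" "\<forall>h\<in>hcarrier H. hinner K y (G h) = 0"
    show "y = 0"
    proof (rule defect_mapD(2)[OF G2 y(1)])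
      fix h2 assume h2: "h2 \<in> hcarrier H2"
      show "hinner K y (G2 h2) = 0"
        using y(2) hadj_closed[OF H H2 Uop h2] onto_isometry_hadj_right[OF H H2 U h2] by (force simp: G_def)
    qed
  qed
  moreover have "hinner K x y - hinner J (hadj J K (b w) x) (hadj J K (b z) y) =
      (1 - zdot z w) * hinner H (row_resolvent H T w (hadj H K G x)) (row_resolvent H T z (hadj H K G y))"
    if zw: "z \<in> \<bool>" "w \<in> \<bool>" and xy: "x \<in> hcarrier K" "y \<in> hcarrier K" for z w x y
  proof -
    note c = hadj_closed[OF H K Gop xy(1)] hadj_closed[OF H K Gop xy(2)]
    have "hinner H2 (row_resolvent H2 T2 w (hadj H2 K G2 x)) (row_resolvent H2 T2 z (hadj H2 K G2 y))
      = hinner H (row_resolvent H T w (hadj H K G x)) (row_resolvent H T z (hadj H K G y))"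
      unfolding UG[OF xy(1), symmetric] UG[OF xy(2), symmetric]
        UR[OF zw(1) c(2), symmetric] UR[OF zw(2) c(1), symmetric]
      by (rule onto_isometry_inner[OF H H2 U row_resolvent_closed[OF H T zw(2) c(1)]
            row_resolvent_closed[OF H T zw(1) c(2)]])
    then show ?thesis using k2[OF zw xy] by (rule subst)
  qed
  ultimately show ?thesis by (rule representsI)
qed

section \<open>The isometric part and model triples\<close>

lemma bounded_op_cong:
  assumes "hilbert_space H" "bounded_op H K A" "\<And>x. x \<in> hcarrier H \<Longrightarrow> B x = A x"
  shows "bounded_op H K B"
  using assms unfolding bounded_op_def by simp

lemma bounded_op_restrict:
  assumes "bounded_op H K A" "M \<subseteq> hcarrier H"
  shows "bounded_op (hsub H M) K A"
proof -
  obtain B where "\<forall>x\<in>hcarrier H. hnorm K (A x) \<le> B * hnorm H x"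
    using assms(1) unfolding bounded_op_def by blast
  then show ?thesis
    using assms by (intro bounded_opI[where M = B]) (auto simp: bounded_op_def subset_iff)
qed

lemma hproj_op:
  assumes H: "hilbert_space H" and M: "cvec.subspace M" "M \<subseteq> hcarrier H" "hclosure H M \<subseteq> M"
  shows "bounded_op H H (hproj H M)"
    and "\<And>x. x \<in> hcarrier H \<Longrightarrow> hnorm H (hproj H M x) \<le> hnorm H x"
proof -
  note pr = hproj_props[OF H M] and eqI = hproj_eq[OF H M(1,2)]
  note os = horth_subspace[OF H M(2)]
  have pH: "hproj H M x \<in> hcarrier H" if "x \<in> hcarrier H" for x using pr(1)[OF that] M(2) by blast
  show nrm: "hnorm H (hproj H M x) \<le> hnorm H x" if x: "x \<in> hcarrier H" for x
  proof (rule power2_le_imp_le)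
    let ?p = "hproj H M x"
    have "hinner H (x - ?p) ?p = 0" using pr[OF x] by (simp add: horth_def)
    then have "(hnorm H ((x - ?p) + ?p))\<^sup>2 = (hnorm H (x - ?p))\<^sup>2 + (hnorm H ?p)\<^sup>2"
      using x pH[OF x] H by (subst hnorm_add_sq[OF H]) simp_all
    then show "(hnorm H ?p)\<^sup>2 \<le> (hnorm H x)\<^sup>2" by simp
  qed (use x H in simp)
  show "bounded_op H H (hproj H M)"
  proof (rule bounded_opI[where M = 1])
    fix x y assume x: "x \<in> hcarrier H" and y: "y \<in> hcarrier H"
    have "(x - hproj H M x) + (y - hproj H M y) \<in> horth H M"
      by (rule cvec.subspace_add[OF os pr(2)[OF x] pr(2)[OF y]])
    then show "hproj H M (x + y) = hproj H M x + hproj H M y"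
      using x y H cvec.subspace_add[OF M(1) pr(1)[OF x] pr(1)[OF y]] by (intro eqI) (simp_all add: algebra_simps)
  next
    fix c x assume x: "x \<in> hcarrier H"
    have "c *\<^sub>C (x - hproj H M x) \<in> horth H M" by (rule cvec.subspace_scale[OF os pr(2)[OF x]])
    then show "hproj H M (c *\<^sub>C x) = c *\<^sub>C hproj H M x"
      using x H cvec.subspace_scale[OF M(1) pr(1)[OF x]] by (intro eqI) (simp_all add: scaleC_diff_right)
  qed (use pH nrm in auto)
qed

text \<open>The same isometry seen as a map into the whole space. The last claim says that
  \<open>A\<close> after its adjoint is the projection onto \<open>M\<close>, phrased for a known
  decomposition of \<open>k\<close>.\<close>

lemma isometry_onto_subspace:
  assumes J: "hilbert_space J" and K: "hilbert_space K" and M: "M \<subseteq> hcarrier K"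
    and hM: "hilbert_space (hsub K M)" and U: "onto_isometry J (hsub K M) A"
  shows "bounded_op J K A"
    and "\<And>j. j \<in> hcarrier J \<Longrightarrow> A j \<in> M"
    and "\<And>i j. i \<in> hcarrier J \<Longrightarrow> j \<in> hcarrier J \<Longrightarrow> hinner K (A i) (A j) = hinner J i j"
    and "\<And>k m. m \<in> M \<Longrightarrow> k \<in> hcarrier K \<Longrightarrow> k - m \<in> horth K M \<Longrightarrow> A (hadj J K A k) = m"
proof -
  note Uop = onto_isometry_op[OF U]
  show cl: "A j \<in> M" if "j \<in> hcarrier J" for j using op_closed[OF Uop that] by simp
  show op: "bounded_op J K A" using Uop M unfolding bounded_op_def by (auto simp: subset_iff)
  show inn: "hinner K (A i) (A j) = hinner J i j" if "i \<in> hcarrier J" "j \<in> hcarrier J" for i j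
    using onto_isometry_inner[OF J hM U that] by simp
  show "A (hadj J K A k) = m" if m: "m \<in> M" and k: "k \<in> hcarrier K" and km: "k - m \<in> horth K M" for k m
  proof -
    have "m \<in> A ` hcarrier J" using U m by (simp add: onto_isometry_def)
    then obtain j where j: "j \<in> hcarrier J" "m = A j" by blast
    have mK: "m \<in> hcarrier K" using m M by blast
    have "hadj J K A k = j"
    proof (rule hadj_eqI[OF J K op k j(1)])
      fix h assume h: "h \<in> hcarrier J"
      have Ah: "A h \<in> hcarrier K" using cl[OF h] M by blast
      have "hinner K (k - m) (A h) = 0" using km cl[OF h] by (simp add: horth_def)
      then have "hinner K (A h) (k - m) = 0" using hinner_eq_0_commute[OF K] Ah k mK K by simp
      then have "hinner K (A h) k = hinner K (A h) m"
        using Ah k mK by (simp add: hinner_diff_right[OF K])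
      then show "hinner K (A h) k = hinner J h j" using inn[OF h j(1)] j(2) by simp
    qed
    then show ?thesis using j by simp
  qed
qed

lemma zrow_zero [simp]: "zrow 0 x = 0"
  by (simp add: zrow_def)

text \<open>The space on which T preserves norms, that is, the orthogonal complement of Ker V for
  the partial isometry V = \<open>iso_part H T\<close>.\<close>

definition init_space :: "'h::complex_vector hspace \<Rightarrow> ('h ^ 'd \<Rightarrow> 'h) \<Rightarrow> ('h ^ 'd) set" where
  "init_space H T = hker (hcol H) (defect (hcol H) H T)"

context
  fixes H :: "'h::complex_vector hspace" and T :: "'h ^ 'd \<Rightarrow> 'h"
  assumes H: "hilbert_space H" and T: "row_contraction H T"
begin

private abbreviation (input) "colH \<equiv> hcol H :: ('h ^ 'd) hspace"
private abbreviation (input) "iniT \<equiv> init_space H T"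
private abbreviation (input) "prjT \<equiv> hproj colH iniT"
private abbreviation (input) "adjT \<equiv> hadj colH H T"
private abbreviation (input) "isoT \<equiv> iso_part H T"

private lemma colH: "hilbert_space colH" by (rule hilbert_hcol[OF H])
private lemma T_contr: "contraction colH H T" using T by (simp add: row_contraction_def)
private lemma T_bounded: "bounded_op colH H T" by (rule row_contraction_op[OF T])

text \<open>The kernel of a self-adjoint operator is the complement of its range; closedness of the
  initial space follows at once.\<close>

lemma init_space_horth: "iniT = horth colH (defect colH H T ` hcarrier colH)"
proof (rule set_eqI)
  fix x
  note Dop = defect_op[OF colH H T_contr]
  show "x \<in> iniT \<longleftrightarrow> x \<in> horth colH (defect colH H T ` hcarrier colH)"
  proof
    assume x: "x \<in> iniT"
    then have xC: "x \<in> hcarrier colH" "defect colH H T x = 0" by (simp_all add: init_space_def hker_def)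
    have "hinner colH x (defect colH H T y) = 0" if "y \<in> hcarrier colH" for y
      using defect_selfadjoint[OF colH H T_contr xC(1) that] xC that colH by simp
    then show "x \<in> horth colH (defect colH H T ` hcarrier colH)" using xC by (auto simp: horth_def)
  next
    assume x: "x \<in> horth colH (defect colH H T ` hcarrier colH)"
    then have xC: "x \<in> hcarrier colH" by (simp add: horth_def)
    note Dx = op_closed[OF Dop xC]
    have "hinner colH (defect colH H T x) (defect colH H T x) = 0"
      using x Dx defect_selfadjoint[OF colH H T_contr xC Dx] by (simp add: horth_def)
    then show "x \<in> iniT" using xC Dx colH by (simp add: init_space_def hker_def)
  qed
qed

lemma init_space_closed:
  shows "cvec.subspace iniT" "iniT \<subseteq> hcarrier colH" "hclosure colH iniT \<subseteq> iniT"
proof -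
  have "defect colH H T ` hcarrier colH \<subseteq> hcarrier colH" using op_closed[OF defect_op[OF colH H T_contr]] by blast
  then show "cvec.subspace iniT" "iniT \<subseteq> hcarrier colH" "hclosure colH iniT \<subseteq> iniT"
    unfolding init_space_horth using horth_subspace[OF colH] horth_subset[OF colH] hclosure_horth[OF colH] by blast+
qed

private lemma iniT_col: "n \<in> iniT \<Longrightarrow> n \<in> hcarrier colH" using init_space_closed(2) by blast

lemma init_space_hadj: "n \<in> iniT \<Longrightarrow> adjT (T n) = n"
  using defect_sq[OF colH H T_contr, of n] op_zero[OF defect_op[OF colH H T_contr] colH]
  by (simp add: init_space_def hker_def)

lemma init_space_inner: "n \<in> iniT \<Longrightarrow> x \<in> hcarrier colH \<Longrightarrow> hinner H (T n) (T x) = hinner colH n x"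
  using hadj_inner'[OF colH H T_bounded op_closed[OF T_bounded iniT_col], of n x] by (simp add: init_space_hadj)

lemma init_proj:
  assumes "x \<in> hcarrier colH"
  shows "prjT x \<in> iniT" "x - prjT x \<in> horth colH iniT" "prjT x \<in> hcarrier colH"
  using hproj_props[OF colH init_space_closed assms] iniT_col by blast+

lemma init_proj_id: "n \<in> iniT \<Longrightarrow> prjT n = n"
  using iniT_col[of n] horth_subspace[OF colH init_space_closed(2)]
  by (intro hproj_eq[OF colH init_space_closed(1,2)]) (simp_all add: cvec.subspace_0)

lemma init_proj_inner: "x \<in> hcarrier colH \<Longrightarrow> n \<in> iniT \<Longrightarrow> hinner colH (prjT x) n = hinner colH x n"
  using init_proj[of x] iniT_col[of n] by (auto simp: horth_def hinner_diff_left[OF colH])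

lemma iso_part_eq: "isoT x = T (prjT x)"
  by (simp add: iso_part_def init_space_def)

text \<open>T is isometric on the initial space, so V kills \<open>x\<close> only if the projection
  of \<open>x\<close> there is zero.\<close>

lemma iso_part_ker: "hker colH isoT = horth colH iniT"
proof (rule set_eqI)
  fix x show "x \<in> hker colH isoT \<longleftrightarrow> x \<in> horth colH iniT"
  proof
    assume x: "x \<in> hker colH isoT"
    then have xC: "x \<in> hcarrier colH" and 0: "T (prjT x) = 0" by (simp_all add: hker_def iso_part_eq)
    have "hinner colH (prjT x) (prjT x) = 0"
      using init_space_inner[OF init_proj(1,3)[OF xC]] 0 H by simp
    then have "prjT x = 0" using init_proj(3)[OF xC] colH by simp
    then show "x \<in> horth colH iniT" using init_proj(2)[OF xC] by simp
  next
    assume x: "x \<in> horth colH iniT"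
    then have xC: "x \<in> hcarrier colH" by (simp add: horth_def)
    have "prjT x = 0"
      using x xC init_space_closed cvec.subspace_0 by (intro hproj_eq[OF colH init_space_closed(1,2)]) auto
    then show "x \<in> hker colH isoT" using xC op_zero[OF T_bounded colH] by (simp add: hker_def iso_part_eq)
  qed
qed

lemma iso_part_range: "isoT ` hcarrier colH = T ` iniT"
proof
  show "isoT ` hcarrier colH \<subseteq> T ` iniT" using init_proj(1) by (auto simp: iso_part_eq)
  show "T ` iniT \<subseteq> isoT ` hcarrier colH"
  proof
    fix y assume "y \<in> T ` iniT"
    then obtain n where n: "n \<in> iniT" "y = T n" by blast
    then have "y = isoT n" by (simp add: iso_part_eq init_proj_id)
    then show "y \<in> isoT ` hcarrier colH" using iniT_col[OF n(1)] by blast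
  qed
qed

lemma iso_part_shifted_range: "shifted_range H isoT z = (\<lambda>n. T n - zrow z n) ` iniT"
  unfolding shifted_range_def iso_part_ker horth_horth[OF colH init_space_closed]
  by (intro image_cong refl) (simp add: iso_part_eq init_proj_id)

lemma iso_part_row_contraction: "row_contraction H isoT"
proof -
  note Pop = hproj_op[OF colH init_space_closed]
  have "bounded_op colH H (\<lambda>x. T (prjT x))" by (rule bounded_op_comp[OF Pop(1) T_bounded colH colH])
  moreover have "hnorm H (T (prjT x)) \<le> hnorm colH x" if x: "x \<in> hcarrier colH" for x
    using T_contr init_proj(3)[OF x] Pop(2)[OF x] unfolding contraction_def by (meson order_trans)
  ultimately show ?thesis by (simp add: row_contraction_def contraction_def iso_part_eq[abs_def])
qed

lemma iso_part_hadj: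
  assumes h: "h \<in> hcarrier H"
  shows "hadj colH H isoT h = prjT (adjT h)"
proof (rule hadj_eqI[OF colH H row_contraction_op[OF iso_part_row_contraction] h])
  have t: "adjT h \<in> hcarrier colH" by (rule hadj_closed[OF colH H T_bounded h])
  show "prjT (adjT h) \<in> hcarrier colH" by (rule init_proj(3)[OF t])
  fix x assume x: "x \<in> hcarrier colH"
  have "hinner H (isoT x) h = hinner colH (prjT x) (adjT h)"
    unfolding iso_part_eq by (rule hadj_inner[OF colH H T_bounded h init_proj(3)[OF x]])
  also have "\<dots> = cnj (hinner colH (prjT (adjT h)) (prjT x))"
    using init_proj_inner[OF t init_proj(1)[OF x]] hinner_cnj[OF colH t init_proj(3)[OF x]] by simp
  also have "\<dots> = hinner colH (prjT x) (prjT (adjT h))" by (rule hinner_cnj[OF colH init_proj(3)[OF t] init_proj(3)[OF x]])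
  also have "\<dots> = hinner colH x (prjT (adjT h))" by (rule init_proj_inner[OF x init_proj(1)[OF t]])
  finally show "hinner H (isoT x) h = hinner colH x (prjT (adjT h))" .
qed

lemma iso_range_subset: "T ` iniT \<subseteq> hcarrier H" using op_closed[OF T_bounded] iniT_col by blast

text \<open>\<open>T (prjT (adjT h))\<close> is V V^* applied to \<open>h\<close>, the projection
  onto Ran V, and the difference is the residual.\<close>

lemma defect_horth_range: "h \<in> hcarrier H \<Longrightarrow> h - T (prjT (adjT h)) \<in> horth H (T ` iniT)"
proof -
  assume h: "h \<in> hcarrier H"
  have t: "adjT h \<in> hcarrier colH" by (rule hadj_closed[OF colH H T_bounded h])
  note p = init_proj[OF t] and Tp = op_closed[OF T_bounded init_proj(3)[OF t]]
  have "hinner H (h - T (prjT (adjT h))) (T n) = 0" if n: "n \<in> iniT" for n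
  proof -
    have "hinner H h (T n) = hinner colH (adjT h) n" by (rule hadj_inner'[OF colH H T_bounded h iniT_col[OF n]])
    moreover have "hinner H (T (prjT (adjT h))) (T n) = hinner colH (prjT (adjT h)) n"
      by (rule init_space_inner[OF p(1) iniT_col[OF n]])
    ultimately show ?thesis
      using h Tp op_closed[OF T_bounded iniT_col[OF n]] init_proj_inner[OF t n] by (simp add: hinner_diff_left[OF H])
  qed
  then show ?thesis using h Tp H by (auto simp: horth_def)
qed

text \<open>On Ker V the operator T is minus its pure part C. That C maps Ker V into the complement
  of Ran V follows from \<open>init_space_inner\<close>; the companion lemma
  \<open>hadj_orth_ker\<close> reverses the direction for adjoints.\<close>

lemma range_orth_ker: "x \<in> horth colH iniT \<Longrightarrow> T x \<in> horth H (T ` iniT)"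
proof -
  assume x: "x \<in> horth colH iniT"
  then have xC: "x \<in> hcarrier colH" by (simp add: horth_def)
  have "hinner H (T x) (T n) = 0" if n: "n \<in> iniT" for n
  proof -
    have "hinner colH n x = 0" using x n hinner_eq_0_commute[OF colH iniT_col[OF n] xC] by (simp add: horth_def)
    then have "hinner H (T n) (T x) = 0" by (simp add: init_space_inner[OF n xC])
    then show ?thesis using hinner_eq_0_commute[OF H] op_closed[OF T_bounded xC] op_closed[OF T_bounded iniT_col[OF n]] by simp
  qed
  then show ?thesis using op_closed[OF T_bounded xC] by (auto simp: horth_def)
qed

lemma hadj_orth_ker: "h \<in> horth H (T ` iniT) \<Longrightarrow> adjT h \<in> horth colH iniT"
  using hadj_closed[OF colH H T_bounded] hadj_inner'[OF colH H T_bounded] iniT_col by (auto simp: horth_def)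

text \<open>Write p = e + V z^* p with e orthogonal to Ran V. Pairing p with V n leaves the pairing
  of z^* p with n, which equals the pairing of p with z n, so p is orthogonal to Ran (V -
  z).\<close>

lemma resolvent_in_shifted_orth:
  assumes z: "z \<in> \<bool>" and e: "e \<in> horth H (T ` iniT)"
  shows "row_resolvent H isoT z e \<in> horth H (shifted_range H isoT z)"
proof -
  let ?p = "row_resolvent H isoT z e"
  have eH: "e \<in> hcarrier H" using e by (simp add: horth_def)
  note isoT = iso_part_row_contraction
  have p: "?p \<in> hcarrier H" by (rule row_resolvent_closed[OF H isoT z eH])
  have zp: "zstar z ?p \<in> hcarrier colH" by (rule zstar_closed[OF H p])
  have peq: "?p = e + T (prjT (zstar z ?p))"
    using row_resolvent_eq[OF H isoT z eH] by (simp add: iso_part_eq algebra_simps)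
  have Tpz: "T (prjT (zstar z ?p)) \<in> hcarrier H" by (rule op_closed[OF T_bounded init_proj(3)[OF zp]])
  have "hinner H ?p (T n - zrow z n) = 0" if n: "n \<in> iniT" for n
  proof -
    have Tn: "T n \<in> hcarrier H" by (rule op_closed[OF T_bounded iniT_col[OF n]])
    have "hinner H ?p (T n) = hinner H e (T n) + hinner H (T (prjT (zstar z ?p))) (T n)"
      using arg_cong[OF peq, of "\<lambda>v. hinner H v (T n)"] by (simp add: hinner_add_left[OF H eH Tpz Tn])
    also have "\<dots> = hinner colH (zstar z ?p) n"
      using e n init_space_inner[OF init_proj(1)[OF zp] iniT_col[OF n]] init_proj_inner[OF zp n]
      by (simp add: horth_def)
    also have "\<dots> = hinner H ?p (zrow z n)" by (rule zstar_zrow_inner(1)[OF H p iniT_col[OF n]])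
    finally show ?thesis
      using p Tn zrow_closed[OF H iniT_col[OF n]] by (simp add: hinner_diff_right[OF H])
  qed
  then show ?thesis unfolding iso_part_shifted_range using p by (auto simp: horth_def)
qed

text \<open>Converse of \<open>resolvent_in_shifted_orth\<close>: together they show that I - V z^*
  carries one orthogonal complement bijectively onto the other.\<close>

lemma shifted_orth_in_range_orth:
  assumes z: "z \<in> \<bool>" and u: "u \<in> horth H (shifted_range H isoT z)"
  shows "u - isoT (zstar z u) \<in> horth H (T ` iniT)"
proof -
  have uH: "u \<in> hcarrier H" using u by (simp add: horth_def)
  have zu: "zstar z u \<in> hcarrier colH" by (rule zstar_closed[OF H uH])
  have Vz: "T (prjT (zstar z u)) \<in> hcarrier H" by (rule op_closed[OF T_bounded init_proj(3)[OF zu]])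
  have "hinner H (u - T (prjT (zstar z u))) (T n) = 0" if n: "n \<in> iniT" for n
  proof -
    have Tn: "T n \<in> hcarrier H" by (rule op_closed[OF T_bounded iniT_col[OF n]])
    have "hinner H (T (prjT (zstar z u))) (T n) = hinner H u (zrow z n)"
      using init_space_inner[OF init_proj(1)[OF zu] iniT_col[OF n]] init_proj_inner[OF zu n]
        zstar_zrow_inner(1)[OF H uH iniT_col[OF n]] by simp
    moreover have "hinner H u (T n - zrow z n) = 0"
      using u n unfolding iso_part_shifted_range by (simp add: horth_def)
    ultimately show ?thesis
      using uH Tn Vz zrow_closed[OF H iniT_col[OF n]] by (simp add: hinner_diff_left[OF H] hinner_diff_right[OF H])
  qed
  then show ?thesis using uH Vz H by (auto simp: horth_def iso_part_eq)
qed

section \<open>Existence of model triples\<close>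

text \<open>The canonical model map: the resolvent of V transports the isometry \<open>g0\<close>
  from the origin to \<open>z\<close>. Its inverse applies I - V z^* and then the adjoint of
  \<open>g0\<close>.\<close>

lemma model_triple_exists:
  assumes Ji: "sep_hilbert Ji" and J0: "sep_hilbert J0"
    and gi: "onto_isometry Ji (hsub colH (hker colH isoT)) gi"
    and g0: "onto_isometry J0 (hsub H (horth H (isoT ` hcarrier colH))) g0"
  shows "model_triple H isoT Ji J0 (\<lambda>z y. row_resolvent H isoT z (g0 y)) gi"
proof -
  note hJi = sep_hilbertD[OF Ji] and hJ0 = sep_hilbertD[OF J0] and Vr = iso_part_row_contraction
  let ?M = "horth H (T ` iniT)"
  have MH: "?M \<subseteq> hcarrier H" by (rule horth_subset[OF H])
  have hM: "hilbert_space (hsub H ?M)" by (rule hilbert_horth[OF H iso_range_subset])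
  have hK: "hilbert_space (hsub colH (hker colH isoT))"
    unfolding iso_part_ker by (rule hilbert_horth[OF colH init_space_closed(2)])
  note g0' = g0[unfolded iso_part_range] and s0 = iso_part_shifted_range[of 0]
  note g0s = isometry_onto_subspace[OF hJ0 H MH hM g0']
  have g0H: "g0 y \<in> hcarrier H" if "y \<in> hcarrier J0" for y using g0s(2)[OF that] MH by blast
  define \<gamma> where "\<gamma> = (\<lambda>z y. row_resolvent H isoT z (g0 y))"
  have \<gamma>0: "\<gamma> 0 y = g0 y" if y: "y \<in> hcarrier J0" for y
  proof -
    have "zstar (0 :: complex ^ 'd) (g0 y) = 0" by (simp add: zstar_def vec_eq_iff)
    then have "isoT (zstar 0 (g0 y)) = 0" using op_zero[OF row_contraction_op[OF Vr] colH] by simp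
    then show ?thesis unfolding \<gamma>_def by (intro row_resolvent_eqI[OF H Vr _ g0H[OF y]]) simp_all
  qed
  have iso: "linear_iso J0 (hsub H (horth H (shifted_range H isoT z))) (\<gamma> z)" if z: "z \<in> \<bool>" for z
    unfolding linear_iso_def
  proof (intro conjI exI[of _ "\<lambda>u. hadj J0 H g0 (u - isoT (zstar z u))"] ballI)
    let ?S = "horth H (shifted_range H isoT z)"
    have SH: "?S \<subseteq> hcarrier H" by (rule horth_subset[OF H])
    have op1: "bounded_op J0 H (\<gamma> z)"
      unfolding \<gamma>_def by (rule bounded_op_comp[OF g0s(1) row_resolvent_op[OF H Vr z] hJ0 H])
    have in1: "\<gamma> z y \<in> ?S" if "y \<in> hcarrier J0" for y
      unfolding \<gamma>_def by (rule resolvent_in_shifted_orth[OF z g0s(2)[OF that]])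
    show "bounded_op J0 (hsub H ?S) (\<gamma> z)"
      using op1 in1 unfolding bounded_op_def by simp
    have "bounded_op H H (\<lambda>u. u - isoT (zstar z u))"
      by (rule bounded_op_diff[OF bounded_op_id row_zstar_op[OF H Vr z] H H])
    then have "bounded_op H J0 (\<lambda>u. hadj J0 H g0 (u - isoT (zstar z u)))"
      by (rule bounded_op_comp[OF _ bounded_op_hadj[OF hJ0 H g0s(1)] H H])
    then show "bounded_op (hsub H ?S) J0 (\<lambda>u. hadj J0 H g0 (u - isoT (zstar z u)))"
      by (rule bounded_op_restrict[OF _ SH])
    have g0inv: "g0 (hadj J0 H g0 m) = m" if "m \<in> ?M" for m
    proof (rule g0s(4)[OF that])
      show "m \<in> hcarrier H" using that MH by blast
      show "m - m \<in> horth H ?M" using cvec.subspace_0[OF horth_subspace[OF H MH]] by simp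
    qed
    show "hadj J0 H g0 (\<gamma> z y - isoT (zstar z (\<gamma> z y))) = y" if y: "y \<in> hcarrier J0" for y
    proof -
      have "\<gamma> z y - isoT (zstar z (\<gamma> z y)) = g0 y"
        unfolding \<gamma>_def by (rule row_resolvent_eq[OF H Vr z g0H[OF y]])
      moreover have "hadj J0 H g0 (g0 y) = y"
        by (rule hadj_eqI[OF hJ0 H g0s(1) g0H[OF y] y]) (rule g0s(3)[OF _ y])
      ultimately show ?thesis by simp
    qed
    show "\<gamma> z (hadj J0 H g0 (u - isoT (zstar z u))) = u" if u: "u \<in> hcarrier (hsub H ?S)" for u
    proof -
      have uS: "u \<in> ?S" "u \<in> hcarrier H" using u SH by auto
      show ?thesis unfolding \<gamma>_def g0inv[OF shifted_orth_in_range_orth[OF z uS(1)]]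
        by (rule row_resolvent_eqI[OF H Vr z uS(2) refl])
    qed
  qed
  have "onto_isometry J0 (hsub H ?M) (\<gamma> 0)"
    using g0' bounded_op_cong[OF hJ0 onto_isometry_op[OF g0'] \<gamma>0]
    unfolding onto_isometry_def by (simp add: \<gamma>0)
  then have iso0: "onto_isometry J0 (hsub H (horth H (shifted_range H isoT 0))) (\<gamma> 0)"
    by (simp add: iso_part_shifted_range)
  have "same_hdim Ji (hsub colH (hker colH isoT))" by (rule same_hdim_onto_isometry[OF hJi hK gi])
  moreover have "same_hdim J0 (hsub H (horth H (isoT ` hcarrier colH)))"
    unfolding iso_part_range by (rule same_hdim_onto_isometry[OF hJ0 hM g0'])
  ultimately show ?thesis
    using Ji J0 gi iso iso0 unfolding model_triple_def \<gamma>_def by blast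
qed

end

section \<open>The characteristic function of a model triple\<close>

text \<open>A vector killed by the defect operator keeps its norm under the adjoint of
  \<open>A\<close>, which is pure because \<open>A\<close> is.\<close>

lemma pure_defect_adj_inj:
  assumes H: "hilbert_space H" and K: "hilbert_space K" and A: "pure_contraction H K A"
    and y: "y \<in> hcarrier K" "defect_adj H K A y = 0"
  shows "y = 0"
proof -
  have Ac: "contraction H K A" using A by (simp add: pure_contraction_def)
  have Aop: "bounded_op H K A" using Ac by (simp add: contraction_def)
  have adj2: "hadj K H (hadj H K A) x = A x" if "x \<in> hcarrier H" for x by (rule hadj_hadj[OF H K Aop that])
  have "pure_contraction H K (hadj K H (hadj H K A))"
    using A Aop H unfolding pure_contraction_def contraction_def bounded_op_def by (simp add: adj2)
  then have pure: "pure_contraction K H (hadj H K A)"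
    by (rule pure_contraction_of_adjoint[OF K H bounded_op_hadj[OF H K Aop]])
  show ?thesis
  proof (rule ccontr)
    assume "y \<noteq> 0"
    have a: "hadj H K A y \<in> hcarrier H" by (rule hadj_closed[OF H K Aop y(1)])
    have "hinner K y y - hinner H (hadj H K A y) (hadj H K A y) = 0"
      using defect_adj_inner[OF H K Ac y(1) y(1)] y(2) K by simp
    then have "(hnorm K y)\<^sup>2 = (hnorm H (hadj H K A y))\<^sup>2"
      using hnorm_sq[OF K y(1)] hnorm_sq[OF H a] by (simp add: complex_eq_iff)
    then have "hnorm K y = hnorm H (hadj H K A y)"
      by (rule power2_eq_imp_eq) (use y(1) a H K in simp_all)
    then show False using pure y(1) \<open>y \<noteq> 0\<close> by (auto simp: pure_contraction_def)
  qed
qed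

text \<open>Boundedness makes the difference of the two sides, in one argument, the pairing with a
  fixed vector \<open>v\<close>. If this vanishes on the range of the self-adjoint \<open>E\<close>,
  then \<open>E v = 0\<close> and injectivity gives \<open>v = 0\<close>.\<close>

lemma sesquilinear_identity_extend:
  assumes K: "hilbert_space K" and J: "hilbert_space J" and H: "hilbert_space H"
    and E: "bounded_op K K E" "\<And>x y. x \<in> hcarrier K \<Longrightarrow> y \<in> hcarrier K \<Longrightarrow> hinner K (E x) y = hinner K x (E y)"
      "\<And>x. x \<in> hcarrier K \<Longrightarrow> E x = 0 \<Longrightarrow> x = 0"
    and B: "bounded_op K J B" "bounded_op K J B'" and G: "bounded_op K H G" "bounded_op K H G'"
    and id: "\<And>x y. x \<in> hcarrier K \<Longrightarrow> y \<in> hcarrier K \<Longrightarrow>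
      hinner K (E x) (E y) - hinner J (B (E x)) (B' (E y)) = c * hinner H (G (E x)) (G' (E y))"
    and x: "x \<in> hcarrier K" and y: "y \<in> hcarrier K"
  shows "hinner K x y - hinner J (B x) (B' y) = c * hinner H (G x) (G' y)"
proof -
  have step1: "hinner K x (E y) - hinner J (B x) (B' (E y)) = c * hinner H (G x) (G' (E y))"
    if x: "x \<in> hcarrier K" and y: "y \<in> hcarrier K" for x y
  proof -
    have Ey: "E y \<in> hcarrier K" by (rule op_closed[OF E(1) y])
    let ?b = "hadj K J B (B' (E y))" and ?g = "hadj K H G (G' (E y))"
    have b: "?b \<in> hcarrier K" by (rule hadj_closed[OF K J B(1) op_closed[OF B(2) Ey]])
    have g: "?g \<in> hcarrier K" by (rule hadj_closed[OF K H G(1) op_closed[OF G(2) Ey]])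
    \<comment> \<open>Represents the difference of the two sides as a functional of the first
      argument; conjugate linearity of the second slot explains \<open>cnj c\<close>.\<close>
    define v where "v = E y - ?b - cnj c *\<^sub>C ?g"
    have v: "v \<in> hcarrier K" using Ey b g K by (simp add: v_def)
    have form: "hinner K u v = hinner K u (E y) - hinner J (B u) (B' (E y)) - c * hinner H (G u) (G' (E y))"
      if u: "u \<in> hcarrier K" for u
      using u Ey b g K unfolding v_def
      by (simp add: hinner_simps[OF K] hadj_inner[OF K J B(1) op_closed[OF B(2) Ey]]
          hadj_inner[OF K H G(1) op_closed[OF G(2) Ey]])
    have "hinner K u (E v) = 0" if u: "u \<in> hcarrier K" for u
      using form[OF op_closed[OF E(1) u]] id[OF u y] E(2)[OF u v] by simp
    then have "E v = 0"
      using op_closed[OF E(1) v] hinner_self_eq_0[OF K] by blast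
    then have "v = 0" by (rule E(3)[OF v])
    then show ?thesis using form[OF x] x K by simp
  qed
  let ?b = "hadj K J B' (B x)" and ?g = "hadj K H G' (G x)"
  have b: "?b \<in> hcarrier K" by (rule hadj_closed[OF K J B(2) op_closed[OF B(1) x]])
  have g: "?g \<in> hcarrier K" by (rule hadj_closed[OF K H G(2) op_closed[OF G(1) x]])
  define v where "v = x - ?b - c *\<^sub>C ?g"
  have v: "v \<in> hcarrier K" using x b g K by (simp add: v_def)
  have form: "hinner K v u = hinner K x u - hinner J (B x) (B' u) - c * hinner H (G x) (G' u)"
    if u: "u \<in> hcarrier K" for u
    using u x b g K unfolding v_def
    by (simp add: hinner_simps[OF K] hadj_inner'[OF K J B(2) op_closed[OF B(1) x]]
        hadj_inner'[OF K H G(2) op_closed[OF G(1) x]])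
  have "hinner K (E v) u = 0" if u: "u \<in> hcarrier K" for u
    using form[OF op_closed[OF E(1) u]] step1[OF x u] E(2)[OF v u] by simp
  then have "E v = 0"
    using op_closed[OF E(1) v] hinner_self_eq_0[OF K] by blast
  then have "v = 0" by (rule E(3)[OF v])
  then show ?thesis using form[OF y] y K by simp
qed

abbreviation (input) col_resolvent :: "'h::complex_vector hspace \<Rightarrow> ('h ^ 'd \<Rightarrow> 'h) \<Rightarrow> complex ^ 'd \<Rightarrow> 'h \<Rightarrow> 'h" where
  "col_resolvent H T z \<equiv> hinverse H (\<lambda>q. q - zrow z (hadj (hcol H) H T q))"

context
  fixes H :: "'h::complex_vector hspace" and T :: "'h ^ 'd \<Rightarrow> 'h" and z :: "complex ^ 'd"
  assumes H: "hilbert_space H" and T: "row_contraction H T" and z: "z \<in> \<bool>"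
begin

private lemma norm_z: "0 \<le> norm z" "norm z < 1" using z by simp_all

lemma col_resolvent_closed: "y \<in> hcarrier H \<Longrightarrow> col_resolvent H T z y \<in> hcarrier H"
  and col_resolvent_eq: "y \<in> hcarrier H \<Longrightarrow>
    col_resolvent H T z y - zrow z (hadj (hcol H) H T (col_resolvent H T z y)) = y"
  by (rule neumann_inverse[OF H zrow_hadj_op[OF H T z] norm_z zrow_hadj_norm[OF H T z]]; assumption)+

lemma col_resolvent_eqI:
  "x \<in> hcarrier H \<Longrightarrow> x - zrow z (hadj (hcol H) H T x) = y \<Longrightarrow> col_resolvent H T z y = x"
  by (rule neumann_inverse_eqI[OF H zrow_hadj_op[OF H T z] norm_z zrow_hadj_norm[OF H T z]])

lemma col_resolvent_op: "bounded_op H H (col_resolvent H T z)"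
  by (rule bounded_op_neumann[OF H zrow_hadj_op[OF H T z] norm_z zrow_hadj_norm[OF H T z]])

lemma col_resolvent_inner:
  "x \<in> hcarrier H \<Longrightarrow> y \<in> hcarrier H \<Longrightarrow>
    hinner H (col_resolvent H T z x) y = hinner H x (row_resolvent H T z y)"
  using row_resolvent_inner[OF H T z col_resolvent_closed, of x y] by (simp add: col_resolvent_eq)

end

context
  fixes H :: "'h::complex_vector hspace" and T :: "'h ^ 'd \<Rightarrow> 'h"
    and Ji :: "'m::complex_vector hspace" and J0 :: "'n::complex_vector hspace"
    and \<gamma> :: "complex ^ 'd \<Rightarrow> 'n \<Rightarrow> 'h" and gi :: "'m \<Rightarrow> 'h ^ 'd"
  assumes H: "hilbert_space H" and T: "row_contraction H T"
    and mt: "model_triple H (iso_part H T) Ji J0 \<gamma> gi"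
begin

section \<open>Relations between the model maps, \<open>\<delta>\<close> and T\<close>

private abbreviation (input) "C \<equiv> hcol H :: ('h ^ 'd) hspace"
private abbreviation (input) "N \<equiv> init_space H T"
private abbreviation (input) "P \<equiv> hproj C N"
private abbreviation (input) "Ta \<equiv> hadj C H T"
private abbreviation (input) "V \<equiv> iso_part H T"
private abbreviation (input) "g0 \<equiv> \<gamma> 0"
private abbreviation (input) "g0a \<equiv> hadj J0 H g0"
private abbreviation (input) "gia \<equiv> hadj Ji C gi"
private abbreviation (input) "\<delta> \<equiv> model_delta H T J0 \<gamma> gi"
private abbreviation (input) "\<delta>a \<equiv> hadj Ji J0 \<delta>"
private abbreviation (input) "E \<equiv> defect_adj Ji J0 \<delta>"
private abbreviation (input) "D \<equiv> defect Ji J0 \<delta>"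
private abbreviation (input) "B \<equiv> model_bV H J0 \<gamma> gi"

private lemma C: "hilbert_space C" by (rule hilbert_hcol[OF H])
private lemma Top: "bounded_op C H T" by (rule row_contraction_op[OF T])
private lemma Taop: "bounded_op H C Ta" by (rule bounded_op_hadj[OF C H Top])
private lemma NC: "N \<subseteq> hcarrier C" by (rule init_space_closed(2)[OF H T])
private lemma Ji: "hilbert_space Ji" and J0: "hilbert_space J0"
  using mt by (simp_all add: model_triple_def sep_hilbertD)
private lemma onC: "horth C N \<subseteq> hcarrier C" by (rule horth_subset[OF C])
private lemma otH: "horth H (T ` N) \<subseteq> hcarrier H" by (rule horth_subset[OF H])
private lemma TN: "T ` N \<subseteq> hcarrier H" by (rule iso_range_subset[OF H T])

private lemma g0_iso: "onto_isometry J0 (hsub H (horth H (T ` N))) g0"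
proof -
  have "shifted_range H V 0 = T ` N" by (simp add: iso_part_shifted_range[OF H T])
  then show ?thesis using mt by (simp add: model_triple_def)
qed
private lemma gi_iso: "onto_isometry Ji (hsub C (horth C N)) gi"
  using mt iso_part_ker[OF H T] by (simp add: model_triple_def)

private lemmas g0s = isometry_onto_subspace[OF J0 H otH hilbert_horth[OF H TN] g0_iso]
private lemmas gis = isometry_onto_subspace[OF Ji C onC hilbert_horth[OF C NC] gi_iso]
private lemma g0H: "y \<in> hcarrier J0 \<Longrightarrow> g0 y \<in> hcarrier H" using g0s(2) otH by blast
private lemma giC: "x \<in> hcarrier Ji \<Longrightarrow> gi x \<in> hcarrier C" using gis(2) onC by blast
private lemma g0acl: "h \<in> hcarrier H \<Longrightarrow> g0a h \<in> hcarrier J0" by (rule hadj_closed[OF J0 H g0s(1)])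
private lemma giacl: "c \<in> hcarrier C \<Longrightarrow> gia c \<in> hcarrier Ji" by (rule hadj_closed[OF Ji C gis(1)])
private lemma Tacl: "h \<in> hcarrier H \<Longrightarrow> Ta h \<in> hcarrier C" by (rule op_closed[OF Taop])
private lemma Tcl: "c \<in> hcarrier C \<Longrightarrow> T c \<in> hcarrier H" by (rule op_closed[OF Top])
private lemma Pcl: "c \<in> hcarrier C \<Longrightarrow> P c \<in> hcarrier C" by (rule init_proj(3)[OF H T])

text \<open>\<open>g0\<close> is an isometry onto the complement of Ran V, so \<open>g0\<close>
  after its adjoint is I - V V^*.\<close>

private lemma g0g0a:
  assumes h: "h \<in> hcarrier H" shows "g0 (g0a h) = h - T (P (Ta h))"
proof (rule g0s(4)[OF defect_horth_range[OF H T h] h])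
  have n: "P (Ta h) \<in> N" by (rule init_proj(1)[OF H T Tacl[OF h]])
  have t: "T (P (Ta h)) \<in> hcarrier H" by (rule Tcl[OF Pcl[OF Tacl[OF h]]])
  have "hinner H (T (P (Ta h))) y = 0" if y: "y \<in> horth H (T ` N)" for y
  proof -
    have "hinner H y (T (P (Ta h))) = 0" using y n by (simp add: horth_def)
    moreover have "y \<in> hcarrier H" using y by (simp add: horth_def)
    ultimately show ?thesis using hinner_eq_0_commute[OF H t] by blast
  qed
  then show "h - (h - T (P (Ta h))) \<in> horth H (horth H (T ` N))" using t by (simp add: horth_def)
qed

private lemma gigia:
  assumes c: "c \<in> hcarrier C" shows "gi (gia c) = c - P c"
proof (rule gis(4)[OF init_proj(2)[OF H T c] c])
  show "c - (c - P c) \<in> horth C (horth C N)"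
    using init_proj(1)[OF H T c] by (simp add: horth_horth[OF C init_space_closed[OF H T]])
qed

private lemma g0a_g0: "m \<in> horth H (T ` N) \<Longrightarrow> g0 (g0a m) = m"
  using cvec.subspace_0[OF horth_subspace[OF H otH]] otH by (intro g0s(4)) auto

lemma delta_op: "bounded_op Ji J0 \<delta>"
  unfolding model_delta_def[abs_def]
  by (rule bounded_op_minus[OF bounded_op_comp[OF bounded_op_comp[OF gis(1) Top Ji C]
        bounded_op_hadj[OF J0 H g0s(1)] Ji H] Ji J0])

private lemma dcl: "x \<in> hcarrier Ji \<Longrightarrow> \<delta> x \<in> hcarrier J0" by (rule op_closed[OF delta_op])
private lemma dacl: "y \<in> hcarrier J0 \<Longrightarrow> \<delta>a y \<in> hcarrier Ji" by (rule hadj_closed[OF Ji J0 delta_op])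

private lemma g0_delta:
  assumes x: "x \<in> hcarrier Ji" shows "g0 (\<delta> x) = - T (gi x)"
  using g0a_g0[OF range_orth_ker[OF H T gis(2)[OF x]]] g0acl[OF Tcl[OF giC[OF x]]]
  by (simp add: model_delta_def op_minus[OF g0s(1)])

private lemma delta_inner:
  assumes x: "x \<in> hcarrier Ji" and y: "y \<in> hcarrier Ji"
  shows "hinner J0 (\<delta> x) (\<delta> y) = hinner H (T (gi x)) (T (gi y))"
  using g0s(3)[OF dcl[OF x] dcl[OF y]] Tcl[OF giC[OF x]] Tcl[OF giC[OF y]] H
  by (simp add: g0_delta[OF x] g0_delta[OF y] hinner_simps[OF H])

text \<open>\<open>gi\<close> maps into the complement of the initial space, whereas any vector
  whose norm T preserves lies in the initial space.\<close>

lemma delta_pure: "pure_contraction Ji J0 \<delta>"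
proof (rule pure_contractionI[OF Ji J0 delta_op])
  have Tc: "contraction C H T" using T by (simp add: row_contraction_def)
  fix g assume g: "g \<in> hcarrier Ji" "g \<noteq> 0"
  note G = giC[OF g(1)]
  have n1: "hnorm J0 (\<delta> g) = hnorm H (T (gi g))" by (simp add: hnorm_def delta_inner[OF g(1) g(1)])
  have n2: "hnorm Ji g = hnorm C (gi g)" by (simp add: hnorm_def gis(3)[OF g(1) g(1)])
  have "defect C H T (gi g) \<noteq> 0"
  proof
    assume "defect C H T (gi g) = 0"
    then have "gi g \<in> N" using G by (simp add: init_space_def hker_def)
    then have "hinner C (gi g) (gi g) = 0" using gis(2)[OF g(1)] by (simp add: horth_def)
    then have "hinner Ji g g = 0" using gis(3)[OF g(1) g(1)] by simp
    then show False using g Ji by simp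
  qed
  then have "(hnorm C (defect C H T (gi g)))\<^sup>2 > 0"
    using hnorm_pos[OF C op_closed[OF defect_op[OF C H Tc] G]] by simp
  moreover have "(hnorm C (defect C H T (gi g)))\<^sup>2 = (hnorm C (gi g))\<^sup>2 - (hnorm H (T (gi g)))\<^sup>2"
    using defect_inner[OF C H Tc G G] op_closed[OF defect_op[OF C H Tc] G] G Tcl[OF G]
    by (simp add: hnorm_sq[OF C] hnorm_sq[OF H])
  ultimately have "(hnorm H (T (gi g)))\<^sup>2 < (hnorm C (gi g))\<^sup>2" by simp
  then have "hnorm H (T (gi g)) < hnorm C (gi g)"
    by (rule power2_less_imp_less) (use G C in simp)
  then show "hnorm J0 (\<delta> g) < hnorm Ji g" by (simp add: n1 n2)
qed

private lemma dc: "contraction Ji J0 \<delta>" using delta_pure by (simp add: pure_contraction_def)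
private lemma Eop: "bounded_op J0 J0 E" by (rule defect_adj_op[OF Ji J0 dc])
private lemma Ecl: "y \<in> hcarrier J0 \<Longrightarrow> E y \<in> hcarrier J0" by (rule op_closed[OF Eop])
private lemma Einj: "y \<in> hcarrier J0 \<Longrightarrow> E y = 0 \<Longrightarrow> y = 0" by (rule pure_defect_adj_inj[OF Ji J0 delta_pure])
private lemma Esa: "x \<in> hcarrier J0 \<Longrightarrow> y \<in> hcarrier J0 \<Longrightarrow> hinner J0 (E x) y = hinner J0 x (E y)"
  by (rule defect_adj_selfadjoint[OF Ji J0 dc])
private lemma Dop: "bounded_op Ji Ji D" by (rule defect_op[OF Ji J0 dc])

text \<open>The right-hand side lies in Ker V, the range of \<open>gi\<close>, so it has a preimage,
  and testing the adjoint pairing identifies that preimage up to sign. This relation trades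
  \<open>\<delta>\<close> for T.\<close>

private lemma gi_delta_adj:
  assumes y: "y \<in> hcarrier J0" shows "gi (\<delta>a y) = - Ta (g0 y)"
proof -
  have t: "Ta (g0 y) \<in> horth C N" by (rule hadj_orth_ker[OF H T g0s(2)[OF y]])
  then have tC: "Ta (g0 y) \<in> hcarrier C" using onC by blast
  have "Ta (g0 y) \<in> gi ` hcarrier Ji" using gi_iso t by (simp add: onto_isometry_def)
  then obtain m where m: "m \<in> hcarrier Ji" "Ta (g0 y) = gi m" by blast
  have "\<delta>a y = - m"
  proof (rule hadj_eqI[OF Ji J0 delta_op y])
    show "- m \<in> hcarrier Ji" using m Ji by simp
    fix h assume h: "h \<in> hcarrier Ji"
    have "hinner J0 (\<delta> h) y = hinner H (- T (gi h)) (g0 y)"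
      using g0s(3)[OF dcl[OF h] y] by (simp add: g0_delta[OF h])
    also have "\<dots> = - hinner C (gi h) (Ta (g0 y))"
      using hadj_inner[OF C H Top g0H[OF y] giC[OF h]] Tcl[OF giC[OF h]] g0H[OF y]
      by (simp add: hinner_minus_left[OF H])
    also have "\<dots> = hinner Ji h (- m)" using m h by (simp add: gis(3) hinner_minus_right[OF Ji])
    finally show "hinner J0 (\<delta> h) y = hinner Ji h (- m)" .
  qed
  then show ?thesis using m by (simp add: op_minus[OF gis(1)])
qed

private lemma g0_delta_delta_adj:
  assumes y: "y \<in> hcarrier J0" shows "g0 (\<delta> (\<delta>a y)) = T (Ta (g0 y))"
  using g0_delta[OF dacl[OF y]] gi_delta_adj[OF y] Tacl[OF g0H[OF y]] by (simp add: op_minus[OF Top])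

text \<open>At every point of the ball \<open>D\<^sup>\<gamma>(z)\<^sup>-\<^sup>1 \<gamma>(z)\<^sup>* = \<gamma>(0)\<^sup>* (I - z V\<^sup>*)\<^sup>-\<^sup>1\<close>, so \<open>\<gamma>(z)\<close> for
  \<open>z \<noteq> 0\<close> plays no role.\<close>

private lemma model_bV_eq:
  assumes z: "z \<in> \<bool>" and u: "u \<in> hcarrier Ji" and q: "q \<in> hcarrier H"
    and eq: "q - zrow z (P (Ta q)) = zrow z (gi u)"
  shows "B z u = g0a q"
proof -
  let ?S = "horth H (shifted_range H V z)"
  have SH: "?S \<subseteq> hcarrier H" by (rule horth_subset[OF H])
  have iso: "linear_iso J0 (hsub H ?S) (\<gamma> z)" using mt z by (simp add: model_triple_def)
  have op: "bounded_op J0 H (\<gamma> z)" and inS: "\<And>y. y \<in> hcarrier J0 \<Longrightarrow> \<gamma> z y \<in> ?S"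
    using iso SH unfolding linear_iso_def bounded_op_def by (auto simp: subset_iff)
  note op' = bounded_op_hadj[OF J0 H op]
  \<comment> \<open>The range of \<open>\<gamma> z\<close> is orthogonal to Ran (V - z), so its
    adjoint annihilates that range.\<close>
  have kill: "hadj J0 H (\<gamma> z) (T n - zrow z n) = 0" if n: "n \<in> N" for n
  proof (rule hadj_eqI[OF J0 H op])
    have nC: "n \<in> hcarrier C" using n NC by blast
    show "T n - zrow z n \<in> hcarrier H" using Tcl[OF nC] zrow_closed[OF H nC] H by simp
    show "0 \<in> hcarrier J0" using J0 by simp
    show "hinner H (\<gamma> z h) (T n - zrow z n) = hinner J0 h 0" if h: "h \<in> hcarrier J0" for h
      using inS[OF h] n h J0 by (simp add: horth_def iso_part_shifted_range[OF H T])
  qed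
  let ?p = "P (Ta q)"
  have pN: "?p \<in> N" by (rule init_proj(1)[OF H T Tacl[OF q]])
  have pC: "?p \<in> hcarrier C" by (rule Pcl[OF Tacl[OF q]])
  have zp: "zrow z ?p \<in> hcarrier H" and Tp: "T ?p \<in> hcarrier H" using zrow_closed[OF H pC] Tcl[OF pC] by auto
  have "zrow z (model_N H J0 \<gamma> gi z u) = hadj J0 H (\<gamma> z) (zrow z (gi u))"
  proof -
    have gj: "gi u $ j \<in> hcarrier H" for j using giC[OF u] by (simp add: hcarrier_hcol)
    show ?thesis
      unfolding zrow_def model_N_def using gj H
      by (simp add: op_sum[OF op' H] op_scale[OF op'])
  qed
  also have "\<dots> = hadj J0 H (\<gamma> z) (q - zrow z ?p)" by (simp only: eq)
  \<comment> \<open>The second summand is annihilated by \<open>kill\<close>; the first is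
    \<open>g0 (g0a q)\<close> by \<open>g0g0a\<close>.\<close>
  also have "q - zrow z ?p = (q - T ?p) + (T ?p - zrow z ?p)" by simp
  also have "hadj J0 H (\<gamma> z) \<dots> = hadj J0 H (\<gamma> z) (q - T ?p)"
    using q zp Tp H kill[OF pN] by (subst op_add[OF op']) simp_all
  also have "\<dots> = model_D H J0 \<gamma> z (g0a q)" by (simp add: model_D_def g0g0a[OF q])
  finally have eqD: "zrow z (model_N H J0 \<gamma> gi z u) = model_D H J0 \<gamma> z (g0a q)" .
  have "inj_on (model_D H J0 \<gamma> z) (hcarrier J0)"
  proof (rule inj_onI)
    fix y y' assume y: "y \<in> hcarrier J0" "y' \<in> hcarrier J0" and "model_D H J0 \<gamma> z y = model_D H J0 \<gamma> z y'"
    define d where "d = y - y'"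
    have d: "d \<in> hcarrier J0" using y J0 by (simp add: d_def)
    have 0: "hadj J0 H (\<gamma> z) (g0 d) = 0"
      using \<open>model_D H J0 \<gamma> z y = model_D H J0 \<gamma> z y'\<close> y g0H
      by (simp add: model_D_def d_def op_diff[OF g0s(1) J0] op_diff[OF op' H])
    \<comment> \<open>This vector lies in the range of \<open>\<gamma> z\<close>, hence pairs to
      zero with \<open>g0 d\<close>; yet the same pairing equals the squared norm of
      \<open>d\<close>.\<close>
    let ?r = "row_resolvent H V z (g0 d)"
    note Vr = iso_part_row_contraction[OF H T]
    have r: "?r \<in> ?S" by (rule resolvent_in_shifted_orth[OF H T z g0s(2)[OF d]])
    have rH: "?r \<in> hcarrier H" using r SH by blast
    obtain A where A: "bounded_op (hsub H ?S) J0 A" "\<And>s. s \<in> ?S \<Longrightarrow> \<gamma> z (A s) = s"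
      using iso unfolding linear_iso_def by auto
    have Ar: "A ?r \<in> hcarrier J0" using op_closed[OF A(1)] r by simp
    have "hinner H ?r (g0 d) = hinner J0 (A ?r) (hadj J0 H (\<gamma> z) (g0 d))"
      using hadj_inner[OF J0 H op g0H[OF d] Ar] A(2)[OF r] by simp
    then have ri: "hinner H ?r (g0 d) = 0" using 0 Ar J0 by simp
    have zr: "zstar z ?r \<in> hcarrier C" by (rule zstar_closed[OF H rH])
    have pz: "P (zstar z ?r) \<in> N" "P (zstar z ?r) \<in> hcarrier C" using init_proj[OF H T zr] by auto
    have "?r = g0 d + T (P (zstar z ?r))"
      using row_resolvent_eq[OF H Vr z g0H[OF d]] by (simp add: iso_part_eq[OF H T] algebra_simps)
    then have "hinner H ?r (g0 d) = hinner H (g0 d) (g0 d) + hinner H (T (P (zstar z ?r))) (g0 d)"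
      using hinner_add_left[OF H g0H[OF d] Tcl[OF pz(2)] g0H[OF d]] by metis
    moreover have "hinner H (T (P (zstar z ?r))) (g0 d) = 0"
      using g0s(2)[OF d] pz hinner_eq_0_commute[OF H g0H[OF d] Tcl[OF pz(2)]] by (simp add: horth_def)
    ultimately have "hinner J0 d d = 0" using ri g0s(3)[OF d d] by simp
    then show "y = y'" using d J0 by (simp add: d_def)
  qed
  then show ?thesis
    unfolding model_bV_def eqD hinverse_def by (rule inv_into_f_f) (rule g0acl[OF q])
qed

text \<open>This will be b_V (I + \<open>\<delta>\<close>^* b_V)^(-1), expressed through the
  resolvent of T in place of the one of V.\<close>

private definition "W z x = g0a (col_resolvent H T z (zrow z (gi x)))"

private lemma W_op: "z \<in> \<bool> \<Longrightarrow> bounded_op Ji J0 (W z)"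
  unfolding W_def[abs_def]
  by (rule bounded_op_comp[OF bounded_op_comp[OF bounded_op_comp[OF gis(1) bounded_op_zrow[OF H] Ji C]
        col_resolvent_op[OF H T] Ji H] bounded_op_hadj[OF J0 H g0s(1)] Ji H])

private lemma Pq:
  assumes q: "q \<in> hcarrier H"
  shows "Ta q - Ta (g0 (g0a q)) = P (Ta q)"
proof -
  have n: "P (Ta q) \<in> N" by (rule init_proj(1)[OF H T Tacl[OF q]])
  have t: "T (P (Ta q)) \<in> hcarrier H" by (rule Tcl[OF Pcl[OF Tacl[OF q]]])
  show ?thesis
    by (simp add: g0g0a[OF q] op_diff[OF Taop H q t] init_space_hadj[OF H T n])
qed

private lemma zrow_diff: "zrow z (x - y) = zrow z x - zrow z y" for z :: "complex ^ 'd" and x y :: "'h ^ 'd"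
  using zrow_add[of z x "(-1) *\<^sub>C y"] zrow_scale[of z "-1" y] by simp

text \<open>Since V^* is T^* minus T^* \<open>g0\<close> \<open>g0a\<close>, and T^*
  \<open>g0\<close> is minus \<open>gi\<close> \<open>\<delta>a\<close>, the solution
  \<open>q\<close> of the equation for T with datum \<open>x\<close> also solves the equation for V
  with datum \<open>x - \<delta>a (W z x)\<close>.\<close>

private lemma frostman_bV:
  assumes z: "z \<in> \<bool>" and x: "x \<in> hcarrier Ji"
  shows "B z (x - \<delta>a (W z x)) = W z x"
proof -
  define q where "q = col_resolvent H T z (zrow z (gi x))"
  have zg: "zrow z (gi x) \<in> hcarrier H" by (rule zrow_closed[OF H giC[OF x]])
  have q: "q \<in> hcarrier H" unfolding q_def by (rule col_resolvent_closed[OF H T z zg])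
  have qe: "q - zrow z (Ta q) = zrow z (gi x)" unfolding q_def by (rule col_resolvent_eq[OF H T z zg])
  have Wq: "W z x = g0a q" by (simp add: W_def q_def)
  note da = dacl[OF g0acl[OF q]]
  have "gi (x - \<delta>a (g0a q)) = gi x + Ta (g0 (g0a q))"
    by (simp add: op_diff[OF gis(1) Ji x da] gi_delta_adj[OF g0acl[OF q]])
  then have "zrow z (gi (x - \<delta>a (g0a q))) = zrow z (gi x) + zrow z (Ta (g0 (g0a q)))"
    by (simp add: zrow_add)
  also have "\<dots> = q - zrow z (Ta q - Ta (g0 (g0a q)))"
    by (simp add: qe[symmetric] zrow_diff)
  also have "\<dots> = q - zrow z (P (Ta q))" by (simp only: Pq[OF q])
  finally have "B z (x - \<delta>a (g0a q)) = g0a q"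
    using x da Ji by (intro model_bV_eq[OF z _ q]) simp_all
  then show ?thesis by (simp only: Wq)
qed

text \<open>The same calculation read backwards: \<open>v + \<delta>a (B z v)\<close> determines
  \<open>B z v\<close> through \<open>W\<close>, and then \<open>v\<close>. Injectivity is what
  makes \<open>inv_into\<close> return the intended solution.\<close>

private lemma frostman_inj:
  assumes z: "z \<in> \<bool>"
  shows "inj_on (\<lambda>v. v + \<delta>a (B z v)) (hcarrier Ji)"
proof -
  have key: "B z v = W z (v + \<delta>a (B z v)) \<and> B z v \<in> hcarrier J0" if v: "v \<in> hcarrier Ji" for v
  proof -
    have zg: "zrow z (gi v) \<in> hcarrier H" by (rule zrow_closed[OF H giC[OF v]])
    note Vr = iso_part_row_contraction[OF H T]
    obtain q where q: "q \<in> hcarrier H" "q - zrow z (hadj C H V q) = zrow z (gi v)"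
      using zrow_hadj_solution[OF H Vr z zg] by blast
    have qe: "q - zrow z (P (Ta q)) = zrow z (gi v)" using q iso_part_hadj[OF H T q(1)] by simp
    have Bv: "B z v = g0a q" by (rule model_bV_eq[OF z v q(1) qe])
    note da = dacl[OF g0acl[OF q(1)]]
    have "gi (v + \<delta>a (g0a q)) = gi v - Ta (g0 (g0a q))"
      by (simp add: op_add[OF gis(1) v da] gi_delta_adj[OF g0acl[OF q(1)]])
    then have "zrow z (gi (v + \<delta>a (g0a q))) = zrow z (gi v) - zrow z (Ta (g0 (g0a q)))"
      by (simp add: zrow_diff)
    also have "\<dots> = q - zrow z (Ta q)"
      unfolding qe[symmetric] Pq[OF q(1), symmetric] zrow_diff by simp
    finally have "col_resolvent H T z (zrow z (gi (v + \<delta>a (g0a q)))) = q"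
      by (intro col_resolvent_eqI[OF H T z q(1)]) simp
    then show ?thesis by (simp add: Bv W_def g0acl[OF q(1)])
  qed
  show ?thesis
  proof (rule inj_onI)
    fix v v' assume v: "v \<in> hcarrier Ji" "v' \<in> hcarrier Ji" and eq: "v + \<delta>a (B z v) = v' + \<delta>a (B z v')"
    have "B z v = B z v'" using key[OF v(1)] key[OF v(2)] eq by metis
    then show "v = v'" using eq by simp
  qed
qed

text \<open>The Frostman factor before composition with the defect operator
  \<open>D\<close>.\<close>

private definition "F z x = W z x + \<delta> (x - \<delta>a (W z x))"

private lemma F_op: "z \<in> \<bool> \<Longrightarrow> bounded_op Ji J0 (F z)"
  unfolding F_def[abs_def]
  by (rule bounded_op_add[OF W_op bounded_op_comp[OF bounded_op_diff[OF bounded_op_id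
        bounded_op_comp[OF W_op bounded_op_hadj[OF Ji J0 delta_op] Ji J0] Ji Ji] delta_op Ji Ji] Ji J0])

private lemma frostman_eq:
  assumes z: "z \<in> \<bool>" and x: "x \<in> hcarrier Ji"
  shows "frostman_factor Ji J0 \<delta> (B z) x = F z (D x)"
proof -
  have Dx: "D x \<in> hcarrier Ji" by (rule op_closed[OF Dop x])
  let ?u = "D x - \<delta>a (W z (D x))"
  have Wx: "W z (D x) \<in> hcarrier J0" by (rule op_closed[OF W_op[OF z] Dx])
  have u: "?u \<in> hcarrier Ji" using Dx dacl[OF Wx] Ji by simp
  have Bu: "B z ?u = W z (D x)" by (rule frostman_bV[OF z Dx])
  have "hinverse Ji (\<lambda>v. v + \<delta>a (B z v)) (D x) = ?u"
    using inv_into_f_f[OF frostman_inj[OF z] u] by (simp add: hinverse_def Bu)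
  then show ?thesis by (simp add: frostman_factor_def Let_def Bu F_def)
qed

section \<open>The adjoint of the Frostman factor and its Gram form\<close>

private definition "s z y = row_resolvent H T z (g0 y)"

private lemma scl: "z \<in> \<bool> \<Longrightarrow> y \<in> hcarrier J0 \<Longrightarrow> s z y \<in> hcarrier H"
  unfolding s_def by (rule row_resolvent_closed[OF H T _ g0H])

text \<open>The adjoint of \<open>F z\<close>: because I - \<open>\<delta>\<close>
  \<open>\<delta>a\<close> is \<open>E\<close> squared, F = E E W + \<open>\<delta>\<close>, and the
  adjoint of \<open>W\<close> is read off from its definition.\<close>

private definition "f z y = gia (zstar z (s z (E (E y)))) + \<delta>a y"

private lemma fcl: "z \<in> \<bool> \<Longrightarrow> y \<in> hcarrier J0 \<Longrightarrow> f z y \<in> hcarrier Ji"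
  unfolding f_def by (intro carrier_add[OF Ji] giacl dacl zstar_closed[OF H] scl Ecl)

private lemma EE: "y \<in> hcarrier J0 \<Longrightarrow> E (E y) = y - \<delta> (\<delta>a y)"
  by (rule defect_adj_sq[OF Ji J0 dc])

private lemma F_adj:
  assumes z: "z \<in> \<bool>" and y: "y \<in> hcarrier J0"
  shows "hadj Ji J0 (F z) y = f z y"
proof (rule hadj_eqI[OF Ji J0 F_op[OF z] y fcl[OF z y]])
  fix x assume x: "x \<in> hcarrier Ji"
  define q where "q = col_resolvent H T z (zrow z (gi x))"
  have zg: "zrow z (gi x) \<in> hcarrier H" by (rule zrow_closed[OF H giC[OF x]])
  have q: "q \<in> hcarrier H" unfolding q_def by (rule col_resolvent_closed[OF H T z zg])
  have Wq: "W z x = g0a q" by (simp add: W_def q_def)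
  have w: "W z x \<in> hcarrier J0" by (simp add: Wq g0acl[OF q])
  note dw = dacl[OF w] and dy = dacl[OF y] and ey = Ecl[OF Ecl[OF y]]
  have "hinner J0 (F z x) y = hinner J0 (W z x) y + hinner J0 (\<delta> x) y - hinner J0 (\<delta> (\<delta>a (W z x))) y"
    using x y w dw dcl[OF x] dcl[OF dw] J0
    by (simp add: F_def op_diff[OF delta_op Ji x dw] hinner_simps[OF J0])
  also have "hinner J0 (\<delta> (\<delta>a (W z x))) y = hinner J0 (W z x) (\<delta> (\<delta>a y))"
    by (simp add: hadj_inner[OF Ji J0 delta_op y dw] hadj_inner'[OF Ji J0 delta_op w dy])
  also have "hinner J0 (\<delta> x) y = hinner Ji x (\<delta>a y)" by (rule hadj_inner[OF Ji J0 delta_op y x])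
  also have "hinner J0 (W z x) y + hinner Ji x (\<delta>a y) - hinner J0 (W z x) (\<delta> (\<delta>a y))
      = hinner J0 (W z x) (E (E y)) + hinner Ji x (\<delta>a y)"
    using w y dcl[OF dy] by (simp add: EE[OF y] hinner_simps[OF J0])
  also have "hinner J0 (W z x) (E (E y)) = hinner H q (g0 (E (E y)))"
    unfolding Wq by (rule hadj_inner'[OF J0 H g0s(1) q ey, symmetric])
  also have "\<dots> = hinner H (zrow z (gi x)) (s z (E (E y)))"
    unfolding q_def s_def by (rule col_resolvent_inner[OF H T z zg g0H[OF ey]])
  also have "\<dots> = hinner C (gi x) (zstar z (s z (E (E y))))"
    by (rule zstar_zrow_inner(2)[OF H scl[OF z ey] giC[OF x], symmetric])
  also have "\<dots> = hinner Ji x (gia (zstar z (s z (E (E y)))))"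
    by (rule hadj_inner[OF Ji C gis(1) zstar_closed[OF H scl[OF z ey]] x])
  also have "\<dots> + hinner Ji x (\<delta>a y) = hinner Ji x (f z y)"
    using x dy giacl[OF zstar_closed[OF H scl[OF z ey]]] by (simp add: f_def hinner_add_right[OF Ji])
  finally show "hinner J0 (F z x) y = hinner Ji x (f z y)" .
qed

text \<open>\<open>I - T\<^sup>* T\<close> vanishes on the initial space, which removes the projections onto it.\<close>

private lemma f_inner:
  assumes z: "z \<in> \<bool>" and w: "w \<in> \<bool>" and y: "y \<in> hcarrier J0" and y': "y' \<in> hcarrier J0"
  shows "hinner Ji (D (f w y)) (D (f z y')) =
    hinner J0 (E y) (E y') - (1 - zdot z w) * hinner H (s w (E (E y))) (s z (E (E y')))"
proof -
  have strip: "hinner C (c - P c') (d - P d') - hinner H (T (c - P c')) (T (d - P d'))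
      = hinner C c d - hinner H (T c) (T d)"
    if c: "c \<in> hcarrier C" "c' \<in> hcarrier C" "d \<in> hcarrier C" "d' \<in> hcarrier C" for c c' d d'
  proof -
    have n: "P c' \<in> N" "P d' \<in> N" and nC: "P c' \<in> hcarrier C" "P d' \<in> hcarrier C"
      using init_proj[OF H T] c by auto
    have k1: "hinner H (T (P c')) (T x) = hinner C (P c') x" if "x \<in> hcarrier C" for x
      by (rule init_space_inner[OF H T n(1) that])
    have k2: "hinner H (T x) (T (P d')) = hinner C x (P d')" if x: "x \<in> hcarrier C" for x
    proof -
      have "cnj (hinner H (T (P d')) (T x)) = cnj (hinner C (P d') x)"
        by (simp add: init_space_inner[OF H T n(2) x])
      then show ?thesis using hinner_cnj[OF H Tcl[OF nC(2)] Tcl[OF x]] hinner_cnj[OF C nC(2) x] by simp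
    qed
    have "T (c - P c') = T c - T (P c')" "T (d - P d') = T d - T (P d')"
      using op_diff[OF Top C] c nC by auto
    then show ?thesis
      using c nC C H Tcl by (simp add: hinner_diff_left[OF H] hinner_diff_right[OF H]
          hinner_diff_left[OF C] hinner_diff_right[OF C] k1 k2)
  qed
  define \<sigma> \<sigma>' e e' a a' where defs: "\<sigma> = s w (E (E y))" "\<sigma>' = s z (E (E y'))" "e = g0 y" "e' = g0 y'"
    "a = g0 (E (E y))" "a' = g0 (E (E y'))"
  note EEy = Ecl[OF Ecl[OF y]] and EEy' = Ecl[OF Ecl[OF y']]
  have mem: "\<sigma> \<in> hcarrier H" "\<sigma>' \<in> hcarrier H" "e \<in> hcarrier H" "e' \<in> hcarrier H" "a \<in> hcarrier H" "a' \<in> hcarrier H"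
    unfolding defs by (intro scl[OF w EEy] scl[OF z EEy'] g0H y y' EEy EEy')+
  \<comment> \<open>\<open>g0\<close> intertwines \<open>E\<close> squared with I - T T^*, by
    \<open>g0_delta_delta_adj\<close>.\<close>
  have ae: "a = e - T (Ta e)" "a' = e' - T (Ta e')"
    unfolding defs using EE[OF y] EE[OF y'] op_diff[OF g0s(1) J0] y y' dcl[OF dacl[OF y]] dcl[OF dacl[OF y']]
    by (simp_all add: g0_delta_delta_adj)
  note zs = zstar_closed[OF H mem(1), of w] zstar_closed[OF H mem(2), of z]
  note Te = Tacl[OF mem(3)] Tacl[OF mem(4)]
  note Tz = Tcl[OF zs(1)] Tcl[OF zs(2)] and TTe = Tcl[OF Te(1)] Tcl[OF Te(2)]
  have res: "T (zstar w \<sigma>) = \<sigma> - a" "T (zstar z \<sigma>') = \<sigma>' - a'"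
    using row_resolvent_eq[OF H T w g0H[OF EEy]] row_resolvent_eq[OF H T z g0H[OF EEy']]
    unfolding defs s_def by (simp_all add: algebra_simps)
  have TT: "T (Ta e) = e - a" "T (Ta e') = e' - a'" by (simp_all add: ae)
  define c c' where cdefs: "c = zstar w \<sigma> - Ta e" "c' = zstar z \<sigma>' - Ta e'"
  have cC: "c \<in> hcarrier C" "c' \<in> hcarrier C" unfolding cdefs using zs Te C by simp_all
  have gf: "gi (f w y) = c - P (zstar w \<sigma>)" "gi (f z y') = c' - P (zstar z \<sigma>')"
    unfolding f_def cdefs defs
    using op_add[OF gis(1)] gigia giacl dacl zs[unfolded defs] y y'
    by (simp_all add: gi_delta_adj)
  \<comment> \<open>The resolvent equation and the formula for T T^* both contribute
    \<open>a\<close>, which cancels.\<close>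
  have Tcc: "T c = \<sigma> - e" "T c' = \<sigma>' - e'"
    unfolding cdefs using op_diff[OF Top C] zs Te by (simp_all add: res TT)
  have "hinner Ji (D (f w y)) (D (f z y')) =
      hinner Ji (f w y) (f z y') - hinner J0 (\<delta> (f w y)) (\<delta> (f z y'))"
    by (rule defect_inner[OF Ji J0 dc fcl[OF w y] fcl[OF z y']])
  also have "\<dots> = hinner C (gi (f w y)) (gi (f z y')) - hinner H (T (gi (f w y))) (T (gi (f z y')))"
    by (simp add: gis(3)[OF fcl[OF w y] fcl[OF z y']] delta_inner[OF fcl[OF w y] fcl[OF z y']])
  also have "\<dots> = hinner C c c' - hinner H (T c) (T c')"
    unfolding gf by (rule strip[OF cC(1) zs(1) cC(2) zs(2)])
  also have "hinner H (T c) (T c') = hinner H (\<sigma> - e) (\<sigma>' - e')" by (simp only: Tcc)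
  also have "hinner C c c' = hinner C (zstar w \<sigma>) (zstar z \<sigma>') - hinner C (zstar w \<sigma>) (Ta e')
      - hinner C (Ta e) (zstar z \<sigma>') + hinner C (Ta e) (Ta e')"
    unfolding cdefs using zs Te C by (simp add: hinner_simps[OF C])
  also have "hinner C (zstar w \<sigma>) (zstar z \<sigma>') = zdot z w * hinner H \<sigma> \<sigma>'"
    by (rule zstar_inner[OF H mem(1,2)])
  also have "hinner C (zstar w \<sigma>) (Ta e') = hinner H (\<sigma> - a) e'"
    using hadj_inner[OF C H Top mem(4) zs(1)] by (simp add: res)
  also have "hinner C (Ta e) (zstar z \<sigma>') = hinner H e (\<sigma>' - a')"
    using hadj_inner'[OF C H Top mem(3) zs(2)] by (simp add: res)
  also have "hinner C (Ta e) (Ta e') = hinner H (e - a) e'"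
    using hadj_inner[OF C H Top mem(4) Te(1)] by (simp add: TT)
  \<comment> \<open>Every mixed term cancels, leaving the defect form and the resolvent
    form.\<close>
  also have "zdot z w * hinner H \<sigma> \<sigma>' - hinner H (\<sigma> - a) e' - hinner H e (\<sigma>' - a') + hinner H (e - a) e'
      - hinner H (\<sigma> - e) (\<sigma>' - e') = hinner H e a' - (1 - zdot z w) * hinner H \<sigma> \<sigma>'"
    using mem H by (simp add: hinner_simps[OF H] algebra_simps)
  also have "hinner H e a' = hinner J0 (E y) (E y')"
    unfolding defs using g0s(3)[OF y EEy'] Esa[OF y Ecl[OF y']] by simp
  finally show ?thesis by (simp add: defs)
qed

section \<open>The defect map of a model triple and the extension from the range of
  \<open>E\<close>\<close>

private definition "G h = E (g0a h)"

private lemma G_op: "bounded_op H J0 G"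
  unfolding G_def[abs_def] by (rule bounded_op_comp[OF bounded_op_hadj[OF J0 H g0s(1)] Eop H J0])

private lemma G_adj:
  assumes x: "x \<in> hcarrier J0" shows "hadj H J0 G x = g0 (E x)"
proof (rule hadj_eqI[OF H J0 G_op x g0H[OF Ecl[OF x]]])
  fix h assume h: "h \<in> hcarrier H"
  show "hinner J0 (G h) x = hinner H h (g0 (E x))"
    unfolding G_def using Esa[OF g0acl[OF h] x] hadj_inner'[OF J0 H g0s(1) h Ecl[OF x]] by simp
qed

text \<open>T^* splits orthogonally into its part \<open>p\<close> in the initial space, which is
  V^*, and the remainder, which \<open>\<delta>a\<close> encodes. The first enters through
  \<open>g0\<close>, the second through \<open>E\<close>; together they give I - T T^*. Density of
  the range is injectivity of \<open>E\<close>.\<close>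

private lemma G_defect_map: "defect_map H T J0 G"
  unfolding defect_map_def
proof (intro conjI ballI impI G_op)
  fix y assume y: "y \<in> hcarrier J0" "\<forall>h\<in>hcarrier H. hinner J0 y (G h) = 0"
  have gy: "g0 (E y) \<in> hcarrier H" by (rule g0H[OF Ecl[OF y(1)]])
  have "hinner H (g0 (E y)) (g0 (E y)) = 0"
    using hadj_inner'[OF H J0 G_op y(1) gy] y(2) gy by (simp add: G_adj[OF y(1)])
  then have "hinner J0 (E y) (E y) = 0" using g0s(3)[OF Ecl[OF y(1)] Ecl[OF y(1)]] by simp
  then show "y = 0" using Einj[OF y(1)] Ecl[OF y(1)] J0 by simp
next
  fix h k assume h: "h \<in> hcarrier H" and k: "k \<in> hcarrier H"
  define p p' where pd: "p = P (Ta h)" "p' = P (Ta k)"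
  have pN: "p \<in> N" "p' \<in> N" and pC: "p \<in> hcarrier C" "p' \<in> hcarrier C"
    unfolding pd using init_proj[OF H T Tacl[OF h]] init_proj[OF H T Tacl[OF k]] by auto
  note Th = Tacl[OF h] and Tk = Tacl[OF k] and Tp = Tcl[OF pC(1)] and Tp' = Tcl[OF pC(2)]
  have i1: "hinner C p p' = hinner C (Ta h) p'"
    unfolding pd(1) by (rule init_proj_inner[OF H T Th pN(2)])
  have "hinner C p' p = hinner C (Ta k) p"
    unfolding pd(2) by (rule init_proj_inner[OF H T Tk pN(1)])
  then have i2: "hinner C p p' = hinner C p (Ta k)"
    using hinner_cnj[OF C pC(2) pC(1)] hinner_cnj[OF C Tk pC(1)] by simp
  have i3: "hinner H (T p) (T p') = hinner C p p'" by (rule init_space_inner[OF H T pN(1) pC(2)])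
  have i4: "hinner H h (T p') = hinner C p p'" using hadj_inner'[OF C H Top h pC(2)] i1 by simp
  have i5: "hinner H (T p) k = hinner C p p'" using hadj_inner[OF C H Top k pC(1)] i2 by simp
  have "hinner J0 (G h) (G k) = hinner J0 (g0a h) (g0a k) - hinner Ji (\<delta>a (g0a h)) (\<delta>a (g0a k))"
    unfolding G_def by (rule defect_adj_inner[OF Ji J0 dc g0acl[OF h] g0acl[OF k]])
  also have "hinner J0 (g0a h) (g0a k) = hinner H (h - T p) (k - T p')"
    using g0s(3)[OF g0acl[OF h] g0acl[OF k]] by (simp add: g0g0a[OF h] g0g0a[OF k] pd)
  also have "\<dots> = hinner H h k - hinner C p p'"
    using h k Tp Tp' H by (simp add: hinner_diff_left[OF H] hinner_diff_right[OF H] i3 i4 i5)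
  also have "hinner Ji (\<delta>a (g0a h)) (\<delta>a (g0a k)) = hinner C (Ta h - p) (Ta k - p')"
  proof -
    have eqs: "gi (\<delta>a (g0a h)) = - (Ta h - p)" "gi (\<delta>a (g0a k)) = - (Ta k - p')"
      using Pq[OF h] Pq[OF k] by (simp_all add: gi_delta_adj g0acl h k pd algebra_simps)
    have d: "Ta h - p \<in> hcarrier C" "Ta k - p' \<in> hcarrier C" using Th Tk pC C by simp_all
    have "hinner Ji (\<delta>a (g0a h)) (\<delta>a (g0a k)) = hinner C (- (Ta h - p)) (- (Ta k - p'))"
      unfolding eqs[symmetric] by (rule gis(3)[OF dacl[OF g0acl[OF h]] dacl[OF g0acl[OF k]], symmetric])
    also have "\<dots> = hinner C (Ta h - p) (Ta k - p')"
      by (simp only: hinner_minus_left[OF C d(1) carrier_minus[OF C d(2)]] hinner_minus_right[OF C d(2) d(1)] minus_minus)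
    finally show ?thesis .
  qed
  also have "\<dots> = hinner C (Ta h) (Ta k) - hinner C p p'"
    using Th Tk pC C by (simp add: hinner_diff_left[OF C] hinner_diff_right[OF C] i1 i2[symmetric])
  finally show "hinner J0 (G h) (G k) = hinner H h k - hinner C (Ta h) (Ta k)" by simp
qed

text \<open>The adjoint of b_T at \<open>z\<close>. It precedes b_T itself because the inverse of
  \<open>E\<close> becomes bounded only after composition with the adjoint Frostman factor.\<close>

private definition "Bx z = hextension J0 Ji (E ` hcarrier J0)
  (\<lambda>y. hadj Ji J0 (frostman_factor Ji J0 \<delta> (B z)) (hinverse J0 E y))"

private lemma E_range_dense: "hclosure J0 (E ` hcarrier J0) = hcarrier J0"
proof -
  have sub: "cvec.subspace (E ` hcarrier J0)"
  proof (rule cvec.subspaceI)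
    show "0 \<in> E ` hcarrier J0" using op_zero[OF Eop J0] carrier_0[OF J0] by (metis imageI)
    show "x + y \<in> E ` hcarrier J0" if "x \<in> E ` hcarrier J0" "y \<in> E ` hcarrier J0" for x y
      using that J0 by (auto simp: op_add[OF Eop, symmetric])
    show "c *\<^sub>C x \<in> E ` hcarrier J0" if "x \<in> E ` hcarrier J0" for c x
      using that J0 by (auto simp: op_scale[OF Eop, symmetric])
  qed
  have EJ: "E ` hcarrier J0 \<subseteq> hcarrier J0" using Ecl by blast
  show ?thesis
    unfolding dense_iff[OF J0 sub EJ]
  proof (intro ballI impI)
    fix x assume x: "x \<in> hcarrier J0" "\<forall>s\<in>E ` hcarrier J0. hinner J0 x s = 0"
    have "hinner J0 (E x) (E x) = 0" using x(2) Ecl[OF x(1)] Esa[OF x(1) Ecl[OF x(1)]] by simp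
    then show "x = 0" using Einj[OF x(1)] Ecl[OF x(1)] J0 by simp
  qed
qed

private lemma frostman_adj:
  assumes z: "z \<in> \<bool>" and y: "y \<in> hcarrier J0"
  shows "hadj Ji J0 (frostman_factor Ji J0 \<delta> (B z)) y = D (f z y)"
proof -
  have op: "bounded_op Ji J0 (frostman_factor Ji J0 \<delta> (B z))"
    by (rule bounded_op_cong[OF Ji bounded_op_comp[OF Dop F_op[OF z] Ji Ji] frostman_eq[OF z]])
  show ?thesis
  proof (rule hadj_eqI[OF Ji J0 op y op_closed[OF Dop fcl[OF z y]]])
    fix x assume x: "x \<in> hcarrier Ji"
    show "hinner J0 (frostman_factor Ji J0 \<delta> (B z) x) y = hinner Ji x (D (f z y))"
      using hadj_inner[OF Ji J0 F_op[OF z] y op_closed[OF Dop x]] defect_selfadjoint[OF Ji J0 dc x fcl[OF z y]]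
      by (simp add: frostman_eq[OF z x] F_adj[OF z y])
  qed
qed

private lemma f_add:
  assumes "z \<in> \<bool>" "x \<in> hcarrier J0" "y \<in> hcarrier J0"
  shows "f z (x + y) = f z x + f z y"
  using op_add[OF bounded_op_hadj[OF Ji J0 F_op[OF assms(1)]] assms(2,3)] assms J0
  by (simp add: F_adj)

private lemma f_scale:
  assumes "z \<in> \<bool>" "x \<in> hcarrier J0"
  shows "f z (c *\<^sub>C x) = c *\<^sub>C f z x"
  using op_scale[OF bounded_op_hadj[OF Ji J0 F_op[OF assms(1)]] assms(2)] assms J0
  by (simp add: F_adj)

text \<open>\<open>E y \<mapsto> D (f z y)\<close> is contractive on a dense range, so a bounded
  extension exists and the choice in \<open>hextension\<close> has the intended values.\<close>

private lemma Bx_spec: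
  assumes z: "z \<in> \<bool>"
  shows "bounded_op J0 Ji (Bx z)" and "\<And>y. y \<in> hcarrier J0 \<Longrightarrow> Bx z (E y) = D (f z y)"
proof -
  have inj: "inj_on E (hcarrier J0)"
  proof (rule inj_onI)
    fix x y assume xy: "x \<in> hcarrier J0" "y \<in> hcarrier J0" "E x = E y"
    then have "E (x - y) = 0" by (simp add: op_diff[OF Eop J0])
    then show "x = y" using Einj[of "x - y"] xy J0 by simp
  qed
  have inv: "hinverse J0 E (E y) = y" if "y \<in> hcarrier J0" for y
    unfolding hinverse_def by (rule inv_into_f_f[OF inj that])
  let ?S = "(\<lambda>y. (E y, D (f z y))) ` hcarrier J0"
  obtain L where L: "bounded_op J0 Ji L" "\<And>u v. (u, v) \<in> ?S \<Longrightarrow> L u = v"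
  proof (rule graph_extension[OF J0 Ji, of ?S 1])
    show "?S \<subseteq> hcarrier J0 \<times> hcarrier Ji" using Ecl op_closed[OF Dop fcl[OF z]] by auto
    show "(0, 0) \<in> ?S"
    proof (rule image_eqI[OF _ carrier_0[OF J0]])
      have "f z 0 = 0" using f_scale[OF z carrier_0[OF J0], of 0] by simp
      then show "(0, 0) = (E 0, D (f z 0))" by (simp add: op_zero[OF Eop J0] op_zero[OF Dop Ji])
    qed
    show "(u + u', v + v') \<in> ?S" if uv: "(u, v) \<in> ?S" "(u', v') \<in> ?S" for u v u' v'
    proof -
      obtain y y' where y: "y \<in> hcarrier J0" "u = E y" "v = D (f z y)"
        and y': "y' \<in> hcarrier J0" "u' = E y'" "v' = D (f z y')" using uv by auto
      show ?thesis
        by (rule image_eqI[of _ _ "y + y'"])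
          (simp_all add: y y' J0 op_add[OF Eop] f_add[OF z] op_add[OF Dop] fcl[OF z])
    qed
    show "(c *\<^sub>C u, c *\<^sub>C v) \<in> ?S" if uv: "(u, v) \<in> ?S" for c u v
    proof -
      obtain y where y: "y \<in> hcarrier J0" "u = E y" "v = D (f z y)" using uv by auto
      show ?thesis
        by (rule image_eqI[of _ _ "c *\<^sub>C y"])
          (simp_all add: y J0 op_scale[OF Eop] f_scale[OF z] op_scale[OF Dop] fcl[OF z])
    qed
    \<comment> \<open>This is \<open>f_inner\<close> on the diagonal: the subtracted term is 1 -
      |z|^2 times a squared norm.\<close>
    show "hnorm Ji v \<le> 1 * hnorm J0 u" if uv: "(u, v) \<in> ?S" for u v
    proof -
      obtain y where y: "y \<in> hcarrier J0" "u = E y" "v = D (f z y)" using uv by auto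
      let ?s = "s z (E (E y))"
      have sH: "?s \<in> hcarrier H" by (rule scl[OF z Ecl[OF Ecl[OF y(1)]]])
      have "1 - zdot z z = of_real (1 - (norm z)\<^sup>2)" by (simp add: zdot_self)
      then have "Re ((1 - zdot z z) * hinner H ?s ?s) = (1 - (norm z)\<^sup>2) * (hnorm H ?s)\<^sup>2"
        using sH by (simp add: hinner_self[OF H] del: of_real_power of_real_diff)
      moreover have "(1 - (norm z)\<^sup>2) * (hnorm H ?s)\<^sup>2 \<ge> 0"
        using z by (intro mult_nonneg_nonneg) (simp_all add: power_le_one)
      ultimately have "(hnorm Ji v)\<^sup>2 \<le> (hnorm J0 u)\<^sup>2"
        using f_inner[OF z z y(1) y(1)] hnorm_sq[OF Ji op_closed[OF Dop fcl[OF z y(1)]]] hnorm_sq[OF J0 Ecl[OF y(1)]]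
        by (simp add: y)
      then have "hnorm Ji v \<le> hnorm J0 u"
        by (rule power2_le_imp_le) (use Ecl[OF y(1)] J0 y in simp)
      then show ?thesis by simp
    qed
  qed (auto simp: image_image E_range_dense)
  have "\<exists>L. bounded_op J0 Ji L \<and> (\<forall>x\<in>E ` hcarrier J0.
      L x = hadj Ji J0 (frostman_factor Ji J0 \<delta> (B z)) (hinverse J0 E x))"
    using L by (intro exI[of _ L]) (auto simp: inv frostman_adj[OF z])
  then have *: "bounded_op J0 Ji (Bx z) \<and> (\<forall>x\<in>E ` hcarrier J0.
      Bx z x = hadj Ji J0 (frostman_factor Ji J0 \<delta> (B z)) (hinverse J0 E x))"
    unfolding Bx_def hextension_def by (rule someI_ex)
  then show "bounded_op J0 Ji (Bx z)" by blast
  show "Bx z (E y) = D (f z y)" if "y \<in> hcarrier J0" for y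
    using * that by (simp add: inv frostman_adj[OF z])
qed

section \<open>Kernel, Schur class and purity of the model function\<close>

private abbreviation (input) "bT \<equiv> model_bT H T Ji J0 \<gamma> gi"

private lemma bT_eq: "bT z = hadj J0 Ji (Bx z)"
  by (simp add: model_bT_def Let_def Bx_def)

private lemma bT_op: "z \<in> \<bool> \<Longrightarrow> bounded_op Ji J0 (bT z)"
  unfolding bT_eq by (rule bounded_op_hadj[OF J0 Ji Bx_spec(1)])

private lemma bT_adj: "z \<in> \<bool> \<Longrightarrow> y \<in> hcarrier J0 \<Longrightarrow> hadj Ji J0 (bT z) y = Bx z y"
  unfolding bT_eq by (rule hadj_hadj[OF J0 Ji Bx_spec(1)])

text \<open>\<open>f_inner\<close> is this identity for vectors in the range of \<open>E\<close> in
  both slots; the rest is the extension principle.\<close>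

private lemma bT_kernel:
  assumes z: "z \<in> \<bool>" and w: "w \<in> \<bool>" and x: "x \<in> hcarrier J0" and y: "y \<in> hcarrier J0"
  shows "hinner J0 x y - hinner Ji (hadj Ji J0 (bT w) x) (hadj Ji J0 (bT z) y) =
    (1 - zdot z w) * hinner H (row_resolvent H T w (hadj H J0 G x)) (row_resolvent H T z (hadj H J0 G y))"
proof -
  have op: "bounded_op J0 H (\<lambda>x. s v (E x))" if v: "v \<in> \<bool>" for v
    unfolding s_def by (rule bounded_op_comp[OF bounded_op_comp[OF Eop g0s(1) J0 J0] row_resolvent_op[OF H T v] J0 H])
  have "hinner J0 x y - hinner Ji (Bx w x) (Bx z y) = (1 - zdot z w) * hinner H (s w (E x)) (s z (E y))"
  proof (rule sesquilinear_identity_extend[OF J0 Ji H Eop Esa Einj Bx_spec(1)[OF w] Bx_spec(1)[OF z]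
        op[OF w] op[OF z] _ x y])
    fix u v assume u: "u \<in> hcarrier J0" and v: "v \<in> hcarrier J0"
    show "hinner J0 (E u) (E v) - hinner Ji (Bx w (E u)) (Bx z (E v)) =
        (1 - zdot z w) * hinner H (s w (E (E u))) (s z (E (E v)))"
      by (simp add: Bx_spec(2)[OF w u] Bx_spec(2)[OF z v] f_inner[OF z w u v])
  qed
  then show ?thesis by (simp add: bT_adj[OF w x] bT_adj[OF z y] G_adj[OF x] G_adj[OF y] s_def)
qed

theorem model_bT_represents: "represents H T Ji J0 (model_bT H T Ji J0 \<gamma> gi)"
  by (rule representsI[OF G_defect_map bT_kernel])

text \<open>The resolvents applied to adjoint values of \<open>G\<close> are the auxiliary vectors
  of the lurking isometry.\<close>

theorem model_bT_schur: "schur_class Ji J0 (model_bT H T Ji J0 \<gamma> gi)"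
  by (rule schur_classI[OF Ji J0 H bT_op row_resolvent_closed[OF H T _ hadj_closed[OF H J0 G_op]] bT_kernel])

text \<open>On the diagonal the kernel identity gives the norm lost by the adjoint of b_T as 1 -
  |z|^2 times the squared norm of a resolvent vector, nonzero because \<open>g0\<close> and
  \<open>E\<close> are injective.\<close>

theorem model_bT_pure: "purely_contractive Ji J0 (model_bT H T Ji J0 \<gamma> gi)"
  unfolding purely_contractive_def
proof
  fix z :: "complex ^ 'd" assume z: "z \<in> \<bool>"
  note op = bT_op[OF z] and opa = bounded_op_hadj[OF Ji J0 bT_op[OF z]]
  show "pure_contraction Ji J0 (bT z)"
  proof (rule pure_contraction_of_adjoint[OF Ji J0 op], rule pure_contractionI[OF J0 Ji opa])
    fix y assume y: "y \<in> hcarrier J0" "y \<noteq> 0"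
    define r where "r = row_resolvent H T z (hadj H J0 G y)"
    have gy: "hadj H J0 G y \<in> hcarrier H" by (rule hadj_closed[OF H J0 G_op y(1)])
    have r: "r \<in> hcarrier H" unfolding r_def by (rule row_resolvent_closed[OF H T z gy])
    have "r \<noteq> 0"
    proof
      assume "r = 0"
      then have "hadj H J0 G y = 0"
        using row_resolvent_eq[OF H T z gy] op_zero[OF row_zstar_op[OF H T z] H] by (simp add: r_def[symmetric])
      then have "g0 (E y) = 0" by (simp add: G_adj[OF y(1)])
      then have "hinner J0 (E y) (E y) = 0" using g0s(3)[OF Ecl[OF y(1)] Ecl[OF y(1)]] H by simp
      then show False using Einj[OF y(1)] Ecl[OF y(1)] J0 y(2) by simp
    qed
    then have rpos: "(hnorm H r)\<^sup>2 > 0" using hnorm_pos[OF H r] by simp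
    have "1 - zdot z z = of_real (1 - (norm z)\<^sup>2)" by (simp add: zdot_self)
    then have "Re ((1 - zdot z z) * hinner H r r) = (1 - (norm z)\<^sup>2) * (hnorm H r)\<^sup>2"
      using r by (simp add: hinner_self[OF H] del: of_real_power of_real_diff)
    also have "\<dots> > 0" using z rpos by (intro mult_pos_pos) (simp_all add: power_less_one_iff abs_square_less_1)
    finally have pos: "Re ((1 - zdot z z) * hinner H r r) > 0" .
    note ay = op_closed[OF opa y(1)]
    have "(hnorm J0 y)\<^sup>2 - (hnorm Ji (hadj Ji J0 (bT z) y))\<^sup>2 = Re ((1 - zdot z z) * hinner H r r)"
      using arg_cong[OF bT_kernel[OF z z y(1) y(1)], of Re]
      by (simp only: r_def minus_complex.sel hnorm_sq[OF J0 y(1)] hnorm_sq[OF Ji ay])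
    then have "(hnorm Ji (hadj Ji J0 (bT z) y))\<^sup>2 < (hnorm J0 y)\<^sup>2" using pos by simp
    then show "hnorm Ji (hadj Ji J0 (bT z) y) < hnorm J0 y"
      by (rule power2_less_imp_less) (use y J0 in simp)
  qed
qed

end

section \<open>Extremal Gleason solutions\<close>

lemma comp_op_hadj:
  fixes H :: "'h::complex_vector hspace" and T :: "'h ^ 'd \<Rightarrow> 'h"
  assumes H: "hilbert_space H" and T: "row_contraction H T" and h: "h \<in> hcarrier H"
  shows "hadj H H (comp_op T j) h = hadj (hcol H) H T h $ j"
proof (rule hadj_eqI[OF H H _ h])
  note C = hilbert_hcol[OF H, where 'd = 'd] and Top = row_contraction_op[OF T]
  have t: "hadj (hcol H) H T h \<in> hcarrier (hcol H)" by (rule hadj_closed[OF C H Top h])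
  have ax: "bounded_op H (hcol H) (axis j :: 'h \<Rightarrow> 'h ^ 'd)"
  proof (rule bounded_opI[where M = 1])
    fix x assume x: "x \<in> hcarrier H"
    have "hinner (hcol H) (axis j x) (axis j x) = hinner H x x"
      using H by (simp add: hinner_hcol axis_def if_distrib[of "\<lambda>v. hinner H v _"] if_distrib[of "hinner H x"] sum.delta cong: if_cong)
    then show "hnorm (hcol H) (axis j x :: 'h ^ 'd) \<le> 1 * hnorm H x" by (simp add: hnorm_def)
  qed (simp_all add: axis_closed[OF H], simp_all add: vec_eq_iff axis_def)
  show "bounded_op H H (comp_op T j)"
    unfolding comp_op_def[abs_def] by (rule bounded_op_comp[OF ax Top H C])
  show "hadj (hcol H) H T h $ j \<in> hcarrier H" using t by (simp add: hcarrier_hcol)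
  fix k assume k: "k \<in> hcarrier H"
  have "hinner (hcol H) (axis j k) (hadj (hcol H) H T h) = (\<Sum>i\<in>UNIV. if i = j then hinner H k (hadj (hcol H) H T h $ j) else 0)"
    unfolding hinner_hcol using t H by (intro sum.cong) (auto simp: axis_def hcarrier_hcol)
  then show "hinner H (comp_op T j k) h = hinner H k (hadj (hcol H) H T h $ j)"
    using hadj_inner[OF C H Top h axis_closed[OF H k]] by (simp add: comp_op_def)
qed

lemma sum_fun_apply: "(\<Sum>i\<in>I. f i) x = (\<Sum>i\<in>I. f i x)"
  for f :: "'i \<Rightarrow> 'a \<Rightarrow> 'b::complex_vector"
  by (induction I rule: infinite_finite_induct) auto

lemma zrow_apply: "zrow z F x = (\<Sum>j\<in>UNIV. z $ j *\<^sub>C (F $ j) x)"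
  for F :: "('a \<Rightarrow> 'b::complex_vector) ^ 'd"
  by (simp add: zrow_def sum_fun_apply scaleC_fun_def)

lemma zrow_map:
  assumes "bounded_op H K A" "hilbert_space H" "c \<in> hcarrier (hcol H)"
  shows "A (zrow z c) = zrow z (\<chi> j. A (c $ j))"
  using assms by (simp add: zrow_def op_sum[OF assms(1,2)] op_scale[OF assms(1)] hcarrier_hcol)

context
  fixes J :: "'j::complex_vector hspace" and K :: "'k::complex_vector hspace"
    and b :: "complex ^ 'd \<Rightarrow> 'j \<Rightarrow> 'k"
  assumes J: "hilbert_space J" and K: "hilbert_space K" and b: "schur_class J K b"
begin

private abbreviation (input) "R \<equiv> dbr_space J K b"
private abbreviation (input) "k \<equiv> dbr_kernel J K b"
private lemmas Rk = dbr_space_rkhs[OF J K b]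
private lemmas R = rkhs_hilbert[OF K Rk]

private lemma bop: "z \<in> \<bool> \<Longrightarrow> bounded_op J K (b z)"
  using b by (simp add: schur_class_def)

private lemma kernel_bound:
  assumes w: "w \<in> \<bool>"
  shows "\<exists>M\<ge>0. \<forall>x\<in>hcarrier K. hnorm K (k w w x) \<le> M * hnorm K x"
proof -
  have "bounded_op K K (\<lambda>x. (1 / (1 - zdot w w)) *\<^sub>C (x - b w (hadj J K (b w) x)))"
    by (rule bounded_op_scale[OF bounded_op_diff[OF bounded_op_id
          bounded_op_comp[OF bounded_op_hadj[OF J K bop[OF w]] bop[OF w] K J] K K] K K])
  from op_bound[OF this K] show ?thesis by (simp add: dbr_kernel_def)
qed

lemma dbr_eval_op:
  assumes w: "w \<in> \<bool>" shows "bounded_op R K (\<lambda>f. f w)"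
  using kernel_bound[OF w] rkhs_eval_op[OF K Rk w] by blast

lemma kernel_map_eq:
  assumes w: "w \<in> \<bool>" and x: "x \<in> hcarrier K"
  shows "kernel_map J K b w x = kfun k w x"
  using kernel_bound[OF w] rkhs_hadj_eval[OF K Rk w _ _ x] by (auto simp: kernel_map_def)

lemma kernel_map_hadj:
  assumes w: "w \<in> \<bool>" and f: "f \<in> hcarrier R"
  shows "hadj K R (kernel_map J K b w) f = f w"
  unfolding kernel_map_def by (rule hadj_hadj[OF R K dbr_eval_op[OF w] f])

lemma dbr_kfun_inner:
  assumes zw: "z \<in> \<bool>" "w \<in> \<bool>" and xy: "x \<in> hcarrier K" "y \<in> hcarrier K"
  shows "(1 - zdot z w) * hinner R (kfun k w x) (kfun k z y) =
    hinner K x y - hinner J (hadj J K (b w) x) (hadj J K (b z) y)"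
proof -
  note bx = hadj_closed[OF J K bop[OF zw(2)] xy(1)]
  note bbx = op_closed[OF bop[OF zw(1)] bx]
  have "hinner R (kfun k w x) (kfun k z y) = hinner K (k z w x) y"
    by (rule kfun_inner[OF K Rk zw(2) xy(1) zw(1) xy(2)])
  also have "\<dots> = (1 / (1 - zdot z w)) * (hinner K x y - hinner K (b z (hadj J K (b w) x)) y)"
    using xy bbx K by (simp add: dbr_kernel_def hinner_scale_left[OF K] hinner_diff_left[OF K])
  also have "hinner K (b z (hadj J K (b w) x)) y = hinner J (hadj J K (b w) x) (hadj J K (b z) y)"
    by (rule hadj_inner[OF J K bop[OF zw(1)] xy(2) bx])
  finally show ?thesis using one_minus_zdot[OF zw] by simp
qed

section \<open>Passage between row contractions and Gleason solutions\<close>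

context
  fixes H :: "'h::complex_vector hspace" and T :: "'h ^ 'd \<Rightarrow> 'h"
  assumes H: "hilbert_space H" and T: "row_contraction H T"
begin

private lemmas col_hilbert = hilbert_hcol[OF H, where 'd = 'd]
private lemmas row_op = row_contraction_op[OF T]

text \<open>The Gleason identity at \<open>z\<close> says \<open>k\<^sub>z\<^sup>* (I - z X\<^sup>*) = k\<^sub>0\<^sup>*\<close>, so \<open>k\<^sub>z = (I - X z\<^sup>*)\<^sup>-\<^sup>1 k\<^sub>0\<close>, and
  extremality makes \<open>k\<^sub>0\<^sup>*\<close> a defect map.\<close>

lemma extremal_gleason_represents:
  assumes pure: "purely_contractive J K b" and X: "extremal_gleason J K b X"
    and ue: "unitarily_equivalent H T R X"
  shows "represents H T J K b" and "ccnc H T"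
proof -
  obtain U where U': "onto_isometry H R U \<and>
      (\<forall>j. \<forall>y\<in>hcarrier R. U (comp_op T j (hadj H R U y)) = comp_op X j y)"
    using ue unfolding unitarily_equivalent_def by (rule exE)
  note U = U'[THEN conjunct1] and eq = U'[THEN conjunct2]
  note Uop = onto_isometry_op[OF U] and Uin = onto_isometry_inner[OF H R U]
  have z0: "(0 :: complex ^ 'd) \<in> \<bool>" by simp
  have Xr: "row_contraction R X"
    and gl: "\<And>f z. f \<in> hcarrier R \<Longrightarrow> z \<in> \<bool> \<Longrightarrow>
      (\<Sum>j\<in>UNIV. z $ j *\<^sub>C (hadj R R (comp_op X j) f z)) = f z - f 0"
    and ex: "\<And>f. f \<in> hcarrier R \<Longrightarrow> X (hadj (hcol R) R X f) =
      f - kernel_map J K b 0 (hadj K R (kernel_map J K b 0) f)"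
    using X by (auto simp: extremal_gleason_def gleason_solution_def Let_def)
  note conj = unitary_row_conjugate[OF H T R Xr U eq]
  note CR = hilbert_hcol[OF R, where 'd = 'd] and Xop = row_contraction_op[OF Xr]
  define G where "G h = U h 0" for h
  have Gop: "bounded_op H K G"
    unfolding G_def[abs_def] by (rule bounded_op_comp[OF Uop dbr_eval_op[OF z0] H R])
  \<comment> \<open>The Gleason identity, applied to \<open>U q\<close> and transported back to
    \<open>H\<close>.\<close>
  have key: "U (q - zrow w (hadj (hcol H) H T q)) w = G q" if q: "q \<in> hcarrier H" and w: "w \<in> \<bool>" for q w
  proof -
    note t = hadj_closed[OF col_hilbert H row_op q] and Uq = op_closed[OF Uop q]
    have "U (q - zrow w (hadj (hcol H) H T q)) = U q - zrow w (hadj (hcol R) R X (U q))"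
      by (simp add: op_diff[OF Uop H q zrow_closed[OF H t]] zrow_map[OF Uop H t] conj(2)[OF q])
    then show ?thesis
      using gl[OF Uq w] by (simp add: zrow_apply comp_op_hadj[OF R Xr Uq] G_def)
  qed
  \<comment> \<open>Dual form of \<open>key\<close>: the resolvent vectors are the kernel functions
    seen in \<open>H\<close>.\<close>
  have res: "row_resolvent H T w (hadj H K G x) = hadj H R U (kfun k w x)"
    if w: "w \<in> \<bool>" and x: "x \<in> hcarrier K" for w x
  proof -
    note kf = kfun_closed[OF K Rk w x]
    note gx = hadj_closed[OF H K Gop x]
    show ?thesis
    proof (rule hinner_ext[OF H row_resolvent_closed[OF H T w gx] hadj_closed[OF H R Uop kf]])
      fix h assume h: "h \<in> hcarrier H"
      obtain q where q: "q \<in> hcarrier H" "q - zrow w (hadj (hcol H) H T q) = h"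
        using zrow_hadj_solution[OF H T w h] by blast
      have "hinner H h (row_resolvent H T w (hadj H K G x)) = hinner H q (hadj H K G x)"
        using row_resolvent_inner[OF H T w q(1) gx] by (simp add: q(2))
      also have "\<dots> = hinner K (G q) x" by (rule hadj_inner[OF H K Gop x q(1), symmetric])
      also have "\<dots> = hinner K (U h w) x" using key[OF q(1) w] by (simp add: q(2))
      also have "\<dots> = hinner R (U h) (kfun k w x)"
        by (rule rkhs_reproduces[OF K Rk w x op_closed[OF Uop h], symmetric])
      also have "\<dots> = hinner H h (hadj H R U (kfun k w x))" by (rule hadj_inner[OF H R Uop kf h])
      finally show "hinner H h (row_resolvent H T w (hadj H K G x)) = hinner H h (hadj H R U (kfun k w x))" .
    qed
  qed
  have dm: "defect_map H T K G"
    unfolding defect_map_def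
  proof (intro conjI ballI impI Gop)
    fix y assume y: "y \<in> hcarrier K" "\<forall>h\<in>hcarrier H. hinner K y (G h) = 0"
    note kf = kfun_closed[OF K Rk z0 y(1)]
    \<comment> \<open>Test with the preimage of the kernel function at 0. This says that
      \<open>y\<close> keeps its norm under the adjoint of \<open>b 0\<close>, which purity forbids
      unless \<open>y\<close> is zero.\<close>
    have "hinner K y (kfun k 0 y 0) = 0"
      using y(2) hadj_closed[OF H R Uop kf] onto_isometry_hadj_right[OF H R U kf] by (force simp: G_def)
    then have "hinner K (kfun k 0 y 0) y = 0"
      using hinner_eq_0_commute[OF K y(1) rkhs_val[OF K Rk kf z0]] by simp
    then have "hinner R (kfun k 0 y) (kfun k 0 y) = 0"
      using rkhs_reproduces[OF K Rk z0 y(1) kf] by simp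
    then have "hinner K y y - hinner J (hadj J K (b 0) y) (hadj J K (b 0) y) = 0"
      using dbr_kfun_inner[OF z0 z0 y(1) y(1)] by simp
    moreover have p0: "pure_contraction J K (b 0)" using pure z0 by (simp add: purely_contractive_def)
    then have c0: "contraction J K (b 0)" by (simp add: pure_contraction_def)
    ultimately have "hinner K (defect_adj J K (b 0) y) (defect_adj J K (b 0) y) = 0"
      using defect_adj_inner[OF J K c0 y(1) y(1)] by simp
    then have "defect_adj J K (b 0) y = 0"
      using op_closed[OF defect_adj_op[OF J K c0] y(1)] K by simp
    then show "y = 0" by (rule pure_defect_adj_inj[OF J K p0 y(1)])
  next
    fix h h' assume h: "h \<in> hcarrier H" and h': "h' \<in> hcarrier H"
    note f = op_closed[OF Uop h] and g = op_closed[OF Uop h']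
    have g0: "U h' 0 \<in> hcarrier K" by (rule rkhs_val[OF K Rk g z0])
    note Xf = hadj_closed[OF CR R Xop f] and Xg = hadj_closed[OF CR R Xop g]
    have "hinner K (G h) (G h') = hinner R (U h) (kfun k 0 (U h' 0))"
      unfolding G_def by (rule rkhs_reproduces[OF K Rk z0 g0 f, symmetric])
    \<comment> \<open>Here extremality enters, as an equality and not merely an inequality.\<close>
    also have "kfun k 0 (U h' 0) = U h' - X (hadj (hcol R) R X (U h'))"
      using ex[OF g] by (simp add: kernel_map_hadj[OF z0 g] kernel_map_eq[OF z0 g0])
    also have "hinner R (U h) \<dots> = hinner R (U h) (U h') - hinner (hcol R) (hadj (hcol R) R X (U h)) (hadj (hcol R) R X (U h'))"
      using f g op_closed[OF Xop Xg] hadj_inner'[OF CR R Xop f Xg] by (simp add: hinner_diff_right[OF R])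
    also have "hinner R (U h) (U h') = hinner H h h'" by (rule Uin[OF h h'])
    also have "hinner (hcol R) (hadj (hcol R) R X (U h)) (hadj (hcol R) R X (U h'))
        = hinner (hcol H) (hadj (hcol H) H T h) (hadj (hcol H) H T h')"
      using hadj_closed[OF col_hilbert H row_op h] hadj_closed[OF col_hilbert H row_op h']
      by (simp add: conj(2)[OF h] conj(2)[OF h'] hinner_hcol Uin hcarrier_hcol)
    finally show "hinner K (G h) (G h') = hinner H h h' - hinner (hcol H) (hadj (hcol H) H T h) (hadj (hcol H) H T h')" .
  qed
  show "represents H T J K b"
  proof (rule representsI[OF dm])
    fix z w :: "complex ^ 'd" and x y
    assume zw: "z \<in> \<bool>" "w \<in> \<bool>" and xy: "x \<in> hcarrier K" "y \<in> hcarrier K"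
    note kf = kfun_closed[OF K Rk zw(2) xy(1)] kfun_closed[OF K Rk zw(1) xy(2)]
    have "hinner H (row_resolvent H T w (hadj H K G x)) (row_resolvent H T z (hadj H K G y))
        = hinner R (kfun k w x) (kfun k z y)"
      unfolding res[OF zw(2) xy(1)] res[OF zw(1) xy(2)]
      by (rule onto_isometry_inner[OF R H onto_isometry_hadj[OF H R U] kf])
    then show "hinner K x y - hinner J (hadj J K (b w) x) (hadj J K (b z) y) =
        (1 - zdot z w) * hinner H (row_resolvent H T w (hadj H K G x)) (row_resolvent H T z (hadj H K G y))"
      using dbr_kfun_inner[OF zw xy] by simp
  qed
  show "ccnc H T"
    unfolding ccnc_iff[OF H T K dm]
  proof (intro ballI impI)
    fix h assume h: "h \<in> hcarrier H"
      and 0: "\<forall>w\<in>\<bool>. \<forall>x\<in>hcarrier K. hinner H h (row_resolvent H T w (hadj H K G x)) = 0"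
    have "U h = 0"
    proof (rule rkhs_total[OF K Rk op_closed[OF Uop h]])
      fix w :: "complex ^ 'd" and x assume w: "w \<in> \<bool>" and x: "x \<in> hcarrier K"
      show "hinner R (U h) (kfun k w x) = 0"
        using 0 w x hadj_inner[OF H R Uop kfun_closed[OF K Rk w x] h] by (simp add: res[OF w x, symmetric])
    qed
    then have "hinner H h h = 0" using Uin[OF h h] R by simp
    then show "h = 0" using h H by simp
  qed
qed

text \<open>The kernel factorization equates the Gram matrices of resolvent vectors and kernel
  functions, and CCNC is totality of the former. Conjugating \<open>T\<close> by the resulting
  unitary gives \<open>X\<close>; its Gleason identity is \<open>key\<close>, and extremality is the
  defect identity of \<open>G\<close>.\<close>

lemma represents_extremal_gleason:
  assumes rep: "represents H T J K b" and cc: "ccnc H T"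
  shows "\<exists>X. extremal_gleason J K b X \<and> unitarily_equivalent H T R X"
proof -
  obtain G where rG: "kernel_factor H T J K b G" using rep unfolding represents_def by (rule exE)
  note dm = kernel_factor_map[OF rG] and ker = kernel_factor_eq[OF rG]
  note Gop = defect_mapD(1)[OF dm]
  have z0: "(0 :: complex ^ 'd) \<in> \<bool>" by simp
  have ga: "hadj H K G x \<in> hcarrier H" if "x \<in> hcarrier K" for x by (rule hadj_closed[OF H K Gop that])
  define I where "I = (\<bool> :: (complex ^ 'd) set) \<times> hcarrier K"
  define \<phi> where "\<phi> = (\<lambda>(w :: complex ^ 'd, x). row_resolvent H T w (hadj H K G x))"
  define \<psi> where "\<psi> = (\<lambda>(w :: complex ^ 'd, x). kfun k w x)"
  obtain U where U: "onto_isometry H R U" "\<And>i. i \<in> I \<Longrightarrow> U (\<phi> i) = \<psi> i"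
  proof (rule gram_unitary[OF H R, of I \<phi> \<psi>])
    show "\<phi> i \<in> hcarrier H" if "i \<in> I" for i
      using that by (auto simp: I_def \<phi>_def intro: row_resolvent_closed[OF H T _ ga])
    show "\<psi> i \<in> hcarrier R" if "i \<in> I" for i
      using that by (auto simp: I_def \<psi>_def intro: kfun_closed[OF K Rk])
    show "hinner R (\<psi> i) (\<psi> j) = hinner H (\<phi> i) (\<phi> j)" if ij: "i \<in> I" "j \<in> I" for i j
    proof -
      obtain w x z y where i: "i = (w, x)" "w \<in> \<bool>" "x \<in> hcarrier K"
        and j: "j = (z, y)" "z \<in> \<bool>" "y \<in> hcarrier K" using ij by (auto simp: I_def)
      have "(1 - zdot z w) * hinner R (\<psi> i) (\<psi> j) = (1 - zdot z w) * hinner H (\<phi> i) (\<phi> j)"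
        using ker[OF j(2) i(2,3) j(3)] dbr_kfun_inner[OF j(2) i(2,3) j(3)]
        by (simp only: i(1) j(1) \<phi>_def \<psi>_def split_conv)
      then show ?thesis using one_minus_zdot[OF j(2) i(2)] by simp
    qed
    show "h = 0" if h: "h \<in> hcarrier H" and 0: "\<And>i. i \<in> I \<Longrightarrow> hinner H h (\<phi> i) = 0" for h
    proof -
      have "hinner H h (row_resolvent H T w (hadj H K G x)) = 0" if "w \<in> \<bool>" "x \<in> hcarrier K" for w x
        using 0[of "(w, x)"] that by (simp add: I_def \<phi>_def)
      then show ?thesis using cc[unfolded ccnc_iff[OF H T K dm]] h by blast
    qed
    show "f = 0" if f: "f \<in> hcarrier R" and 0: "\<And>i. i \<in> I \<Longrightarrow> hinner R f (\<psi> i) = 0" for f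
    proof (rule rkhs_total[OF K Rk f])
      fix w :: "complex ^ 'd" and x assume "w \<in> \<bool>" "x \<in> hcarrier K"
      then show "hinner R f (kfun k w x) = 0" using 0[of "(w, x)"] by (simp add: I_def \<psi>_def)
    qed
  qed auto
  note Uop = onto_isometry_op[OF U(1)] and Uin = onto_isometry_inner[OF H R U(1)]
  note U' = onto_isometry_hadj[OF H R U(1)]
  note U'op = onto_isometry_op[OF U']
  have Uk: "U (row_resolvent H T w (hadj H K G x)) = kfun k w x" if "w \<in> \<bool>" "x \<in> hcarrier K" for w x
    using U(2)[of "(w, x)"] that by (simp add: I_def \<phi>_def \<psi>_def)
  have key: "U (q - zrow w (hadj (hcol H) H T q)) w = G q" if q: "q \<in> hcarrier H" and w: "w \<in> \<bool>" for q w
  proof -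
    have h: "q - zrow w (hadj (hcol H) H T q) \<in> hcarrier H" (is "?h \<in> _")
      using q zrow_closed[OF H hadj_closed[OF col_hilbert H row_op q]] H by simp
    note Uh = op_closed[OF Uop h]
    show ?thesis
    proof (rule hinner_ext_left[OF K rkhs_val[OF K Rk Uh w] op_closed[OF Gop q]])
      fix x assume x: "x \<in> hcarrier K"
      have "hinner K (U ?h w) x = hinner R (U ?h) (kfun k w x)"
        by (rule rkhs_reproduces[OF K Rk w x Uh, symmetric])
      also have "\<dots> = hinner H ?h (row_resolvent H T w (hadj H K G x))"
        unfolding Uk[OF w x, symmetric] by (rule Uin[OF h row_resolvent_closed[OF H T w ga[OF x]]])
      also have "\<dots> = hinner H q (hadj H K G x)" by (rule row_resolvent_inner[OF H T w q ga[OF x]])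
      also have "\<dots> = hinner K (G q) x" by (rule hadj_inner[OF H K Gop x q, symmetric])
      finally show "hinner K (U ?h w) x = hinner K (G q) x" .
    qed
  qed
  have U0: "U h 0 = G h" if "h \<in> hcarrier H" for h using key[OF that z0] by simp
  have Uk0: "U (hadj H K G x) = kfun k 0 x" if x: "x \<in> hcarrier K" for x
  proof -
    have "zstar (0 :: complex ^ 'd) (hadj H K G x) = 0" by (simp add: zstar_def vec_eq_iff)
    then have "row_resolvent H T 0 (hadj H K G x) = hadj H K G x"
      using op_zero[OF row_op col_hilbert] by (intro row_resolvent_eqI[OF H T z0 ga[OF x]]) simp
    then show ?thesis using Uk[OF z0 x] by simp
  qed
  define A :: "(complex ^ 'd \<Rightarrow> 'k) ^ 'd \<Rightarrow> 'h ^ 'd" where "A F = (\<chi> j. hadj H R U (F $ j))" for F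
  define X where "X F = U (T (A F))" for F
  have AC: "A F \<in> hcarrier (hcol H)" if "F \<in> hcarrier (hcol R)" for F
    using that op_closed[OF U'op] by (simp add: A_def hcarrier_hcol)
  have An: "hnorm (hcol H) (A F) = hnorm (hcol R) F" if F: "F \<in> hcarrier (hcol R)" for F
    unfolding hnorm_hcol[OF H AC[OF F]] hnorm_hcol[OF R F]
    using U' F by (simp add: A_def onto_isometry_def hcarrier_hcol)
  have Aop: "bounded_op (hcol R) (hcol H) A"
    by (rule bounded_opI[where M = 1])
      (simp_all add: AC An, simp_all add: A_def vec_eq_iff op_add[OF U'op] op_scale[OF U'op] hcarrier_hcol)
  have Xr: "row_contraction R X"
    unfolding row_contraction_def contraction_def
  proof (intro conjI ballI)
    show "bounded_op (hcol R) R X"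
      unfolding X_def[abs_def]
      by (rule bounded_op_comp[OF bounded_op_comp[OF Aop row_op hilbert_hcol[OF R] col_hilbert] Uop hilbert_hcol[OF R] H])
    fix F :: "(complex ^ 'd \<Rightarrow> 'k) ^ 'd" assume F: "F \<in> hcarrier (hcol R)"
    have "hnorm R (X F) = hnorm H (T (A F))"
      using U(1) op_closed[OF row_op AC[OF F]] by (simp add: X_def onto_isometry_def)
    also have "\<dots> \<le> hnorm (hcol H) (A F)" using T AC[OF F] by (simp add: row_contraction_def contraction_def)
    finally show "hnorm R (X F) \<le> hnorm (hcol R) F" by (simp add: An[OF F])
  qed
  have eq: "\<forall>j. \<forall>y\<in>hcarrier R. U (comp_op T j (hadj H R U y)) = comp_op X j y"
  proof (intro allI ballI)
    fix j y assume "y \<in> hcarrier R"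
    have "A (axis j y) = axis j (hadj H R U y)"
      using op_zero[OF U'op R] by (simp add: A_def vec_eq_iff axis_def)
    then show "U (comp_op T j (hadj H R U y)) = comp_op X j y" by (simp add: comp_op_def X_def)
  qed
  note conj = unitary_row_conjugate[OF H T R Xr U(1) eq]
  have surj: "\<exists>h\<in>hcarrier H. f = U h" if "f \<in> hcarrier R" for f
    using U(1) that unfolding onto_isometry_def by blast
  have "extremal_gleason J K b X"
    unfolding extremal_gleason_def gleason_solution_def Let_def
  proof (intro conjI ballI Xr)
    fix f and z :: "complex ^ 'd" assume f: "f \<in> hcarrier R" and z: "z \<in> \<bool>"
    obtain h where h: "h \<in> hcarrier H" "f = U h" using surj[OF f] by blast
    note t = hadj_closed[OF col_hilbert H row_op h(1)]
    have "(\<Sum>j\<in>UNIV. z $ j *\<^sub>C (hadj R R (comp_op X j) f z)) = zrow z (hadj (hcol R) R X f) z"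
      by (simp add: zrow_apply comp_op_hadj[OF R Xr f])
    also have "zrow z (hadj (hcol R) R X f) = U (zrow z (hadj (hcol H) H T h))"
      by (simp add: h(2) conj(2)[OF h(1)] zrow_map[OF Uop H t])
    also have "U (zrow z (hadj (hcol H) H T h)) z = f z - f 0"
      using key[OF h(1) z] U0[OF h(1)] by (simp add: h(2) op_diff[OF Uop H h(1) zrow_closed[OF H t]] algebra_simps)
    finally show "(\<Sum>j\<in>UNIV. z $ j *\<^sub>C (hadj R R (comp_op X j) f z)) = f z - f 0" .
  next
    fix f assume f: "f \<in> hcarrier R"
    obtain h where h: "h \<in> hcarrier H" "f = U h" using surj[OF f] by blast
    note t = hadj_closed[OF col_hilbert H row_op h(1)] and Gh = op_closed[OF Gop h(1)]
    note Tt = op_closed[OF row_op t] and gg = ga[OF Gh]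
    have TT: "T (hadj (hcol H) H T h) = h - hadj H K G (G h)"
    proof (rule hinner_ext[OF H Tt])
      show "h - hadj H K G (G h) \<in> hcarrier H" using h(1) gg H by simp
      fix y assume y: "y \<in> hcarrier H"
      have "hinner H y (T (hadj (hcol H) H T h)) = hinner (hcol H) (hadj (hcol H) H T y) (hadj (hcol H) H T h)"
        by (rule hadj_inner'[OF col_hilbert H row_op y t])
      also have "\<dots> = hinner H y h - hinner K (G y) (G h)" using defect_mapD(3)[OF dm y h(1)] by simp
      also have "hinner K (G y) (G h) = hinner H y (hadj H K G (G h))" by (rule hadj_inner[OF H K Gop Gh y])
      finally show "hinner H y (T (hadj (hcol H) H T h)) = hinner H y (h - hadj H K G (G h))"
        using h(1) gg y by (simp add: hinner_diff_right[OF H])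
    qed
    \<comment> \<open>Conjugation turns I - G^* G into subtraction of the kernel function at 0 with
      vector \<open>G h\<close>, which is the value \<open>f 0\<close>.\<close>
    have "X (hadj (hcol R) R X f) = U (T (hadj (hcol H) H T h))"
      unfolding h(2) conj(2)[OF h(1)] by (rule conj(1)[OF t])
    also have "\<dots> = f - kfun k 0 (G h)" by (simp add: TT op_diff[OF Uop H h(1) gg] Uk0[OF Gh] h(2))
    also have "kfun k 0 (G h) = kernel_map J K b 0 (hadj K R (kernel_map J K b 0) f)"
      using kernel_map_eq[OF z0 Gh] kernel_map_hadj[OF z0 f] U0[OF h(1)] by (simp add: h(2))
    finally show "X (hadj (hcol R) R X f) = f - kernel_map J K b 0 (hadj K R (kernel_map J K b 0) f)" .
  qed
  moreover have "unitarily_equivalent H T R X"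
    unfolding unitarily_equivalent_def using U(1) eq by blast
  ultimately show ?thesis by blast
qed

end

end

lemma extremal_gleason_model_represents:
  assumes H: "hilbert_space H" and T: "row_contraction H T" and m: "extremal_gleason_model H T J K b"
  shows "represents H T J K b" "ccnc H T"
proof -
  have hJ: "hilbert_space J" and hK: "hilbert_space K"
    and b: "schur_class J K b" and pure: "purely_contractive J K b"
    using m by (simp_all add: extremal_gleason_model_def sep_hilbertD)
  obtain X where X: "extremal_gleason J K b X" "unitarily_equivalent H T (dbr_space J K b) X"
    using m unfolding extremal_gleason_model_def by blast
  show "represents H T J K b" "ccnc H T"
    by (rule extremal_gleason_represents[OF hJ hK b H T pure X])+
qed

section \<open>Defect spaces\<close>

lemma horth_hclosure:
  assumes H: "hilbert_space H" and S: "S \<subseteq> hcarrier H"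
  shows "horth H (hclosure H S) = horth H S"
proof
  show "horth H (hclosure H S) \<subseteq> horth H S" using hclosure_incl[OF H S] by (auto simp: horth_def)
  show "horth H S \<subseteq> horth H (hclosure H S)"
  proof
    fix x assume x: "x \<in> horth H S"
    then have xH: "x \<in> hcarrier H" by (simp add: horth_def)
    have "S \<subseteq> horth H {x}" using x S xH by (auto simp: horth_def subset_iff hinner_eq_0_commute[OF H])
    then have "hclosure H S \<subseteq> horth H {x}"
      using hclosure_mono[OF H, of S "horth H {x}"] hclosure_horth[OF H, of "{x}"] xH by blast
    then show "x \<in> horth H (hclosure H S)"
      using xH hclosure_subset[OF H, of S] by (auto simp: horth_def subset_iff hinner_eq_0_commute[OF H])
  qed
qed

lemma range_subspace:
  assumes H: "hilbert_space H" and A: "bounded_op H K A"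
  shows "cvec.subspace (A ` hcarrier H)"
proof (rule cvec.subspaceI)
  show "0 \<in> A ` hcarrier H" using op_zero[OF A H] imageI[OF carrier_0[OF H], of A] by simp
  show "x + y \<in> A ` hcarrier H" if "x \<in> A ` hcarrier H" "y \<in> A ` hcarrier H" for x y
    using that H by (auto simp: op_add[OF A, symmetric])
  show "c *\<^sub>C x \<in> A ` hcarrier H" if "x \<in> A ` hcarrier H" for c x
    using that H by (auto simp: op_scale[OF A, symmetric])
qed

text \<open>The closed range equals its double complement, and its complement is that of the range
  itself.\<close>

lemma hclosure_range_eq:
  assumes H: "hilbert_space H" and A: "bounded_op H H A"
    and N: "horth H (A ` hcarrier H) = N"
  shows "hclosure H (A ` hcarrier H) = horth H N"
proof -
  have S: "cvec.subspace (A ` hcarrier H)" "A ` hcarrier H \<subseteq> hcarrier H"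
    using range_subspace[OF H A] op_closed[OF A] by auto
  have cl: "hclosure H (hclosure H (A ` hcarrier H)) \<subseteq> hclosure H (A ` hcarrier H)"
    by (simp add: hclosure_idem[OF H S(2)])
  have "horth H (horth H (hclosure H (A ` hcarrier H))) = hclosure H (A ` hcarrier H)"
    by (rule horth_horth[OF H hclosure_subspace[OF H S] hclosure_subset[OF H] cl])
  then show ?thesis by (simp add: horth_hclosure[OF H S(2)] N)
qed

context
  fixes H :: "'h::complex_vector hspace" and T :: "'h ^ 'd \<Rightarrow> 'h"
  assumes sH: "sep_hilbert H" and T: "row_contraction H T"
begin

private lemmas hH = sep_hilbertD[OF sH]
private lemmas hC = hilbert_hcol[OF hH, where 'd = 'd]
private lemmas hT = row_contraction_op[OF T]
private lemma hTc: "contraction (hcol H) H T" using T by (simp add: row_contraction_def)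

text \<open>With \<open>defect_adj_space_eq\<close> this identifies the closed defect spaces
  literally with Ker V and the complement of Ran V, so identity maps can be the isometries of a
  model triple.\<close>

lemma defect_space_eq:
  "hclosure (hcol H) (defect (hcol H) H T ` hcarrier (hcol H)) = hker (hcol H) (iso_part H T)"
  unfolding iso_part_ker[OF hH T]
  by (rule hclosure_range_eq[OF hC defect_op[OF hC hH hTc] init_space_horth[OF hH T, symmetric]])

text \<open>A vector killed by the adjoint defect satisfies T T^* x = x with norms preserved, so T^*
  x lies in the initial space and x in its image under T; the converse uses T^* T = I there.\<close>

lemma defect_adj_space_eq:
  "hclosure H (defect_adj (hcol H) H T ` hcarrier H) = horth H (iso_part H T ` hcarrier (hcol H))"
  unfolding iso_part_range[OF hH T]
proof (rule hclosure_range_eq[OF hH])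
  let ?D = "defect_adj (hcol H) H T"
  note Dop = defect_adj_op[OF hC hH hTc] and Dsa = defect_adj_selfadjoint[OF hC hH hTc]
  note D'op = defect_op[OF hC hH hTc]
  show "bounded_op H H ?D" by (rule Dop)
  show "horth H (?D ` hcarrier H) = T ` init_space H T"
  proof
    show "horth H (?D ` hcarrier H) \<subseteq> T ` init_space H T"
    proof
      fix x assume x: "x \<in> horth H (?D ` hcarrier H)"
      then have xH: "x \<in> hcarrier H" by (simp add: horth_def)
      let ?t = "hadj (hcol H) H T x"
      have t: "?t \<in> hcarrier (hcol H)" by (rule hadj_closed[OF hC hH hT xH])
      note Dx = op_closed[OF Dop xH]
      have "hinner H (?D x) (?D x) = 0" using x Dx Dsa[OF xH Dx] by (simp add: horth_def)
      then have "?D x = 0" using Dx hH by simp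
      then have TT: "T ?t = x"
        using defect_adj_sq[OF hC hH hTc xH] op_zero[OF Dop hH] by simp
      have "hinner (hcol H) ?t ?t = hinner H x x" using hadj_inner[OF hC hH hT xH t] TT by simp
      then have "hinner (hcol H) (defect (hcol H) H T ?t) (defect (hcol H) H T ?t) = 0"
        using defect_inner[OF hC hH hTc t t] TT by simp
      then have "defect (hcol H) H T ?t = 0" using op_closed[OF D'op t] hC by simp
      then have "?t \<in> init_space H T" using t by (simp add: init_space_def hker_def)
      then show "x \<in> T ` init_space H T" using TT by (metis imageI)
    qed
    show "T ` init_space H T \<subseteq> horth H (?D ` hcarrier H)"
    proof
      fix x assume "x \<in> T ` init_space H T"
      then obtain n where n: "n \<in> init_space H T" "x = T n" by blast
      have nC: "n \<in> hcarrier (hcol H)" using n init_space_closed(2)[OF hH T] by blast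
      have x: "x \<in> hcarrier H" using op_closed[OF hT nC] n by simp
      have "?D (?D x) = 0"
        using defect_adj_sq[OF hC hH hTc x] init_space_hadj[OF hH T n(1)] n(2) by simp
      then have "hinner H (?D x) (?D x) = 0"
        using Dsa[OF x op_closed[OF Dop x]] x hH by simp
      then have "?D x = 0" using op_closed[OF Dop x] hH by simp
      then have "hinner H x (?D y) = 0" if "y \<in> hcarrier H" for y
        using Dsa[OF x that] that hH by simp
      then show "x \<in> horth H (?D ` hcarrier H)" using x by (auto simp: horth_def)
    qed
  qed
qed

section \<open>Model triples on sequence spaces and the characteristic function\<close>

lemma sep_ker_space: "sep_hilbert (hsub (hcol H) (hker (hcol H) (iso_part H T)))"
proof -
  note N = init_space_closed(2)[OF hH T]
  show ?thesis unfolding iso_part_ker[OF hH T]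
    by (rule sep_hilbert_hsub[OF sep_hilbert_hcol[OF sH] horth_subspace[OF hC N] horth_subset[OF hC] hclosure_horth[OF hC N]])
qed

lemma sep_range_orth: "sep_hilbert (hsub H (horth H (iso_part H T ` hcarrier (hcol H))))"
proof -
  note N = iso_range_subset[OF hH T]
  show ?thesis unfolding iso_part_range[OF hH T]
    by (rule sep_hilbert_hsub[OF sH horth_subspace[OF hH N] horth_subset[OF hH] hclosure_horth[OF hH N]])
qed

lemma model_triple_sequence_exists:
  "\<exists>(Ji :: (nat \<Rightarrow> complex) hspace) (J0 :: (nat \<Rightarrow> complex) hspace) \<gamma> gi.
    model_triple H (iso_part H T) Ji J0 \<gamma> gi"
proof -
  obtain Ji :: "(nat \<Rightarrow> complex) hspace" and gi
    where Ji: "sep_hilbert Ji" "onto_isometry Ji (hsub (hcol H) (hker (hcol H) (iso_part H T))) gi"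
    using sep_hilbert_sequence_model[OF sep_ker_space] by metis
  obtain J0 :: "(nat \<Rightarrow> complex) hspace" and g0
    where J0: "sep_hilbert J0" "onto_isometry J0 (hsub H (horth H (iso_part H T ` hcarrier (hcol H)))) g0"
    using sep_hilbert_sequence_model[OF sep_range_orth] by metis
  show ?thesis using model_triple_exists[OF hH T Ji(1) J0(1) Ji(2) J0(2)] by blast
qed

lemma model_triple_weakly_coincide:
  assumes J: "hilbert_space J" and K: "hilbert_space K"
    and b: "schur_class J K b" "represents H T J K b"
    and mt: "model_triple H (iso_part H T) Ji J0 \<gamma> gi"
  shows "weakly_coincide J K b Ji J0 (model_bT H T Ji J0 \<gamma> gi)"
proof -
  have "hilbert_space Ji" "hilbert_space J0" using mt by (simp_all add: model_triple_def sep_hilbertD)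
  then show ?thesis
    by (intro represents_weakly_coincide[OF hH T J K _ _ b] model_bT_schur[OF hH T mt] model_bT_represents[OF hH T mt])
qed

text \<open>One model triple on sequences has to be exhibited; any works, since its model function
  is represented by the same row contraction.\<close>

lemma characteristic_functionI:
  assumes cc: "ccnc H T" and J: "sep_hilbert J" and K: "sep_hilbert K"
    and b: "schur_class J K b" "represents H T J K b"
  shows "characteristic_function H T J K b"
proof -
  obtain Ji J0 :: "(nat \<Rightarrow> complex) hspace" and \<gamma> gi
    where mt: "model_triple H (iso_part H T) Ji J0 \<gamma> gi"
    using model_triple_sequence_exists by blast
  show ?thesis
    unfolding characteristic_function_def
    using cc J K mt model_triple_weakly_coincide[OF sep_hilbertD[OF J] sep_hilbertD[OF K] b mt] by blast
qed

text \<open>Trades weak coincidence with a model function for a kernel factorization, in which the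
  model triple no longer appears.\<close>

lemma characteristic_functionD:
  assumes "characteristic_function H T J K b"
  shows "ccnc H T" "sep_hilbert J" "sep_hilbert K" "schur_class J K b" "represents H T J K b"
proof -
  show J: "sep_hilbert J" and K: "sep_hilbert K" and "ccnc H T"
    using assms by (simp_all add: characteristic_function_def)
  obtain Ji J0 :: "(nat \<Rightarrow> complex) hspace" and \<gamma> gi
    where mt: "model_triple H (iso_part H T) Ji J0 \<gamma> gi"
      and wc: "weakly_coincide J K b Ji J0 (model_bT H T Ji J0 \<gamma> gi)"
    using assms unfolding characteristic_function_def by blast
  show "schur_class J K b" using wc by (simp add: weakly_coincide_def)
  have "hilbert_space Ji" "hilbert_space J0" using mt by (simp_all add: model_triple_def sep_hilbertD)
  then show "represents H T J K b"
    by (rule represents_of_weakly_coincide[OF hH T sep_hilbertD[OF J] sep_hilbertD[OF K] _ _ wc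
          model_bT_represents[OF hH T mt]])
qed

end

theorem theorem1:
  fixes H :: "'h::complex_vector hspace" and T :: "'h ^ 'd \<Rightarrow> 'h"
  assumes "sep_hilbert H" and "row_contraction H T"
  shows
    \<comment> \<open>(a); the second clause is the converse for spaces in arbitrary ambient types\<close>
    "(ccnc H T \<longleftrightarrow>
        (\<exists>(J :: (nat \<Rightarrow> complex) hspace) (K :: (nat \<Rightarrow> complex) hspace) b.
           extremal_gleason_model H T J K b))
   \<and> (\<forall>(J :: 'j::complex_vector hspace) (K :: 'k::complex_vector hspace) b.
        extremal_gleason_model H T J K b \<longrightarrow> ccnc H T)
   \<comment> \<open>(b); the second clause covers model triples in arbitrary ambient types\<close>
   \<and> (\<forall>(J :: 'j hspace) (K :: 'k hspace) b.
        extremal_gleason_model H T J K b \<longrightarrow> characteristic_function H T J K b)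
   \<and> (\<forall>(J :: 'j hspace) (K :: 'k hspace) b
        (Ji :: 'm::complex_vector hspace) (J0 :: 'n::complex_vector hspace) \<gamma> \<gamma>i.
        extremal_gleason_model H T J K b \<and> model_triple H (iso_part H T) Ji J0 \<gamma> \<gamma>i
        \<longrightarrow> weakly_coincide J K b Ji J0 (model_bT H T Ji J0 \<gamma> \<gamma>i))
   \<and> (\<forall>(H2 :: 'g::complex_vector hspace) (T2 :: 'g ^ 'd \<Rightarrow> 'g)
        (J1 :: 'j hspace) (K1 :: 'k hspace) b1
        (J2 :: 'j2::complex_vector hspace) (K2 :: 'k2::complex_vector hspace) b2.
        sep_hilbert H2 \<and> row_contraction H2 T2 \<and> ccnc H T \<and> ccnc H2 T2
        \<and> unitarily_equivalent H T H2 T2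
        \<and> characteristic_function H T J1 K1 b1 \<and> characteristic_function H2 T2 J2 K2 b2
        \<longrightarrow> weakly_coincide J1 K1 b1 J2 K2 b2)
   \<comment> \<open>(c)\<close>
   \<and> (ccnc H T \<longrightarrow>
        (\<exists>b. characteristic_function H T
               (hsub (hcol H) (hclosure (hcol H) (defect (hcol H) H T ` hcarrier (hcol H))))
               (hsub H (hclosure H (defect_adj (hcol H) H T ` hcarrier H))) b))"
proof (intro conjI iffI allI impI)
  note sH = assms(1) and T = assms(2)
  note H = sep_hilbertD[OF sH]
  show "ccnc H T" if "\<exists>(J :: (nat \<Rightarrow> complex) hspace) (K :: (nat \<Rightarrow> complex) hspace) b. extremal_gleason_model H T J K b"
    using that extremal_gleason_model_represents(2)[OF H T] by blast
  show "ccnc H T" if "extremal_gleason_model H T J K b" for J :: "'j hspace" and K :: "'k hspace" and b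
    by (rule extremal_gleason_model_represents(2)[OF H T that])
  show "characteristic_function H T J K b" if m: "extremal_gleason_model H T J K b"
    for J :: "'j hspace" and K :: "'k hspace" and b
    using m extremal_gleason_model_represents[OF H T m]
    by (intro characteristic_functionI[OF sH T]) (simp_all add: extremal_gleason_model_def)
  show "weakly_coincide J K b Ji J0 (model_bT H T Ji J0 \<gamma> \<gamma>i)"
    if m: "extremal_gleason_model H T J K b \<and> model_triple H (iso_part H T) Ji J0 \<gamma> \<gamma>i"
    for J :: "'j hspace" and K :: "'k hspace" and b
      and Ji :: "'m hspace" and J0 :: "'n hspace" and \<gamma> \<gamma>i
    using m extremal_gleason_model_represents[OF H T conjunct1[OF m]]
    by (intro model_triple_weakly_coincide[OF sH T]) (simp_all add: extremal_gleason_model_def sep_hilbertD)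
  show "weakly_coincide J1 K1 b1 J2 K2 b2"
    if a: "sep_hilbert H2 \<and> row_contraction H2 T2 \<and> ccnc H T \<and> ccnc H2 T2
        \<and> unitarily_equivalent H T H2 T2
        \<and> characteristic_function H T J1 K1 b1 \<and> characteristic_function H2 T2 J2 K2 b2"
    for H2 :: "'g hspace" and T2 :: "'g ^ 'd \<Rightarrow> 'g"
      and J1 :: "'j hspace" and K1 :: "'k hspace" and b1
      and J2 :: "'j2 hspace" and K2 :: "'k2 hspace" and b2
  proof -
    have sH2: "sep_hilbert H2" and T2: "row_contraction H2 T2" and ue: "unitarily_equivalent H T H2 T2"
      and c1: "characteristic_function H T J1 K1 b1" and c2: "characteristic_function H2 T2 J2 K2 b2"
      using a by blast+
    note d1 = characteristic_functionD[OF sH T c1] and d2 = characteristic_functionD[OF sH2 T2 c2]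
    \<comment> \<open>Both functions now represent the same row contraction
      \<open>T\<close>.\<close>
    have r2: "represents H T J2 K2 b2"
      by (rule represents_unitary[OF H T sep_hilbertD[OF sH2] T2 sep_hilbertD[OF d2(3)] ue d2(5)])
    show ?thesis
      by (rule represents_weakly_coincide[OF H T d1(2,3)[THEN sep_hilbertD] d2(2,3)[THEN sep_hilbertD]
            d1(4,5) d2(4) r2])
  qed
  show "\<exists>(J :: (nat \<Rightarrow> complex) hspace) (K :: (nat \<Rightarrow> complex) hspace) b. extremal_gleason_model H T J K b"
    if cc: "ccnc H T"
  proof -
    obtain Ji J0 :: "(nat \<Rightarrow> complex) hspace" and \<gamma> gi
      where mt: "model_triple H (iso_part H T) Ji J0 \<gamma> gi"
      using model_triple_sequence_exists[OF sH T] by blast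
    have s: "sep_hilbert Ji" "sep_hilbert J0" using mt by (simp_all add: model_triple_def)
    note b = model_bT_schur[OF H T mt]
    \<comment> \<open>The witness is the model function itself; CCNC makes the realization on its de
      Branges-Rovnyak space unitary.\<close>
    have "extremal_gleason_model H T Ji J0 (model_bT H T Ji J0 \<gamma> gi)"
      unfolding extremal_gleason_model_def
      using s b model_bT_pure[OF H T mt]
        represents_extremal_gleason[OF s[THEN sep_hilbertD] b H T model_bT_represents[OF H T mt] cc] by blast
    then show ?thesis by blast
  qed
  show "\<exists>b. characteristic_function H T
               (hsub (hcol H) (hclosure (hcol H) (defect (hcol H) H T ` hcarrier (hcol H))))
               (hsub H (hclosure H (defect_adj (hcol H) H T ` hcarrier H))) b" if cc: "ccnc H T"
  proof -
    note J = sep_ker_space[OF sH T] and K = sep_range_orth[OF sH T]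
    \<comment> \<open>Identity maps on the defect spaces serve as the values of the model map at 0
      and at infinity.\<close>
    note mt = model_triple_exists[OF H T J K onto_isometry_id onto_isometry_id]
    show ?thesis
      unfolding defect_space_eq[OF sH T] defect_adj_space_eq[OF sH T]
      by (rule exI, rule characteristic_functionI[OF sH T cc J K model_bT_schur[OF H T mt] model_bT_represents[OF H T mt]])
  qed
qed

end
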